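(* Let $M>0$, $M_1>0$. There exists a constant $C(M,M_1)>0$ depending only on $M$ and $M_1$ such that the following holds. Assume that $\boldsymbol\Omega=\boldsymbol\Sigma^{-1}$ belongs to the collection $\mathcal{U}(M,M_1)$. For any integer $k\in\{1,\dots,p\}$, any $k$-sparse vector $\beta^*\in\mathbb{R}^p$ and any $\sigma>0$, $$\mathbb{E}\left[\left(\widehat\eta^A_{CL}-\eta\right)^2\right]\le C(M,M_1)\left[\frac1n+\left(\frac{k^2\log^2(p)}{n^2}\right)\wedge\left(\frac{p\log(p)}{n^2}\right)\right].$$
   Context: Model: $Y=(y_1,\dots,y_n)^T=\mathbf{X}\beta^*+\epsilon$, where $\mathbf{X}\in\mathbb{R}^{n\times p}$ has i.i.d. rows with distribution $\mathcal{N}(0,\boldsymbol\Sigma)$, $\epsilon\sim\mathcal{N}(0,\sigma^2\mathbf{I}_n)$ is independent of $\mathbf{X}$, $\boldsymbol\Sigma$ is invertible, $\boldsymbol\Omega:=\boldsymbol\Sigma^{-1}$. $\mathbf{X}^{(2)}$ is an independent copy of $\mathbf{X}$, independent of $(\mathbf{X},\epsilon)$. A vector is $k$-sparse if at most $k$ of its coordinates are nonzero. The proportion of explained variation is $\eta:=\frac{\beta^{*T}\boldsymbol\Sigma\beta^*}{\sigma^2+\beta^{*T}\boldsymbol\Sigma\beta^*}$. Notation: $a\wedge b=\min(a,b)$, $a\vee b=\max(a,b)$. With $\|\mathbf{A}\|_{1\to1}=\max_{j}\sum_i|\mathbf{A}_{i,j}|$, $\mathcal{U}(M,M_1)$ is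 the set of symmetric positive definite $p\times p$ matrices $\boldsymbol\Omega$ such that $\frac1{M_1}\le\lambda_{\min}(\boldsymbol\Omega)\le\lambda_{\max}(\boldsymbol\Omega)\le M_1$, $\|\boldsymbol\Omega\|_{1\to1}\le M$ and $\max_{1\le j\le p}\sum_{i=1}^p\mathbf{1}_{\boldsymbol\Omega_{i,j}\ne0}\le\sqrt{\frac{p}{n\log(p)}}$. CLIME estimator: let $\widehat{\boldsymbol\Sigma}^{(2)}:=\mathbf{X}^{(2)T}\mathbf{X}^{(2)}/n$ and $\lambda_n:=2(25\vee M_1)\big(3+e^3(5\vee\sqrt{M_1})\big)^2M\sqrt{\log(p)/n}$. Let $\widehat{\boldsymbol\Omega}_1$ be a solution of: minimize $\sum_{i,j}|\boldsymbol\Omega'_{i,j}|$ over $\boldsymbol\Omega'\in\mathbb{R}^{p\times p}$ subject to $\max_{i,j}|(\widehat{\boldsymbol\Sigma}^{(2)}\boldsymbol\Omega'-\mathbf{I}_p)_{i,j}|\le\lambda_n$ (with an arbitrary measurable convention if the constraint set is empty). The matrix $\widehat{\boldsymbol\Omega}_{CL}$ is defined by $(\widehat{\boldsymbol\Omega}_{CL})_{i,j}=(\widehat{\boldsymbol\Omega}_1)_{i,j}$ if $|(\widehat{\boldsymbol\Omega}_1)_{i,j}|\le|(\widehat{\boldsymbol\Omega}_1)_{j,i}|$ and $(\widehat{\boldsymbol\Omega}_{CL})_{i,j}=(\widehat{\boldsymbol\Omega}_1)_{j,i}$ otherwise. Plug-in estimator: for a $p\times p$ matrix $\mathbf{M}$,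 $\widehat\eta^D(\mathbf{M}):=\frac{Y^T(\mathbf{X}\mathbf{M}\mathbf{X}^T-\mathrm{tr}(\mathbf{X}\mathbf{M}\mathbf{X}^T)\mathbf{I}_n/n)Y}{(n+1)\|Y\|_2^2}$ and $\widehat\eta^D_T(\mathbf{M}):=\min(1,\max(0,\widehat\eta^D(\mathbf{M})))$. Square-root Lasso estimator: let $\mathbf{W}$ be the matrix whose $j$-th column is the $j$-th column of $\mathbf{X}$ divided by its Euclidean norm, $\lambda_0:=13\sqrt{\log p}$, and $\widetilde\beta_{SL}$ a minimizer over $\beta\in\mathbb{R}^p$ of $\|Y-\mathbf{W}\beta\|_2+\frac{\lambda_0}{\sqrt n}\|\beta\|_1$; then $\widehat\eta^{SL}:=1-\|Y-\mathbf{W}\widetilde\beta_{SL}\|_2^2/\|Y\|_2^2$. Constants: $C_1,C_2$ are numerical constants such that, whenever $p\ge n$, for any invertible $\boldsymbol\Sigma$, any $\beta^*$, $\sigma>0$ and $0\le t\le n^{1/3}$, $\mathbb{P}\big[|\widehat\eta^D(\mathbf{I}_p)-\beta^{*T}\boldsymbol\Sigma^2\beta^*/\mathrm{Var}(y_1)|\le C_1\|\boldsymbol\Sigma\|_{op}\sqrt{pt}/n\big]\ge1-C_2e^{-t}$ (existence is another theorem of the paper). $C_3$ is a numerical constant such that, if $\log p\le n/8$ and $\boldsymbol\Omega\in\mathcal{U}(M,M_1)$, then $\|\widehat{\boldsymbol\Omega}_{CL}-\boldsymbol\Omega\|_{op}\le C_3M^2M_1^2\sqrt p/n$ with probability larger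 than $1-4/p$ (existence follows from a theorem of Cai, Liu and Luo). Set $c_0(M,M_1):=4C_1M_1^2+2C_3M^2M_1^3$. Adaptive estimator: $\widehat\eta^A_{CL}:=\widehat\eta^{SL}$ if $|\widehat\eta^D_T(\widehat{\boldsymbol\Omega}_{CL})-\widehat\eta^{SL}|\le c_0(M,M_1)\sqrt{p\log(p)}/n$, and $\widehat\eta^A_{CL}:=\widehat\eta^D_T(\widehat{\boldsymbol\Omega}_{CL})$ otherwise. *)

theory Defs
  imports
    "HOL-Probability.Probability"
    "Jordan_Normal_Form.Gauss_Jordan_Elimination"
    "Jordan_Normal_Form.Spectral_Radius"
begin

(* n and p are quantified below a constant that must not depend on them, hence matrices and
   vectors whose dimensions are values, not types. *)

unbundle no inner_syntax
unbundle no vec_syntax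

definition vnorm :: "real vec \<Rightarrow> real" where
  "vnorm v = sqrt (v \<bullet> v)"

definition l1_norm :: "real vec \<Rightarrow> real" where
  "l1_norm v = (\<Sum>j<dim_vec v. \<bar>v $ j\<bar>)"

definition nnz :: "real vec \<Rightarrow> nat" where
  "nnz v = card {j. j < dim_vec v \<and> v $ j \<noteq> 0}"

definition op_norm :: "real mat \<Rightarrow> real" where
  "op_norm A = Sup {vnorm (A *\<^sub>v v) | v. v \<in> carrier_vec (dim_col A) \<and> vnorm v = 1}"

definition one_one_norm :: "real mat \<Rightarrow> real" where
  "one_one_norm A = Max ((\<lambda>j. \<Sum>i<dim_row A. \<bar>A $$ (i, j)\<bar>) ` {..<dim_col A})"

definition max_entry :: "real mat \<Rightarrow> real" where
  "max_entry A = Max (abs ` elements_mat A)"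

definition entry_l1 :: "real mat \<Rightarrow> real" where
  "entry_l1 A = (\<Sum>i<dim_row A. \<Sum>j<dim_col A. \<bar>A $$ (i, j)\<bar>)"

definition mat_trace :: "real mat \<Rightarrow> real" where
  "mat_trace A = (\<Sum>i<dim_row A. A $$ (i, i))"

definition sym_pos_def :: "nat \<Rightarrow> real mat set" where
  "sym_pos_def p = {A \<in> carrier_mat p p. transpose_mat A = A \<and>
     (\<forall>v \<in> carrier_vec p. v \<noteq> 0\<^sub>v p \<longrightarrow> 0 < v \<bullet> (A *\<^sub>v v))}"

(* Only applied to invertible matrices, for which mat_inverse returns Some. *)
definition inv_mat :: "real mat \<Rightarrow> real mat" where
  "inv_mat A = the (mat_inverse A)"

(* For p = 1 the sparsity bound sqrt (p / (n ln p)) has a vanishing denominator. It is read as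
   infinity there; Isabelle's x / 0 = 0 would instead make the class empty. *)
definition prec_class :: "nat \<Rightarrow> nat \<Rightarrow> real \<Rightarrow> real \<Rightarrow> real mat set" where
  "prec_class n p M M1 = {A \<in> sym_pos_def p.
     1 / M1 \<le> Min (spectrum A) \<and> Max (spectrum A) \<le> M1 \<and>
     one_one_norm A \<le> M \<and>
     (p = 1 \<or> real (Max ((\<lambda>j. nnz (col A j)) ` {..<p})) \<le> sqrt (real p / (real n * ln (real p))))}"

(* The law N(0,S) for symmetric positive definite S; a point of the underlying space is a function on
   the index set {..<p}. *)
definition gaussian_law :: "nat \<Rightarrow> real mat \<Rightarrow> (nat \<Rightarrow> real) measure" where
  "gaussian_law p S = density (PiM {..<p} (\<lambda>_. lborel))
     (\<lambda>x. ennreal (exp (- (vec p x \<bullet> (inv_mat S *\<^sub>v vec p x)) / 2) / sqrt ((2 * pi) ^ p * det S)))"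

definition design_law :: "nat \<Rightarrow> nat \<Rightarrow> real mat \<Rightarrow> (nat \<Rightarrow> nat \<Rightarrow> real) measure" where
  "design_law n p S = PiM {..<n} (\<lambda>_. gaussian_law p S)"

definition model_law ::
    "nat \<Rightarrow> nat \<Rightarrow> real mat \<Rightarrow> real \<Rightarrow> ((nat \<Rightarrow> nat \<Rightarrow> real) \<times> (nat \<Rightarrow> real)) measure" where
  "model_law n p S \<sigma> = design_law n p S \<Otimes>\<^sub>M gaussian_law n (\<sigma>\<^sup>2 \<cdot>\<^sub>m 1\<^sub>m n)"

definition design :: "nat \<Rightarrow> nat \<Rightarrow> (nat \<Rightarrow> nat \<Rightarrow> real) \<Rightarrow> real mat" where
  "design n p x = mat n p (\<lambda>(i, j). x i j)"

definition response ::
    "nat \<Rightarrow> nat \<Rightarrow> real vec \<Rightarrow> (nat \<Rightarrow> nat \<Rightarrow> real) \<Rightarrow> (nat \<Rightarrow> real) \<Rightarrow> real vec" where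
  "response n p \<beta> x e = design n p x *\<^sub>v \<beta> + vec n e"

definition eta :: "real mat \<Rightarrow> real vec \<Rightarrow> real \<Rightarrow> real" where
  "eta S \<beta> \<sigma> = (\<beta> \<bullet> (S *\<^sub>v \<beta>)) / (\<sigma>\<^sup>2 + \<beta> \<bullet> (S *\<^sub>v \<beta>))"

(* In the estimators n and p are read off the dimensions of the design matrix. *)
definition eta_D :: "real mat \<Rightarrow> real vec \<Rightarrow> real mat \<Rightarrow> real" where
  "eta_D X Y A = (let n = dim_row X; G = X * A * transpose_mat X in
     (Y \<bullet> ((G - (mat_trace G / real n) \<cdot>\<^sub>m 1\<^sub>m n) *\<^sub>v Y)) / ((real n + 1) * (vnorm Y)\<^sup>2))"

definition eta_D_T :: "real mat \<Rightarrow> real vec \<Rightarrow> real mat \<Rightarrow> real" where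
  "eta_D_T X Y A = min 1 (max 0 (eta_D X Y A))"

definition clime_lambda :: "nat \<Rightarrow> nat \<Rightarrow> real \<Rightarrow> real \<Rightarrow> real" where
  "clime_lambda n p M M1 =
     2 * max 25 M1 * (3 + exp 3 * max 5 (sqrt M1))\<^sup>2 * M * sqrt (ln (real p) / real n)"

definition clime_feasible :: "real \<Rightarrow> real \<Rightarrow> real mat \<Rightarrow> real mat \<Rightarrow> bool" where
  "clime_feasible M M1 X2 A \<longleftrightarrow> (let n = dim_row X2; p = dim_col X2;
       S2 = (1 / real n) \<cdot>\<^sub>m (transpose_mat X2 * X2) in
     A \<in> carrier_mat p p \<and> max_entry (S2 * A - 1\<^sub>m p) \<le> clime_lambda n p M M1)"

(* Om1 is any measurable choice of a minimizer as a function of the second sample; where the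
   constraint set is empty, its value is arbitrary. *)
definition clime_solution :: "nat \<Rightarrow> nat \<Rightarrow> real \<Rightarrow> real \<Rightarrow> (real mat \<Rightarrow> real mat) \<Rightarrow> bool" where
  "clime_solution n p M M1 Om1 \<longleftrightarrow>
     (\<forall>X2 \<in> carrier_mat n p. Om1 X2 \<in> carrier_mat p p \<and>
        ((\<exists>A. clime_feasible M M1 X2 A) \<longrightarrow> is_arg_min entry_l1 (clime_feasible M M1 X2) (Om1 X2))) \<and>
     (\<forall>i<p. \<forall>j<p. (\<lambda>x. Om1 (design n p x) $$ (i, j))
        \<in> borel_measurable (PiM {..<n} (\<lambda>_. PiM {..<p} (\<lambda>_. borel))))"

definition clime_sym :: "real mat \<Rightarrow> real mat" where
  "clime_sym A = mat (dim_row A) (dim_col A)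
     (\<lambda>(i, j). if \<bar>A $$ (i, j)\<bar> \<le> \<bar>A $$ (j, i)\<bar> then A $$ (i, j) else A $$ (j, i))"

definition normalize_cols :: "real mat \<Rightarrow> real mat" where
  "normalize_cols X = mat (dim_row X) (dim_col X) (\<lambda>(i, j). X $$ (i, j) / vnorm (col X j))"

definition sqrt_lasso_obj :: "real mat \<Rightarrow> real vec \<Rightarrow> real vec \<Rightarrow> real" where
  "sqrt_lasso_obj X Y b = vnorm (Y - normalize_cols X *\<^sub>v b) +
     13 * sqrt (ln (real (dim_col X))) / sqrt (real (dim_row X)) * l1_norm b"

definition sqrt_lasso_solution :: "nat \<Rightarrow> nat \<Rightarrow> (real mat \<Rightarrow> real vec \<Rightarrow> real vec) \<Rightarrow> bool" where
  "sqrt_lasso_solution n p sl \<longleftrightarrow>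
     (\<forall>X \<in> carrier_mat n p. \<forall>Y \<in> carrier_vec n.
        is_arg_min (sqrt_lasso_obj X Y) (\<lambda>b. b \<in> carrier_vec p) (sl X Y)) \<and>
     (\<forall>j<p. (\<lambda>(x, y). sl (design n p x) (vec n y) $ j)
        \<in> borel_measurable (PiM {..<n} (\<lambda>_. PiM {..<p} (\<lambda>_. borel)) \<Otimes>\<^sub>M PiM {..<n} (\<lambda>_. borel)))"

definition eta_SL :: "real mat \<Rightarrow> real vec \<Rightarrow> real vec \<Rightarrow> real" where
  "eta_SL X Y b = 1 - (vnorm (Y - normalize_cols X *\<^sub>v b))\<^sup>2 / (vnorm Y)\<^sup>2"

definition plug_in_constants :: "real \<Rightarrow> real \<Rightarrow> bool" where
  "plug_in_constants C1 C2 \<longleftrightarrow>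
     (\<forall>n p S \<beta> \<sigma> t. 1 \<le> n \<and> n \<le> p \<and> S \<in> sym_pos_def p \<and> \<beta> \<in> carrier_vec p \<and> 0 < \<sigma> \<and>
        0 \<le> t \<and> t \<le> root 3 (real n) \<longrightarrow>
        \<P>(\<omega> in model_law n p S \<sigma>.
          \<bar>eta_D (design n p (fst \<omega>)) (response n p \<beta> (fst \<omega>) (snd \<omega>)) (1\<^sub>m p) -
             (\<beta> \<bullet> ((S * S) *\<^sub>v \<beta>)) /
               prob_space.variance (model_law n p S \<sigma>) (\<lambda>(x, e). response n p \<beta> x e $ 0)\<bar>
            \<le> C1 * op_norm S * sqrt (real p * t) / real n)
        \<ge> 1 - C2 * exp (- t))"

definition clime_constant :: "real \<Rightarrow> bool" where
  "clime_constant C3 \<longleftrightarrow>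
     (\<forall>n p M M1 S Om1. 1 \<le> n \<and> 1 \<le> p \<and> 0 < M \<and> 0 < M1 \<and> S \<in> sym_pos_def p \<and>
        ln (real p) \<le> real n / 8 \<and> inv_mat S \<in> prec_class n p M M1 \<and>
        clime_solution n p M M1 Om1 \<longrightarrow>
        \<P>(x2 in design_law n p S.
          op_norm (clime_sym (Om1 (design n p x2)) - inv_mat S) \<le> C3 * M\<^sup>2 * M1\<^sup>2 * sqrt (real p) / real n)
        \<ge> 1 - 4 / real p)"

definition c0 :: "real \<Rightarrow> real \<Rightarrow> real \<Rightarrow> real \<Rightarrow> real" where
  "c0 C1 C3 M M1 = 4 * C1 * M1\<^sup>2 + 2 * C3 * M\<^sup>2 * M1 ^ 3"

definition eta_A ::
    "real \<Rightarrow> real \<Rightarrow> real \<Rightarrow> real \<Rightarrow> (real mat \<Rightarrow> real mat) \<Rightarrow> (real mat \<Rightarrow> real vec \<Rightarrow> real vec)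
      \<Rightarrow> real mat \<Rightarrow> real vec \<Rightarrow> real mat \<Rightarrow> real" where
  "eta_A C1 C3 M M1 Om1 sl X Y X2 =
     (let n = dim_row X; p = dim_col X;
          d = eta_D_T X Y (clime_sym (Om1 X2));
          s = eta_SL X Y (sl X Y) in
      if \<bar>d - s\<bar> \<le> c0 C1 C3 M M1 * sqrt (real p * ln (real p)) / real n then s else d)"

end

theory Submission
  imports Defs
begin

text \<open>
  Both component estimators and \<open>\<eta>\<close> lie in \<open>[0, 1]\<close>, so every regime in which the right-hand side is bounded
  below, in particular \<open>n\<close> bounded or \<open>ln p \<ge> c n\<close>, is trivial; the column sparsity of \<open>\<Omega>\<close>
  forces \<open>n ln p \<le> p\<close> for \<open>p \<ge> 2\<close>.  Let \<open>\<tau>\<close> be the selection threshold.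

  Dense rate: conditionally on the second sample, the symmetrised CLIME matrix \<open>A\<close> is positive definite,
  and whitening the design by a Cholesky factor of \<open>A\<close> reduces the plug-in estimator with \<open>A\<close> to the one
  with the identity.  Hence it is within \<open>\<tau> / 2\<close> of \<open>\<eta>\<close> outside an event of probability \<open>O(1 / n)\<close>
  whenever \<open>\<tau> < 1\<close>; when \<open>\<tau> \<ge> 1\<close> the Lasso is always selected and the dense rate is trivial.

  Sparse rate: for \<open>k ln p \<le> c n\<close> the square-root Lasso satisfies a cone condition, and the restricted
  eigenvalue property on the cone follows by Maurey's empirical method from a chi-square lower tail and a
  union bound over the \<open>(2 p)\<^sup>m\<close> sums of \<open>m\<close> signed basis vectors, with \<open>m\<close> proportional to \<open>k\<close>.
  On the good event, selecting the plug-in estimator can only improve on the Lasso.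

  For \<open>p = 1\<close> both the penalty and the CLIME slack vanish and second moments suffice.
\<close>

section \<open>Quadratic forms and spectra\<close>

text \<open>\<open>C1\<close>, \<open>C2\<close>, \<open>C3\<close> are only assumed to satisfy
  probability bounds, so their signs are open: a negative \<open>C1\<close> makes the assumed event
  empty and bounds \<open>n\<close>, a negative \<open>C3\<close> is excluded for
  \<open>p \<ge> 5\<close> by an event of positive probability, and \<open>C2\<close> enters through
  \<open>max 0 C2\<close>. \<open>clime_sym\<close> need not return a symmetric matrix, since
  mirrored entries of equal modulus and opposite signs are both kept. As \<open>eta_D\<close>
  depends on the symmetric part only, whitening is applied to that part. Its positive definiteness
  is where \<tau> < 1 enters: the operator error \<delta> of CLIME satisfies 2 M1 \<delta> \<le>
  \<tau>, while the precision form is at least 1 / M1. The two terms of \<open>c0\<close> are twice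
  two errors: the whitened covariance has norm at most 2 M1^2, and replacing the precision matrix by
  its estimate moves the target by at most \<delta> M1. The risk is a nonnegative integral, which is
  monotone for every integrand. The squared error is dominated pointwise by indicators of bad events
  and squared relative deviations; the loss is at most 1 where deviations are large, so second
  moments give the rate 1 / n.\<close>

lemma scalar_prod_lessThan:
  "w \<in> carrier_vec n \<Longrightarrow> v \<bullet> w = (\<Sum>i<n. v $ i * w $ i)"
  by (simp add: scalar_prod_def lessThan_atLeast0)

lemma sprod_self_nonneg: "0 \<le> v \<bullet> (v :: real vec)"
  by (auto simp: scalar_prod_def intro!: sum_nonneg)

lemma vnorm_nonneg [simp]: "0 \<le> vnorm v"
  by (simp add: vnorm_def sprod_self_nonneg)

lemma vnorm_sq: "(vnorm v)\<^sup>2 = v \<bullet> v"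
  by (simp add: vnorm_def sprod_self_nonneg)

lemma sprod_self_eq_0:
  assumes "v \<in> carrier_vec n" shows "v \<bullet> v = (0::real) \<longleftrightarrow> v = 0\<^sub>v n"
proof
  assume "v \<bullet> v = 0"
  then have "(\<Sum>i<n. v $ i * v $ i) = 0" using scalar_prod_lessThan[OF assms] by metis
  then have "\<forall>i<n. v $ i = 0" by (subst (asm) sum_nonneg_eq_0_iff) auto
  then show "v = 0\<^sub>v n" using assms by (intro eq_vecI) auto
qed auto

lemma vnorm_eq_0: "v \<in> carrier_vec n \<Longrightarrow> vnorm v = 0 \<longleftrightarrow> v = 0\<^sub>v n"
  by (simp add: vnorm_def sprod_self_eq_0)

lemma sprod_pos: "v \<in> carrier_vec n \<Longrightarrow> v \<noteq> 0\<^sub>v n \<Longrightarrow> 0 < v \<bullet> (v :: real vec)"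
  using sprod_self_eq_0[of v n] sprod_self_nonneg[of v] by linarith

lemma sprod_Cauchy_Schwarz:
  assumes "u \<in> carrier_vec n" "v \<in> carrier_vec n"
  shows "(u \<bullet> v)\<^sup>2 \<le> (u \<bullet> u) * (v \<bullet> (v :: real vec))"
  using Cauchy_Schwarz_ineq_sum[of "\<lambda>i. u $ i" "\<lambda>i. v $ i" "{..<n}"] assms
  by (simp add: scalar_prod_lessThan power2_eq_square)

lemma abs_sprod_le:
  assumes "u \<in> carrier_vec n" "v \<in> carrier_vec n"
  shows "\<bar>u \<bullet> v\<bar> \<le> vnorm u * vnorm v"
  using sprod_Cauchy_Schwarz[OF assms]
  by (metis abs_ge_zero abs_le_square_iff abs_mult abs_of_nonneg power_mult_distrib vnorm_nonneg vnorm_sq)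

lemma vnorm_smult: "vnorm (c \<cdot>\<^sub>v v) = \<bar>c\<bar> * vnorm v"
proof -
  have "(c \<cdot>\<^sub>v v) \<bullet> (c \<cdot>\<^sub>v v) = c\<^sup>2 * (v \<bullet> v)"
    by (simp add: scalar_prod_def sum_distrib_left power2_eq_square ac_simps)
  then show ?thesis by (simp add: vnorm_def real_sqrt_mult)
qed

lemma sprod_sym_mat:
  assumes "A \<in> carrier_mat n n" "transpose_mat A = A" "u \<in> carrier_vec n" "v \<in> carrier_vec n"
  shows "u \<bullet> (A *\<^sub>v v) = v \<bullet> (A *\<^sub>v (u :: real vec))"
  using transpose_vec_mult_scalar[of A n n v u] assms
  by (metis comm_scalar_prod mult_mat_vec_carrier)

text \<open>The form at \<open>u + t v\<close> is a nonnegative quadratic in \<open>t\<close>, so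
  its discriminant is nonpositive. Semidefiniteness has to suffice, because the main application is
  to the singular matrix \<open>\<mu> I - A\<close> of the Rayleigh argument.\<close>

lemma psd_Cauchy_Schwarz:
  fixes A :: "real mat"
  assumes A: "A \<in> carrier_mat n n" "transpose_mat A = A"
    and psd: "\<And>v. v \<in> carrier_vec n \<Longrightarrow> 0 \<le> v \<bullet> (A *\<^sub>v v)"
    and u: "u \<in> carrier_vec n" and v: "v \<in> carrier_vec n"
  shows "(u \<bullet> (A *\<^sub>v v))\<^sup>2 \<le> (u \<bullet> (A *\<^sub>v u)) * (v \<bullet> (A *\<^sub>v v))"
proof -
  define a b c where "a = u \<bullet> (A *\<^sub>v u)" and "b = u \<bullet> (A *\<^sub>v v)" and "c = v \<bullet> (A *\<^sub>v v)"
  have quad: "0 \<le> a + 2 * b * t + c * t\<^sup>2" for t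
  proof -
    have w: "u + t \<cdot>\<^sub>v v \<in> carrier_vec n" using u v by simp
    have "(u + t \<cdot>\<^sub>v v) \<bullet> (A *\<^sub>v (u + t \<cdot>\<^sub>v v)) = u \<bullet> (A *\<^sub>v u) + t * (u \<bullet> (A *\<^sub>v v))
        + (t * (v \<bullet> (A *\<^sub>v u)) + t * (t * (v \<bullet> (A *\<^sub>v v))))"
      using A(1) u v
      by (simp add: mult_add_distrib_mat_vec[of A n n] mult_mat_vec[of A n n]
          add_scalar_prod_distrib[of _ n] scalar_prod_add_distrib[of _ n] distrib_left)
    with psd[OF w] show ?thesis
      unfolding a_def b_def c_def sprod_sym_mat[OF A v u] by (simp add: algebra_simps power2_eq_square)
  qed
  have c0: "0 \<le> c" using psd[OF v] by (simp add: c_def)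
  have "b\<^sup>2 \<le> a * c"
  proof (cases "c = 0")
    case True
    \<comment> \<open>With \<open>c = 0\<close> the quadratic is affine in \<open>t\<close>; a
      nonzero slope would give it the value -1 at the \<open>t\<close> chosen below.\<close>
    have "b = 0"
    proof (rule ccontr)
      assume b: "b \<noteq> 0"
      then have "2 * b * (- (a + 1) / (2 * b)) = - (a + 1)" by simp
      then show False using quad[of "- (a + 1) / (2 * b)"] unfolding True by linarith
    qed
    then show ?thesis using True by simp
  next
    case False
    then have c: "0 < c" using c0 by simp
    have "a + 2 * b * (- b / c) + c * (- b / c)\<^sup>2 = a - b\<^sup>2 / c"
      using c by (simp add: field_simps power2_eq_square)
    then have "b\<^sup>2 / c \<le> a" using quad[of "- b / c"] by linarith
    then show ?thesis using c by (simp add: field_simps)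
  qed
  then show ?thesis by (simp add: a_def b_def c_def)
qed

text \<open>Cauchy-Schwarz in every row gives the squared Frobenius norm as the bound. Only its
  existence matters: it keeps the suprema over unit vectors finite.\<close>

lemma mat_vec_bounded:
  fixes A :: "real mat"
  assumes A: "A \<in> carrier_mat n m"
  shows "\<exists>K\<ge>0. \<forall>v \<in> carrier_vec m. (A *\<^sub>v v) \<bullet> (A *\<^sub>v v) \<le> K * (v \<bullet> v)"
proof (intro exI conjI ballI)
  show "0 \<le> (\<Sum>i<n. row A i \<bullet> row A i)" by (intro sum_nonneg sprod_self_nonneg)
  fix v :: "real vec" assume v: "v \<in> carrier_vec m"
  have "(A *\<^sub>v v) \<bullet> (A *\<^sub>v v) = (\<Sum>i<n. (row A i \<bullet> v)\<^sup>2)"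
    using A v by (subst scalar_prod_lessThan[of _ n]) (auto simp: power2_eq_square)
  also have "\<dots> \<le> (\<Sum>i<n. (row A i \<bullet> row A i) * (v \<bullet> v))"
    by (intro sum_mono sprod_Cauchy_Schwarz[of _ m]) (use A v in auto)
  finally show "(A *\<^sub>v v) \<bullet> (A *\<^sub>v v) \<le> (\<Sum>i<n. row A i \<bullet> row A i) * (v \<bullet> v)"
    by (simp add: sum_distrib_right)
qed

lemma det_nonzero_inverse:
  fixes A :: "real mat"
  assumes A: "A \<in> carrier_mat n n" and d: "det A \<noteq> 0"
  shows "\<exists>B. mat_inverse A = Some B \<and> B \<in> carrier_mat n n \<and> A * B = 1\<^sub>m n \<and> B * A = 1\<^sub>m n"
proof -
  have "A \<in> Units (ring_mat TYPE(real) n ())" using det_non_zero_imp_unit[OF A d] .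
  then obtain B where "mat_inverse A = Some B" using mat_inverse(1)[OF A, where b = "()"] by (cases "mat_inverse A") auto
  then show ?thesis using mat_inverse(2)[OF A] by auto
qed

text \<open>The supremum of the Rayleigh quotient is an eigenvalue: otherwise \<open>\<mu> I - A\<close> would be invertible
  and hence, by the Cauchy--Schwarz inequality for semidefinite forms, bounded away from zero.\<close>

lemma rayleigh_le:
  fixes A :: "real mat"
  assumes A: "A \<in> carrier_mat n n" "transpose_mat A = A"
    and sp: "\<And>e. e \<in> spectrum A \<Longrightarrow> e \<le> c" and v: "v \<in> carrier_vec n"
  shows "v \<bullet> (A *\<^sub>v v) \<le> c * (v \<bullet> v)"
proof (cases "v = 0\<^sub>v n")
  case True
  then show ?thesis using A by simp
next
  case v0: False
  define U where "U = {w \<bullet> (A *\<^sub>v w) | w. w \<in> carrier_vec n \<and> w \<bullet> w = 1}"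
  have unit: "(1 / vnorm w) \<cdot>\<^sub>v w \<in> carrier_vec n \<and> ((1 / vnorm w) \<cdot>\<^sub>v w) \<bullet> ((1 / vnorm w) \<cdot>\<^sub>v w) = 1
     \<and> ((1 / vnorm w) \<cdot>\<^sub>v w) \<bullet> (A *\<^sub>v ((1 / vnorm w) \<cdot>\<^sub>v w)) = (w \<bullet> (A *\<^sub>v w)) / (w \<bullet> w)"
    if w: "w \<in> carrier_vec n" "w \<noteq> 0\<^sub>v n" for w
  proof -
    have p: "0 < w \<bullet> w" by (rule sprod_pos[OF w])
    have "(vnorm w)\<^sup>2 = w \<bullet> w" by (rule vnorm_sq)
    then have q: "vnorm w * vnorm w = w \<bullet> w" "vnorm w \<noteq> 0" using p by (auto simp: power2_eq_square)
    show ?thesis using w A q p by (simp add: mult_mat_vec[of A n n] field_simps)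
  qed
  obtain K where K: "K \<ge> 0" "\<And>w. w \<in> carrier_vec n \<Longrightarrow> (A *\<^sub>v w) \<bullet> (A *\<^sub>v w) \<le> K * (w \<bullet> w)"
    using mat_vec_bounded[OF A(1)] by blast
  have bdd: "bdd_above U"
  proof (rule bdd_aboveI[of _ "K + 1"])
    fix x assume "x \<in> U"
    then obtain w where w: "w \<in> carrier_vec n" "w \<bullet> w = 1" "x = w \<bullet> (A *\<^sub>v w)" unfolding U_def by auto
    have "x\<^sup>2 \<le> (w \<bullet> w) * ((A *\<^sub>v w) \<bullet> (A *\<^sub>v w))" unfolding w(3)
      by (rule sprod_Cauchy_Schwarz[of _ n]) (use A w in auto)
    also have "\<dots> \<le> K" using K(2)[OF w(1)] w by simp
    also have "\<dots> \<le> (K + 1)\<^sup>2" using K(1) by (simp add: power2_eq_square algebra_simps)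
    finally show "x \<le> K + 1" using K(1) by (meson abs_le_square_iff abs_le_D1 abs_of_nonneg add_nonneg_nonneg order_trans abs_ge_self power2_le_imp_le zero_le_one)
  qed
  have ne: "U \<noteq> {}" using unit[OF v v0] unfolding U_def by blast
  define \<mu> where "\<mu> = Sup U"
  define N where "N = \<mu> \<cdot>\<^sub>m 1\<^sub>m n - A"
  have N: "N \<in> carrier_mat n n" unfolding N_def by (rule minus_carrier_mat[OF A(1)])
  have Nsym: "transpose_mat N = N" 
  proof (rule eq_matI)
    fix i j assume ij: "i < dim_row N" "j < dim_col N"
    then have "A $$ (j, i) = A $$ (i, j)" using A N
      by (metis carrier_matD index_transpose_mat(1))
    then show "transpose_mat N $$ (i, j) = N $$ (i, j)" using ij A N by (auto simp: N_def)
  qed (use N in auto)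
  have one: "(\<mu> \<cdot>\<^sub>m 1\<^sub>m n) *\<^sub>v w = \<mu> \<cdot>\<^sub>v w" if "w \<in> carrier_vec n" for w
    using that by (intro eq_vecI) auto
  have Nv: "N *\<^sub>v w = \<mu> \<cdot>\<^sub>v w - A *\<^sub>v w" if "w \<in> carrier_vec n" for w
    using that A unfolding N_def by (subst minus_mult_distrib_mat_vec[of _ n n]) (auto simp: one)
  have Nq: "w \<bullet> (N *\<^sub>v w) = \<mu> * (w \<bullet> w) - w \<bullet> (A *\<^sub>v w)" if "w \<in> carrier_vec n" for w
    unfolding Nv[OF that] using that A by (subst scalar_prod_minus_distrib[of _ n]) auto
  have Npsd: "0 \<le> w \<bullet> (N *\<^sub>v w)" if w: "w \<in> carrier_vec n" for w
  proof (cases "w = 0\<^sub>v n")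
    case True
    then show ?thesis using N by simp
  next
    case False
    then have "(w \<bullet> (A *\<^sub>v w)) / (w \<bullet> w) \<in> U" using unit[OF w] unfolding U_def by (smt (verit) mem_Collect_eq)
    then have "(w \<bullet> (A *\<^sub>v w)) / (w \<bullet> w) \<le> \<mu>" unfolding \<mu>_def by (rule cSup_upper[OF _ bdd])
    then show ?thesis using sprod_pos[OF w False] Nq[OF w] by (simp add: field_simps)
  qed
  have "det N = 0"
  proof (rule ccontr)
    assume "det N \<noteq> 0"
    then obtain B where B: "B \<in> carrier_mat n n" "B * N = 1\<^sub>m n" using det_nonzero_inverse[OF N] by blast
    obtain KB where KB: "KB \<ge> 0" "\<And>w. w \<in> carrier_vec n \<Longrightarrow> (B *\<^sub>v w) \<bullet> (B *\<^sub>v w) \<le> KB * (w \<bullet> w)"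
      using mat_vec_bounded[OF B(1)] by blast
    obtain KN where KN: "KN \<ge> 0" "\<And>w. w \<in> carrier_vec n \<Longrightarrow> (N *\<^sub>v w) \<bullet> (N *\<^sub>v w) \<le> KN * (w \<bullet> w)"
      using mat_vec_bounded[OF N] by blast
    define L where "L = KB * (KN + 1) + 1"
    have L: "L > 0" unfolding L_def using KB KN by (simp add: add_nonneg_pos)
    \<comment> \<open>Put u = N w. The semidefinite inequality gives |u|^4 \<le> (u' N u) (w' N w)
      with w' N w = \<mu> - x, and u' N u is at most a multiple of |u|^2. Since w = B u has norm
      one, |u| is bounded below, hence so is \<mu> - x, uniformly over \<open>U\<close>. This
      contradicts that \<mu> is the supremum.\<close>
    have gap: "1 \<le> L * (\<mu> - x)" if "x \<in> U" for x
    proof -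
      from that obtain w where w: "w \<in> carrier_vec n" "w \<bullet> w = 1" "x = w \<bullet> (A *\<^sub>v w)" unfolding U_def by auto
      define u where "u = N *\<^sub>v w"
      have u: "u \<in> carrier_vec n" using N w by (simp add: u_def)
      have uu0: "0 \<le> u \<bullet> u" by (rule sprod_self_nonneg)
      have x: "w \<bullet> (N *\<^sub>v w) = \<mu> - x" using Nq[OF w(1)] w by simp
      have xpos: "0 \<le> \<mu> - x" using Npsd[OF w(1)] x by simp
      have Nu: "u \<bullet> (N *\<^sub>v u) \<le> (KN + 1) * (u \<bullet> u)"
      proof -
        have "(u \<bullet> (N *\<^sub>v u))\<^sup>2 \<le> (u \<bullet> u) * ((N *\<^sub>v u) \<bullet> (N *\<^sub>v u))"
          by (rule sprod_Cauchy_Schwarz[of _ n]) (use N u in auto)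
        also have "\<dots> \<le> (u \<bullet> u) * (KN * (u \<bullet> u))" using KN(2)[OF u] uu0 by (rule mult_left_mono)
        also have "\<dots> \<le> ((KN + 1) * (u \<bullet> u))\<^sup>2"
        proof -
          have "KN \<le> (KN + 1)\<^sup>2" using KN(1) by (simp add: power2_eq_square algebra_simps)
          then have "KN * (u \<bullet> u)\<^sup>2 \<le> (KN + 1)\<^sup>2 * (u \<bullet> u)\<^sup>2" by (rule mult_right_mono) simp
          then show ?thesis by (simp add: power_mult_distrib power2_eq_square ac_simps)
        qed
        finally show ?thesis by (rule power2_le_imp_le) (use KN uu0 in simp)
      qed
      have "(u \<bullet> u)\<^sup>2 \<le> (u \<bullet> (N *\<^sub>v u)) * (\<mu> - x)"
        using psd_Cauchy_Schwarz[OF N Nsym Npsd u w(1)] x by (simp add: u_def)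
      also have "\<dots> \<le> ((KN + 1) * (u \<bullet> u)) * (\<mu> - x)" using Nu xpos by (rule mult_right_mono)
      finally have "(u \<bullet> u) * (u \<bullet> u) \<le> (u \<bullet> u) * ((KN + 1) * (\<mu> - x))" by (simp add: power2_eq_square ac_simps)
      then have uu: "u \<bullet> u \<le> (KN + 1) * (\<mu> - x)"
        using uu0 KN(1) xpos by (cases "u \<bullet> u = 0") (auto simp: mult_le_cancel_left)
      have "B *\<^sub>v u = w" unfolding u_def using B N w
        by (metis assoc_mult_mat_vec one_mult_mat_vec)
      then have "1 \<le> KB * (u \<bullet> u)" using KB(2)[OF u] w by simp
      also have "\<dots> \<le> KB * ((KN + 1) * (\<mu> - x))" using uu KB(1) by (rule mult_left_mono)
      also have "\<dots> \<le> L * (\<mu> - x)" unfolding L_def using xpos by (simp add: algebra_simps)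
      finally show ?thesis .
    qed
    have "x \<le> \<mu> - 1 / L" if "x \<in> U" for x using gap[OF that] L by (simp add: field_simps)
    then have "\<mu> \<le> \<mu> - 1 / L" unfolding \<mu>_def by (intro cSup_least[OF ne]) 
    then show False using L by simp
  qed
  then obtain w where w: "w \<in> carrier_vec n" "w \<noteq> 0\<^sub>v n" "N *\<^sub>v w = 0\<^sub>v n"
    using det_0_iff_vec_prod_zero_field[OF N] by blast
  have "A *\<^sub>v w = \<mu> \<cdot>\<^sub>v w"
  proof (rule eq_vecI)
    fix i assume i: "i < dim_vec (\<mu> \<cdot>\<^sub>v w)"
    have "(\<mu> \<cdot>\<^sub>v w - A *\<^sub>v w) $ i = 0" using w Nv[OF w(1)] i by auto
    then show "(A *\<^sub>v w) $ i = (\<mu> \<cdot>\<^sub>v w) $ i" using i A w by simp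
  qed (use A w in auto)
  then have "\<mu> \<in> spectrum A" using w A unfolding spectrum_def eigenvalue_def eigenvector_def by auto
  then have "\<mu> \<le> c" by (rule sp)
  then have "\<mu> * (v \<bullet> v) \<le> c * (v \<bullet> v)" by (rule mult_right_mono) (rule sprod_self_nonneg)
  then show ?thesis using Npsd[OF v] Nq[OF v] by simp
qed

text \<open>The upper bound is applied to \<open>- A\<close>, whose eigenvalues are the negated
  eigenvalues of \<open>A\<close>.\<close>

lemma rayleigh_ge:
  fixes A :: "real mat"
  assumes A: "A \<in> carrier_mat n n" "transpose_mat A = A"
    and sp: "\<And>e. e \<in> spectrum A \<Longrightarrow> c \<le> e" and v: "v \<in> carrier_vec n"
  shows "c * (v \<bullet> v) \<le> v \<bullet> (A *\<^sub>v v)"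
proof -
  have neg: "(- A) *\<^sub>v w = - (A *\<^sub>v w)" if "w \<in> carrier_vec n" for w
    using A that by (intro eq_vecI) (auto simp: scalar_prod_def sum_negf)
  have "v \<bullet> ((- A) *\<^sub>v v) \<le> (- c) * (v \<bullet> v)"
  proof (rule rayleigh_le)
    show "- A \<in> carrier_mat n n" using A by simp
    show "transpose_mat (- A) = - A" using A by (metis transpose_uminus)
    fix e assume "e \<in> spectrum (- A)"
    then obtain w where w: "w \<in> carrier_vec n" "w \<noteq> 0\<^sub>v n" "(- A) *\<^sub>v w = e \<cdot>\<^sub>v w"
      using A unfolding spectrum_def eigenvalue_def eigenvector_def by auto
    have "A *\<^sub>v w = (- e) \<cdot>\<^sub>v w"
    proof (rule eq_vecI)
      fix i assume i: "i < dim_vec ((- e) \<cdot>\<^sub>v w)"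
      have "(- (A *\<^sub>v w)) $ i = (e \<cdot>\<^sub>v w) $ i" using w(3) neg[OF w(1)] by simp
      moreover have "i < dim_vec (A *\<^sub>v w)" "i < dim_vec w" using i A w by auto
      ultimately show "(A *\<^sub>v w) $ i = ((- e) \<cdot>\<^sub>v w) $ i" by (simp del: index_mult_mat_vec)
    qed (use A w in auto)
    then have "- e \<in> spectrum A" using w A unfolding spectrum_def eigenvalue_def eigenvector_def by auto
    then show "e \<le> - c" using sp by fastforce
  qed (rule v)
  then show ?thesis using neg[OF v] A v by simp
qed

section \<open>Positive definite matrices, their inverses and the precision class\<close>

lemma sym_pos_defD:
  assumes "S \<in> sym_pos_def p"
  shows "S \<in> carrier_mat p p" "transpose_mat S = S"
    "v \<in> carrier_vec p \<Longrightarrow> v \<noteq> 0\<^sub>v p \<Longrightarrow> 0 < v \<bullet> (S *\<^sub>v v)"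
    "v \<in> carrier_vec p \<Longrightarrow> 0 \<le> v \<bullet> (S *\<^sub>v v)"
proof -
  show S: "S \<in> carrier_mat p p" and "transpose_mat S = S"
    and pos: "v \<in> carrier_vec p \<Longrightarrow> v \<noteq> 0\<^sub>v p \<Longrightarrow> 0 < v \<bullet> (S *\<^sub>v v)"
    using assms by (auto simp: sym_pos_def_def)
  show "0 \<le> v \<bullet> (S *\<^sub>v v)" if "v \<in> carrier_vec p"
    using pos[OF that] S that by (cases "v = 0\<^sub>v p") auto
qed

lemma sym_pos_def_det_nonzero: "S \<in> sym_pos_def p \<Longrightarrow> det S \<noteq> 0"
  using sym_pos_defD[of S p] det_0_iff_vec_prod_zero_field[of S p]
  by (metis less_irrefl scalar_prod_right_zero)

lemma inv_mat_works:
  assumes "S \<in> carrier_mat p p" "det S \<noteq> 0"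
  shows "inv_mat S \<in> carrier_mat p p" "S * inv_mat S = 1\<^sub>m p" "inv_mat S * S = 1\<^sub>m p"
  using det_nonzero_inverse[OF assms] by (auto simp: inv_mat_def)

lemma mat_inverse_unique:
  fixes A :: "real mat"
  assumes "A \<in> carrier_mat p p" "B \<in> carrier_mat p p" "C \<in> carrier_mat p p" "B * A = 1\<^sub>m p" "A * C = 1\<^sub>m p"
  shows "B = C"
  using assms by (metis assoc_mult_mat left_mult_one_mat right_mult_one_mat)

lemma inv_mat_eqI:
  assumes A: "A \<in> carrier_mat p p" and B: "B \<in> carrier_mat p p" and AB: "A * B = 1\<^sub>m p"
  shows "inv_mat A = B"
proof -
  have "det A * det B = 1" using det_mult[OF A B] AB by simp
  then have "det A \<noteq> 0" by auto
  then show ?thesis using mat_inverse_unique[of A p "inv_mat A" B] inv_mat_works[OF A] assms by blast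
qed

lemma inv_mat_sym_pos_def:
  assumes S: "S \<in> sym_pos_def p"
  shows "inv_mat S \<in> sym_pos_def p"
proof -
  note c = sym_pos_defD(1)[OF S] and i = inv_mat_works[OF sym_pos_defD(1)[OF S] sym_pos_def_det_nonzero[OF S]]
  have "transpose_mat (inv_mat S) * S = transpose_mat (S * inv_mat S)"
    using transpose_mult[OF c i(1)] sym_pos_defD(2)[OF S] by simp
  then have "transpose_mat (inv_mat S) * S = 1\<^sub>m p" using i by simp
  then have t: "transpose_mat (inv_mat S) = inv_mat S"
    using mat_inverse_unique[of S p "transpose_mat (inv_mat S)" "inv_mat S"] c i by simp
  have "0 < v \<bullet> (inv_mat S *\<^sub>v v)" if v: "v \<in> carrier_vec p" "v \<noteq> 0\<^sub>v p" for v
  proof -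
    define w where "w = inv_mat S *\<^sub>v v"
    have w: "w \<in> carrier_vec p" using i v by (simp add: w_def)
    have Sw: "S *\<^sub>v w = v" unfolding w_def using c i v by (metis assoc_mult_mat_vec one_mult_mat_vec)
    then have "w \<noteq> 0\<^sub>v p" using v c by auto
    then have "0 < w \<bullet> (S *\<^sub>v w)" by (rule sym_pos_defD(3)[OF S w])
    then show ?thesis unfolding Sw using comm_scalar_prod[OF w v(1)] by (simp add: w_def)
  qed
  then show ?thesis using t i by (simp add: sym_pos_def_def)
qed

text \<open>The interval from 1 / M1 to M1 is invariant under inversion, so the covariance obtains
  the same constants as the precision matrix. The bounds on \<open>S\<close> come from the form of
  \<open>Q = inv_mat S\<close> at \<open>w = S v\<close>, where \<open>Q w = v\<close>, without
  passing through the spectrum of \<open>S\<close>.\<close>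

lemma prec_class_bounds:
  assumes "S \<in> sym_pos_def p" "inv_mat S \<in> prec_class n p M M1" "0 < M1" "v \<in> carrier_vec p"
  shows prec_class_quad_ge: "(v \<bullet> v) / M1 \<le> v \<bullet> (inv_mat S *\<^sub>v v)"
    and prec_class_quad_le: "v \<bullet> (inv_mat S *\<^sub>v v) \<le> M1 * (v \<bullet> v)"
    and cov_quad_ge: "(v \<bullet> v) / M1 \<le> v \<bullet> (S *\<^sub>v v)"
    and cov_quad_le: "v \<bullet> (S *\<^sub>v v) \<le> M1 * (v \<bullet> v)"
    and cov_vnorm_le: "vnorm (S *\<^sub>v v) \<le> M1 * vnorm v"
proof -
  define Q where "Q = inv_mat S"
  have Q: "Q \<in> sym_pos_def p" unfolding Q_def by (rule inv_mat_sym_pos_def[OF assms(1)])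
  note Qc = sym_pos_defD[OF Q] and Sc = sym_pos_defD[OF assms(1)]
  note i = inv_mat_works[OF sym_pos_defD(1)[OF assms(1)] sym_pos_def_det_nonzero[OF assms(1)], folded Q_def]
  have fin: "finite (spectrum Q)" by (rule card_finite_spectrum(1)[OF Qc(1)])
  have mm: "1 / M1 \<le> Min (spectrum Q)" "Max (spectrum Q) \<le> M1"
    using assms(2) by (auto simp: prec_class_def Q_def)
  have ge: "(1 / M1) * (w \<bullet> w) \<le> w \<bullet> (Q *\<^sub>v w)" if "w \<in> carrier_vec p" for w
    by (rule rayleigh_ge[OF Qc(1,2) _ that]) (use mm fin Min_le order_trans in blast)
  have le: "w \<bullet> (Q *\<^sub>v w) \<le> M1 * (w \<bullet> w)" if "w \<in> carrier_vec p" for w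
    by (rule rayleigh_le[OF Qc(1,2) _ that]) (use mm fin Max_ge order_trans in blast)
  show "(v \<bullet> v) / M1 \<le> v \<bullet> (inv_mat S *\<^sub>v v)" "v \<bullet> (inv_mat S *\<^sub>v v) \<le> M1 * (v \<bullet> v)"
    using ge[OF assms(4)] le[OF assms(4)] by (simp_all add: Q_def)
  define w where "w = S *\<^sub>v v"
  have w: "w \<in> carrier_vec p" using Sc(1) assms(4) by (simp add: w_def)
  have Qw: "Q *\<^sub>v w = v" unfolding w_def using Sc(1) i assms(4) by (metis assoc_mult_mat_vec one_mult_mat_vec)
  have "vnorm w * vnorm w \<le> M1 * (w \<bullet> v)"
    using ge[OF w] assms(3) vnorm_sq[of w] by (simp add: Qw field_simps power2_eq_square)
  also have "\<dots> \<le> M1 * (vnorm w * vnorm v)"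
    using abs_sprod_le[OF w assms(4)] assms(3) by (intro mult_left_mono) auto
  finally have "vnorm w * vnorm w \<le> vnorm w * (M1 * vnorm v)" by (simp add: ac_simps)
  then show n: "vnorm (S *\<^sub>v v) \<le> M1 * vnorm v"
    using vnorm_nonneg[of w] vnorm_nonneg[of v] assms(3) unfolding w_def[symmetric]
    by (cases "vnorm w = 0") (auto simp: mult_le_cancel_left)
  have "v \<bullet> w \<le> vnorm v * vnorm w" using abs_sprod_le[OF assms(4) w] by simp
  also have "\<dots> \<le> vnorm v * (M1 * vnorm v)" using n by (intro mult_left_mono) (auto simp: w_def)
  also have "\<dots> = M1 * (v \<bullet> v)" using vnorm_sq[of v] by (simp add: power2_eq_square)
  finally show "v \<bullet> (S *\<^sub>v v) \<le> M1 * (v \<bullet> v)" by (simp add: w_def)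
  \<comment> \<open>For the lower bound v.v is written as v' Q w; Cauchy-Schwarz for the form of
    \<open>Q\<close> leaves one factor v.v to cancel.\<close>
  have "(v \<bullet> v)\<^sup>2 = (v \<bullet> (Q *\<^sub>v w))\<^sup>2" by (simp add: Qw)
  also have "\<dots> \<le> (v \<bullet> (Q *\<^sub>v v)) * (w \<bullet> (Q *\<^sub>v w))"
    by (rule psd_Cauchy_Schwarz[OF Qc(1,2) Qc(4) assms(4) w])
  also have "\<dots> \<le> M1 * (v \<bullet> v) * (w \<bullet> v)"
    unfolding Qw using le[OF assms(4)] Qc(4)[OF w] by (intro mult_right_mono) (auto simp: Qw)
  finally have "(v \<bullet> v) * (v \<bullet> v) \<le> (v \<bullet> v) * (M1 * (w \<bullet> v))" by (simp add: power2_eq_square ac_simps)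
  moreover have "0 \<le> M1 * (w \<bullet> v)" using Qc(4)[OF w] assms(3) by (simp add: Qw)
  ultimately have "v \<bullet> v \<le> M1 * (w \<bullet> v)"
    using sprod_self_nonneg[of v] by (cases "v \<bullet> v = 0") (auto simp: mult_le_cancel_left)
  then show "(v \<bullet> v) / M1 \<le> v \<bullet> (S *\<^sub>v v)"
    using assms(3) comm_scalar_prod[OF w assms(4)] by (simp add: w_def field_simps)
qed

text \<open>The real supremum in \<open>op_norm\<close> dominates its set only if that set is
  bounded above, which \<open>mat_vec_bounded\<close> supplies; the rest is homogeneity.\<close>

lemma vnorm_mult_le_op_norm:
  assumes A: "A \<in> carrier_mat n m" and v: "v \<in> carrier_vec m"
  shows "vnorm (A *\<^sub>v v) \<le> op_norm A * vnorm v"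
proof (cases "v = 0\<^sub>v m")
  case True
  have "A *\<^sub>v 0\<^sub>v m = 0\<^sub>v n" using A by auto
  then show ?thesis using True by (simp add: vnorm_def)
next
  case False
  then have p: "0 < vnorm v" using vnorm_eq_0[OF v] vnorm_nonneg[of v] by linarith
  obtain K where K: "K \<ge> 0" "\<And>w. w \<in> carrier_vec m \<Longrightarrow> (A *\<^sub>v w) \<bullet> (A *\<^sub>v w) \<le> K * (w \<bullet> w)"
    using mat_vec_bounded[OF A] by blast
  have bdd: "bdd_above {vnorm (A *\<^sub>v v) | v. v \<in> carrier_vec (dim_col A) \<and> vnorm v = 1}"
  proof (rule bdd_aboveI[of _ "sqrt K"])
    fix x assume "x \<in> {vnorm (A *\<^sub>v v) | v. v \<in> carrier_vec (dim_col A) \<and> vnorm v = 1}"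
    then obtain w where w: "w \<in> carrier_vec m" "vnorm w = 1" "x = vnorm (A *\<^sub>v w)" using A by auto
    have "w \<bullet> w = 1" using vnorm_sq[of w] w by simp
    then show "x \<le> sqrt K" using K(2)[OF w(1)] w by (simp add: vnorm_def)
  qed
  define w where "w = (1 / vnorm v) \<cdot>\<^sub>v v"
  have w: "w \<in> carrier_vec m" "vnorm w = 1" using v p by (auto simp: w_def vnorm_smult)
  have "vnorm (A *\<^sub>v w) \<le> op_norm A" unfolding op_norm_def
    by (rule cSup_upper[OF _ bdd]) (use w A in auto)
  moreover have "A *\<^sub>v w = (1 / vnorm v) \<cdot>\<^sub>v (A *\<^sub>v v)" using A v by (simp add: w_def mult_mat_vec)
  ultimately show ?thesis using p by (simp add: vnorm_smult field_simps)
qed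

text \<open>The assumption \<open>0 < m\<close> provides a unit vector; the least-upper-bound
  property of a real supremum requires a nonempty set.\<close>

lemma op_norm_leI:
  assumes A: "A \<in> carrier_mat n m" and m: "0 < m" and K: "\<And>v. v \<in> carrier_vec m \<Longrightarrow> vnorm (A *\<^sub>v v) \<le> K * vnorm v"
  shows "op_norm A \<le> K"
  unfolding op_norm_def
proof (rule cSup_least)
  have "vnorm (unit_vec m 0) = 1" using m by (simp add: vnorm_def)
  then show "{vnorm (A *\<^sub>v v) | v. v \<in> carrier_vec (dim_col A) \<and> vnorm v = 1} \<noteq> {}"
    using A by (auto intro!: exI[of _ "unit_vec m 0"])
qed (use A K in fastforce)

lemma op_norm_nonneg:
  assumes A: "A \<in> carrier_mat n m" and m: "0 < m"
  shows "0 \<le> op_norm A"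
proof -
  have "vnorm (unit_vec m 0) = 1" using m by (simp add: vnorm_def)
  then show ?thesis using vnorm_mult_le_op_norm[OF A, of "unit_vec m 0"] vnorm_nonneg[of "A *\<^sub>v unit_vec m 0"] m
    by (simp del: vnorm_nonneg)
qed

section \<open>Triangular maps and Gaussian laws\<close>

lemma lower_triangular_solve:
  fixes L :: "nat \<Rightarrow> nat \<Rightarrow> real"
  assumes "\<And>i. i < p \<Longrightarrow> L i i \<noteq> 0" "\<And>i j. i < j \<Longrightarrow> j < p \<Longrightarrow> L i j = 0"
  shows "\<exists>x. \<forall>i<p. (\<Sum>k<p. L i k * x k) = b i"
  using assms
proof (induction p)
  case (Suc p)
  obtain x where x: "\<forall>i<p. (\<Sum>k<p. L i k * x k) = b i"
    using Suc.IH[OF Suc.prems(1) Suc.prems(2)] by (metis less_SucI)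
  define y where "y = x(p := (b p - (\<Sum>k<p. L p k * x k)) / L p p)"
  have "(\<Sum>k<Suc p. L i k * y k) = b i" if "i < Suc p" for i
  proof -
    have "(\<Sum>k<p. L i k * y k) = (\<Sum>k<p. L i k * x k)" by (rule sum.cong) (auto simp: y_def)
    then show ?thesis using that x Suc.prems by (cases "i = p") (auto simp: y_def)
  qed
  then show ?case by blast
qed simp

text \<open>This is the transposed system, stated for the same lower triangular \<open>L\<close>.
  The last unknown is eliminated first, which changes the right-hand side, so \<open>b\<close>
  varies in the induction.\<close>

lemma upper_triangular_solve:
  fixes L :: "nat \<Rightarrow> nat \<Rightarrow> real"
  assumes "\<And>i. i < p \<Longrightarrow> L i i \<noteq> 0" "\<And>i j. i < j \<Longrightarrow> j < p \<Longrightarrow> L i j = 0"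
  shows "\<exists>x. \<forall>j<p. (\<Sum>i<p. L i j * x i) = b j"
  using assms
proof (induction p arbitrary: b)
  case (Suc p)
  define y where "y = b p / L p p"
  obtain x where x: "\<forall>j<p. (\<Sum>i<p. L i j * x i) = b j - L p j * y"
    using Suc.IH[OF Suc.prems(1) Suc.prems(2), where b = "\<lambda>j. b j - L p j * y"] by (metis less_SucI)
  have "(\<Sum>i<Suc p. L i j * (x(p := y)) i) = b j" if "j < Suc p" for j
  proof -
    have e: "(\<Sum>i<p. L i j * (x(p := y)) i) = (\<Sum>i<p. L i j * x i)" by (rule sum.cong) auto
    show ?thesis
    proof (cases "j = p")
      case True
      then have "(\<Sum>i<p. L i j * x i) = 0" using Suc.prems by (intro sum.neutral) auto
      then show ?thesis using True e Suc.prems by (simp add: y_def)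
    next
      case False
      then show ?thesis using x that e by simp
    qed
  qed
  then show ?case by blast
qed simp

text \<open>Factorisation by bordering: once the leading block is L L', the new row \<open>l\<close>
  solves L l = (S i p), and the new diagonal entry is the square root of the Schur complement S p p
  - |l|^2. Functions on index pairs allow the induction to pass from \<open>p\<close> to
  \<open>Suc p\<close> without resizing matrices.\<close>

lemma cholesky_fun:
  fixes S :: "nat \<Rightarrow> nat \<Rightarrow> real"
  assumes "\<And>i j. i < p \<Longrightarrow> j < p \<Longrightarrow> S i j = S j i"
    and "\<And>v. \<exists>i<p. v i \<noteq> 0 \<Longrightarrow> 0 < (\<Sum>i<p. \<Sum>j<p. v i * S i j * v j)"
  shows "\<exists>L. (\<forall>i<p. 0 < L i i) \<and> (\<forall>i j. i < j \<longrightarrow> j < p \<longrightarrow> L i j = 0) \<and>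
     (\<forall>i<p. \<forall>j<p. S i j = (\<Sum>k<p. L i k * L j k))"
  using assms
proof (induction p)
  case (Suc p)
  have pd: "0 < (\<Sum>i<p. \<Sum>j<p. v i * S i j * v j)" if v: "\<exists>i<p. v i \<noteq> 0" for v
  proof -
    have "\<exists>i<Suc p. (v(p := 0)) i \<noteq> 0" using v by (metis fun_upd_other less_SucI less_irrefl)
    from Suc.prems(2)[OF this] show ?thesis by simp
  qed
  have "\<And>i j. i < p \<Longrightarrow> j < p \<Longrightarrow> S i j = S j i" using Suc.prems(1) by simp
  from Suc.IH[OF this pd] obtain L where L: "\<And>i. i < p \<Longrightarrow> 0 < L i i" "\<And>i j. i < j \<Longrightarrow> j < p \<Longrightarrow> L i j = 0"
      "\<And>i j. i < p \<Longrightarrow> j < p \<Longrightarrow> S i j = (\<Sum>k<p. L i k * L j k)"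
    by blast
  have L0: "\<And>i. i < p \<Longrightarrow> L i i \<noteq> 0" using L(1) by (metis less_irrefl)
  obtain l where l: "\<And>i. i < p \<Longrightarrow> (\<Sum>k<p. L i k * l k) = S i p"
    using lower_triangular_solve[where L = L and p = p and b = "\<lambda>i. S i p"] L0 L(2) by blast
  obtain w where w: "\<And>j. j < p \<Longrightarrow> (\<Sum>i<p. L i j * w i) = l j"
    using upper_triangular_solve[where L = L and p = p and b = l] L0 L(2) by blast
  define d where "d = S p p - (\<Sum>k<p. (l k)\<^sup>2)"
  \<comment> \<open>If L' w = l, then the quadratic form of the bordered matrix at (-w, 1) is
    exactly the Schur complement \<open>d\<close>.\<close>
  have "0 < d"
  proof -
    define v where "v i = (if i < p then - w i else 1)" for i
    have 1: "(\<Sum>i<p. w i * S i p) = (\<Sum>k<p. (l k)\<^sup>2)"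
    proof -
      have "(\<Sum>i<p. w i * S i p) = (\<Sum>i<p. \<Sum>k<p. w i * (L i k * l k))"
        by (intro sum.cong refl) (use l in \<open>simp add: sum_distrib_left[symmetric]\<close>)
      also have "\<dots> = (\<Sum>k<p. l k * (\<Sum>i<p. L i k * w i))"
        by (subst sum.swap) (simp add: sum_distrib_left ac_simps)
      also have "\<dots> = (\<Sum>k<p. (l k)\<^sup>2)" by (rule sum.cong) (use w in \<open>auto simp: power2_eq_square\<close>)
      finally show ?thesis .
    qed
    have 2: "(\<Sum>i<p. \<Sum>j<p. w i * S i j * w j) = (\<Sum>k<p. (l k)\<^sup>2)"
    proof -
      have "(\<Sum>i<p. \<Sum>j<p. w i * S i j * w j) = (\<Sum>i<p. \<Sum>j<p. \<Sum>k<p. w i * (L i k * L j k) * w j)"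
        by (intro sum.cong refl) (simp add: L(3) sum_distrib_left sum_distrib_right)
      also have "\<dots> = (\<Sum>i<p. \<Sum>k<p. \<Sum>j<p. w i * (L i k * L j k) * w j)"
        by (intro sum.cong refl sum.swap)
      also have "\<dots> = (\<Sum>k<p. \<Sum>i<p. \<Sum>j<p. w i * (L i k * L j k) * w j)" by (rule sum.swap)
      also have "\<dots> = (\<Sum>k<p. (\<Sum>i<p. L i k * w i) * (\<Sum>j<p. L j k * w j))"
        by (intro sum.cong refl) (simp add: sum_product ac_simps)
      also have "\<dots> = (\<Sum>k<p. (l k)\<^sup>2)" by (rule sum.cong) (use w in \<open>auto simp: power2_eq_square\<close>)
      finally show ?thesis .
    qed
    have "\<exists>i<Suc p. v i \<noteq> 0" by (rule exI[of _ p]) (simp add: v_def)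
    then have "0 < (\<Sum>i<Suc p. \<Sum>j<Suc p. v i * S i j * v j)" by (rule Suc.prems(2))
    also have "\<dots> = (\<Sum>i<p. (\<Sum>j<p. w i * S i j * w j) - w i * S i p) + ((\<Sum>j<p. - S p j * w j) + S p p)"
      by (simp add: v_def)
    also have "(\<Sum>j<p. - S p j * w j) = - (\<Sum>j<p. w j * S j p)"
      unfolding sum_negf[symmetric]
      by (intro sum.cong refl) (use Suc.prems(1) in \<open>simp add: mult.commute\<close>)
    also have "(\<Sum>i<p. (\<Sum>j<p. w i * S i j * w j) - w i * S i p) = 0"
      using 1 2 by (simp add: sum_subtractf)
    finally show ?thesis using 1 by (simp add: d_def)
  qed
  define L' where "L' i j = (if i < p then if j < p then L i j else 0
     else if j < p then l j else if i = p \<and> j = p then sqrt d else 0)" for i j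
  have Lp: "(\<Sum>k<p. L' i k * L' j k) = (\<Sum>k<p. (if i < p then L i k else l k) * (if j < p then L j k else l k))" for i j
    by (intro sum.cong) (auto simp: L'_def)
  have "S i j = (\<Sum>k<Suc p. L' i k * L' j k)" if "i < Suc p" "j < Suc p" for i j
  proof -
    consider "i < p" "j < p" | "i < p" "j = p" | "i = p" "j < p" | "i = p" "j = p" using \<open>i < Suc p\<close> \<open>j < Suc p\<close> by linarith
    then show ?thesis
    proof cases
      case 1
      then show ?thesis by (simp add: Lp L(3)) (simp add: L'_def)
    next
      case 2
      then show ?thesis by (simp add: Lp l) (simp add: L'_def)
    next
      case 3
      then have "S i j = S j p" using Suc.prems(1)[of j p] by simp
      also have "\<dots> = (\<Sum>k<p. l k * L j k)" using l[of j] 3 by (simp add: mult.commute)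
      finally show ?thesis using 3 by (simp add: Lp) (simp add: L'_def)
    next
      case 4
      then show ?thesis using \<open>0 < d\<close> by (simp add: Lp) (simp add: L'_def d_def power2_eq_square)
    qed
  qed
  moreover have "0 < L' i i" if "i < Suc p" for i
    using that L(1) \<open>0 < d\<close> by (auto simp: L'_def)
  moreover have "L' i j = 0" if "i < j" "j < Suc p" for i j
    using that L(2) by (auto simp: L'_def)
  ultimately show ?case by blast
qed auto

text \<open>The positive diagonal is part of the notion, so that the determinant is positive and
  serves as the Jacobian factor without an absolute value.\<close>

definition lower_triangular :: "nat \<Rightarrow> real mat \<Rightarrow> bool" where
  "lower_triangular p L \<longleftrightarrow> L \<in> carrier_mat p p \<and> (\<forall>i j. i < j \<longrightarrow> j < p \<longrightarrow> L $$ (i, j) = 0) \<and> (\<forall>i<p. 0 < L $$ (i, i))"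

lemma quad_form_sum:
  assumes "A \<in> carrier_mat p p" "v \<in> carrier_vec p"
  shows "v \<bullet> (A *\<^sub>v v) = (\<Sum>i<p. \<Sum>j<p. v $ i * A $$ (i, j) * v $ j)"
  using assms by (subst scalar_prod_lessThan[of _ p])
    (auto simp: scalar_prod_lessThan[of _ p] sum_distrib_left ac_simps)

lemma cholesky:
  assumes S: "S \<in> sym_pos_def p"
  shows "\<exists>L. lower_triangular p L \<and> S = L * transpose_mat L"
proof -
  note Sc = sym_pos_defD[OF S]
  have "0 < (\<Sum>i<p. \<Sum>j<p. v i * S $$ (i, j) * v j)" if v: "\<exists>i<p. v i \<noteq> 0" for v
  proof -
    have "vec p v \<noteq> 0\<^sub>v p" using v by (metis index_vec index_zero_vec(1))
    then have "0 < vec p v \<bullet> (S *\<^sub>v vec p v)" by (intro Sc(3)) auto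
    then show ?thesis using quad_form_sum[OF Sc(1), of "vec p v"] by simp
  qed
  moreover have "S $$ (i, j) = S $$ (j, i)" if "i < p" "j < p" for i j
    using Sc(1,2) that by (metis carrier_matD index_transpose_mat(1))
  ultimately obtain L where L: "\<forall>i<p. 0 < L i i" "\<forall>i j. i < j \<longrightarrow> j < p \<longrightarrow> L i j = 0"
     "\<forall>i<p. \<forall>j<p. S $$ (i, j) = (\<Sum>k<p. L i k * L j k)"
    using cholesky_fun[of p "\<lambda>i j. S $$ (i, j)"] by blast
  define M where "M = mat p p (\<lambda>(i, j). L i j)"
  have "S = M * transpose_mat M"
    using Sc(1) L(3) by (intro eq_matI) (auto simp: M_def scalar_prod_lessThan[of _ p])
  moreover have "lower_triangular p M" using L(1,2) by (auto simp: lower_triangular_def M_def)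
  ultimately show ?thesis by blast
qed

lemma lower_triangular_det:
  assumes "lower_triangular p L"
  shows "det L = (\<Prod>i<p. L $$ (i, i))" "0 < det L"
proof -
  have "det L = prod_list (diag_mat L)"
    using assms by (intro det_lower_triangular[of p]) (auto simp: lower_triangular_def)
  also have "\<dots> = (\<Prod>i<p. L $$ (i, i))"
    using assms by (auto simp: lower_triangular_def diag_mat_def prod.list_conv_set_nth lessThan_atLeast0 intro!: prod.cong)
  finally show "det L = (\<Prod>i<p. L $$ (i, i))" .
  then show "0 < det L" using assms by (auto simp: lower_triangular_def intro!: prod_pos)
qed

lemma lower_triangular_inv:
  assumes "lower_triangular p L"
  shows "inv_mat L \<in> carrier_mat p p" "L * inv_mat L = 1\<^sub>m p" "inv_mat L * L = 1\<^sub>m p"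
proof -
  have "L \<in> carrier_mat p p" "det L \<noteq> 0"
    using lower_triangular_det(2)[OF assms] assms by (auto simp: lower_triangular_def)
  then show "inv_mat L \<in> carrier_mat p p" "L * inv_mat L = 1\<^sub>m p" "inv_mat L * L = 1\<^sub>m p"
    using inv_mat_works by blast+
qed

section \<open>Linear change of variables and transport of Gaussian laws\<close>

abbreviation lebesgue_fun :: "nat \<Rightarrow> (nat \<Rightarrow> real) measure" where
  "lebesgue_fun p \<equiv> PiM {..<p} (\<lambda>_. lborel)"

text \<open>Fubini reduces the change of variables to one dimension: with the last coordinate
  integrated innermost, the earlier image coordinates are fixed, and the last one is an affine
  function of the integration variable with slope \<open>L p p\<close>. Translation and scaling of
  Lebesgue measure then remove one row, and the induction hypothesis treats the remaining
  ones.\<close>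

lemma nn_integral_lower_triangular:
  fixes L :: "nat \<Rightarrow> nat \<Rightarrow> real"
  assumes "\<And>i. i < p \<Longrightarrow> L i i \<noteq> 0" "f \<in> borel_measurable (lebesgue_fun p)"
  shows "ennreal (\<Prod>i<p. \<bar>L i i\<bar>) * (\<integral>\<^sup>+x. f (\<lambda>i\<in>{..<p}. \<Sum>k\<le>i. L i k * x k) \<partial>lebesgue_fun p)
     = integral\<^sup>N (lebesgue_fun p) f"
  using assms
proof (induction p arbitrary: f)
  case 0
  interpret product_sigma_finite "\<lambda>_::nat. lborel :: real measure" ..
  \<comment> \<open>The product measure over no indices lives on a single point, the function that
    is \<open>undefined\<close> everywhere.\<close>
  have "(\<lambda>i\<in>{..<0::nat}. \<Sum>k\<le>i. L i k * x k) = (\<lambda>_. undefined)" for x by auto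
  moreover have "integral\<^sup>N (PiM {} (\<lambda>_. lborel)) f = f (\<lambda>_. undefined)"
    by (rule nn_integral_empty) simp
  moreover have "(\<integral>\<^sup>+(x::nat \<Rightarrow> real). f (\<lambda>_. undefined) \<partial>PiM {} (\<lambda>_. lborel)) = f (\<lambda>_. undefined)"
    by (rule nn_integral_empty[of "\<lambda>_. f (\<lambda>_. undefined)"]) simp
  ultimately show ?case by (simp only: lessThan_0 prod.empty ennreal_1 mult_1)
next
  case (Suc p)
  interpret product_sigma_finite "\<lambda>_::nat. lborel :: real measure" ..
  note f [measurable] = Suc.prems(2)
  let ?P = "lebesgue_fun p"
  let ?T = "\<lambda>p x. \<lambda>i\<in>{..<p}. \<Sum>k\<le>i. L i k * x k"
  have ins: "{..<Suc p} = insert p {..<p}" by auto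
  have f' [measurable]: "f \<in> borel_measurable (PiM (insert p {..<p}) (\<lambda>_. lborel))" using f unfolding ins .
  have T: "?T q \<in> measurable (lebesgue_fun q) (lebesgue_fun q)" for q
    by (intro measurable_restrict) (auto intro!: borel_measurable_sum borel_measurable_times measurable_component_singleton)
  have TS: "?T (Suc p) \<in> measurable (PiM (insert p {..<p}) (\<lambda>_. lborel)) (PiM (insert p {..<p}) (\<lambda>_. lborel))"
    using T[of "Suc p"] unfolding ins .
  have eq: "lebesgue_fun (Suc p) = PiM (insert p {..<p}) (\<lambda>_. lborel)" by (simp only: ins)
  have mf: "(\<lambda>x. f (?T (Suc p) x)) \<in> borel_measurable (PiM (insert p {..<p}) (\<lambda>_. lborel))"
    using measurable_compose[OF TS f'] .
  have "(\<lambda>(x, y). f (?T (Suc p) (x(p := y)))) \<in> borel_measurable (?P \<Otimes>\<^sub>M lborel)"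
    using measurable_compose[OF measurable_add_dim mf] by (simp only: case_prod_unfold)
  then have m2: "(\<lambda>x. \<integral>\<^sup>+y. f (?T (Suc p) (x(p := y))) \<partial>lborel) \<in> borel_measurable ?P"
    by (rule lborel.borel_measurable_nn_integral)
  have upd: "?T (Suc p) (x(p := y)) = (?T p x)(p := (\<Sum>k<p. L p k * x k) + L p p * y)" for x y
  proof
    fix i
    have "(\<Sum>k\<le>i. L i k * (x(p := y)) k) = (\<Sum>k\<le>i. L i k * x k)" if "i < p"
      using that by (intro sum.cong) auto
    moreover have "(\<Sum>k\<le>p. L p k * (x(p := y)) k) = (\<Sum>k<p. L p k * x k) + L p p * y"
      by (simp add: lessThan_Suc_atMost[symmetric])
    ultimately show "?T (Suc p) (x(p := y)) i = ((?T p x)(p := (\<Sum>k<p. L p k * x k) + L p p * y)) i"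
      by (cases "i < p") (auto simp: restrict_def)
  qed
  define h where "h x = (\<integral>\<^sup>+y. f (x(p := y)) \<partial>lborel)" for x
  have h [measurable]: "h \<in> borel_measurable ?P" unfolding h_def by measurable
  \<comment> \<open>The shift is the contribution of the first \<open>p\<close> coordinates to row
    \<open>p\<close>; it is constant in the inner integral.\<close>
  have inner: "ennreal \<bar>L p p\<bar> * (\<integral>\<^sup>+y. f (?T (Suc p) (x(p := y))) \<partial>lborel) = h (?T p x)"
    if x: "x \<in> space ?P" for x
  proof -
    have sp: "?T p x \<in> space ?P" using measurable_space[OF T x] .
    have "(\<lambda>y. f ((?T p x)(p := y))) \<in> borel_measurable lborel"
      using measurable_compose[OF measurable_component_update[OF sp, of p] f'] by simp
    then show ?thesis unfolding upd h_def using Suc.prems(1)[of p]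
      by (subst nn_integral_real_affine[where c = "L p p" and t = "\<Sum>k<p. L p k * x k"]) auto
  qed
  have "ennreal (\<Prod>i<Suc p. \<bar>L i i\<bar>) * (\<integral>\<^sup>+x. f (?T (Suc p) x) \<partial>lebesgue_fun (Suc p))
     = ennreal (\<Prod>i<p. \<bar>L i i\<bar>) * (ennreal \<bar>L p p\<bar> * (\<integral>\<^sup>+x. \<integral>\<^sup>+y. f (?T (Suc p) (x(p := y))) \<partial>lborel \<partial>?P))"
    unfolding eq product_nn_integral_insert[OF finite_lessThan _ mf, simplified]
    by (simp add: ennreal_mult prod_nonneg mult.assoc del: restrict_apply)
  also have "\<dots> = ennreal (\<Prod>i<p. \<bar>L i i\<bar>) * (\<integral>\<^sup>+x. ennreal \<bar>L p p\<bar> * (\<integral>\<^sup>+y. f (?T (Suc p) (x(p := y))) \<partial>lborel) \<partial>?P)"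
    by (subst nn_integral_cmult[OF m2]) simp
  also have "\<dots> = ennreal (\<Prod>i<p. \<bar>L i i\<bar>) * (\<integral>\<^sup>+x. h (?T p x) \<partial>?P)"
    using inner by (intro arg_cong2[where f = "(*)"] refl nn_integral_cong) auto
  also have "\<dots> = integral\<^sup>N ?P h" using Suc.prems(1) by (intro Suc.IH) auto
  also have "\<dots> = integral\<^sup>N (lebesgue_fun (Suc p)) f"
    unfolding ins h_def by (rule product_nn_integral_insert[symmetric]) auto
  finally show ?case .
qed

definition mat_fun :: "nat \<Rightarrow> real mat \<Rightarrow> (nat \<Rightarrow> real) \<Rightarrow> nat \<Rightarrow> real" where
  "mat_fun p L x = (\<lambda>i\<in>{..<p}. \<Sum>k<p. L $$ (i, k) * x k)"

lemma vec_mat_fun: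
  assumes "L \<in> carrier_mat p p"
  shows "vec p (mat_fun p L x) = L *\<^sub>v vec p x"
  using assms by (intro eq_vecI) (auto simp: mat_fun_def scalar_prod_lessThan[of _ p])

lemma measurable_mat_fun [measurable]: "mat_fun p L \<in> measurable (lebesgue_fun p) (lebesgue_fun p)"
  unfolding mat_fun_def
  by (intro measurable_restrict) (auto intro!: borel_measurable_sum borel_measurable_times measurable_component_singleton)

lemma nn_integral_mat_fun:
  assumes L: "lower_triangular p L" and f: "f \<in> borel_measurable (lebesgue_fun p)"
  shows "ennreal (det L) * (\<integral>\<^sup>+x. f (mat_fun p L x) \<partial>lebesgue_fun p) = integral\<^sup>N (lebesgue_fun p) f"
proof -
  have pos: "\<And>i. i < p \<Longrightarrow> 0 < L $$ (i, i)" using L by (auto simp: lower_triangular_def)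
  have "mat_fun p L x = (\<lambda>i\<in>{..<p}. \<Sum>k\<le>i. L $$ (i, k) * x k)" for x
  proof
    fix i
    have "(\<Sum>k<p. L $$ (i, k) * x k) = (\<Sum>k\<le>i. L $$ (i, k) * x k)" if "i < p"
      using that L by (intro sum.mono_neutral_right) (auto simp: lower_triangular_def not_le)
    then show "mat_fun p L x i = (\<lambda>i\<in>{..<p}. \<Sum>k\<le>i. L $$ (i, k) * x k) i"
      by (simp add: mat_fun_def)
  qed
  moreover have "det L = (\<Prod>i<p. \<bar>L $$ (i, i)\<bar>)"
    unfolding lower_triangular_det(1)[OF L] using pos by (auto intro!: prod.cong simp: abs_of_pos)
  moreover have "\<And>i. i < p \<Longrightarrow> L $$ (i, i) \<noteq> 0" using pos by fastforce
  ultimately show ?thesis using nn_integral_lower_triangular[of p "\<lambda>i j. L $$ (i, j)" f] f by simp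
qed

lemma sprod_vec_measurable [measurable]:
  assumes "A \<in> carrier_mat p p"
  shows "(\<lambda>x. vec p x \<bullet> (A *\<^sub>v vec p x)) \<in> borel_measurable (lebesgue_fun p)"
proof -
  have "(\<lambda>x. vec p x \<bullet> (A *\<^sub>v vec p x)) = (\<lambda>x. \<Sum>i<p. \<Sum>j<p. x i * A $$ (i, j) * x j)"
    using assms by (simp add: quad_form_sum)
  then show ?thesis
    by (auto intro!: borel_measurable_sum borel_measurable_times measurable_component_singleton)
qed

lemma sets_gaussian_law [measurable_cong]: "sets (gaussian_law p S) = sets (lebesgue_fun p)"
  and space_gaussian_law: "space (gaussian_law p S) = space (lebesgue_fun p)"
  by (simp_all add: gaussian_law_def)

text \<open>With T the inverse of L, the inverse of L S L' is T' times the inverse of S times T, so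
  the exponent is unchanged along the map, and the normalising constants differ by det L, which is
  the Jacobian. It is used with S = I to represent Gaussian vectors by standard normals, and with
  general S to undo the whitening of the design.\<close>

lemma gaussian_law_congruence:
  assumes S: "S \<in> carrier_mat p p" "det S \<noteq> 0" and L: "lower_triangular p L"
  shows "gaussian_law p (L * S * transpose_mat L) = distr (gaussian_law p S) (lebesgue_fun p) (mat_fun p L)"
proof (rule measure_eqI)
  define S' where "S' = L * S * transpose_mat L"
  define T where "T = inv_mat L"
  define Q where "Q = inv_mat S"
  have Lc: "L \<in> carrier_mat p p" using L by (simp add: lower_triangular_def)
  have T: "T \<in> carrier_mat p p" "L * T = 1\<^sub>m p" "T * L = 1\<^sub>m p"
    using lower_triangular_inv[OF L] by (auto simp: T_def)
  have Q: "Q \<in> carrier_mat p p" "S * Q = 1\<^sub>m p" using inv_mat_works[OF S] by (auto simp: Q_def)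
  have Tt: "transpose_mat L * transpose_mat T = 1\<^sub>m p" using transpose_mult[OF T(1) Lc] T(3) by simp
  have S'c: "S' \<in> carrier_mat p p" using Lc S by (simp add: S'_def)
  have inv: "inv_mat S' = transpose_mat T * (Q * T)"
  proof (rule inv_mat_eqI)
    have "S' * (transpose_mat T * (Q * T)) = L * (S * ((transpose_mat L * transpose_mat T) * (Q * T)))"
      using Lc S(1) T(1) Q(1) by (simp add: S'_def assoc_mult_mat[of _ p p _ p _ p])
    also have "\<dots> = L * ((S * Q) * T)"
      using Lc S(1) T(1) Q(1) by (simp add: Tt assoc_mult_mat[of _ p p _ p _ p])
    also have "\<dots> = 1\<^sub>m p" using Q T by simp
    finally show "S' * (transpose_mat T * (Q * T)) = 1\<^sub>m p" .
  qed (use S'c T Q in auto)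
  have quad: "(L *\<^sub>v v) \<bullet> (inv_mat S' *\<^sub>v (L *\<^sub>v v)) = v \<bullet> (Q *\<^sub>v v)" if v: "v \<in> carrier_vec p" for v
  proof -
    have TL: "T *\<^sub>v (L *\<^sub>v v) = v" using T Lc v by (metis assoc_mult_mat_vec one_mult_mat_vec)
    have "inv_mat S' *\<^sub>v (L *\<^sub>v v) = transpose_mat T *\<^sub>v ((Q * T) *\<^sub>v (L *\<^sub>v v))"
      unfolding inv using T(1) Q(1) Lc v by (intro assoc_mult_mat_vec[of _ p p _ p]) auto
    also have "(Q * T) *\<^sub>v (L *\<^sub>v v) = Q *\<^sub>v v"
      using T(1) Q(1) Lc v TL assoc_mult_mat_vec[of Q p p T p "L *\<^sub>v v"] by simp
    finally have "(L *\<^sub>v v) \<bullet> (inv_mat S' *\<^sub>v (L *\<^sub>v v)) = (L *\<^sub>v v) \<bullet> (transpose_mat T *\<^sub>v (Q *\<^sub>v v))" by simp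
    also have "\<dots> = (transpose_mat T *\<^sub>v (Q *\<^sub>v v)) \<bullet> (L *\<^sub>v v)"
      using T(1) Q(1) Lc v by (intro comm_scalar_prod[of _ p]) auto
    also have "\<dots> = (Q *\<^sub>v v) \<bullet> (T *\<^sub>v (L *\<^sub>v v))"
      using T(1) Q(1) Lc v by (intro transpose_vec_mult_scalar[of _ p p]) auto
    also have "\<dots> = v \<bullet> (Q *\<^sub>v v)" unfolding TL using Q(1) v by (intro comm_scalar_prod[of _ p]) auto
    finally show ?thesis .
  qed
  have dL: "0 < det L" by (rule lower_triangular_det(2)[OF L])
  have det: "det S' = (det L)\<^sup>2 * det S"
  proof -
    have "det S' = det (L * S) * det (transpose_mat L)" unfolding S'_def by (rule det_mult[of _ p]) (use Lc S in auto)
    also have "\<dots> = det L * det S * det L" using Lc S det_mult[of L p S] det_transpose[of L p] by simp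
    finally show ?thesis by (simp add: power2_eq_square)
  qed
  fix A assume "A \<in> sets (gaussian_law p (L * S * transpose_mat L))"
  then have A [measurable]: "A \<in> sets (lebesgue_fun p)" by (simp add: sets_gaussian_law)
  define g where "g S x = exp (- (vec p x \<bullet> (inv_mat S *\<^sub>v vec p x)) / 2) / sqrt ((2 * pi) ^ p * det S)" for S x
  have S'i: "inv_mat S' \<in> carrier_mat p p" using S'c det S(2) dL by (intro inv_mat_works(1)) auto
  have [measurable]: "g S \<in> borel_measurable (lebesgue_fun p)"
    using sprod_vec_measurable[OF Q(1)] unfolding g_def Q_def by measurable
  have [measurable]: "g S' \<in> borel_measurable (lebesgue_fun p)"
    using sprod_vec_measurable[OF S'i] unfolding g_def by measurable
  have g: "ennreal (det L) * ennreal (g S' (mat_fun p L x)) = ennreal (g S x)" for x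
  proof -
    have "sqrt ((2 * pi) ^ p * ((det L)\<^sup>2 * det S)) = det L * sqrt ((2 * pi) ^ p * det S)"
      using dL by (simp add: real_sqrt_mult)
    then have "det L * g S' (mat_fun p L x) = g S x"
      using dL by (simp add: g_def vec_mat_fun[OF Lc] quad Q_def det)
    then show ?thesis using dL by (metis ennreal_mult' less_imp_le)
  qed
  have "emeasure (gaussian_law p S') A = (\<integral>\<^sup>+x. ennreal (g S' x) * indicator A x \<partial>lebesgue_fun p)"
    unfolding gaussian_law_def g_def[symmetric] by (rule emeasure_density) auto
  also have "\<dots> = ennreal (det L) * (\<integral>\<^sup>+x. ennreal (g S' (mat_fun p L x)) * indicator A (mat_fun p L x) \<partial>lebesgue_fun p)"
    by (rule nn_integral_mat_fun[OF L, symmetric]) measurable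
  also have "\<dots> = (\<integral>\<^sup>+x. ennreal (g S x) * indicator A (mat_fun p L x) \<partial>lebesgue_fun p)"
    by (subst nn_integral_cmult[symmetric]) (auto simp: g mult.assoc[symmetric])
  also have "\<dots> = (\<integral>\<^sup>+x. ennreal (g S x) * indicator (mat_fun p L -` A \<inter> space (lebesgue_fun p)) x \<partial>lebesgue_fun p)"
    by (intro nn_integral_cong) (auto simp: indicator_def)
  also have "\<dots> = emeasure (gaussian_law p S) (mat_fun p L -` A \<inter> space (lebesgue_fun p))"
    unfolding gaussian_law_def g_def[symmetric] by (rule emeasure_density[symmetric]) auto
  also have "\<dots> = emeasure (distr (gaussian_law p S) (lebesgue_fun p) (mat_fun p L)) A"
    by (subst emeasure_distr) (auto simp: space_gaussian_law)
  finally show "emeasure (gaussian_law p (L * S * transpose_mat L)) A = \<dots>" unfolding S'_def .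
qed (simp add: sets_gaussian_law)

section \<open>Standard normal products and linear forms\<close>

abbreviation std_normal :: "real measure" where
  "std_normal \<equiv> density lborel (\<lambda>x. ennreal (std_normal_density x))"

lemma prob_space_std_normal: "prob_space std_normal"
  by (rule prob_space_normal_density) simp

interpretation std_normal: prob_space std_normal
  by (rule prob_space_std_normal)

interpretation std_product: product_sigma_finite "\<lambda>_::nat. std_normal"
  by standard

lemma sets_std_product [measurable_cong]: "sets (PiM I (\<lambda>_::nat. std_normal)) = sets (PiM I (\<lambda>_. lborel))"
  by (intro sets_PiM_cong) auto

text \<open>Exponent and normalisation split over the coordinates, so the two measures agree on
  rectangles. This is the passage from the density definition of \<open>gaussian_law\<close> to
  independent coordinates.\<close>

lemma gaussian_law_one: "gaussian_law p (1\<^sub>m p) = PiM {..<p} (\<lambda>_. std_normal)"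
proof (rule std_product.PiM_eqI)
  interpret product_sigma_finite "\<lambda>_::nat. lborel :: real measure" ..
  show "sets (gaussian_law p (1\<^sub>m p)) = sets (PiM {..<p} (\<lambda>_. std_normal))"
    by (simp add: sets_gaussian_law sets_std_product)
  fix A assume "\<And>i. i \<in> {..<p} \<Longrightarrow> A i \<in> sets std_normal"
  then have A [measurable]: "\<And>i. i \<in> {..<p} \<Longrightarrow> A i \<in> sets borel" by simp
  have inv: "inv_mat (1\<^sub>m p) = 1\<^sub>m p" by (rule inv_mat_eqI) auto
  have dens: "exp (- (vec p x \<bullet> (inv_mat (1\<^sub>m p) *\<^sub>v vec p x)) / 2) / sqrt ((2 * pi) ^ p * det (1\<^sub>m p))
     = (\<Prod>i<p. std_normal_density (x i))" for x
  proof -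
    have "- (vec p x \<bullet> (inv_mat (1\<^sub>m p) *\<^sub>v vec p x)) / 2 = (\<Sum>i<p. - (x i)\<^sup>2 / 2)"
      by (simp add: inv scalar_prod_lessThan[of _ p] sum_negf sum_divide_distrib power2_eq_square)
    moreover have "sqrt ((2 * pi) ^ p * det (1\<^sub>m p)) = (\<Prod>i<p. sqrt (2 * pi))"
      by (simp add: real_sqrt_power real_sqrt_mult power_mult_distrib)
    ultimately show ?thesis
      by (simp add: exp_sum std_normal_density_def prod_dividef del: prod_constant)
  qed
  have PA: "Pi\<^sub>E {..<p} A \<in> sets (lebesgue_fun p)" using A by (intro sets_PiM_I_finite) auto
  have m: "(\<lambda>x. \<Prod>i<p. std_normal_density (x i)) \<in> borel_measurable (lebesgue_fun p)"
    by (intro borel_measurable_prod) auto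
  have "emeasure (gaussian_law p (1\<^sub>m p)) (Pi\<^sub>E {..<p} A)
      = (\<integral>\<^sup>+x. ennreal (\<Prod>i<p. std_normal_density (x i)) * indicator (Pi\<^sub>E {..<p} A) x \<partial>lebesgue_fun p)"
    unfolding gaussian_law_def dens by (rule emeasure_density[OF _ PA]) (use m in measurable)
  also have "\<dots> = (\<integral>\<^sup>+x. (\<Prod>i<p. ennreal (std_normal_density (x i)) * indicator (A i) (x i)) \<partial>lebesgue_fun p)"
  proof (rule nn_integral_cong)
    fix x assume x: "x \<in> space (lebesgue_fun p)"
    have "indicator (Pi\<^sub>E {..<p} A) x = (\<Prod>i<p. indicator (A i) (x i) :: ennreal)"
    proof (cases "x \<in> Pi\<^sub>E {..<p} A")
      case True
      then have "(\<Prod>i<p. indicator (A i) (x i) :: ennreal) = 1" by (intro prod.neutral) (auto simp: PiE_iff)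
      then show ?thesis using True by simp
    next
      case False
      then obtain i where "i < p" "x i \<notin> A i" using x by (auto simp: space_PiM PiE_iff)
      then have "(\<Prod>i<p. indicator (A i) (x i) :: ennreal) = 0" by (intro prod_zero) (auto intro!: bexI[of _ i])
      then show ?thesis using False by simp
    qed
    then show "ennreal (\<Prod>i<p. std_normal_density (x i)) * indicator (Pi\<^sub>E {..<p} A) x
       = (\<Prod>i<p. ennreal (std_normal_density (x i)) * indicator (A i) (x i))"
      by (simp add: prod.distrib prod_ennreal)
  qed
  also have "\<dots> = (\<Prod>i<p. \<integral>\<^sup>+x. ennreal (std_normal_density x) * indicator (A i) x \<partial>lborel)"
    by (rule product_nn_integral_prod) auto
  also have "\<dots> = (\<Prod>i<p. emeasure std_normal (A i))"
    by (intro prod.cong refl emeasure_density[symmetric]) auto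
  finally show "emeasure (gaussian_law p (1\<^sub>m p)) (Pi\<^sub>E {..<p} A) = (\<Prod>i\<in>{..<p}. emeasure std_normal (A i))" .
qed simp

lemma gaussian_law_std:
  assumes L: "lower_triangular p L"
  shows "gaussian_law p (L * transpose_mat L) = distr (PiM {..<p} (\<lambda>_. std_normal)) (lebesgue_fun p) (mat_fun p L)"
proof -
  have "L \<in> carrier_mat p p" using L by (simp add: lower_triangular_def)
  then have "L * 1\<^sub>m p = L" by simp
  then show ?thesis using gaussian_law_congruence[of "1\<^sub>m p" p L] L by (simp add: gaussian_law_one)
qed

lemma measurable_mat_fun_std: "mat_fun p L \<in> measurable (PiM {..<p} (\<lambda>_. std_normal)) (lebesgue_fun p)"
  using measurable_mat_fun[of p L] by (simp cong: measurable_cong_sets add: sets_std_product)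

lemma prob_space_gaussian_law:
  assumes "S \<in> sym_pos_def p" shows "prob_space (gaussian_law p S)"
proof -
  obtain L where L: "lower_triangular p L" "S = L * transpose_mat L" using cholesky[OF assms] by blast
  interpret product_prob_space "\<lambda>_. std_normal" "{..<p}" ..
  show ?thesis unfolding L(2) gaussian_law_std[OF L(1)] by (intro prob_space_distr measurable_mat_fun_std)
qed

text \<open>A sum of independent normals is normal. Normal densities require positive variances, so
  zero coefficients are dropped first; if none remains, both sides are the point mass at 0.\<close>

lemma distr_std_linear:
  fixes c :: "nat \<Rightarrow> real"
  shows "distr (PiM {..<p} (\<lambda>_. std_normal)) borel (\<lambda>z. \<Sum>k<p. c k * z k)
    = distr std_normal borel (\<lambda>z. sqrt (\<Sum>k<p. (c k)\<^sup>2) * z)"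
proof -
  let ?P = "PiM {..<p} (\<lambda>_. std_normal)"
  interpret P: product_prob_space "\<lambda>_. std_normal" "{..<p}" ..
  define J where "J = {k. k < p \<and> c k \<noteq> 0}"
  have J: "J \<subseteq> {..<p}" "finite J" by (auto simp: J_def)
  have sJ: "(\<Sum>k<p. c k * z k) = (\<Sum>k\<in>J. c k * z k)" for z :: "nat \<Rightarrow> real"
    by (rule sum.mono_neutral_right) (use J in \<open>auto simp: J_def\<close>)
  have sJ2: "(\<Sum>k<p. (c k)\<^sup>2) = (\<Sum>k\<in>J. (\<bar>c k\<bar>)\<^sup>2)"
    unfolding power2_abs by (rule sum.mono_neutral_right) (use J in \<open>auto simp: J_def\<close>)
  have comp: "(\<lambda>z. z k) \<in> borel_measurable ?P" if "k < p" for k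
    using that measurable_component_singleton[of k "{..<p}" "\<lambda>_. std_normal"] by simp
  have dcomp: "distr ?P borel (\<lambda>z. z k) = std_normal" if "k < p" for k
  proof -
    have "distr ?P borel (\<lambda>z. z k) = distr ?P std_normal (\<lambda>z. z k)" by (rule distr_cong) auto
    also have "\<dots> = std_normal" using that by (intro distr_PiM_component prob_space_std_normal) auto
    finally show ?thesis .
  qed
  show ?thesis
  proof (cases "J = {}")
    case True
    have "distr ?P borel (\<lambda>z. 0) = return borel (0::real)" by (rule P.distr_const) simp
    moreover have "distr std_normal borel (\<lambda>z. 0) = return borel (0::real)" by (rule std_normal.distr_const) simp
    ultimately show ?thesis by (simp add: sJ sJ2 True)
  next
    case False
    then have "{..<p} \<noteq> {}" using J by auto
    then have "P.indep_vars (\<lambda>_. borel) (\<lambda>k z. z k) {..<p}"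
    proof (subst P.indep_vars_iff_distr_eq_PiM')
      have "distr ?P (PiM {..<p} (\<lambda>_. borel)) (\<lambda>x. \<lambda>i\<in>{..<p}. x i) = distr ?P (PiM {..<p} (\<lambda>_. borel)) (\<lambda>x. x)"
        by (rule distr_cong) (auto simp: space_PiM intro!: extensional_restrict PiE_ext)
      also have "\<dots> = ?P" by (rule distr_id2) (simp add: sets_std_product cong: sets_PiM_cong)
      also have "\<dots> = PiM {..<p} (\<lambda>i. distr ?P borel (\<lambda>x. x i))" by (intro PiM_cong refl) (simp add: dcomp)
      finally show "distr ?P (PiM {..<p} (\<lambda>_. borel)) (\<lambda>x. \<lambda>i\<in>{..<p}. x i) = PiM {..<p} (\<lambda>i. distr ?P borel (\<lambda>x. x i))" .
    qed (use comp in auto)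
    from P.indep_vars_subset[OF this J(1)]
    have ind: "P.indep_vars (\<lambda>_. borel) (\<lambda>k z. c k * z k) J" by (rule P.indep_vars_compose2) auto
    have "distributed ?P lborel (\<lambda>z. 0 + c k * z k) (normal_density (0 + c k * 0) (\<bar>c k\<bar> * 1))" if "k \<in> J" for k
    proof (rule P.normal_density_affine)
      have k: "k < p" using that J by auto
      have "distr ?P lborel (\<lambda>z. z k) = std_normal" using dcomp[OF k] by (simp cong: distr_cong)
      then show "distributed ?P lborel (\<lambda>z. z k) (normal_density 0 1)"
        using comp[OF k] by (simp add: distributed_def)
    qed (use that in \<open>auto simp: J_def\<close>)
    then have "distributed ?P lborel (\<lambda>z. \<Sum>k\<in>J. c k * z k) (normal_density (\<Sum>k\<in>J. 0) (sqrt (\<Sum>k\<in>J. (\<bar>c k\<bar>)\<^sup>2)))"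
      by (intro P.sum_indep_normal J False ind) (auto simp: J_def)
    then have 1: "distr ?P lborel (\<lambda>z. \<Sum>k\<in>J. c k * z k) = density lborel (normal_density 0 (sqrt (\<Sum>k\<in>J. (\<bar>c k\<bar>)\<^sup>2)))"
      by (simp add: distributed_def)
    have pos: "0 < sqrt (\<Sum>k\<in>J. (\<bar>c k\<bar>)\<^sup>2)"
      using J False by (simp add: J_def) (intro sum_pos, auto)
    have "distr std_normal lborel (\<lambda>z. z) = std_normal" by (rule distr_id2) simp
    then have "distributed std_normal lborel (\<lambda>z. z) (normal_density 0 1)" by (simp add: distributed_def)
    from std_normal.normal_density_affine[OF this _ less_imp_neq[OF pos, symmetric], of 0]
    have 2: "distr std_normal lborel (\<lambda>z. sqrt (\<Sum>k\<in>J. (\<bar>c k\<bar>)\<^sup>2) * z) = density lborel (normal_density 0 (sqrt (\<Sum>k\<in>J. (\<bar>c k\<bar>)\<^sup>2)))"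
      using pos by (simp add: distributed_def)
    have "distr ?P borel (\<lambda>z. \<Sum>k\<in>J. c k * z k) = distr ?P lborel (\<lambda>z. \<Sum>k\<in>J. c k * z k)" by (rule distr_cong) auto
    also have "\<dots> = distr std_normal lborel (\<lambda>z. sqrt (\<Sum>k\<in>J. (\<bar>c k\<bar>)\<^sup>2) * z)" by (simp only: 1 2)
    also have "\<dots> = distr std_normal borel (\<lambda>z. sqrt (\<Sum>k\<in>J. (\<bar>c k\<bar>)\<^sup>2) * z)" by (rule distr_cong) auto
    finally show ?thesis by (simp only: sJ sJ2)
  qed
qed

lemma measurable_linear_form [measurable]:
  assumes "v \<in> carrier_vec p"
  shows "(\<lambda>x. vec p x \<bullet> v) \<in> borel_measurable (lebesgue_fun p)"
  using assms by (simp add: scalar_prod_lessThan[of _ p])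

text \<open>A linear form in L z has coefficient vector c = L' v with c.c = v' S v. All later
  moments and tails of the design rows and of the noise thereby become one-dimensional
  integrals.\<close>

lemma distr_gaussian_linear:
  assumes S: "S \<in> sym_pos_def p" and v: "v \<in> carrier_vec p"
  shows "distr (gaussian_law p S) borel (\<lambda>x. vec p x \<bullet> v) = distr std_normal borel (\<lambda>z. sqrt (v \<bullet> (S *\<^sub>v v)) * z)"
proof -
  obtain L where L: "lower_triangular p L" "S = L * transpose_mat L" using cholesky[OF S] by blast
  then have Lc: "L \<in> carrier_mat p p" by (simp add: lower_triangular_def)
  define c where "c = transpose_mat L *\<^sub>v v"
  have c: "c \<in> carrier_vec p" using Lc v by (simp add: c_def)
  have form: "vec p (mat_fun p L z) \<bullet> v = (\<Sum>k<p. c $ k * z k)" for z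
  proof -
    have "vec p (mat_fun p L z) \<bullet> v = v \<bullet> (L *\<^sub>v vec p z)"
      unfolding vec_mat_fun[OF Lc] using Lc v by (intro comm_scalar_prod[of _ p]) auto
    also have "\<dots> = c \<bullet> vec p z" unfolding c_def
      using Lc v by (intro transpose_vec_mult_scalar[symmetric, of _ p p]) auto
    also have "\<dots> = (\<Sum>k<p. c $ k * z k)" by (simp add: scalar_prod_lessThan[of _ p])
    finally show ?thesis .
  qed
  have "v \<bullet> (S *\<^sub>v v) = v \<bullet> (L *\<^sub>v c)" unfolding L(2) c_def using Lc v assoc_mult_mat_vec[of L p p "transpose_mat L" p v] by simp
  also have "\<dots> = c \<bullet> c" unfolding c_def
    using Lc v by (intro transpose_vec_mult_scalar[symmetric, of _ p p]) auto
  finally have q: "v \<bullet> (S *\<^sub>v v) = (\<Sum>k<p. (c $ k)\<^sup>2)" using c by (simp add: scalar_prod_lessThan[of _ p] power2_eq_square)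
  have "distr (gaussian_law p S) borel (\<lambda>x. vec p x \<bullet> v)
      = distr (PiM {..<p} (\<lambda>_. std_normal)) borel ((\<lambda>x. vec p x \<bullet> v) \<circ> mat_fun p L)"
    unfolding L(2) gaussian_law_std[OF L(1)]
    by (rule distr_distr) (use v measurable_mat_fun_std in auto)
  also have "\<dots> = distr (PiM {..<p} (\<lambda>_. std_normal)) borel (\<lambda>z. \<Sum>k<p. c $ k * z k)"
    by (simp add: comp_def form)
  also have "\<dots> = distr std_normal borel (\<lambda>z. sqrt (v \<bullet> (S *\<^sub>v v)) * z)" unfolding q by (rule distr_std_linear)
  finally show ?thesis .
qed

lemma nn_integral_gaussian_linear:
  assumes S: "S \<in> sym_pos_def p" and v: "v \<in> carrier_vec p" and [measurable]: "f \<in> borel_measurable borel"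
  shows "(\<integral>\<^sup>+x. f (vec p x \<bullet> v) \<partial>gaussian_law p S) = (\<integral>\<^sup>+z. f (sqrt (v \<bullet> (S *\<^sub>v v)) * z) \<partial>std_normal)"
proof -
  have m: "(\<lambda>x. vec p x \<bullet> v) \<in> borel_measurable (gaussian_law p S)" using v by measurable
  have "(\<integral>\<^sup>+x. f (vec p x \<bullet> v) \<partial>gaussian_law p S) = (\<integral>\<^sup>+y. f y \<partial>distr (gaussian_law p S) borel (\<lambda>x. vec p x \<bullet> v))"
    using m by (simp add: nn_integral_distr)
  also have "\<dots> = (\<integral>\<^sup>+z. f (sqrt (v \<bullet> (S *\<^sub>v v)) * z) \<partial>std_normal)"
    unfolding distr_gaussian_linear[OF S v] by (simp add: nn_integral_distr)
  finally show ?thesis .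
qed

lemma
  fixes f :: "real \<Rightarrow> real"
  assumes S: "S \<in> sym_pos_def p" and v: "v \<in> carrier_vec p" and [measurable]: "f \<in> borel_measurable borel"
  shows integral_gaussian_linear:
      "(\<integral>x. f (vec p x \<bullet> v) \<partial>gaussian_law p S) = (\<integral>z. f (sqrt (v \<bullet> (S *\<^sub>v v)) * z) \<partial>std_normal)"
    and integrable_gaussian_linear:
      "integrable (gaussian_law p S) (\<lambda>x. f (vec p x \<bullet> v)) \<longleftrightarrow> integrable std_normal (\<lambda>z. f (sqrt (v \<bullet> (S *\<^sub>v v)) * z))"
proof -
  have m: "(\<lambda>x. vec p x \<bullet> v) \<in> borel_measurable (gaussian_law p S)" using v by measurable
  have "(\<integral>x. f (vec p x \<bullet> v) \<partial>gaussian_law p S) = (\<integral>y. f y \<partial>distr (gaussian_law p S) borel (\<lambda>x. vec p x \<bullet> v))"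
    using m by (simp add: integral_distr)
  also have "\<dots> = (\<integral>z. f (sqrt (v \<bullet> (S *\<^sub>v v)) * z) \<partial>std_normal)"
    unfolding distr_gaussian_linear[OF S v] by (simp add: integral_distr)
  finally show "(\<integral>x. f (vec p x \<bullet> v) \<partial>gaussian_law p S) = (\<integral>z. f (sqrt (v \<bullet> (S *\<^sub>v v)) * z) \<partial>std_normal)" .
  have "integrable (gaussian_law p S) (\<lambda>x. f (vec p x \<bullet> v)) \<longleftrightarrow> integrable (distr (gaussian_law p S) borel (\<lambda>x. vec p x \<bullet> v)) f"
    using m by (simp add: integrable_distr_eq)
  also have "\<dots> \<longleftrightarrow> integrable std_normal (\<lambda>z. f (sqrt (v \<bullet> (S *\<^sub>v v)) * z))"
    unfolding distr_gaussian_linear[OF S v] by (simp add: integrable_distr_eq)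
  finally show "integrable (gaussian_law p S) (\<lambda>x. f (vec p x \<bullet> v)) \<longleftrightarrow> integrable std_normal (\<lambda>z. f (sqrt (v \<bullet> (S *\<^sub>v v)) * z))" .
qed

text \<open>The integrand against the normal density is a multiple of the centred normal density of
  variance 1 / (1 + 2 a). Negative \<open>a\<close> above -1/2 is allowed: it gives the exponential
  moments behind the chi-square upper tail.\<close>

lemma std_normal_exp_square:
  assumes a: "0 < 1 + 2 * a"
  shows "(\<integral>\<^sup>+z. ennreal (exp (- a * z\<^sup>2)) \<partial>std_normal) = ennreal (1 / sqrt (1 + 2 * a))"
proof -
  define s where "s = 1 / sqrt (1 + 2 * a)"
  have s: "0 < s" "s\<^sup>2 = 1 / (1 + 2 * a)" using a by (auto simp: s_def power_divide)
  have eq: "std_normal_density z * exp (- (a * z\<^sup>2)) = s * normal_density 0 s z" for z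
  proof -
    have "- z\<^sup>2 / 2 + - a * z\<^sup>2 = - z\<^sup>2 / (2 * s\<^sup>2)" using a by (simp add: s(2) field_simps)
    then have e: "exp (- z\<^sup>2 / 2) * exp (- a * z\<^sup>2) = exp (- z\<^sup>2 / (2 * s\<^sup>2))" by (simp only: exp_add[symmetric])
    have "sqrt (2 * pi * s\<^sup>2) = sqrt (2 * pi) * s" using s(1) by (simp add: real_sqrt_mult)
    then have "s * normal_density 0 s z = 1 / sqrt (2 * pi) * exp (- z\<^sup>2 / (2 * s\<^sup>2))"
      using s(1) by (simp add: normal_density_def)
    then show ?thesis using e by (simp add: std_normal_density_def)
  qed
  have "(\<integral>\<^sup>+z. ennreal (exp (- a * z\<^sup>2)) \<partial>std_normal) = (\<integral>\<^sup>+z. ennreal (std_normal_density z) * ennreal (exp (- a * z\<^sup>2)) \<partial>lborel)"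
    by (rule nn_integral_density) auto
  also have "\<dots> = (\<integral>\<^sup>+z. ennreal s * ennreal (normal_density 0 s z) \<partial>lborel)"
    using s(1) by (intro nn_integral_cong) (simp add: ennreal_mult'[symmetric] eq)
  also have "\<dots> = ennreal s * (\<integral>\<^sup>+z. ennreal (normal_density 0 s z) \<partial>lborel)" by (rule nn_integral_cmult) auto
  also have "(\<integral>\<^sup>+z. ennreal (normal_density 0 s z) \<partial>lborel) = 1"
    using s by (simp add: nn_integral_eq_integral)
  finally show ?thesis by (simp add: s_def)
qed

lemma std_normal_mgf: "(\<integral>\<^sup>+z. ennreal (exp (s * z)) \<partial>std_normal) = ennreal (exp (s\<^sup>2 / 2))"
proof -
  have eq: "std_normal_density z * exp (s * z) = exp (s\<^sup>2 / 2) * normal_density s 1 z" for z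
  proof -
    have "- z\<^sup>2 / 2 + s * z = s\<^sup>2 / 2 + - (z - s)\<^sup>2 / 2" by (simp add: power2_eq_square field_simps)
    then have "exp (- z\<^sup>2 / 2) * exp (s * z) = exp (s\<^sup>2 / 2) * exp (- (z - s)\<^sup>2 / 2)" by (simp only: exp_add[symmetric])
    then show ?thesis by (simp add: normal_density_def)
  qed
  have "(\<integral>\<^sup>+z. ennreal (exp (s * z)) \<partial>std_normal) = (\<integral>\<^sup>+z. ennreal (std_normal_density z) * ennreal (exp (s * z)) \<partial>lborel)"
    by (rule nn_integral_density) auto
  also have "\<dots> = (\<integral>\<^sup>+z. ennreal (exp (s\<^sup>2 / 2)) * ennreal (normal_density s 1 z) \<partial>lborel)"
    by (intro nn_integral_cong) (simp add: ennreal_mult'[symmetric] eq)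
  also have "\<dots> = ennreal (exp (s\<^sup>2 / 2)) * (\<integral>\<^sup>+z. ennreal (normal_density s 1 z) \<partial>lborel)" by (rule nn_integral_cmult) auto
  also have "(\<integral>\<^sup>+z. ennreal (normal_density s 1 z) \<partial>lborel) = 1"
    by (simp add: nn_integral_eq_integral)
  finally show ?thesis by simp
qed

lemma std_normal_moments:
  shows integrable_std_normal_pow: "integrable std_normal (\<lambda>z. z ^ k)"
    and integral_std_normal_1: "(\<integral>z. z \<partial>std_normal) = 0"
    and integral_std_normal_2: "(\<integral>z. z\<^sup>2 \<partial>std_normal) = 1"
    and integral_std_normal_4: "(\<integral>z. z ^ 4 \<partial>std_normal) = 3"
proof -
  show "integrable std_normal (\<lambda>z. z ^ k)"
    by (subst integrable_density) (auto intro: integrable_std_normal_moment)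
  have d: "(\<integral>z. f z \<partial>std_normal) = (\<integral>z. std_normal_density z * f z \<partial>lborel)" if "f \<in> borel_measurable borel" for f :: "real \<Rightarrow> real"
    using that by (subst integral_density) auto
  show "(\<integral>z. z \<partial>std_normal) = 0" using d[of "\<lambda>z. z"] integral_std_normal_moment_odd[of 0] by simp
  show "(\<integral>z. z\<^sup>2 \<partial>std_normal) = 1" using d[of "\<lambda>z. z\<^sup>2"] integral_std_normal_moment_even[of 1] by simp
  show "(\<integral>z. z ^ 4 \<partial>std_normal) = 3" using d[of "\<lambda>z. z ^ 4"] integral_std_normal_moment_even[of 2]
    by (simp add: fact_numeral)
qed

lemma gaussian_linear_moments:
  assumes S: "S \<in> sym_pos_def p" and v: "v \<in> carrier_vec p"
  shows integrable_gaussian_pow: "integrable (gaussian_law p S) (\<lambda>x. (vec p x \<bullet> v) ^ k)"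
    and integral_gaussian_1: "(\<integral>x. vec p x \<bullet> v \<partial>gaussian_law p S) = 0"
    and integral_gaussian_2: "(\<integral>x. (vec p x \<bullet> v)\<^sup>2 \<partial>gaussian_law p S) = v \<bullet> (S *\<^sub>v v)"
    and integral_gaussian_4: "(\<integral>x. (vec p x \<bullet> v) ^ 4 \<partial>gaussian_law p S) = 3 * (v \<bullet> (S *\<^sub>v v))\<^sup>2"
proof -
  have q: "0 \<le> v \<bullet> (S *\<^sub>v v)" using sym_pos_defD(4)[OF S v] .
  show "integrable (gaussian_law p S) (\<lambda>x. (vec p x \<bullet> v) ^ k)"
    using integrable_gaussian_linear[OF S v, of "\<lambda>y. y ^ k"] integrable_std_normal_pow[of k] by (simp add: power_mult_distrib)
  show "(\<integral>x. vec p x \<bullet> v \<partial>gaussian_law p S) = 0"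
    using integral_gaussian_linear[OF S v, of "\<lambda>y. y"] integral_std_normal_1 by simp
  show "(\<integral>x. (vec p x \<bullet> v)\<^sup>2 \<partial>gaussian_law p S) = v \<bullet> (S *\<^sub>v v)"
    using integral_gaussian_linear[OF S v, of "\<lambda>y. y\<^sup>2"] integral_std_normal_2 q by (simp add: power_mult_distrib)
  have "sqrt (v \<bullet> (S *\<^sub>v v)) ^ 4 = ((sqrt (v \<bullet> (S *\<^sub>v v)))\<^sup>2)\<^sup>2" by (simp flip: power_mult)
  also have "\<dots> = (v \<bullet> (S *\<^sub>v v))\<^sup>2" using q by simp
  finally show "(\<integral>x. (vec p x \<bullet> v) ^ 4 \<partial>gaussian_law p S) = 3 * (v \<bullet> (S *\<^sub>v v))\<^sup>2"
    using integral_gaussian_linear[OF S v, of "\<lambda>y. y ^ 4"] integral_std_normal_4 by (simp add: power_mult_distrib)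
qed

section \<open>Chi-square deviations\<close>

lemma emeasure_le_nn_integral:
  assumes "A \<in> sets M" "\<And>x. x \<in> A \<Longrightarrow> 1 \<le> f x"
  shows "emeasure M A \<le> (\<integral>\<^sup>+x. f x \<partial>M)"
proof -
  have "emeasure M A = (\<integral>\<^sup>+x. indicator A x \<partial>M)" using assms(1) by simp
  also have "\<dots> \<le> (\<integral>\<^sup>+x. f x \<partial>M)" using assms(2) by (intro nn_integral_mono) (auto simp: indicator_def)
  finally show ?thesis .
qed

lemma nn_integral_PiM_prod_same:
  assumes "prob_space P" "f \<in> borel_measurable P"
  shows "(\<integral>\<^sup>+x. (\<Prod>i<n. f (x i)) \<partial>PiM {..<n::nat} (\<lambda>_. P)) = (integral\<^sup>N P f) ^ n"
proof -
  interpret prob_space P by fact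
  interpret product_sigma_finite "\<lambda>_::nat. P" by standard
  show ?thesis using product_nn_integral_prod[of "{..<n}" "\<lambda>_. f"] assms(2) by simp
qed

text \<open>Products of distinct summands integrate to zero, because the factors are independent and
  centred; only the \<open>n\<close> diagonal terms survive.\<close>

lemma iid_sum_second_moment:
  fixes \<phi> :: "'a \<Rightarrow> real"
  assumes P: "prob_space P" and i1: "integrable P \<phi>" and i2: "integrable P (\<lambda>x. (\<phi> x)\<^sup>2)" and z: "(\<integral>x. \<phi> x \<partial>P) = 0"
  shows "integrable (PiM {..<n::nat} (\<lambda>_. P)) (\<lambda>x. (\<Sum>i<n. \<phi> (x i))\<^sup>2)"
    and "(\<integral>x. (\<Sum>i<n. \<phi> (x i))\<^sup>2 \<partial>PiM {..<n} (\<lambda>_. P)) = real n * (\<integral>x. (\<phi> x)\<^sup>2 \<partial>P)"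
proof -
  interpret prob_space P by fact
  interpret product_sigma_finite "\<lambda>_::nat. P" by standard
  have one: "integral\<^sup>L P (\<lambda>_. 1) = (1::real)" using prob_space by simp
  have cross: "integrable (PiM {..<n} (\<lambda>_. P)) (\<lambda>x. \<phi> (x i) * \<phi> (x j)) \<and>
     (\<integral>x. \<phi> (x i) * \<phi> (x j) \<partial>PiM {..<n} (\<lambda>_. P)) = (if i = j then \<integral>x. (\<phi> x)\<^sup>2 \<partial>P else 0)"
    if ij: "i < n" "j < n" for i j
  proof -
    \<comment> \<open>Both kinds of products are written as full products over the coordinates,
      padded with the constant 1, so that one product formula treats \<open>i = j\<close> and
      \<open>i \<noteq> j\<close> alike.\<close>
    define f where "f k = (if i = j then if k = i then \<lambda>x. (\<phi> x)\<^sup>2 else (\<lambda>_. 1)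
       else if k = i \<or> k = j then \<phi> else (\<lambda>_. 1))" for k
    have fi: "integrable P (f k)" for k using i1 i2 by (simp add: f_def)
    have eq: "(\<Prod>k<n. f k (x k)) = \<phi> (x i) * \<phi> (x j)" for x
    proof -
      have "(\<Prod>k<n. f k (x k)) = (\<Prod>k\<in>{i, j}. f k (x k))"
        by (rule prod.mono_neutral_right) (use ij in \<open>auto simp: f_def\<close>)
      also have "\<dots> = \<phi> (x i) * \<phi> (x j)" by (cases "i = j") (simp_all add: f_def power2_eq_square)
      finally show ?thesis .
    qed
    have eqi: "(\<Prod>k<n. integral\<^sup>L P (f k)) = (if i = j then \<integral>x. (\<phi> x)\<^sup>2 \<partial>P else 0)"
    proof -
      have "(\<Prod>k<n. integral\<^sup>L P (f k)) = (\<Prod>k\<in>{i, j}. integral\<^sup>L P (f k))"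
        by (rule prod.mono_neutral_right) (use ij in \<open>auto simp: f_def prob_space\<close>)
      also have "\<dots> = (if i = j then \<integral>x. (\<phi> x)\<^sup>2 \<partial>P else 0)" using z by (cases "i = j") (simp_all add: f_def)
      finally show ?thesis .
    qed
    show ?thesis
      using product_integrable_prod[of "{..<n}" f] product_integral_prod[of "{..<n}" f] fi
      by (simp add: eq eqi)
  qed
  have sq: "(\<Sum>i<n. \<phi> (x i))\<^sup>2 = (\<Sum>i<n. \<Sum>j<n. \<phi> (x i) * \<phi> (x j))" for x
    by (simp add: power2_eq_square sum_product)
  show "integrable (PiM {..<n} (\<lambda>_. P)) (\<lambda>x. (\<Sum>i<n. \<phi> (x i))\<^sup>2)"
    unfolding sq using cross by (intro Bochner_Integration.integrable_sum) auto
  have "(\<integral>x. (\<Sum>i<n. \<phi> (x i))\<^sup>2 \<partial>PiM {..<n} (\<lambda>_. P)) = (\<Sum>i<n. \<Sum>j<n. \<integral>x. \<phi> (x i) * \<phi> (x j) \<partial>PiM {..<n} (\<lambda>_. P))"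
    unfolding sq using cross
    by (subst Bochner_Integration.integral_sum; (intro Bochner_Integration.integrable_sum)?; auto intro!: sum.cong simp: Bochner_Integration.integral_sum)
  also have "\<dots> = (\<Sum>i<n. \<Sum>j<n. if i = j then \<integral>x. (\<phi> x)\<^sup>2 \<partial>P else 0)"
    using cross by (intro sum.cong refl) auto
  also have "\<dots> = real n * (\<integral>x. (\<phi> x)\<^sup>2 \<partial>P)" by simp
  finally show "(\<integral>x. (\<Sum>i<n. \<phi> (x i))\<^sup>2 \<partial>PiM {..<n} (\<lambda>_. P)) = real n * (\<integral>x. (\<phi> x)\<^sup>2 \<partial>P)" .
qed

section \<open>Concentration of the Gaussian design\<close>

lemma sets_design_law [measurable_cong]: "sets (design_law n p S) = sets (PiM {..<n} (\<lambda>_. lebesgue_fun p))"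
  unfolding design_law_def by (intro sets_PiM_cong refl) (simp add: sets_gaussian_law)

lemma prob_space_design_law: "S \<in> sym_pos_def p \<Longrightarrow> prob_space (design_law n p S)"
  unfolding design_law_def by (intro prob_space_PiM prob_space_gaussian_law)

lemma measurable_coord: "i < p \<Longrightarrow> (\<lambda>x. x i) \<in> borel_measurable (lebesgue_fun p)"
  using measurable_component_singleton[of i "{..<p}" "\<lambda>_. lborel"] by simp

lemma measurable_entry [measurable]:
  "i < n \<Longrightarrow> j < p \<Longrightarrow> (\<lambda>x. x i j) \<in> borel_measurable (PiM {..<n} (\<lambda>_. lebesgue_fun p))"
  using measurable_compose[OF measurable_component_singleton[of i "{..<n}" "\<lambda>_. lebesgue_fun p"]
      measurable_component_singleton[of j "{..<p}" "\<lambda>_. lborel"]] by simp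

lemma measurable_row_form [measurable]:
  assumes "i < n" "v \<in> carrier_vec p"
  shows "(\<lambda>x. vec p (x i) \<bullet> v) \<in> borel_measurable (PiM {..<n} (\<lambda>_. lebesgue_fun p))"
  using measurable_compose[OF measurable_component_singleton[of i "{..<n}" "\<lambda>_. lebesgue_fun p"]
      measurable_linear_form[OF assms(2)]] assms(1) by simp

lemma design_mult_index: "v \<in> carrier_vec p \<Longrightarrow> i < n \<Longrightarrow> (design n p x *\<^sub>v v) $ i = vec p (x i) \<bullet> v"
  by (auto simp: design_def scalar_prod_lessThan[of _ p])

lemma design_carrier [simp]: "design n p x \<in> carrier_mat n p"
  by (simp add: design_def)

lemma design_mult_sq:
  assumes "v \<in> carrier_vec p"
  shows "(design n p x *\<^sub>v v) \<bullet> (design n p x *\<^sub>v v) = (\<Sum>i<n. (vec p (x i) \<bullet> v)\<^sup>2)"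
proof -
  have "design n p x *\<^sub>v v \<in> carrier_vec n" using assms by (intro mult_mat_vec_carrier[of _ n p]) auto
  then show ?thesis using assms
    by (simp add: scalar_prod_lessThan[of _ n] power2_eq_square design_mult_index del: index_mult_mat_vec)
qed

text \<open>This is |X v|^2, written as a sum over the independent rows of the design. Under
  \<open>design_law\<close> it is v' S v times a chi-square variable with \<open>n\<close> degrees
  of freedom.\<close>

definition energy :: "nat \<Rightarrow> nat \<Rightarrow> real vec \<Rightarrow> (nat \<Rightarrow> nat \<Rightarrow> real) \<Rightarrow> real" where
  "energy n p v x = (\<Sum>i<n. (vec p (x i) \<bullet> v)\<^sup>2)"

lemma measurable_energy [measurable]:
  "v \<in> carrier_vec p \<Longrightarrow> energy n p v \<in> borel_measurable (PiM {..<n} (\<lambda>_. lebesgue_fun p))"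
  unfolding energy_def by measurable

lemma energy_nonneg: "0 \<le> energy n p v x"
  by (simp add: energy_def sum_nonneg)

lemma energy_exp:
  assumes S: "S \<in> sym_pos_def p" and v: "v \<in> carrier_vec p" and a: "0 < 1 + 2 * (a * (v \<bullet> (S *\<^sub>v v)))"
  shows "(\<integral>\<^sup>+x. ennreal (exp (- (a * energy n p v x))) \<partial>design_law n p S)
    = ennreal ((1 / sqrt (1 + 2 * (a * (v \<bullet> (S *\<^sub>v v))))) ^ n)"
proof -
  have q: "0 \<le> v \<bullet> (S *\<^sub>v v)" by (rule sym_pos_defD(4)[OF S v])
  have "(\<integral>\<^sup>+x. ennreal (exp (- (a * energy n p v x))) \<partial>design_law n p S)
     = (\<integral>\<^sup>+x. (\<Prod>i<n. ennreal (exp (- (a * (vec p (x i) \<bullet> v)\<^sup>2)))) \<partial>PiM {..<n} (\<lambda>_. gaussian_law p S))"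
    unfolding design_law_def
    by (intro nn_integral_cong) (simp add: energy_def sum_distrib_left sum_negf[symmetric] exp_sum prod_ennreal)
  also have "\<dots> = (\<integral>\<^sup>+y. ennreal (exp (- (a * (vec p y \<bullet> v)\<^sup>2))) \<partial>gaussian_law p S) ^ n"
    using v by (intro nn_integral_PiM_prod_same prob_space_gaussian_law S) measurable
  also have "(\<integral>\<^sup>+y. ennreal (exp (- (a * (vec p y \<bullet> v)\<^sup>2))) \<partial>gaussian_law p S)
     = (\<integral>\<^sup>+z. ennreal (exp (- (a * (sqrt (v \<bullet> (S *\<^sub>v v)) * z)\<^sup>2))) \<partial>std_normal)"
    by (rule nn_integral_gaussian_linear[OF S v]) measurable
  also have "\<dots> = (\<integral>\<^sup>+z. ennreal (exp (- (a * (v \<bullet> (S *\<^sub>v v))) * z\<^sup>2)) \<partial>std_normal)"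
    using q by (simp add: power_mult_distrib mult.assoc)
  also have "\<dots> = ennreal (1 / sqrt (1 + 2 * (a * (v \<bullet> (S *\<^sub>v v)))))" by (rule std_normal_exp_square[OF a])
  finally show ?thesis using a by (simp add: ennreal_power)
qed

text \<open>Chernoff bound at the parameter 1 / (2 q): the exponential moment is 2 to the power -n/2
  and the threshold contributes exp (n / 4). The rate 1/12 comes from 1/4 - (ln 2) / 2 \<le> 1/4 -
  1/3.\<close>

lemma energy_lower_tail:
  assumes S: "S \<in> sym_pos_def p" and v: "v \<in> carrier_vec p" "v \<noteq> 0\<^sub>v p"
  shows "emeasure (design_law n p S) {x \<in> space (design_law n p S). energy n p v x < real n * (v \<bullet> (S *\<^sub>v v)) / 2}
    \<le> ennreal (exp (- real n / 12))"
proof -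
  define q where "q = v \<bullet> (S *\<^sub>v v)"
  have q: "0 < q" unfolding q_def by (rule sym_pos_defD(3)[OF S v])
  have "emeasure (design_law n p S) {x \<in> space (design_law n p S). energy n p v x < real n * q / 2}
     \<le> (\<integral>\<^sup>+x. ennreal (exp (real n / 4)) * ennreal (exp (- (1 / (2 * q) * energy n p v x))) \<partial>design_law n p S)"
  proof (rule emeasure_le_nn_integral)
    show "{x \<in> space (design_law n p S). energy n p v x < real n * q / 2} \<in> sets (design_law n p S)"
      using v by measurable
    fix x assume "x \<in> {x \<in> space (design_law n p S). energy n p v x < real n * q / 2}"
    then have "0 \<le> real n / 4 + - (1 / (2 * q) * energy n p v x)" using q by (simp add: field_simps)
    then have "1 \<le> exp (real n / 4) * exp (- (1 / (2 * q) * energy n p v x))" by (simp only: exp_add[symmetric] one_le_exp_iff)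
    then show "1 \<le> ennreal (exp (real n / 4)) * ennreal (exp (- (1 / (2 * q) * energy n p v x)))"
      by (simp only: ennreal_mult'[symmetric] exp_ge_zero ennreal_1[symmetric] ennreal_leI)
  qed
  also have "\<dots> = ennreal (exp (real n / 4)) * ennreal ((1 / sqrt (1 + 2 * (1 / (2 * q) * q))) ^ n)"
  proof -
    have "(\<integral>\<^sup>+x. ennreal (exp (- (1 / (2 * q) * energy n p v x))) \<partial>design_law n p S)
       = ennreal ((1 / sqrt (1 + 2 * (1 / (2 * q) * q))) ^ n)"
      unfolding q_def by (rule energy_exp[OF S v(1)]) (use q in \<open>simp add: q_def[symmetric]\<close>)
    moreover have "(\<lambda>x. ennreal (exp (- (1 / (2 * q) * energy n p v x)))) \<in> borel_measurable (design_law n p S)"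
      using v(1) by measurable
    ultimately show ?thesis by (subst nn_integral_cmult) simp_all
  qed
  also have "\<dots> = ennreal (exp (real n / 4) * (1 / sqrt 2) ^ n)"
    using q by (simp add: ennreal_mult'[symmetric])
  also have "\<dots> \<le> ennreal (exp (- real n / 12))"
  proof (rule ennreal_leI)
    have "exp (1 / 4) * (1 / sqrt 2) = exp (1 / 4 - ln 2 / (2::real))"
      by (simp add: exp_diff ln_sqrt[symmetric])
    also have "\<dots> \<le> exp (- 1 / 12)" using ln2_ge_two_thirds by simp
    finally have "(exp (1 / 4) * (1 / sqrt 2)) ^ n \<le> (exp (- 1 / 12 :: real)) ^ n" by (rule power_mono) simp
    moreover have "exp (1 / 4) ^ n = exp (real n / 4)" "exp (- 1 / 12) ^ n = exp (- real n / 12)"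
      using exp_of_nat_mult[of n "1 / 4 :: real"] exp_of_nat_mult[of n "- 1 / 12 :: real"] by simp_all
    ultimately show "exp (real n / 4) * (1 / sqrt 2) ^ n \<le> exp (- real n / 12)"
      by (simp only: power_mult_distrib)
  qed
  finally show ?thesis by (simp add: q_def)
qed

text \<open>Chernoff bound at the negative parameter -1 / (4 q): the exponential moment is 2 to the
  power n/2, the threshold 4 n q contributes exp (- n), and (ln 2) / 2 - 1 \<le> - 1/2.\<close>

lemma energy_upper_tail:
  assumes S: "S \<in> sym_pos_def p" and v: "v \<in> carrier_vec p" "v \<noteq> 0\<^sub>v p"
  shows "emeasure (design_law n p S) {x \<in> space (design_law n p S). 4 * real n * (v \<bullet> (S *\<^sub>v v)) < energy n p v x}
    \<le> ennreal (exp (- real n / 2))"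
proof -
  define q where "q = v \<bullet> (S *\<^sub>v v)"
  have q: "0 < q" unfolding q_def by (rule sym_pos_defD(3)[OF S v])
  have "emeasure (design_law n p S) {x \<in> space (design_law n p S). 4 * real n * q < energy n p v x}
     \<le> (\<integral>\<^sup>+x. ennreal (exp (- real n)) * ennreal (exp (- (- 1 / (4 * q) * energy n p v x))) \<partial>design_law n p S)"
  proof (rule emeasure_le_nn_integral)
    show "{x \<in> space (design_law n p S). 4 * real n * q < energy n p v x} \<in> sets (design_law n p S)"
      using v by measurable
    fix x assume "x \<in> {x \<in> space (design_law n p S). 4 * real n * q < energy n p v x}"
    then have "0 \<le> - real n + - (- 1 / (4 * q) * energy n p v x)" using q by (simp add: field_simps)
    then have "1 \<le> exp (- real n) * exp (- (- 1 / (4 * q) * energy n p v x))" by (simp only: exp_add[symmetric] one_le_exp_iff)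
    then show "1 \<le> ennreal (exp (- real n)) * ennreal (exp (- (- 1 / (4 * q) * energy n p v x)))"
      by (simp only: ennreal_mult'[symmetric] exp_ge_zero ennreal_1[symmetric] ennreal_leI)
  qed
  also have "\<dots> = ennreal (exp (- real n)) * ennreal ((1 / sqrt (1 + 2 * (- 1 / (4 * q) * q))) ^ n)"
    using v q energy_exp[OF S v(1), of "- 1 / (4 * q)" n] by (subst nn_integral_cmult) (auto simp: q_def)
  also have "\<dots> = ennreal (exp (- real n) * (sqrt 2) ^ n)"
    using q by (simp add: ennreal_mult'[symmetric] real_sqrt_divide)
  also have "\<dots> \<le> ennreal (exp (- real n / 2))"
  proof (rule ennreal_leI)
    have "sqrt 2 = exp (ln 2 / (2::real))" by (simp add: ln_sqrt[symmetric])
    then have "exp (- 1) * sqrt 2 = exp (- 1 + ln 2 / (2::real))" by (simp only: exp_add)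
    also have "\<dots> \<le> exp (- 1 / 2)" using ln_2_less_1 by simp
    finally have "(exp (- 1) * sqrt 2) ^ n \<le> (exp (- 1 / 2 :: real)) ^ n" by (rule power_mono) simp
    then show "exp (- real n) * sqrt 2 ^ n \<le> exp (- real n / 2)"
      by (simp add: power_mult_distrib exp_of_nat_mult[symmetric])
  qed
  finally show ?thesis by (simp add: q_def)
qed

text \<open>The squared row forms have fourth-moment constant 3, so each has variance 3 q^2 - q^2 =
  2 q^2.\<close>

lemma energy_variance:
  assumes S: "S \<in> sym_pos_def p" and v: "v \<in> carrier_vec p"
  shows "(\<integral>\<^sup>+x. ennreal ((energy n p v x - real n * (v \<bullet> (S *\<^sub>v v)))\<^sup>2) \<partial>design_law n p S)
    = ennreal (2 * real n * (v \<bullet> (S *\<^sub>v v))\<^sup>2)"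
proof -
  define q where "q = v \<bullet> (S *\<^sub>v v)"
  define \<phi> where "\<phi> x = (vec p x \<bullet> v)\<^sup>2 - q" for x
  interpret prob_space "gaussian_law p S" by (rule prob_space_gaussian_law[OF S])
  note i = integrable_gaussian_pow[OF S v]
  have sq: "(\<phi> x)\<^sup>2 = (vec p x \<bullet> v) ^ 4 - 2 * q * (vec p x \<bullet> v)\<^sup>2 + q\<^sup>2" for x
    by (simp add: \<phi>_def power2_eq_square power4_eq_xxxx algebra_simps)
  have i1: "integrable (gaussian_law p S) \<phi>" unfolding \<phi>_def using i by auto
  have i2: "integrable (gaussian_law p S) (\<lambda>x. (\<phi> x)\<^sup>2)" unfolding sq using i by auto
  have z: "(\<integral>x. \<phi> x \<partial>gaussian_law p S) = 0"
    unfolding \<phi>_def using i integral_gaussian_2[OF S v] prob_space by (simp add: q_def)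
  have "(\<integral>x. (\<phi> x)\<^sup>2 \<partial>gaussian_law p S) = 3 * q\<^sup>2 - 2 * q * q + q\<^sup>2"
    unfolding sq using i integral_gaussian_2[OF S v] integral_gaussian_4[OF S v] prob_space
    by (simp add: q_def)
  then have "(\<integral>x. (\<phi> x)\<^sup>2 \<partial>gaussian_law p S) = 2 * q\<^sup>2" by (simp add: power2_eq_square)
  moreover have "energy n p v x - real n * q = (\<Sum>i<n. \<phi> (x i))" for x
    by (simp add: energy_def \<phi>_def sum_subtractf)
  ultimately show ?thesis
    using iid_sum_second_moment[OF prob_space_gaussian_law[OF S] i1 i2 z, of n]
    by (simp add: design_law_def q_def[symmetric] nn_integral_eq_integral)
qed

section \<open>The Gaussian noise vector\<close>

abbreviation noise_cov :: "nat \<Rightarrow> real \<Rightarrow> real mat" where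
  "noise_cov n \<sigma> \<equiv> \<sigma>\<^sup>2 \<cdot>\<^sub>m 1\<^sub>m n"

lemma noise_cov_quad: "u \<in> carrier_vec n \<Longrightarrow> u \<bullet> (noise_cov n \<sigma> *\<^sub>v u) = \<sigma>\<^sup>2 * (u \<bullet> u)"
proof -
  assume u: "u \<in> carrier_vec n"
  then have "noise_cov n \<sigma> *\<^sub>v u = \<sigma>\<^sup>2 \<cdot>\<^sub>v u" by (intro eq_vecI) auto
  then show ?thesis using u by simp
qed

lemma noise_cov_sym_pos_def: "0 < \<sigma> \<Longrightarrow> noise_cov n \<sigma> \<in> sym_pos_def n"
  unfolding sym_pos_def_def by (auto simp: noise_cov_quad sprod_pos intro!: eq_matI)

lemma prob_space_noise: "0 < \<sigma> \<Longrightarrow> prob_space (gaussian_law n (noise_cov n \<sigma>))"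
  by (rule prob_space_gaussian_law[OF noise_cov_sym_pos_def])

text \<open>The noise law is a single \<open>n\<close>-dimensional Gaussian density rather than a
  product measure; writing it as the image of independent standard normals under multiplication by
  \<sigma> makes the second-moment formula for independent sums applicable.\<close>

lemma noise_variance:
  assumes \<sigma>: "0 < \<sigma>"
  shows "(\<integral>\<^sup>+e. ennreal ((vec n e \<bullet> vec n e - real n * \<sigma>\<^sup>2)\<^sup>2) \<partial>gaussian_law n (noise_cov n \<sigma>))
    = ennreal (2 * real n * (\<sigma>\<^sup>2)\<^sup>2)"
proof -
  define L where "L = \<sigma> \<cdot>\<^sub>m (1\<^sub>m n :: real mat)"
  have L: "lower_triangular n L" using \<sigma> by (auto simp: L_def lower_triangular_def)
  have "L * transpose_mat L = noise_cov n \<sigma>"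
    using \<sigma> by (intro eq_matI) (auto simp: L_def scalar_prod_lessThan[of _ n] power2_eq_square if_distrib cong: if_cong)
  then have law: "gaussian_law n (noise_cov n \<sigma>) = distr (PiM {..<n} (\<lambda>_. std_normal)) (lebesgue_fun n) (mat_fun n L)"
    using gaussian_law_std[OF L] by simp
  have sp: "(vec n e \<bullet> vec n e - real n * \<sigma>\<^sup>2)\<^sup>2 = ((\<Sum>i<n. (e i)\<^sup>2) - real n * \<sigma>\<^sup>2)\<^sup>2" for e
    by (simp add: scalar_prod_lessThan[of _ n] power2_eq_square)
  have mf: "mat_fun n L z i = \<sigma> * z i" if "i < n" for z i
  proof -
    have "(\<Sum>k<n. L $$ (i, k) * z k) = (\<Sum>k\<in>{i}. L $$ (i, k) * z k)"
      by (rule sum.mono_neutral_right) (use that in \<open>auto simp: L_def\<close>)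
    then show ?thesis using that by (simp add: mat_fun_def L_def)
  qed
  define \<phi> where "\<phi> z = z\<^sup>2 - (1::real)" for z
  have sq: "(\<phi> z)\<^sup>2 = z ^ 4 - 2 * z\<^sup>2 + 1" for z by (simp add: \<phi>_def power2_eq_square power4_eq_xxxx algebra_simps)
  have i1: "integrable std_normal \<phi>" unfolding \<phi>_def using integrable_std_normal_pow by auto
  have i2: "integrable std_normal (\<lambda>x. (\<phi> x)\<^sup>2)" unfolding sq using integrable_std_normal_pow by auto
  have z: "(\<integral>x. \<phi> x \<partial>std_normal) = 0"
    unfolding \<phi>_def using integrable_std_normal_pow integral_std_normal_2 std_normal.prob_space by simp
  have v: "(\<integral>x. (\<phi> x)\<^sup>2 \<partial>std_normal) = 2"
    unfolding sq using integrable_std_normal_pow integral_std_normal_2 integral_std_normal_4 std_normal.prob_space by simp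
  have "(\<Sum>i<n. (mat_fun n L z i)\<^sup>2) - real n * \<sigma>\<^sup>2 = \<sigma>\<^sup>2 * (\<Sum>i<n. \<phi> (z i))" for z
    by (simp add: mf \<phi>_def sum_subtractf power_mult_distrib sum_distrib_left right_diff_distrib)
  then have eq: "((\<Sum>i<n. (mat_fun n L z i)\<^sup>2) - real n * \<sigma>\<^sup>2)\<^sup>2 = (\<sigma>\<^sup>2)\<^sup>2 * (\<Sum>i<n. \<phi> (z i))\<^sup>2" for z
    by (simp add: power_mult_distrib)
  have "(\<integral>\<^sup>+e. ennreal ((vec n e \<bullet> vec n e - real n * \<sigma>\<^sup>2)\<^sup>2) \<partial>gaussian_law n (noise_cov n \<sigma>))
     = (\<integral>\<^sup>+z. ennreal ((\<sigma>\<^sup>2)\<^sup>2 * (\<Sum>i<n. \<phi> (z i))\<^sup>2) \<partial>PiM {..<n} (\<lambda>_. std_normal))"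
  proof -
    have "(\<lambda>e. ((\<Sum>i<n. (e i)\<^sup>2) - real n * \<sigma>\<^sup>2)\<^sup>2) \<in> borel_measurable (lebesgue_fun n)"
      by (intro borel_measurable_power borel_measurable_diff borel_measurable_sum borel_measurable_const measurable_coord) auto
    then show ?thesis unfolding law sp by (subst nn_integral_distr) (auto simp: eq measurable_mat_fun_std)
  qed
  also have "\<dots> = ennreal (\<integral>z. (\<sigma>\<^sup>2)\<^sup>2 * (\<Sum>i<n. \<phi> (z i))\<^sup>2 \<partial>PiM {..<n} (\<lambda>_. std_normal))"
    by (intro nn_integral_eq_integral integrable_mult_right iid_sum_second_moment(1) i1 i2 z prob_space_std_normal) auto
  also have "\<dots> = ennreal (2 * real n * (\<sigma>\<^sup>2)\<^sup>2)"
    using iid_sum_second_moment(2)[OF prob_space_std_normal i1 i2 z, of n] v by (simp add: mult_ac)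
  finally show ?thesis .
qed

lemma noise_linear_second_moment:
  assumes \<sigma>: "0 < \<sigma>" and u: "u \<in> carrier_vec n"
  shows "(\<integral>\<^sup>+e. ennreal ((vec n e \<bullet> u)\<^sup>2) \<partial>gaussian_law n (noise_cov n \<sigma>)) = ennreal (\<sigma>\<^sup>2 * (u \<bullet> u))"
  using integrable_gaussian_pow[OF noise_cov_sym_pos_def[OF \<sigma>] u, of 2]
    integral_gaussian_2[OF noise_cov_sym_pos_def[OF \<sigma>] u]
  by (simp add: nn_integral_eq_integral noise_cov_quad[OF u])

text \<open>Two-sided Chernoff bound: the parameter s / (\<sigma> |u|) optimises the Gaussian
  exponent for either sign. For \<open>u = 0\<close> the strict inequality makes the event
  empty.\<close>

lemma noise_linear_tail:
  assumes \<sigma>: "0 < \<sigma>" and u: "u \<in> carrier_vec n" and s: "0 \<le> s"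
  shows "emeasure (gaussian_law n (noise_cov n \<sigma>))
      {e \<in> space (gaussian_law n (noise_cov n \<sigma>)). (u \<bullet> u) * s\<^sup>2 * \<sigma>\<^sup>2 < (vec n e \<bullet> u)\<^sup>2}
    \<le> ennreal (2 * exp (- s\<^sup>2 / 2))"
proof (cases "u = 0\<^sub>v n")
  case True
  then show ?thesis by simp
next
  case False
  let ?G = "gaussian_law n (noise_cov n \<sigma>)"
  have uu: "0 < u \<bullet> u" by (rule sprod_pos[OF u False])
  define w where "w = vnorm u"
  have w: "0 < w" "w\<^sup>2 = u \<bullet> u" using vnorm_sq[of u] uu vnorm_nonneg[of u] by (auto simp: w_def vnorm_def)
  define l where "l = s / (\<sigma> * w)"
  have l: "0 \<le> l" "l * (w * s * \<sigma>) = s\<^sup>2" using s \<sigma> w by (auto simp: l_def power2_eq_square)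
  have mgf: "(\<integral>\<^sup>+e. ennreal (exp (a * (vec n e \<bullet> u))) \<partial>?G) = ennreal (exp (s\<^sup>2 / 2))" if "a = l \<or> a = - l" for a
  proof -
    have "(\<integral>\<^sup>+e. ennreal (exp (a * (vec n e \<bullet> u))) \<partial>?G) = (\<integral>\<^sup>+z. ennreal (exp (a * (sqrt (u \<bullet> (noise_cov n \<sigma> *\<^sub>v u)) * z))) \<partial>std_normal)"
      by (rule nn_integral_gaussian_linear[OF noise_cov_sym_pos_def[OF \<sigma>] u]) measurable
    also have "\<dots> = (\<integral>\<^sup>+z. ennreal (exp ((a * (\<sigma> * w)) * z)) \<partial>std_normal)"
      using \<sigma> w by (simp add: noise_cov_quad[OF u] real_sqrt_mult w(2)[symmetric] mult.assoc)
    also have "\<dots> = ennreal (exp ((a * (\<sigma> * w))\<^sup>2 / 2))" by (rule std_normal_mgf)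
    also have "(a * (\<sigma> * w))\<^sup>2 = s\<^sup>2" using that \<sigma> w by (auto simp: l_def)
    finally show ?thesis .
  qed
  have "emeasure ?G {e \<in> space ?G. (u \<bullet> u) * s\<^sup>2 * \<sigma>\<^sup>2 < (vec n e \<bullet> u)\<^sup>2}
      \<le> (\<integral>\<^sup>+e. ennreal (exp (- s\<^sup>2)) * (ennreal (exp (l * (vec n e \<bullet> u))) + ennreal (exp (- l * (vec n e \<bullet> u)))) \<partial>?G)"
  proof (rule emeasure_le_nn_integral)
    show "{e \<in> space ?G. (u \<bullet> u) * s\<^sup>2 * \<sigma>\<^sup>2 < (vec n e \<bullet> u)\<^sup>2} \<in> sets ?G" using u by measurable
    fix e assume "e \<in> {e \<in> space ?G. (u \<bullet> u) * s\<^sup>2 * \<sigma>\<^sup>2 < (vec n e \<bullet> u)\<^sup>2}"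
    then have "(w * s * \<sigma>)\<^sup>2 < \<bar>vec n e \<bullet> u\<bar>\<^sup>2" by (simp add: power_mult_distrib w(2))
    then have "w * s * \<sigma> \<le> \<bar>vec n e \<bullet> u\<bar>" by (meson abs_ge_zero less_imp_le power2_less_imp_less)
    then have "l * (w * s * \<sigma>) \<le> l * \<bar>vec n e \<bullet> u\<bar>" by (rule mult_left_mono[OF _ l(1)])
    then have "s\<^sup>2 \<le> l * (vec n e \<bullet> u) \<or> s\<^sup>2 \<le> - l * (vec n e \<bullet> u)" unfolding l(2) by (auto simp: abs_if split: if_splits)
    then have "exp (s\<^sup>2) \<le> exp (l * (vec n e \<bullet> u)) \<or> exp (s\<^sup>2) \<le> exp (- l * (vec n e \<bullet> u))" by (simp only: exp_le_cancel_iff)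
    then have "exp (s\<^sup>2) \<le> exp (l * (vec n e \<bullet> u)) + exp (- l * (vec n e \<bullet> u))"
      using exp_gt_zero[of "l * (vec n e \<bullet> u)"] exp_gt_zero[of "- l * (vec n e \<bullet> u)"] by linarith
    then have "1 \<le> exp (- s\<^sup>2) * (exp (l * (vec n e \<bullet> u)) + exp (- l * (vec n e \<bullet> u)))" by (simp add: exp_minus field_simps)
    then show "1 \<le> ennreal (exp (- s\<^sup>2)) * (ennreal (exp (l * (vec n e \<bullet> u))) + ennreal (exp (- l * (vec n e \<bullet> u))))"
      by (simp only: ennreal_plus[symmetric] ennreal_mult'[symmetric] exp_ge_zero ennreal_1[symmetric] ennreal_leI)
  qed
  also have "\<dots> = ennreal (exp (- s\<^sup>2)) * (ennreal (exp (s\<^sup>2 / 2)) + ennreal (exp (s\<^sup>2 / 2)))"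
    using u by (subst nn_integral_cmult, measurable) (subst nn_integral_add, measurable, simp only: mgf[OF disjI1[OF refl]] mgf[OF disjI2[OF refl]])
  also have "\<dots> = ennreal (2 * exp (- s\<^sup>2 / 2))"
  proof -
    have "exp (- s\<^sup>2) * exp (s\<^sup>2 / 2) = exp (- s\<^sup>2 / 2)" by (simp add: exp_add[symmetric])
    then have "exp (- s\<^sup>2) * (exp (s\<^sup>2 / 2) + exp (s\<^sup>2 / 2)) = 2 * exp (- s\<^sup>2 / 2)" by (simp add: algebra_simps)
    then show ?thesis by (simp only: ennreal_plus[symmetric] ennreal_mult'[symmetric] exp_ge_zero)
  qed
  finally show ?thesis .
qed

section \<open>Maurey's method and the square-root Lasso\<close>

text \<open>These are the possible totals of \<open>m\<close> draws in the empirical method, before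
  division by \<open>m\<close>; quadratic forms absorb that scaling. Different draws may produce the
  same vector, and terms may cancel to zero.\<close>

primrec signed_sums :: "nat \<Rightarrow> nat \<Rightarrow> real vec set" where
  "signed_sums p 0 = {0\<^sub>v p}"
| "signed_sums p (Suc m) = (\<lambda>(v, j, s). s \<cdot>\<^sub>v unit_vec p j + v) ` (signed_sums p m \<times> {..<p} \<times> {-1, 1})"

lemma signed_sums_carrier: "v \<in> signed_sums p m \<Longrightarrow> v \<in> carrier_vec p"
  by (induction m arbitrary: v) auto

lemma finite_signed_sums: "finite (signed_sums p m)"
  by (induction m) auto

lemma card_signed_sums: "card (signed_sums p m) \<le> (2 * p) ^ m"
proof (induction m)
  case (Suc m)
  have "card (signed_sums p (Suc m)) \<le> card (signed_sums p m \<times> {..<p} \<times> {-1, 1::real})"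
    unfolding signed_sums.simps by (rule card_image_le) (simp add: finite_signed_sums)
  also have "\<dots> = card (signed_sums p m) * (2 * p)" by (simp add: card_cartesian_product)
  also have "\<dots> \<le> (2 * p) ^ m * (2 * p)" using Suc.IH by (rule mult_le_mono1)
  finally show ?case by (simp add: mult.commute)
qed simp

text \<open>Drawing the same signed vector \<open>m\<close> times gives this multiple, so control
  over all signed sums includes control over every single column of the design.\<close>

lemma smult_unit_in_signed_sums: "j < p \<Longrightarrow> real m \<cdot>\<^sub>v unit_vec p j \<in> signed_sums p m"
proof (induction m)
  case (Suc m)
  have "real (Suc m) \<cdot>\<^sub>v unit_vec p j = 1 \<cdot>\<^sub>v unit_vec p j + real m \<cdot>\<^sub>v (unit_vec p j :: real vec)"
    by (intro eq_vecI) (auto simp: algebra_simps)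
  then show ?case using Suc by (auto intro!: image_eqI[of _ _ "(real m \<cdot>\<^sub>v unit_vec p j, j, 1)"])
qed auto

lemma quad_form_add:
  fixes A :: "real mat"
  assumes "A \<in> carrier_mat p p" "transpose_mat A = A" "u \<in> carrier_vec p" "v \<in> carrier_vec p"
  shows "(u + v) \<bullet> (A *\<^sub>v (u + v)) = u \<bullet> (A *\<^sub>v u) + 2 * (v \<bullet> (A *\<^sub>v u)) + v \<bullet> (A *\<^sub>v v)"
  using assms sprod_sym_mat[OF assms]
  by (simp add: mult_add_distrib_mat_vec[of A p p] add_scalar_prod_distrib[of _ p] scalar_prod_add_distrib[of _ p])

lemma quad_form_smult:
  fixes A :: "real mat"
  assumes "A \<in> carrier_mat p p" "v \<in> carrier_vec p"
  shows "(c \<cdot>\<^sub>v v) \<bullet> (A *\<^sub>v (c \<cdot>\<^sub>v v)) = c\<^sup>2 * (v \<bullet> (A *\<^sub>v v))"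
  using assms by (simp add: mult_mat_vec[of A p p] power2_eq_square)

lemma quad_form_unit:
  fixes A :: "real mat"
  assumes "A \<in> carrier_mat p p" "j < p"
  shows "unit_vec p j \<bullet> (A *\<^sub>v unit_vec p j) = A $$ (j, j)"
  using assms by (simp add: mult_mat_vec_def scalar_prod_left_unit)

text \<open>This is the expectation over a single draw with weights \<bar>h j\<bar>, which sum to
  one. The cross term averages to the one with \<open>h\<close>. What remains besides the form at u
  + h is a variance-like term independent of \<open>u\<close>, because the squared sign is 1
  wherever the weight is positive.\<close>

lemma quad_form_average:
  fixes A :: "real mat"
  assumes A: "A \<in> carrier_mat p p" "transpose_mat A = A" and u: "u \<in> carrier_vec p" and h: "h \<in> carrier_vec p"
    and one: "l1_norm h = 1"
  shows "(\<Sum>j<p. \<bar>h $ j\<bar> * ((sgn (h $ j) \<cdot>\<^sub>v unit_vec p j + u) \<bullet> (A *\<^sub>v (sgn (h $ j) \<cdot>\<^sub>v unit_vec p j + u))))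
    = (u + h) \<bullet> (A *\<^sub>v (u + h)) - h \<bullet> (A *\<^sub>v h) + (\<Sum>j<p. \<bar>h $ j\<bar> * A $$ (j, j))"
proof -
  have s1: "(\<Sum>j<p. \<bar>h $ j\<bar>) = 1" using one h by (simp add: l1_norm_def)
  have trm: "\<bar>h $ j\<bar> * ((sgn (h $ j) \<cdot>\<^sub>v unit_vec p j + u) \<bullet> (A *\<^sub>v (sgn (h $ j) \<cdot>\<^sub>v unit_vec p j + u)))
     = \<bar>h $ j\<bar> * (u \<bullet> (A *\<^sub>v u)) + 2 * (h $ j * (A *\<^sub>v u) $ j) + \<bar>h $ j\<bar> * A $$ (j, j)" if j: "j < p" for j
  proof -
    define s where "s = sgn (h $ j)"
    have s: "\<bar>h $ j\<bar> * s = h $ j" "\<bar>h $ j\<bar> * s\<^sup>2 = \<bar>h $ j\<bar>"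
      by (auto simp: s_def sgn_if power2_eq_square)
    have e: "s \<cdot>\<^sub>v unit_vec p j \<in> carrier_vec p" by simp
    have "s \<cdot>\<^sub>v unit_vec p j + u = u + s \<cdot>\<^sub>v unit_vec p j" using u by (intro comm_add_vec[of _ p]) auto
    then have "(s \<cdot>\<^sub>v unit_vec p j + u) \<bullet> (A *\<^sub>v (s \<cdot>\<^sub>v unit_vec p j + u))
      = u \<bullet> (A *\<^sub>v u) + 2 * (s * (A *\<^sub>v u) $ j) + s\<^sup>2 * A $$ (j, j)"
      using quad_form_add[OF A u e] quad_form_smult[OF A(1), of "unit_vec p j" s] quad_form_unit[OF A(1) j] A(1) u j
      by (simp add: scalar_prod_left_unit[of _ p] del: index_mult_mat_vec)
    then have "\<bar>h $ j\<bar> * ((s \<cdot>\<^sub>v unit_vec p j + u) \<bullet> (A *\<^sub>v (s \<cdot>\<^sub>v unit_vec p j + u)))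
      = \<bar>h $ j\<bar> * (u \<bullet> (A *\<^sub>v u)) + 2 * ((\<bar>h $ j\<bar> * s) * (A *\<^sub>v u) $ j) + (\<bar>h $ j\<bar> * s\<^sup>2) * A $$ (j, j)"
      by (simp add: algebra_simps del: index_mult_mat_vec)
    then show ?thesis unfolding s by (simp add: s_def)
  qed
  have "(\<Sum>j<p. h $ j * (A *\<^sub>v u) $ j) = h \<bullet> (A *\<^sub>v u)"
    using A(1) u by (simp add: scalar_prod_lessThan[of _ p] del: index_mult_mat_vec)
  then have "(\<Sum>j<p. \<bar>h $ j\<bar> * (u \<bullet> (A *\<^sub>v u)) + 2 * (h $ j * (A *\<^sub>v u) $ j) + \<bar>h $ j\<bar> * A $$ (j, j))
     = u \<bullet> (A *\<^sub>v u) + 2 * (h \<bullet> (A *\<^sub>v u)) + (\<Sum>j<p. \<bar>h $ j\<bar> * A $$ (j, j))"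
    by (simp only: sum.distrib sum_distrib_left[symmetric] sum_distrib_right[symmetric] s1 mult_1)
  then show ?thesis using quad_form_add[OF A u h] by (simp add: trm del: index_mult_mat_vec)
qed

text \<open>Maurey's empirical method: if the signs and indices are drawn independently with weights
  \<open>\<bar>h j\<bar>\<close>, the expectation of the quadratic form at \<open>u\<close> plus the sum of \<open>m\<close> draws is the right-hand
  side below.\<close>

lemma maurey:
  fixes A :: "real mat"
  assumes A: "A \<in> carrier_mat p p" "transpose_mat A = A" and h: "h \<in> carrier_vec p" and one: "l1_norm h = 1"
    and u: "u \<in> carrier_vec p"
    and pos: "\<And>v. v \<in> signed_sums p m \<Longrightarrow> 0 \<le> (u + v) \<bullet> (A *\<^sub>v (u + v))"
  shows "0 \<le> (u + real m \<cdot>\<^sub>v h) \<bullet> (A *\<^sub>v (u + real m \<cdot>\<^sub>v h))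
     + real m * ((\<Sum>j<p. \<bar>h $ j\<bar> * A $$ (j, j)) - h \<bullet> (A *\<^sub>v h))"
  using u pos
proof (induction m arbitrary: u)
  case 0
  have "real 0 \<cdot>\<^sub>v h = 0\<^sub>v p" using h by (intro eq_vecI) auto
  then show ?case using 0 by simp
next
  case (Suc m)
  define D where "D = (\<Sum>j<p. \<bar>h $ j\<bar> * A $$ (j, j)) - h \<bullet> (A *\<^sub>v h)"
  define w where "w = u + real m \<cdot>\<^sub>v h"
  have w: "w \<in> carrier_vec p" using Suc.prems(1) h by (simp add: w_def)
  have s1: "(\<Sum>j<p. \<bar>h $ j\<bar>) = 1" using one h by (simp add: l1_norm_def)
  have "0 \<le> \<bar>h $ j\<bar> * ((sgn (h $ j) \<cdot>\<^sub>v unit_vec p j + w) \<bullet> (A *\<^sub>v (sgn (h $ j) \<cdot>\<^sub>v unit_vec p j + w)) + real m * D)"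
    if j: "j < p" for j
  \<comment> \<open>Where \<open>h j\<close> vanishes its sign is 0, which is not an admissible sign
    in \<open>signed_sums\<close>; the weight is then 0 as well.\<close>
  proof (cases "h $ j = 0")
    case False
    define s where "s = sgn (h $ j)"
    have s: "s \<in> {-1, 1}" using False by (auto simp: s_def sgn_if)
    have u': "s \<cdot>\<^sub>v unit_vec p j + u \<in> carrier_vec p" using Suc.prems(1) by simp
    have "0 \<le> ((s \<cdot>\<^sub>v unit_vec p j + u) + v) \<bullet> (A *\<^sub>v ((s \<cdot>\<^sub>v unit_vec p j + u) + v))" if v: "v \<in> signed_sums p m" for v
    proof -
      have "s \<cdot>\<^sub>v unit_vec p j + v \<in> signed_sums p (Suc m)"
        using v s j by (auto intro!: image_eqI[of _ _ "(v, j, s)"])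
      moreover have "(s \<cdot>\<^sub>v unit_vec p j + u) + v = u + (s \<cdot>\<^sub>v unit_vec p j + v)"
        using signed_sums_carrier[OF v] Suc.prems(1) by (intro eq_vecI) auto
      ultimately show ?thesis using Suc.prems(2) by simp
    qed
    from Suc.IH[OF u' this]
    have "0 \<le> ((s \<cdot>\<^sub>v unit_vec p j + u) + real m \<cdot>\<^sub>v h) \<bullet> (A *\<^sub>v ((s \<cdot>\<^sub>v unit_vec p j + u) + real m \<cdot>\<^sub>v h)) + real m * D"
      by (simp add: D_def)
    moreover have "(s \<cdot>\<^sub>v unit_vec p j + u) + real m \<cdot>\<^sub>v h = s \<cdot>\<^sub>v unit_vec p j + w"
      unfolding w_def using h Suc.prems(1) by (intro eq_vecI) auto
    ultimately show ?thesis by (simp add: s_def)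
  qed simp
  then have "0 \<le> (\<Sum>j<p. \<bar>h $ j\<bar> * ((sgn (h $ j) \<cdot>\<^sub>v unit_vec p j + w) \<bullet> (A *\<^sub>v (sgn (h $ j) \<cdot>\<^sub>v unit_vec p j + w)) + real m * D))"
    by (intro sum_nonneg) auto
  also have "\<dots> = (\<Sum>j<p. \<bar>h $ j\<bar> * ((sgn (h $ j) \<cdot>\<^sub>v unit_vec p j + w) \<bullet> (A *\<^sub>v (sgn (h $ j) \<cdot>\<^sub>v unit_vec p j + w)))) + real m * D"
    by (simp only: distrib_left sum.distrib sum_distrib_right[symmetric] s1 mult_1)
  also have "\<dots> = (w + h) \<bullet> (A *\<^sub>v (w + h)) + real (Suc m) * D"
    unfolding quad_form_average[OF A w h one] by (simp add: D_def algebra_simps)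
  also have "w + h = u + real (Suc m) \<cdot>\<^sub>v h"
    unfolding w_def using h Suc.prems(1) by (intro eq_vecI) (auto simp: algebra_simps)
  finally show ?case by (simp add: D_def)
qed

text \<open>For l1 norm one and base point 0 the expectation is m (m - 1) h' A h plus m times the
  weighted diagonal. The shift from \<open>m\<close> to \<open>m - 1\<close> is the subtracted term
  h' A h of each draw. The general case is homogeneity of degree two.\<close>

lemma maurey_lower_bound:
  fixes A :: "real mat"
  assumes A: "A \<in> carrier_mat p p" "transpose_mat A = A" and h: "h \<in> carrier_vec p"
    and pos: "\<And>v. v \<in> signed_sums p m \<Longrightarrow> 0 \<le> v \<bullet> (A *\<^sub>v v)" and m: "0 < m"
    and diag: "\<And>j. j < p \<Longrightarrow> A $$ (j, j) \<le> K"
  shows "- K * (l1_norm h)\<^sup>2 \<le> (real m - 1) * (h \<bullet> (A *\<^sub>v h))"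
proof -
  define c where "c = l1_norm h"
  have c0: "0 \<le> c" by (simp add: c_def l1_norm_def sum_nonneg)
  show ?thesis
  proof (cases "c = 0")
    case True
    then have "\<forall>j<p. h $ j = 0" using h by (auto simp: c_def l1_norm_def sum_nonneg_eq_0_iff)
    then have "h = 0\<^sub>v p" using h by (intro eq_vecI) auto
    then show ?thesis using True A(1) by (simp add: c_def)
  next
    case False
    then have c: "0 < c" using c0 by simp
    define g where "g = (1 / c) \<cdot>\<^sub>v h"
    have g: "g \<in> carrier_vec p" using h by (simp add: g_def)
    have hg: "h = c \<cdot>\<^sub>v g" using h c by (intro eq_vecI) (auto simp: g_def)
    have one: "l1_norm g = 1" using c h by (simp add: g_def l1_norm_def c_def abs_mult sum_divide_distrib[symmetric])
    have "0 \<le> (0\<^sub>v p + real m \<cdot>\<^sub>v g) \<bullet> (A *\<^sub>v (0\<^sub>v p + real m \<cdot>\<^sub>v g))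
        + real m * ((\<Sum>j<p. \<bar>g $ j\<bar> * A $$ (j, j)) - g \<bullet> (A *\<^sub>v g))"
      by (rule maurey[OF A g one]) (use pos signed_sums_carrier in auto)
    also have "0\<^sub>v p + real m \<cdot>\<^sub>v g = real m \<cdot>\<^sub>v g" using g by simp
    also have "(real m \<cdot>\<^sub>v g) \<bullet> (A *\<^sub>v (real m \<cdot>\<^sub>v g)) = (real m)\<^sup>2 * (g \<bullet> (A *\<^sub>v g))" by (rule quad_form_smult[OF A(1) g])
    finally have "0 \<le> real m * ((real m - 1) * (g \<bullet> (A *\<^sub>v g)) + (\<Sum>j<p. \<bar>g $ j\<bar> * A $$ (j, j)))"
      by (simp add: algebra_simps power2_eq_square)
    then have "0 \<le> (real m - 1) * (g \<bullet> (A *\<^sub>v g)) + (\<Sum>j<p. \<bar>g $ j\<bar> * A $$ (j, j))"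
      using m by (simp add: zero_le_mult_iff)
    also have "(\<Sum>j<p. \<bar>g $ j\<bar> * A $$ (j, j)) \<le> (\<Sum>j<p. \<bar>g $ j\<bar> * K)"
      by (intro sum_mono mult_left_mono) (use diag in auto)
    also have "\<dots> = K" using one g by (simp add: sum_distrib_right[symmetric] l1_norm_def)
    finally have "0 \<le> c\<^sup>2 * ((real m - 1) * (g \<bullet> (A *\<^sub>v g)) + K)" by simp
    moreover have "h \<bullet> (A *\<^sub>v h) = c\<^sup>2 * (g \<bullet> (A *\<^sub>v g))" unfolding hg by (rule quad_form_smult[OF A(1) g])
    ultimately show ?thesis by (simp add: c_def[symmetric] algebra_simps)
  qed
qed

section \<open>Deterministic error bound for the square-root Lasso\<close>

lemma sum_abs_le_sqrt_card:
  assumes "finite T" "card T \<le> k" "T \<subseteq> {..<p}" "h \<in> carrier_vec p"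
  shows "(\<Sum>j\<in>T. \<bar>h $ j\<bar>)\<^sup>2 \<le> real k * (h \<bullet> (h :: real vec))"
proof -
  have "(\<Sum>j\<in>T. \<bar>h $ j\<bar>)\<^sup>2 = (\<Sum>j\<in>T. 1 * \<bar>h $ j\<bar>)\<^sup>2" by simp
  also have "\<dots> \<le> (\<Sum>j\<in>T. 1\<^sup>2) * (\<Sum>j\<in>T. \<bar>h $ j\<bar>\<^sup>2)" by (rule Cauchy_Schwarz_ineq_sum)
  also have "\<dots> \<le> real k * (\<Sum>j<p. (h $ j)\<^sup>2)"
    using assms by (intro mult_mono sum_nonneg) (auto intro!: sum_mono2)
  finally show ?thesis using assms(4) by (simp add: scalar_prod_lessThan[of _ p] power2_eq_square)
qed

lemma mult_mat_vec_dot_cols: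
  fixes W :: "real mat"
  assumes "W \<in> carrier_mat n p" "h \<in> carrier_vec p" "e \<in> carrier_vec n"
  shows "(W *\<^sub>v h) \<bullet> e = (\<Sum>j<p. h $ j * (col W j \<bullet> e))"
proof -
  have "(W *\<^sub>v h) \<bullet> e = e \<bullet> (W *\<^sub>v h)" using assms by (intro comm_scalar_prod[of _ n]) auto
  also have "\<dots> = (transpose_mat W *\<^sub>v e) \<bullet> h"
    using assms by (intro transpose_vec_mult_scalar[symmetric, of _ n p]) auto
  also have "\<dots> = (\<Sum>j<p. (transpose_mat W *\<^sub>v e) $ j * h $ j)" using assms by (simp add: scalar_prod_lessThan[of _ p] del: index_mult_mat_vec)
  also have "\<dots> = (\<Sum>j<p. h $ j * (col W j \<bullet> e))" using assms by (intro sum.cong) auto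
  finally show ?thesis .
qed

text \<open>Optimality bounds R - E from above by lam (A - C), with R and E the residual and noise
  norms and A, C the l1 errors on and off the support. Convexity of the norm bounds it from below by
  - lam (A + C) / 2. Together they give the cone condition C \<le> 3 A and \<bar>R - E\<bar> \<le> 2
  lam A. The conclusion concerns the residual sum of squares, the only feature of the fit that
  \<open>eta_SL\<close> uses.\<close>

lemma sqrt_lasso_error:
  fixes W :: "real mat"
  assumes W: "W \<in> carrier_mat n p" and e: "e \<in> carrier_vec n" and b: "b \<in> carrier_vec p" and b0: "b0 \<in> carrier_vec p"
    and Y: "Y = W *\<^sub>v b0 + e" and lam: "0 < lam"
    and opt: "vnorm (Y - W *\<^sub>v b) + lam * l1_norm b \<le> vnorm (Y - W *\<^sub>v b0) + lam * l1_norm b0"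
    and T: "T = {j. j < p \<and> b0 $ j \<noteq> 0}" "card T \<le> k"
    and corr: "\<And>j. j < p \<Longrightarrow> \<bar>col W j \<bullet> e\<bar> \<le> lam / 2 * vnorm e"
    and epos: "0 < vnorm e" and B: "0 \<le> B"
    and re: "\<And>h. h \<in> carrier_vec p \<Longrightarrow> (\<Sum>j\<in>{..<p} - T. \<bar>h $ j\<bar>) \<le> 3 * (\<Sum>j\<in>T. \<bar>h $ j\<bar>) \<Longrightarrow>
       h \<bullet> h \<le> B * ((W *\<^sub>v h) \<bullet> (W *\<^sub>v h))"
  shows "\<bar>(vnorm (Y - W *\<^sub>v b))\<^sup>2 - (vnorm e)\<^sup>2\<bar> \<le> 12 * lam\<^sup>2 * real k * B * (vnorm (Y - W *\<^sub>v b) + vnorm e)\<^sup>2"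
proof -
  define R where "R = vnorm (Y - W *\<^sub>v b)"
  define E where "E = vnorm e"
  define h where "h = b - b0"
  define z where "z = W *\<^sub>v h"
  have h: "h \<in> carrier_vec p" using b b0 by (simp add: h_def)
  have z: "z \<in> carrier_vec n" using W h by (simp add: z_def)
  have Wb: "W *\<^sub>v b \<in> carrier_vec n" "W *\<^sub>v b0 \<in> carrier_vec n" using W b b0 by auto
  have "z = W *\<^sub>v b - W *\<^sub>v b0" unfolding z_def h_def using W b b0 by (rule mult_minus_distrib_mat_vec)
  moreover have "(x + e) - y = e - (y - x)" "(x + e) - x = e" if "x \<in> carrier_vec n" "y \<in> carrier_vec n" for x y
    using e that by (auto intro!: eq_vecI)
  ultimately have res: "Y - W *\<^sub>v b = e - z" and res0: "Y - W *\<^sub>v b0 = e" unfolding Y using Wb by auto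
  have R0: "0 \<le> R" by (simp add: R_def)
  have E0: "0 < E" using epos by (simp add: E_def)
  have TT: "finite T" "T \<subseteq> {..<p}" using T by auto
  define A where "A = (\<Sum>j\<in>T. \<bar>h $ j\<bar>)"
  define C where "C = (\<Sum>j\<in>{..<p} - T. \<bar>h $ j\<bar>)"
  have A0: "0 \<le> A" by (simp add: A_def sum_nonneg)
  have split: "(\<Sum>j<p. f j) = (\<Sum>j\<in>T. f j) + (\<Sum>j\<in>{..<p} - T. f j)" for f :: "nat \<Rightarrow> real"
    using sum.subset_diff[OF TT(2), of f] by simp
  have l1: "l1_norm b0 - l1_norm b \<le> A - C"
  proof -
    have "l1_norm b0 - l1_norm b = (\<Sum>j<p. \<bar>b0 $ j\<bar> - \<bar>b $ j\<bar>)" using b b0 by (simp add: l1_norm_def sum_subtractf)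
    also have "\<dots> = (\<Sum>j\<in>T. \<bar>b0 $ j\<bar> - \<bar>b $ j\<bar>) + (\<Sum>j\<in>{..<p} - T. \<bar>b0 $ j\<bar> - \<bar>b $ j\<bar>)" by (rule split)
    also have "\<dots> \<le> A + (\<Sum>j\<in>{..<p} - T. - \<bar>h $ j\<bar>)"
      unfolding A_def
    proof (intro add_mono sum_mono)
      fix j assume "j \<in> T"
      then show "\<bar>b0 $ j\<bar> - \<bar>b $ j\<bar> \<le> \<bar>h $ j\<bar>" using TT b b0 by (auto simp: h_def)
    next
      fix j assume "j \<in> {..<p} - T"
      then show "\<bar>b0 $ j\<bar> - \<bar>b $ j\<bar> \<le> - \<bar>h $ j\<bar>" using T b b0 by (auto simp: h_def)
    qed
    finally show ?thesis by (simp add: C_def sum_negf)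
  qed
  have upper: "R - E \<le> lam * (A - C)"
  proof -
    have "R - E \<le> lam * (l1_norm b0 - l1_norm b)" using opt unfolding res0 by (simp add: R_def E_def algebra_simps)
    also have "\<dots> \<le> lam * (A - C)" using l1 lam by (intro mult_left_mono) auto
    finally show ?thesis .
  qed
  have ze: "\<bar>z \<bullet> e\<bar> \<le> lam / 2 * E * (A + C)"
  proof -
    have "\<bar>z \<bullet> e\<bar> \<le> (\<Sum>j<p. \<bar>h $ j * (col W j \<bullet> e)\<bar>)" unfolding z_def mult_mat_vec_dot_cols[OF W h e] by (rule sum_abs)
    also have "\<dots> \<le> (\<Sum>j<p. \<bar>h $ j\<bar> * (lam / 2 * E))"
      unfolding abs_mult E_def by (intro sum_mono mult_left_mono corr) auto
    also have "\<dots> = lam / 2 * E * (A + C)" unfolding A_def C_def split[symmetric] sum_distrib_left by (intro sum.cong) auto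
    finally show ?thesis .
  qed
  have ee: "e \<bullet> e = E\<^sup>2" using vnorm_sq[of e] by (simp add: E_def)
  \<comment> \<open>The residual is e - z; pairing it with \<open>e\<close> gives E^2 - z.e \<le> R
    E, and one factor E > 0 cancels.\<close>
  have lower: "- (lam / 2 * (A + C)) \<le> R - E"
  proof -
    have "E\<^sup>2 - z \<bullet> e = (e - z) \<bullet> e" using e z by (simp add: minus_scalar_prod_distrib[of _ n] ee)
    also have "\<dots> \<le> R * E" using abs_sprod_le[of "e - z" n e] e z by (simp add: R_def res E_def)
    finally have "E * E - lam / 2 * E * (A + C) \<le> R * E" using ze by (simp add: power2_eq_square)
    then have "E * (E - lam / 2 * (A + C)) \<le> E * R" by (simp add: algebra_simps)
    then show ?thesis using E0 by simp
  qed
  have cone: "C \<le> 3 * A"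
  proof -
    have "lam * (- ((A + C) / 2)) \<le> lam * (A - C)" using lower upper by simp
    then have "- ((A + C) / 2) \<le> A - C" using lam by (simp only: mult_le_cancel_left_pos)
    then show ?thesis by (simp add: field_simps)
  qed
  have RE: "\<bar>R - E\<bar> \<le> 2 * lam * A"
  proof -
    have "lam * (A - C) \<le> lam * (2 * A)" using lam A0 by (intro mult_left_mono) (auto simp: C_def sum_nonneg intro: order_trans[of _ 0])
    moreover have "lam * ((A + C) / 2) \<le> lam * (2 * A)" using lam cone by (intro mult_left_mono) auto
    ultimately show ?thesis using upper lower by (simp add: abs_le_iff)
  qed
  have sq: "R\<^sup>2 - E\<^sup>2 = (R - E) * (R + E)" by (simp add: power2_eq_square algebra_simps)
  have diff: "\<bar>R\<^sup>2 - E\<^sup>2\<bar> \<le> 2 * lam * A * (R + E)"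
    unfolding sq abs_mult using RE R0 E0 A0 lam by (intro mult_mono) auto
  \<comment> \<open>Expanding |e - z|^2 expresses |z|^2 through R^2 - E^2 and z.e, both of which are
    already linear in A.\<close>
  have zz: "z \<bullet> z \<le> 6 * lam * A * (R + E)"
  proof -
    have "R\<^sup>2 = (e - z) \<bullet> (e - z)" by (simp add: R_def res vnorm_sq)
    also have "\<dots> = E\<^sup>2 - 2 * (z \<bullet> e) + z \<bullet> z"
      using e z comm_scalar_prod[OF e z]
      by (simp add: minus_scalar_prod_distrib[of _ n] scalar_prod_minus_distrib[of _ n] ee)
    finally have "z \<bullet> z = (R\<^sup>2 - E\<^sup>2) + 2 * (z \<bullet> e)" by simp
    also have "\<dots> \<le> 2 * lam * A * (R + E) + lam * E * (4 * A)"
    proof (rule add_mono)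
      have "2 * (z \<bullet> e) \<le> lam * E * (A + C)" using ze by simp
      also have "\<dots> \<le> lam * E * (4 * A)" using cone lam E0 by (intro mult_left_mono) auto
      finally show "2 * (z \<bullet> e) \<le> lam * E * (4 * A)" .
    qed (use diff in simp)
    also have "lam * E * (4 * A) \<le> 4 * lam * A * (R + E)" using lam A0 R0 E0 by (simp add: algebra_simps)
    finally show ?thesis by (simp add: algebra_simps)
  qed
  \<comment> \<open>The restricted eigenvalue bounds A^2 by a multiple of |z|^2, which is linear in
    A. Cancelling one A turns this into a bound on A itself, and inserting it produces the factor
    lam^2 k B.\<close>
  have "A\<^sup>2 \<le> real k * (h \<bullet> h)" unfolding A_def by (rule sum_abs_le_sqrt_card[OF TT(1) T(2) TT(2) h])
  also have "\<dots> \<le> real k * (B * (z \<bullet> z))" unfolding z_def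
    by (intro mult_left_mono re h) (use cone in \<open>auto simp: A_def C_def\<close>)
  also have "\<dots> \<le> real k * (B * (6 * lam * A * (R + E)))" by (intro mult_left_mono zz B) auto
  finally have "A * A \<le> A * (6 * real k * B * lam * (R + E))" by (simp add: power2_eq_square algebra_simps)
  moreover have "0 \<le> 6 * real k * B * lam * (R + E)" using B lam R0 E0 by simp
  ultimately have A: "A \<le> 6 * real k * B * lam * (R + E)"
    using A0 by (cases "A = 0") (auto simp: mult_le_cancel_left)
  have "\<bar>R\<^sup>2 - E\<^sup>2\<bar> \<le> 2 * lam * A * (R + E)" by (rule diff)
  also have "\<dots> \<le> 2 * lam * (6 * real k * B * lam * (R + E)) * (R + E)"
    using A lam R0 E0 by (intro mult_right_mono mult_left_mono) auto
  also have "\<dots> = 12 * lam\<^sup>2 * real k * B * (R + E)\<^sup>2" by (simp add: power2_eq_square)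
  finally show ?thesis by (simp add: R_def E_def)
qed

section \<open>Restricted eigenvalues of the normalised design\<close>

lemma normalize_cols_carrier: "X \<in> carrier_mat n p \<Longrightarrow> normalize_cols X \<in> carrier_mat n p"
  by (simp add: normalize_cols_def)

lemma normalize_cols_mult:
  assumes "X \<in> carrier_mat n p" "h \<in> carrier_vec p"
  shows "normalize_cols X *\<^sub>v h = X *\<^sub>v vec p (\<lambda>j. h $ j / vnorm (col X j))"
  using assms by (intro eq_vecI) (auto simp: normalize_cols_def scalar_prod_lessThan[of _ p] intro!: sum.cong)

lemma col_normalize_cols:
  "X \<in> carrier_mat n p \<Longrightarrow> j < p \<Longrightarrow> col (normalize_cols X) j = (1 / vnorm (col X j)) \<cdot>\<^sub>v col X j"
  by (intro eq_vecI) (auto simp: normalize_cols_def)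

lemma sprod_design_gram:
  fixes X :: "real mat"
  assumes "X \<in> carrier_mat n p" "v \<in> carrier_vec p"
  shows "v \<bullet> ((transpose_mat X * X) *\<^sub>v v) = (X *\<^sub>v v) \<bullet> (X *\<^sub>v v)"
proof -
  have "(transpose_mat X * X) *\<^sub>v v = transpose_mat X *\<^sub>v (X *\<^sub>v v)"
    using assms by (intro assoc_mult_mat_vec) auto
  moreover have "v \<bullet> (transpose_mat X *\<^sub>v (X *\<^sub>v v)) = (transpose_mat X *\<^sub>v (X *\<^sub>v v)) \<bullet> v"
    using assms by (intro comm_scalar_prod[of _ p]) auto
  moreover have "\<dots> = (X *\<^sub>v v) \<bullet> (X *\<^sub>v v)"
    using assms by (intro transpose_vec_mult_scalar[of _ n p]) auto
  ultimately show ?thesis by simp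
qed

text \<open>Maurey's bound is applied to X' X - (n / 2) S, which is nonnegative on signed sums, at
  the vector \<open>g\<close> with g j = h j / |X j|. On the cone |h|_1^2 \<le> 16 k |h|^2, so the
  negative part is at most 128 M1^2 k |h|^2 / (m - 1), while (n / 2) g' S g \<ge> |h|^2 / (8 M1^2).
  The size 2048 = 128 times 16 of \<open>m\<close> leaves half of the latter, which gives the
  constant 16 M1^2.\<close>

lemma restricted_eigenvalue:
  fixes X :: "real mat"
  assumes X: "X \<in> carrier_mat n p" and n: "0 < n" and S: "S \<in> sym_pos_def p" and M1: "0 < M1"
    and Slo: "\<And>v. v \<in> carrier_vec p \<Longrightarrow> (v \<bullet> v) / M1 \<le> v \<bullet> (S *\<^sub>v v)"
    and low: "\<And>v. v \<in> signed_sums p m \<Longrightarrow> real n / 2 * (v \<bullet> (S *\<^sub>v v)) \<le> (X *\<^sub>v v) \<bullet> (X *\<^sub>v v)"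
    and cols: "\<And>j. j < p \<Longrightarrow> (vnorm (col X j))\<^sup>2 \<le> 4 * real n * M1"
    and m: "2048 * M1 ^ 4 * real k + 1 \<le> real m"
    and T: "T \<subseteq> {..<p}" "card T \<le> k"
    and h: "h \<in> carrier_vec p" and cone: "(\<Sum>j\<in>{..<p} - T. \<bar>h $ j\<bar>) \<le> 3 * (\<Sum>j\<in>T. \<bar>h $ j\<bar>)"
  shows "h \<bullet> h \<le> 16 * M1\<^sup>2 * ((normalize_cols X *\<^sub>v h) \<bullet> (normalize_cols X *\<^sub>v h))"
    and "j < p \<Longrightarrow> real n / (2 * M1) \<le> (vnorm (col X j))\<^sup>2"
proof -
  have m1: "1 \<le> real m" using m M1 by (smt (verit) mult_nonneg_nonneg of_nat_0_le_iff zero_le_power)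
  then have m0: "0 < m" by simp
  have Sc: "S \<in> carrier_mat p p" "transpose_mat S = S" using sym_pos_defD[OF S] by auto
  have colX: "X *\<^sub>v unit_vec p j = col X j" if "j < p" for j using X that by (intro eq_vecI) auto
  \<comment> \<open>The column \<open>j\<close> is read off the signed sum in which \<open>j\<close>
    is drawn \<open>m\<close> times with sign +1; the factor m^2 cancels.\<close>
  have clow: "real n / (2 * M1) \<le> (vnorm (col X j))\<^sup>2" if j: "j < p" for j
  proof -
    have u: "unit_vec p j \<in> carrier_vec p" by simp
    have "(real m)\<^sup>2 * (real n / 2 * (unit_vec p j \<bullet> (S *\<^sub>v unit_vec p j))) \<le> (real m)\<^sup>2 * (col X j \<bullet> col X j)"
      using low[OF smult_unit_in_signed_sums[OF j]] quad_form_smult[OF Sc(1) u, of "real m"] X j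
      by (simp add: mult_mat_vec[of X n p] colX power2_eq_square mult_ac)
    then have "real n / 2 * (unit_vec p j \<bullet> (S *\<^sub>v unit_vec p j)) \<le> col X j \<bullet> col X j"
      using m0 by (simp only: mult_le_cancel_left_pos zero_less_power of_nat_0_less_iff)
    moreover have "real n / 2 * (1 / M1) \<le> real n / 2 * (unit_vec p j \<bullet> (S *\<^sub>v unit_vec p j))"
      using Slo[OF u] j by (intro mult_left_mono) auto
    ultimately show ?thesis by (simp add: vnorm_sq)
  qed
  show "real n / (2 * M1) \<le> (vnorm (col X j))\<^sup>2" if "j < p" by (rule clow[OF that])
  define A where "A = transpose_mat X * X - (real n / 2) \<cdot>\<^sub>m S"
  have Ac: "A \<in> carrier_mat p p" unfolding A_def using X Sc by (intro minus_carrier_mat smult_carrier_mat) auto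
  have At: "transpose_mat A = A"
  proof (rule eq_matI)
    fix i j assume ij: "i < dim_row A" "j < dim_col A"
    then have "S $$ (j, i) = S $$ (i, j)" using Sc Ac by (metis carrier_matD index_transpose_mat(1))
    moreover have "col X j \<bullet> col X i = col X i \<bullet> col X j" using X by (intro comm_scalar_prod[of _ n]) auto
    ultimately show "transpose_mat A $$ (i, j) = A $$ (i, j)" using ij Ac X Sc by (auto simp: A_def)
  qed (use Ac in auto)
  have Aq: "v \<bullet> (A *\<^sub>v v) = (X *\<^sub>v v) \<bullet> (X *\<^sub>v v) - real n / 2 * (v \<bullet> (S *\<^sub>v v))" if v: "v \<in> carrier_vec p" for v
  proof -
    have "(real n / 2 \<cdot>\<^sub>m S) *\<^sub>v v = (real n / 2) \<cdot>\<^sub>v (S *\<^sub>v v)"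
      using Sc v by (intro eq_vecI) auto
    then have "A *\<^sub>v v = (transpose_mat X * X) *\<^sub>v v - (real n / 2) \<cdot>\<^sub>v (S *\<^sub>v v)"
      unfolding A_def using X Sc v by (subst minus_mult_distrib_mat_vec[of _ p p]) auto
    then show ?thesis using X Sc v sprod_design_gram[OF X v] by (simp add: scalar_prod_minus_distrib[of _ p])
  qed
  have diag: "A $$ (j, j) \<le> 4 * real n * M1" if j: "j < p" for j
  proof -
    have u: "unit_vec p j \<in> carrier_vec p" by simp
    have "A $$ (j, j) = col X j \<bullet> col X j - real n / 2 * (unit_vec p j \<bullet> (S *\<^sub>v unit_vec p j))"
      using Aq[OF u] quad_form_unit[OF Ac j] colX[OF j] by simp
    also have "\<dots> \<le> (vnorm (col X j))\<^sup>2" using sym_pos_defD(4)[OF S u] by (simp add: vnorm_sq)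
    also have "\<dots> \<le> 4 * real n * M1" by (rule cols[OF j])
    finally show ?thesis .
  qed
  define d where "d j = vnorm (col X j)" for j
  have d: "0 < d j" "real n / (2 * M1) \<le> (d j)\<^sup>2" "(d j)\<^sup>2 \<le> 4 * real n * M1" if "j < p" for j
  proof -
    show "real n / (2 * M1) \<le> (d j)\<^sup>2" "(d j)\<^sup>2 \<le> 4 * real n * M1" using clow[OF that] cols[OF that] by (auto simp: d_def)
    then have "0 < (d j)\<^sup>2" using n M1 by (smt (verit) divide_pos_pos of_nat_0_less_iff)
    then show "0 < d j" by (simp add: d_def order_less_le)
  qed
  define g where "g = vec p (\<lambda>j. h $ j / d j)"
  have g: "g \<in> carrier_vec p" by (simp add: g_def)
  define W where "W = (normalize_cols X *\<^sub>v h) \<bullet> (normalize_cols X *\<^sub>v h)"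
  have Wg: "W = (X *\<^sub>v g) \<bullet> (X *\<^sub>v g)" unfolding W_def normalize_cols_mult[OF X h] g_def d_def by simp
  have hg: "h \<bullet> h \<le> 4 * real n * M1 * (g \<bullet> g)"
  proof -
    have "h \<bullet> h = (\<Sum>j<p. (h $ j)\<^sup>2)" using h by (simp add: scalar_prod_lessThan[of _ p] power2_eq_square)
    also have "\<dots> = (\<Sum>j<p. (d j)\<^sup>2 * (g $ j)\<^sup>2)"
      using d(1) by (intro sum.cong) (force simp: g_def power_divide)+
    also have "\<dots> \<le> (\<Sum>j<p. 4 * real n * M1 * (g $ j)\<^sup>2)" using d(3) by (intro sum_mono mult_right_mono) auto
    also have "\<dots> = 4 * real n * M1 * (g \<bullet> g)" using g by (simp add: scalar_prod_lessThan[of _ p] power2_eq_square sum_distrib_left)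
    finally show ?thesis .
  qed
  \<comment> \<open>Dividing by the column norms, which are at least sqrt (n / (2 M1)), passes from
    the l1 norm of \<open>h\<close> to that of \<open>g\<close>.\<close>
  have l1g: "(l1_norm g)\<^sup>2 \<le> 2 * M1 / real n * (l1_norm h)\<^sup>2"
  proof -
    define r where "r = sqrt (2 * M1 / real n)"
    have r: "0 \<le> r" "r\<^sup>2 = 2 * M1 / real n" using M1 n by (auto simp: r_def)
    have "\<bar>g $ j\<bar> \<le> r * \<bar>h $ j\<bar>" if j: "j < p" for j
    proof -
      have "1 / (d j)\<^sup>2 \<le> 2 * M1 / real n" using d[OF j] n M1 by (simp add: field_simps)
      then have "(1 / d j)\<^sup>2 \<le> r\<^sup>2" by (simp add: r power_divide)
      then have "1 / d j \<le> r" using r(1) by (rule power2_le_imp_le)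
      then have "1 / d j * \<bar>h $ j\<bar> \<le> r * \<bar>h $ j\<bar>" by (rule mult_right_mono) simp
      then show ?thesis using j d(1)[OF j] by (simp add: g_def)
    qed
    then have "l1_norm g \<le> r * l1_norm h" using g h by (auto simp: l1_norm_def sum_distrib_left intro!: sum_mono)
    then have "(l1_norm g)\<^sup>2 \<le> (r * l1_norm h)\<^sup>2" by (rule power_mono) (simp add: l1_norm_def sum_nonneg)
    then show ?thesis by (simp add: power_mult_distrib r)
  qed
  have l1h: "(l1_norm h)\<^sup>2 \<le> 16 * real k * (h \<bullet> h)"
  proof -
    have "finite T" using T finite_subset by blast
    have "l1_norm h = (\<Sum>j\<in>T. \<bar>h $ j\<bar>) + (\<Sum>j\<in>{..<p} - T. \<bar>h $ j\<bar>)"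
      using h sum.subset_diff[OF T(1), of "\<lambda>j. \<bar>h $ j\<bar>"] by (simp add: l1_norm_def)
    then have "l1_norm h \<le> 4 * (\<Sum>j\<in>T. \<bar>h $ j\<bar>)" using cone by simp
    then have "(l1_norm h)\<^sup>2 \<le> (4 * (\<Sum>j\<in>T. \<bar>h $ j\<bar>))\<^sup>2" by (rule power_mono) (simp add: l1_norm_def sum_nonneg)
    also have "\<dots> = 16 * (\<Sum>j\<in>T. \<bar>h $ j\<bar>)\<^sup>2" by (simp add: power_mult_distrib)
    also have "\<dots> \<le> 16 * (real k * (h \<bullet> h))" using sum_abs_le_sqrt_card[OF \<open>finite T\<close> T(2,1) h] by simp
    finally show ?thesis by simp
  qed
  have Q: "- (4 * real n * M1) * (l1_norm g)\<^sup>2 \<le> (real m - 1) * (g \<bullet> (A *\<^sub>v g))"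
    by (rule maurey_lower_bound[OF Ac At g _ m0 diag]) (use low signed_sums_carrier Aq in force)+
  show "h \<bullet> h \<le> 16 * M1\<^sup>2 * ((normalize_cols X *\<^sub>v h) \<bullet> (normalize_cols X *\<^sub>v h))"
  proof (cases "k = 0")
    case True
    then have "l1_norm h = 0" using l1h by simp
    then have "\<forall>j<p. h $ j = 0" using h by (auto simp: l1_norm_def sum_nonneg_eq_0_iff)
    then have "h = 0\<^sub>v p" using h by (intro eq_vecI) auto
    then show ?thesis using sprod_self_nonneg by simp
  next
    case False
    define H where "H = h \<bullet> h"
    have H0: "0 \<le> H" unfolding H_def by (rule sprod_self_nonneg)
    have mm: "2048 * M1 ^ 4 * real k \<le> real m - 1" using m by simp
    have mpos: "0 < real m - 1" using mm False M1 by (smt (verit) mult_pos_pos of_nat_0_less_iff neq0_conv zero_less_power)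
    have "4 * real n * M1 * (l1_norm g)\<^sup>2 \<le> 4 * real n * M1 * (2 * M1 / real n * (16 * real k * H))"
      using l1g l1h M1 n by (intro mult_left_mono order_trans[OF l1g] mult_left_mono) (auto simp: H_def)
    also have "\<dots> = 128 * M1\<^sup>2 * real k * H" using n by (simp add: power2_eq_square)
    finally have "- (128 * M1\<^sup>2 * real k * H) \<le> (real m - 1) * (g \<bullet> (A *\<^sub>v g))"
      using Q unfolding mult_minus_left by (meson neg_le_iff_le order_trans)
    moreover have "128 * M1\<^sup>2 * real k * H \<le> (real m - 1) * (H / (16 * M1\<^sup>2))"
    proof -
      have "128 * M1\<^sup>2 * real k * H = 2048 * M1 ^ 4 * real k * (H / (16 * M1\<^sup>2))"
        using M1 by (simp add: field_simps power2_eq_square power4_eq_xxxx)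
      also have "\<dots> \<le> (real m - 1) * (H / (16 * M1\<^sup>2))" using mm H0 by (intro mult_right_mono) auto
      finally show ?thesis .
    qed
    ultimately have "(real m - 1) * (- (H / (16 * M1\<^sup>2))) \<le> (real m - 1) * (g \<bullet> (A *\<^sub>v g))" by simp
    then have gA: "- (H / (16 * M1\<^sup>2)) \<le> g \<bullet> (A *\<^sub>v g)" using mpos by (simp only: mult_le_cancel_left_pos)
    have "H / (8 * M1\<^sup>2) \<le> real n / 2 * ((g \<bullet> g) / M1)"
      using hg M1 by (simp add: H_def field_simps power2_eq_square)
    also have "\<dots> \<le> real n / 2 * (g \<bullet> (S *\<^sub>v g))" using Slo[OF g] by (intro mult_left_mono) auto
    finally have "H / (8 * M1\<^sup>2) - H / (16 * M1\<^sup>2) \<le> W" using gA Aq[OF g] Wg by simp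
    then have "H / (16 * M1\<^sup>2) \<le> W" by simp
    then show ?thesis using M1 by (simp add: H_def W_def[symmetric] field_simps)
  qed
qed

section \<open>Risk of the square-root Lasso\<close>

lemma sets_model_law [measurable_cong]:
  "sets (model_law n p S \<sigma>) = sets (PiM {..<n} (\<lambda>_. lebesgue_fun p) \<Otimes>\<^sub>M lebesgue_fun n)"
  unfolding model_law_def by (intro sets_pair_measure_cong sets_design_law sets_gaussian_law)

lemma space_model_law: "space (model_law n p S \<sigma>) = space (design_law n p S) \<times> space (gaussian_law n (noise_cov n \<sigma>))"
  unfolding model_law_def by (simp add: space_pair_measure)

lemma measurable_model_fst:
  "f \<in> borel_measurable (PiM {..<n} (\<lambda>_. lebesgue_fun p)) \<Longrightarrow> (\<lambda>\<omega>. f (fst \<omega>)) \<in> borel_measurable (model_law n p S \<sigma>)"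
  using measurable_compose[OF measurable_fst, of f "PiM {..<n} (\<lambda>_. lebesgue_fun p)" borel "lebesgue_fun n"]
  by (simp cong: measurable_cong_sets add: sets_model_law)

lemma measurable_model_snd:
  "f \<in> borel_measurable (lebesgue_fun n) \<Longrightarrow> (\<lambda>\<omega>. f (snd \<omega>)) \<in> borel_measurable (model_law n p S \<sigma>)"
  using measurable_compose[OF measurable_snd, of f "lebesgue_fun n" borel "PiM {..<n} (\<lambda>_. lebesgue_fun p)"]
  by (simp cong: measurable_cong_sets add: sets_model_law)

lemma measurable_model_entry [measurable]:
  "i < n \<Longrightarrow> j < p \<Longrightarrow> (\<lambda>\<omega>. fst \<omega> i j) \<in> borel_measurable (model_law n p S \<sigma>)"
  by (rule measurable_model_fst) (rule measurable_entry)

lemma measurable_model_noise [measurable]: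
  "i < n \<Longrightarrow> (\<lambda>\<omega>. snd \<omega> i) \<in> borel_measurable (model_law n p S \<sigma>)"
  by (rule measurable_model_snd) (rule measurable_coord)

lemma vec_sprod_vec: "vec n f \<bullet> vec n g = (\<Sum>i<n. f i * g i)"
  by (simp add: scalar_prod_lessThan[of _ n])

lemma ennreal_combine_three:
  assumes "0 \<le> a" "0 \<le> b" "0 \<le> c"
  shows "3 * (ennreal a + ennreal b + 4 * ennreal c) = ennreal (3 * (a + b + 4 * c))"
proof -
  have "4 * ennreal c = ennreal (4 * c)" by (simp add: ennreal_mult')
  moreover have "3 * ennreal (a + b + 4 * c) = ennreal (3 * (a + b + 4 * c))" by (subst ennreal_mult') auto
  ultimately show ?thesis using assms by (simp add: ennreal_plus[symmetric] del: ennreal_plus)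
qed

locale gaussian_regression =
  fixes n p :: nat and S :: "real mat" and \<beta> :: "real vec" and \<sigma> :: real
  assumes n1: "1 \<le> n" and S: "S \<in> sym_pos_def p" and \<beta>: "\<beta> \<in> carrier_vec p" and \<sigma>: "0 < \<sigma>"
begin

abbreviation "D \<equiv> design_law n p S"
abbreviation "E \<equiv> gaussian_law n (noise_cov n \<sigma>)"
abbreviation "M \<equiv> model_law n p S \<sigma>"

definition "q = \<beta> \<bullet> (S *\<^sub>v \<beta>)"
definition "V = \<sigma>\<^sup>2 + q"

definition sq_noise :: "(nat \<Rightarrow> real) \<Rightarrow> real" where
  "sq_noise e = (\<Sum>i<n. (e i)\<^sup>2)"

definition signal_noise :: "(nat \<Rightarrow> nat \<Rightarrow> real) \<Rightarrow> (nat \<Rightarrow> real) \<Rightarrow> real" where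
  "signal_noise x e = (\<Sum>i<n. (vec p (x i) \<bullet> \<beta>) * e i)"

definition sq_response :: "(nat \<Rightarrow> nat \<Rightarrow> real) \<Rightarrow> (nat \<Rightarrow> real) \<Rightarrow> real" where
  "sq_response x e = (\<Sum>i<n. (vec p (x i) \<bullet> \<beta> + e i)\<^sup>2)"

sublocale D: prob_space D by (rule prob_space_design_law[OF S])
sublocale E: prob_space E by (rule prob_space_noise[OF \<sigma>])
sublocale DE: pair_prob_space D E ..
sublocale M: prob_space M unfolding model_law_def by (rule DE.prob_space_axioms)

lemma q_nonneg: "0 \<le> q" unfolding q_def by (rule sym_pos_defD(4)[OF S \<beta>])
lemma V_pos: "0 < V" using q_nonneg \<sigma> by (simp add: V_def add_pos_nonneg)
lemma n_pos: "0 < real n" using n1 by simp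
lemma eta_eq: "eta S \<beta> \<sigma> = q / V" by (simp add: eta_def q_def V_def)
lemma eta_eq': "eta S \<beta> \<sigma> = 1 - \<sigma>\<^sup>2 / V" using V_pos by (simp add: eta_eq V_def field_simps)
lemma eta_bounds: "0 \<le> eta S \<beta> \<sigma>" "eta S \<beta> \<sigma> \<le> 1"
  using V_pos q_nonneg \<sigma> by (auto simp: eta_eq V_def)

lemma measurable_model_row [measurable]:
  "i < n \<Longrightarrow> v \<in> carrier_vec p \<Longrightarrow> (\<lambda>\<omega>. vec p (fst \<omega> i) \<bullet> v) \<in> borel_measurable M"
  by (rule measurable_model_fst) (rule measurable_row_form)

lemma measurable_sq_noise: "sq_noise \<in> borel_measurable (lebesgue_fun n)"
  unfolding sq_noise_def by (intro borel_measurable_sum borel_measurable_power measurable_coord) auto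

lemma measurable_sq_response [measurable]: "(\<lambda>\<omega>. sq_response (fst \<omega>) (snd \<omega>)) \<in> borel_measurable M"
  unfolding sq_response_def
  by (intro borel_measurable_sum borel_measurable_power borel_measurable_add measurable_model_row measurable_model_noise \<beta>) auto

lemma measurable_signal_noise [measurable]: "(\<lambda>\<omega>. signal_noise (fst \<omega>) (snd \<omega>)) \<in> borel_measurable M"
  unfolding signal_noise_def
  by (intro borel_measurable_sum borel_measurable_times measurable_model_row measurable_model_noise \<beta>) auto

lemma sq_response_expand: "sq_response x e = energy n p \<beta> x + 2 * signal_noise x e + sq_noise e"
  by (simp add: sq_response_def energy_def signal_noise_def sq_noise_def power2_sum sum.distrib sum_distrib_left mult.assoc)

lemma nn_integral_model:
  assumes "f \<in> borel_measurable M"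
  shows "(\<integral>\<^sup>+\<omega>. f \<omega> \<partial>M) = (\<integral>\<^sup>+x. \<integral>\<^sup>+e. f (x, e) \<partial>E \<partial>D)"
  using assms E.nn_integral_fst[of f D] by (simp add: model_law_def)

lemma nn_integral_model_fst:
  assumes "f \<in> borel_measurable (PiM {..<n} (\<lambda>_. lebesgue_fun p))"
  shows "(\<integral>\<^sup>+\<omega>. f (fst \<omega>) \<partial>M) = (\<integral>\<^sup>+x. f x \<partial>D)"
  by (subst nn_integral_model[OF measurable_model_fst[OF assms]]) (simp add: E.emeasure_space_1)

lemma nn_integral_model_snd:
  assumes "f \<in> borel_measurable (lebesgue_fun n)"
  shows "(\<integral>\<^sup>+\<omega>. f (snd \<omega>) \<partial>M) = (\<integral>\<^sup>+e. f e \<partial>E)"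
  by (subst nn_integral_model[OF measurable_model_snd[OF assms]]) (simp add: D.emeasure_space_1)

lemma noise_deviation: "(\<integral>\<^sup>+\<omega>. ennreal ((sq_noise (snd \<omega>) - real n * \<sigma>\<^sup>2)\<^sup>2) \<partial>M) = ennreal (2 * real n * (\<sigma>\<^sup>2)\<^sup>2)"
proof -
  have "(\<lambda>e. ennreal ((sq_noise e - real n * \<sigma>\<^sup>2)\<^sup>2)) \<in> borel_measurable (lebesgue_fun n)"
    using measurable_sq_noise by measurable
  then have "(\<integral>\<^sup>+\<omega>. ennreal ((sq_noise (snd \<omega>) - real n * \<sigma>\<^sup>2)\<^sup>2) \<partial>M) = (\<integral>\<^sup>+e. ennreal ((sq_noise e - real n * \<sigma>\<^sup>2)\<^sup>2) \<partial>E)"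
    by (rule nn_integral_model_snd)
  then show ?thesis using noise_variance[OF \<sigma>, of n] by (simp add: sq_noise_def vec_sprod_vec power2_eq_square[symmetric])
qed

lemma signal_deviation: "(\<integral>\<^sup>+\<omega>. ennreal ((energy n p \<beta> (fst \<omega>) - real n * q)\<^sup>2) \<partial>M) = ennreal (2 * real n * q\<^sup>2)"
proof -
  have "(\<lambda>x. ennreal ((energy n p \<beta> x - real n * q)\<^sup>2)) \<in> borel_measurable (PiM {..<n} (\<lambda>_. lebesgue_fun p))"
    using measurable_energy[OF \<beta>] by measurable
  then have "(\<integral>\<^sup>+\<omega>. ennreal ((energy n p \<beta> (fst \<omega>) - real n * q)\<^sup>2) \<partial>M) = (\<integral>\<^sup>+x. ennreal ((energy n p \<beta> x - real n * q)\<^sup>2) \<partial>D)"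
    by (rule nn_integral_model_fst)
  then show ?thesis using energy_variance[OF S \<beta>, of n] by (simp add: q_def)
qed

lemma energy_mean:
  assumes v: "v \<in> carrier_vec p"
  shows "(\<integral>\<^sup>+x. ennreal (energy n p v x) \<partial>D) = ennreal (real n * (v \<bullet> (S *\<^sub>v v)))"
proof -
  have row: "(\<integral>\<^sup>+x. ennreal ((vec p (x i) \<bullet> v)\<^sup>2) \<partial>D) = ennreal (v \<bullet> (S *\<^sub>v v))" if i: "i < n" for i
  proof -
    have m: "(\<lambda>y. ennreal ((vec p y \<bullet> v)\<^sup>2)) \<in> borel_measurable (gaussian_law p S)" using v by measurable
    have "(\<integral>\<^sup>+x. ennreal ((vec p (x i) \<bullet> v)\<^sup>2) \<partial>D) = (\<integral>\<^sup>+y. ennreal ((vec p y \<bullet> v)\<^sup>2) \<partial>distr D (gaussian_law p S) (\<lambda>x. x i))"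
      unfolding design_law_def using i m by (subst nn_integral_distr) auto
    also have "distr D (gaussian_law p S) (\<lambda>x. x i) = gaussian_law p S"
      unfolding design_law_def using i by (intro distr_PiM_component prob_space_gaussian_law S) auto
    also have "(\<integral>\<^sup>+y. ennreal ((vec p y \<bullet> v)\<^sup>2) \<partial>gaussian_law p S) = ennreal (v \<bullet> (S *\<^sub>v v))"
      using integrable_gaussian_pow[OF S v, of 2] integral_gaussian_2[OF S v] by (simp add: nn_integral_eq_integral)
    finally show ?thesis .
  qed
  have "(\<integral>\<^sup>+x. ennreal (energy n p v x) \<partial>D) = (\<integral>\<^sup>+x. (\<Sum>i<n. ennreal ((vec p (x i) \<bullet> v)\<^sup>2)) \<partial>D)"
    by (simp add: energy_def)
  also have "\<dots> = (\<Sum>i<n. \<integral>\<^sup>+x. ennreal ((vec p (x i) \<bullet> v)\<^sup>2) \<partial>D)"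
  proof (rule nn_integral_sum)
    fix i assume "i \<in> {..<n}"
    then have "(\<lambda>x. vec p (x i) \<bullet> v) \<in> borel_measurable D"
      using measurable_row_form[of i n v p] v by (simp cong: measurable_cong_sets add: sets_design_law)
    then show "(\<lambda>x. ennreal ((vec p (x i) \<bullet> v)\<^sup>2)) \<in> borel_measurable D" by measurable
  qed
  also have "\<dots> = (\<Sum>i<n. ennreal (v \<bullet> (S *\<^sub>v v)))" using row by (intro sum.cong) auto
  also have "\<dots> = ennreal (real n * (v \<bullet> (S *\<^sub>v v)))"
    using sym_pos_defD(4)[OF S v] by (simp add: ennreal_mult ennreal_of_nat_eq_real_of_nat)
  finally show ?thesis .
qed

text \<open>Given the design, the cross term is linear in the noise with conditional second moment
  \<sigma>^2 times the energy of \<beta>. Integrating over the design leaves the mean energy n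
  q.\<close>

lemma cross_deviation: "(\<integral>\<^sup>+\<omega>. ennreal ((signal_noise (fst \<omega>) (snd \<omega>))\<^sup>2) \<partial>M) = ennreal (real n * q * \<sigma>\<^sup>2)"
proof -
  have "(\<integral>\<^sup>+\<omega>. ennreal ((signal_noise (fst \<omega>) (snd \<omega>))\<^sup>2) \<partial>M) = (\<integral>\<^sup>+x. \<integral>\<^sup>+e. ennreal ((signal_noise x e)\<^sup>2) \<partial>E \<partial>D)"
    by (subst nn_integral_model) auto
  also have "\<dots> = (\<integral>\<^sup>+x. ennreal (\<sigma>\<^sup>2) * ennreal (energy n p \<beta> x) \<partial>D)"
  proof (rule nn_integral_cong)
    fix x
    let ?u = "vec n (\<lambda>i. vec p (x i) \<bullet> \<beta>)"
    have "signal_noise x e = vec n e \<bullet> ?u" for e by (simp add: signal_noise_def vec_sprod_vec mult.commute)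
    moreover have "?u \<bullet> ?u = energy n p \<beta> x" by (simp add: energy_def vec_sprod_vec power2_eq_square)
    ultimately show "(\<integral>\<^sup>+e. ennreal ((signal_noise x e)\<^sup>2) \<partial>E) = ennreal (\<sigma>\<^sup>2) * ennreal (energy n p \<beta> x)"
      using noise_linear_second_moment[OF \<sigma>, of ?u n] by (simp add: ennreal_mult' )
  qed
  also have "\<dots> = ennreal (\<sigma>\<^sup>2) * ennreal (real n * q)"
    using measurable_energy[OF \<beta>, of n] by (subst nn_integral_cmult) (auto simp: energy_mean[OF \<beta>] q_def cong: measurable_cong_sets)
  also have "\<dots> = ennreal (real n * q * \<sigma>\<^sup>2)" by (simp add: ennreal_mult'[symmetric] mult_ac)
  finally show ?thesis .
qed

text \<open>The response energy splits into signal, cross and noise parts with second moments 2 n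
  q^2, n q \<sigma>^2 (entering with factor 4) and 2 n \<sigma>^4, which add up to 2 n V^2. The
  elementary inequality for the square of three terms costs the factor 3 and makes independence of
  the parts unnecessary.\<close>

lemma response_deviation: "(\<integral>\<^sup>+\<omega>. ennreal ((sq_response (fst \<omega>) (snd \<omega>) - real n * V)\<^sup>2) \<partial>M) \<le> ennreal (6 * real n * V\<^sup>2)"
proof -
  define a where "a \<omega> = (energy n p \<beta> (fst \<omega>) - real n * q)\<^sup>2" for \<omega> :: "(nat \<Rightarrow> nat \<Rightarrow> real) \<times> (nat \<Rightarrow> real)"
  define b where "b \<omega> = (sq_noise (snd \<omega>) - real n * \<sigma>\<^sup>2)\<^sup>2" for \<omega> :: "(nat \<Rightarrow> nat \<Rightarrow> real) \<times> (nat \<Rightarrow> real)"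
  define c where "c \<omega> = (signal_noise (fst \<omega>) (snd \<omega>))\<^sup>2" for \<omega>
  have [measurable]: "a \<in> borel_measurable M" "b \<in> borel_measurable M" "c \<in> borel_measurable M"
    using measurable_model_fst[OF measurable_energy[OF \<beta>], of n] measurable_model_snd[OF measurable_sq_noise]
    unfolding a_def b_def c_def by measurable
  have nn: "0 \<le> a \<omega>" "0 \<le> b \<omega>" "0 \<le> c \<omega>" for \<omega> by (auto simp: a_def b_def c_def)
  have three: "(s + 2 * t + r)\<^sup>2 \<le> 3 * (s\<^sup>2 + r\<^sup>2 + 4 * t\<^sup>2)" for s t r :: real
  proof -
    have "3 * (s\<^sup>2 + r\<^sup>2 + 4 * t\<^sup>2) - (s + 2 * t + r)\<^sup>2 = (s - 2 * t)\<^sup>2 + (s - r)\<^sup>2 + (2 * t - r)\<^sup>2"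
      by (simp add: power2_eq_square algebra_simps)
    also have "0 \<le> \<dots>" by simp
    finally show ?thesis by simp
  qed
  have "(sq_response (fst \<omega>) (snd \<omega>) - real n * V)\<^sup>2 \<le> 3 * (a \<omega> + b \<omega> + 4 * c \<omega>)" for \<omega>
    using three[of "energy n p \<beta> (fst \<omega>) - real n * q" "signal_noise (fst \<omega>) (snd \<omega>)" "sq_noise (snd \<omega>) - real n * \<sigma>\<^sup>2"]
    by (simp add: a_def b_def c_def sq_response_expand V_def algebra_simps)
  then have "(\<integral>\<^sup>+\<omega>. ennreal ((sq_response (fst \<omega>) (snd \<omega>) - real n * V)\<^sup>2) \<partial>M)
     \<le> (\<integral>\<^sup>+\<omega>. 3 * (ennreal (a \<omega>) + ennreal (b \<omega>) + 4 * ennreal (c \<omega>)) \<partial>M)"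
  proof (intro nn_integral_mono)
    fix \<omega> assume "\<And>\<omega>. (sq_response (fst \<omega>) (snd \<omega>) - real n * V)\<^sup>2 \<le> 3 * (a \<omega> + b \<omega> + 4 * c \<omega>)"
    then have "ennreal ((sq_response (fst \<omega>) (snd \<omega>) - real n * V)\<^sup>2) \<le> ennreal (3 * (a \<omega> + b \<omega> + 4 * c \<omega>))" by (rule ennreal_leI)
    also have "\<dots> = 3 * (ennreal (a \<omega>) + ennreal (b \<omega>) + 4 * ennreal (c \<omega>))"
      using nn[of \<omega>] by (intro ennreal_combine_three[symmetric])
    finally show "ennreal ((sq_response (fst \<omega>) (snd \<omega>) - real n * V)\<^sup>2) \<le> 3 * (ennreal (a \<omega>) + ennreal (b \<omega>) + 4 * ennreal (c \<omega>))" .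
  qed
  also have "\<dots> = 3 * ((\<integral>\<^sup>+\<omega>. ennreal (a \<omega>) \<partial>M) + (\<integral>\<^sup>+\<omega>. ennreal (b \<omega>) \<partial>M) + 4 * (\<integral>\<^sup>+\<omega>. ennreal (c \<omega>) \<partial>M))"
    by (subst nn_integral_cmult, measurable) (subst nn_integral_add, measurable, subst nn_integral_add, measurable, subst nn_integral_cmult, measurable)
  also have "\<dots> = 3 * (ennreal (2 * real n * q\<^sup>2) + ennreal (2 * real n * (\<sigma>\<^sup>2)\<^sup>2) + 4 * ennreal (real n * q * \<sigma>\<^sup>2))"
    unfolding a_def b_def c_def signal_deviation noise_deviation cross_deviation ..
  also have "\<dots> = ennreal (3 * (2 * real n * q\<^sup>2 + 2 * real n * (\<sigma>\<^sup>2)\<^sup>2 + 4 * (real n * q * \<sigma>\<^sup>2)))"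
    using q_nonneg by (intro ennreal_combine_three) auto
  also have "3 * (2 * real n * q\<^sup>2 + 2 * real n * (\<sigma>\<^sup>2)\<^sup>2 + 4 * (real n * q * \<sigma>\<^sup>2)) = 6 * real n * V\<^sup>2"
    by (simp add: V_def power2_eq_square algebra_simps)
  finally show ?thesis .
qed

text \<open>Squared relative deviations have a double use: below 1/4 they confine a quantity to
  within half of its mean, and above 1/4 four times the deviation already exceeds the trivial loss
  bound 1.\<close>

definition "rel_noise \<omega> = (sq_noise (snd \<omega>) - real n * \<sigma>\<^sup>2)\<^sup>2 / (real n * \<sigma>\<^sup>2)\<^sup>2"
  for \<omega> :: "(nat \<Rightarrow> nat \<Rightarrow> real) \<times> (nat \<Rightarrow> real)"

definition "rel_response \<omega> = (sq_response (fst \<omega>) (snd \<omega>) - real n * V)\<^sup>2 / (real n * V)\<^sup>2"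

lemma rel_measurable [measurable]: "rel_noise \<in> borel_measurable M" "rel_response \<in> borel_measurable M"
  using measurable_model_snd[OF measurable_sq_noise] unfolding rel_noise_def rel_response_def by measurable

lemma rel_nonneg: "0 \<le> rel_noise \<omega>" "0 \<le> rel_response \<omega>" by (auto simp: rel_noise_def rel_response_def)

lemma rel_noise_mean: "(\<integral>\<^sup>+\<omega>. ennreal (rel_noise \<omega>) \<partial>M) \<le> ennreal (2 / real n)"
proof -
  have "(\<integral>\<^sup>+\<omega>. ennreal (rel_noise \<omega>) \<partial>M)
     = (\<integral>\<^sup>+\<omega>. ennreal (1 / (real n * \<sigma>\<^sup>2)\<^sup>2) * ennreal ((sq_noise (snd \<omega>) - real n * \<sigma>\<^sup>2)\<^sup>2) \<partial>M)"
    by (intro nn_integral_cong) (simp add: rel_noise_def ennreal_mult'[symmetric])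
  also have "\<dots> = ennreal (1 / (real n * \<sigma>\<^sup>2)\<^sup>2) * ennreal (2 * real n * (\<sigma>\<^sup>2)\<^sup>2)"
    using measurable_model_snd[OF measurable_sq_noise] by (subst nn_integral_cmult) (auto simp: noise_deviation)
  also have "\<dots> = ennreal (2 / real n)"
    using n_pos \<sigma> by (simp add: ennreal_mult'[symmetric] power2_eq_square)
  finally show ?thesis by simp
qed

lemma rel_response_mean: "(\<integral>\<^sup>+\<omega>. ennreal (rel_response \<omega>) \<partial>M) \<le> ennreal (6 / real n)"
proof -
  have "(\<integral>\<^sup>+\<omega>. ennreal (rel_response \<omega>) \<partial>M)
     = (\<integral>\<^sup>+\<omega>. ennreal (1 / (real n * V)\<^sup>2) * ennreal ((sq_response (fst \<omega>) (snd \<omega>) - real n * V)\<^sup>2) \<partial>M)"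
    by (intro nn_integral_cong) (simp add: rel_response_def ennreal_mult'[symmetric])
  also have "\<dots> = ennreal (1 / (real n * V)\<^sup>2) * (\<integral>\<^sup>+\<omega>. ennreal ((sq_response (fst \<omega>) (snd \<omega>) - real n * V)\<^sup>2) \<partial>M)"
    by (subst nn_integral_cmult) auto
  also have "\<dots> \<le> ennreal (1 / (real n * V)\<^sup>2) * ennreal (6 * real n * V\<^sup>2)"
    by (intro mult_left_mono response_deviation) simp
  also have "\<dots> = ennreal (6 / real n)"
    using n_pos V_pos by (simp add: ennreal_mult'[symmetric] power2_eq_square)
  finally show ?thesis .
qed

text \<open>Both energies lie within a factor of their means, so the denominator of the ratio is at
  least n V / 2. The error of the ratio is linear in the two deviations, with weights at most 1
  because \<sigma>^2 \<le> V; squaring the sum gives 2, and the squared denominator gives 4.\<close>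

lemma deviation_small:
  assumes "4 * rel_noise (x, e) < 1" "4 * rel_response (x, e) < 1"
  shows "real n * \<sigma>\<^sup>2 / 2 < sq_noise e" "sq_noise e < 3 / 2 * (real n * \<sigma>\<^sup>2)" "real n * V / 2 < sq_response x e"
    and "sq_noise e \<le> 3 * sq_response x e"
    and "(sq_noise e / sq_response x e - \<sigma>\<^sup>2 / V)\<^sup>2 \<le> 8 * rel_noise (x, e) + 8 * rel_response (x, e)"
proof -
  have half: "\<bar>y\<bar> < a / 2" if "4 * (y\<^sup>2 / a\<^sup>2) < 1" "0 < a" for y a :: real
  proof -
    have "y\<^sup>2 < (a / 2)\<^sup>2" using that by (simp add: field_simps power_divide)
    then show ?thesis using that(2) by (metis abs_le_square_iff abs_of_pos half_gt_zero linorder_not_less)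
  qed
  have ns: "0 < real n * \<sigma>\<^sup>2" and nV: "0 < real n * V" using n_pos \<sigma> V_pos by auto
  have 1: "\<bar>sq_noise e - real n * \<sigma>\<^sup>2\<bar> < real n * \<sigma>\<^sup>2 / 2" using half[OF _ ns] assms(1) by (simp add: rel_noise_def)
  have 2: "\<bar>sq_response x e - real n * V\<bar> < real n * V / 2" using half[OF _ nV] assms(2) by (simp add: rel_response_def)
  show a: "real n * \<sigma>\<^sup>2 / 2 < sq_noise e" and b: "sq_noise e < 3 / 2 * (real n * \<sigma>\<^sup>2)" using 1 unfolding abs_diff_less_iff by auto
  show c: "real n * V / 2 < sq_response x e" using 2 unfolding abs_diff_less_iff by auto
  have sV: "\<sigma>\<^sup>2 \<le> V" using q_nonneg by (simp add: V_def)
  then have nsV: "real n * \<sigma>\<^sup>2 \<le> real n * V" by (simp add: mult_left_mono)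
  show "sq_noise e \<le> 3 * sq_response x e" using b c nsV by simp
  define N R where "N = sq_noise e - real n * \<sigma>\<^sup>2" and "R = real n * V - sq_response x e"
  have Rpos: "0 < sq_response x e" using c nV by simp
  have eq: "sq_noise e / sq_response x e - \<sigma>\<^sup>2 / V = (N + \<sigma>\<^sup>2 / V * R) / sq_response x e"
    using Rpos V_pos by (simp add: N_def R_def field_simps)
  have "(N + \<sigma>\<^sup>2 / V * R)\<^sup>2 \<le> 2 * N\<^sup>2 + 2 * (\<sigma>\<^sup>2 / V * R)\<^sup>2"
  proof -
    have "2 * N\<^sup>2 + 2 * (\<sigma>\<^sup>2 / V * R)\<^sup>2 - (N + \<sigma>\<^sup>2 / V * R)\<^sup>2 = (N - \<sigma>\<^sup>2 / V * R)\<^sup>2"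
      by (simp add: power2_eq_square algebra_simps)
    also have "0 \<le> \<dots>" by simp
    finally show ?thesis by simp
  qed
  also have "(\<sigma>\<^sup>2 / V * R)\<^sup>2 \<le> 1 * R\<^sup>2"
    unfolding power_mult_distrib using sV V_pos by (intro mult_right_mono power_le_one) auto
  finally have num: "(N + \<sigma>\<^sup>2 / V * R)\<^sup>2 \<le> 2 * N\<^sup>2 + 2 * R\<^sup>2" by simp
  have den: "(real n * V)\<^sup>2 / 4 \<le> (sq_response x e)\<^sup>2"
    using power_mono[of "real n * V / 2" "sq_response x e" 2] c nV by (simp add: power_divide)
  have "(sq_noise e / sq_response x e - \<sigma>\<^sup>2 / V)\<^sup>2 = (N + \<sigma>\<^sup>2 / V * R)\<^sup>2 / (sq_response x e)\<^sup>2" by (simp add: eq power_divide)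
  also have "\<dots> \<le> (2 * N\<^sup>2 + 2 * R\<^sup>2) / ((real n * V)\<^sup>2 / 4)"
    using num den nV Rpos n1 by (intro frac_le) auto
  also have "\<dots> = 8 * (N\<^sup>2 / (real n * V)\<^sup>2) + 8 * (R\<^sup>2 / (real n * V)\<^sup>2)" by (simp add: add_divide_distrib)
  also have "N\<^sup>2 / (real n * V)\<^sup>2 \<le> N\<^sup>2 / (real n * \<sigma>\<^sup>2)\<^sup>2"
    using nsV ns nV n1 V_pos \<sigma> by (intro divide_left_mono power_mono mult_pos_pos zero_less_power) auto
  finally show "(sq_noise e / sq_response x e - \<sigma>\<^sup>2 / V)\<^sup>2 \<le> 8 * rel_noise (x, e) + 8 * rel_response (x, e)"
    by (simp add: rel_noise_def rel_response_def N_def R_def power2_commute)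
qed

lemma response_vec: "response n p \<beta> x e = vec n (\<lambda>i. vec p (x i) \<bullet> \<beta> + e i)"
  unfolding response_def using \<beta> design_mult_index[OF \<beta>]
  by (intro eq_vecI) (auto simp: design_def simp del: index_mult_mat_vec)

lemma response_carrier: "response n p \<beta> x e \<in> carrier_vec n"
  by (simp add: response_vec)

lemma vnorm_response: "(vnorm (response n p \<beta> x e))\<^sup>2 = sq_response x e"
  unfolding vnorm_sq response_vec by (simp add: vec_sprod_vec sq_response_def power2_eq_square)

lemma vnorm_noise: "(vnorm (vec n e))\<^sup>2 = sq_noise e"
  unfolding vnorm_sq by (simp add: vec_sprod_vec sq_noise_def power2_eq_square)

end

section \<open>Bad events and risk of the Lasso estimator\<close>

lemma exp_minus_le_inverse: "0 < u \<Longrightarrow> exp (- u) \<le> 1 / (u :: real)"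
proof -
  assume u: "0 < u"
  have "u \<le> exp u" using exp_ge_add_one_self[of u] by (rule order_trans[rotated]) simp
  then show ?thesis using u by (simp add: exp_minus field_simps)
qed

lemma is_arg_min_le: "is_arg_min f P x \<Longrightarrow> P y \<Longrightarrow> f x \<le> (f y :: real)"
  by (auto simp: is_arg_min_def not_less)

text \<open>Comparison with the coefficient vector 0; the penalty is nonnegative because
  \<open>1 \<le> p\<close> makes the logarithm nonnegative.\<close>

lemma sqrt_lasso_residual_le:
  assumes X: "X \<in> carrier_mat n p" and Y: "Y \<in> carrier_vec n" and p: "1 \<le> p"
    and b: "is_arg_min (sqrt_lasso_obj X Y) (\<lambda>b. b \<in> carrier_vec p) b"
  shows "vnorm (Y - normalize_cols X *\<^sub>v b) \<le> vnorm Y"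
proof -
  have W: "normalize_cols X \<in> carrier_mat n p" by (rule normalize_cols_carrier[OF X])
  have "vnorm (Y - normalize_cols X *\<^sub>v b) \<le> sqrt_lasso_obj X Y b"
    using p X by (simp add: sqrt_lasso_obj_def l1_norm_def sum_nonneg)
  also have "\<dots> \<le> sqrt_lasso_obj X Y (0\<^sub>v p)" by (rule is_arg_min_le[OF b]) simp
  also have "\<dots> = vnorm Y"
  proof -
    have "normalize_cols X *\<^sub>v 0\<^sub>v p = 0\<^sub>v n" using W by auto
    then show ?thesis using Y by (simp add: sqrt_lasso_obj_def l1_norm_def)
  qed
  finally show ?thesis .
qed

lemma eta_SL_bounds:
  assumes "X \<in> carrier_mat n p" "Y \<in> carrier_vec n" "1 \<le> p"
    and "is_arg_min (sqrt_lasso_obj X Y) (\<lambda>b. b \<in> carrier_vec p) b"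
  shows "0 \<le> eta_SL X Y b" "eta_SL X Y b \<le> 1"
proof -
  have "(vnorm (Y - normalize_cols X *\<^sub>v b))\<^sup>2 \<le> (vnorm Y)\<^sup>2"
    by (intro power_mono sqrt_lasso_residual_le[OF assms]) simp
  then have "(vnorm (Y - normalize_cols X *\<^sub>v b))\<^sup>2 / (vnorm Y)\<^sup>2 \<le> 1"
    by (cases "vnorm Y = 0") (auto simp: divide_le_eq_1)
  then show "0 \<le> eta_SL X Y b" "eta_SL X Y b \<le> 1" by (auto simp: eta_SL_def)
qed

lemma sq_diff_le_1:
  fixes a b :: real
  assumes "0 \<le> a" "a \<le> 1" "0 \<le> b" "b \<le> 1"
  shows "(a - b)\<^sup>2 \<le> 1"
proof -
  have "\<bar>a - b\<bar> \<le> 1" using assms by (auto simp: abs_le_iff)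
  then show ?thesis by (simp add: abs_square_le_1)
qed

locale regression_model = gaussian_regression +
  fixes M1 :: real
  assumes M1: "0 < M1"
    and quad_ge: "\<And>v. v \<in> carrier_vec p \<Longrightarrow> (v \<bullet> v) / M1 \<le> v \<bullet> (S *\<^sub>v v)"
    and quad_le: "\<And>v. v \<in> carrier_vec p \<Longrightarrow> v \<bullet> (S *\<^sub>v v) \<le> M1 * (v \<bullet> v)"
begin

definition "sparse_bad m = {x \<in> space D. \<exists>v\<in>signed_sums p m. energy n p v x < real n / 2 * (v \<bullet> (S *\<^sub>v v))}"

definition "column_bad = {x \<in> space D. \<exists>j\<in>{..<p}. 4 * real n * (unit_vec p j \<bullet> (S *\<^sub>v unit_vec p j)) < energy n p (unit_vec p j) x}"

definition "correlation_bad = {\<omega> \<in> space M. \<exists>j\<in>{..<p}.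
   (\<Sum>i<n. (fst \<omega> i j)\<^sup>2) * (4 * ln (real p)) * \<sigma>\<^sup>2 < (\<Sum>i<n. snd \<omega> i * fst \<omega> i j)\<^sup>2}"

lemma energy_set_sets:
  assumes "v \<in> carrier_vec p"
  shows "{x \<in> space D. energy n p v x < c} \<in> sets D" "{x \<in> space D. c < energy n p v x} \<in> sets D"
proof -
  have "energy n p v \<in> borel_measurable D"
    using measurable_energy[OF assms, of n] by (simp cong: measurable_cong_sets add: sets_design_law)
  then show "{x \<in> space D. energy n p v x < c} \<in> sets D" "{x \<in> space D. c < energy n p v x} \<in> sets D" by measurable
qed

lemma sparse_bad_prob:
  shows "sparse_bad m \<in> sets D" "emeasure D (sparse_bad m) \<le> ennreal (real ((2 * p) ^ m) * exp (- real n / 12))"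
proof -
  define F where "F v = {x \<in> space D. energy n p v x < real n * (v \<bullet> (S *\<^sub>v v)) / 2}" for v
  have F: "F v \<in> sets D" if "v \<in> signed_sums p m" for v
    unfolding F_def by (rule energy_set_sets(1)[OF signed_sums_carrier[OF that]])
  have un: "sparse_bad m = (\<Union>v\<in>signed_sums p m. F v)" by (auto simp: sparse_bad_def F_def)
  show "sparse_bad m \<in> sets D" unfolding un using F finite_signed_sums by (intro sets.finite_UN) auto
  have each: "emeasure D (F v) \<le> ennreal (exp (- real n / 12))" if v: "v \<in> signed_sums p m" for v
  \<comment> \<open>Signed sums may cancel to 0, where the chi-square tail bound does not apply; the
    event is then empty because an energy is never negative.\<close>
  proof (cases "v = 0\<^sub>v p")
    case True
    have "S *\<^sub>v 0\<^sub>v p = 0\<^sub>v p" using sym_pos_defD(1)[OF S] by auto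
    then have "F v = {}" unfolding F_def True using energy_nonneg[of n p "0\<^sub>v p"] by (auto simp: not_less)
    then show ?thesis by simp
  next
    case False
    then show ?thesis unfolding F_def by (rule energy_lower_tail[OF S signed_sums_carrier[OF v]])
  qed
  have "emeasure D (sparse_bad m) \<le> (\<Sum>v\<in>signed_sums p m. emeasure D (F v))"
    unfolding un using F by (intro emeasure_subadditive_finite finite_signed_sums) auto
  also have "\<dots> \<le> (\<Sum>v\<in>signed_sums p m. ennreal (exp (- real n / 12)))" by (intro sum_mono each)
  also have "\<dots> = ennreal (real (card (signed_sums p m)) * exp (- real n / 12))"
    by (simp add: ennreal_mult ennreal_of_nat_eq_real_of_nat)
  also have "\<dots> \<le> ennreal (real ((2 * p) ^ m) * exp (- real n / 12))"
    using card_signed_sums[of p m] by (intro ennreal_leI mult_right_mono) (simp_all only: of_nat_le_iff exp_ge_zero)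
  finally show "emeasure D (sparse_bad m) \<le> ennreal (real ((2 * p) ^ m) * exp (- real n / 12))" .
qed

lemma column_bad_prob:
  shows "column_bad \<in> sets D" "emeasure D column_bad \<le> ennreal (real p * exp (- real n / 2))"
proof -
  define F where "F j = {x \<in> space D. 4 * real n * (unit_vec p j \<bullet> (S *\<^sub>v unit_vec p j)) < energy n p (unit_vec p j) x}" for j
  have F: "F j \<in> sets D" for j unfolding F_def by (rule energy_set_sets(2)) simp
  have un: "column_bad = (\<Union>j\<in>{..<p}. F j)" by (auto simp: column_bad_def F_def)
  show "column_bad \<in> sets D" unfolding un using F by (intro sets.finite_UN) auto
  have each: "emeasure D (F j) \<le> ennreal (exp (- real n / 2))" if j: "j < p" for j
  proof -
    have "unit_vec p j \<noteq> (0\<^sub>v p :: real vec)" using j by (metis index_unit_vec(2) index_zero_vec(1) zero_neq_one)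
    then show ?thesis unfolding F_def by (intro energy_upper_tail[OF S]) auto
  qed
  have "emeasure D column_bad \<le> (\<Sum>j<p. emeasure D (F j))"
    unfolding un using F by (intro emeasure_subadditive_finite) auto
  also have "\<dots> \<le> (\<Sum>j<p. ennreal (exp (- real n / 2)))" by (intro sum_mono each) auto
  also have "\<dots> = ennreal (real p * exp (- real n / 2))"
    by (simp add: ennreal_mult ennreal_of_nat_eq_real_of_nat)
  finally show "emeasure D column_bad \<le> ennreal (real p * exp (- real n / 2))" .
qed

text \<open>Given the design, every column correlation is a Gaussian linear form in the noise. The
  level s^2 = 4 ln p gives 2 / p^2 per column, hence 2 / p after the union bound.\<close>

lemma correlation_bad_prob:
  assumes p: "1 \<le> p"
  shows "correlation_bad \<in> sets M" "emeasure M correlation_bad \<le> ennreal (2 / real p)"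
proof -
  define F where "F j = {\<omega> \<in> space M. (\<Sum>i<n. (fst \<omega> i j)\<^sup>2) * (4 * ln (real p)) * \<sigma>\<^sup>2 < (\<Sum>i<n. snd \<omega> i * fst \<omega> i j)\<^sup>2}" for j
  have F: "F j \<in> sets M" if j: "j < p" for j
  proof -
    have [measurable]: "(\<lambda>\<omega>. \<Sum>i<n. (fst \<omega> i j)\<^sup>2) \<in> borel_measurable M" "(\<lambda>\<omega>. \<Sum>i<n. snd \<omega> i * fst \<omega> i j) \<in> borel_measurable M"
      using j by (auto intro!: borel_measurable_sum borel_measurable_power borel_measurable_times measurable_model_entry measurable_model_noise)
    show ?thesis unfolding F_def by measurable
  qed
  have un: "correlation_bad = (\<Union>j\<in>{..<p}. F j)" by (auto simp: correlation_bad_def F_def)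
  show "correlation_bad \<in> sets M" unfolding un using F by (intro sets.finite_UN) auto
  define s where "s = 2 * sqrt (ln (real p))"
  have lnp: "0 \<le> ln (real p)" using p by simp
  have s: "0 \<le> s" "s\<^sup>2 = 4 * ln (real p)" using lnp by (auto simp: s_def power_mult_distrib)
  have ex: "exp (- s\<^sup>2 / 2) = 1 / (real p)\<^sup>2"
  proof -
    have "- s\<^sup>2 / 2 = - (ln (real p) + ln (real p))" using s by simp
    then show ?thesis using p by (simp only: exp_minus exp_add) (simp add: power2_eq_square inverse_eq_divide)
  qed
  have each: "emeasure M (F j) \<le> ennreal (2 / (real p)\<^sup>2)" if j: "j < p" for j
  proof -
    have "emeasure M (F j) = (\<integral>\<^sup>+x. emeasure E (Pair x -` F j) \<partial>D)"
      using F[OF j] unfolding model_law_def by (rule E.emeasure_pair_measure_alt)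
    also have "\<dots> \<le> (\<integral>\<^sup>+x. ennreal (2 / (real p)\<^sup>2) \<partial>D)"
    proof (rule nn_integral_mono)
      fix x assume x: "x \<in> space D"
      define u where "u = vec n (\<lambda>i. x i j)"
      have u: "u \<in> carrier_vec n" by (simp add: u_def)
      have "u \<bullet> u = (\<Sum>i<n. (x i j)\<^sup>2)" by (simp add: u_def vec_sprod_vec power2_eq_square)
      moreover have "vec n e \<bullet> u = (\<Sum>i<n. e i * x i j)" for e by (simp add: u_def vec_sprod_vec)
      ultimately have "Pair x -` F j = {e \<in> space E. (u \<bullet> u) * s\<^sup>2 * \<sigma>\<^sup>2 < (vec n e \<bullet> u)\<^sup>2}"
        using x by (auto simp: F_def space_model_law s)
      then show "emeasure E (Pair x -` F j) \<le> ennreal (2 / (real p)\<^sup>2)"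
        using noise_linear_tail[OF \<sigma> u s(1)] by (simp only: ex times_divide_eq_right mult_1_right)
    qed
    also have "\<dots> = ennreal (2 / (real p)\<^sup>2)" by (simp add: D.emeasure_space_1)
    finally show ?thesis .
  qed
  have "emeasure M correlation_bad \<le> (\<Sum>j<p. emeasure M (F j))"
    unfolding un using F by (intro emeasure_subadditive_finite) auto
  also have "\<dots> \<le> (\<Sum>j<p. ennreal (2 / (real p)\<^sup>2))" by (intro sum_mono each) auto
  also have "\<dots> = ennreal (real p * (2 / (real p)\<^sup>2))"
    by (simp only: sum_constant card_lessThan ennreal_mult' ennreal_of_nat_eq_real_of_nat of_nat_0_le_iff)
  also have "real p * (2 / (real p)\<^sup>2) = 2 / real p" by (simp add: power2_eq_square)
  finally show "emeasure M correlation_bad \<le> ennreal (2 / real p)" .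
qed

text \<open>The error is split at the true noise energy: the Lasso residual against the noise, and
  the noise ratio against \<sigma>^2 / V. The constant is 259584 = 12 times 169 times 16 times 8:
  from \<open>sqrt_lasso_error\<close>, the squared penalty level 13, the restricted eigenvalue, and
  (R + |\<epsilon>|)^2 \<le> 8 |Y|^2.\<close>

lemma sqrt_lasso_good:
  assumes p: "2 \<le> p" and k: "nnz \<beta> \<le> k" and m: "2048 * M1 ^ 4 * real k + 1 \<le> real m"
    and b: "is_arg_min (sqrt_lasso_obj (design n p x) (response n p \<beta> x e)) (\<lambda>b. b \<in> carrier_vec p) b"
    and sp: "x \<in> space D" "e \<in> space E"
    and good: "x \<notin> sparse_bad m" "x \<notin> column_bad" "(x, e) \<notin> correlation_bad"
    and u: "4 * rel_noise (x, e) < 1" "4 * rel_response (x, e) < 1"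
  shows "(eta_SL (design n p x) (response n p \<beta> x e) b - eta S \<beta> \<sigma>)\<^sup>2
    \<le> 2 * (259584 * M1\<^sup>2 * (real k * ln (real p) / real n))\<^sup>2 + 2 * (8 * rel_noise (x, e) + 8 * rel_response (x, e))"
proof -
  define X where "X = design n p x"
  define Y where "Y = response n p \<beta> x e"
  define \<epsilon> where "\<epsilon> = vec n e"
  define W where "W = normalize_cols X"
  define d where "d j = vnorm (col X j)" for j
  define lam where "lam = 13 * sqrt (ln (real p)) / sqrt (real n)"
  note dev = deviation_small[OF u]
  have X: "X \<in> carrier_mat n p" and \<epsilon>: "\<epsilon> \<in> carrier_vec n" and Y: "Y \<in> carrier_vec n"
    by (auto simp: X_def \<epsilon>_def Y_def response_carrier)
  have W: "W \<in> carrier_mat n p" unfolding W_def by (rule normalize_cols_carrier[OF X])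
  have lnp: "0 < ln (real p)" using p by simp
  have lam: "0 < lam" using lnp n_pos by (simp add: lam_def)
  have lam2: "lam\<^sup>2 = 169 * ln (real p) / real n" using lnp n_pos by (simp add: lam_def power_divide power_mult_distrib)
  have colX: "col X j = vec n (\<lambda>i. x i j)" if "j < p" for j using that by (intro eq_vecI) (auto simp: X_def design_def)
  have d2: "(d j)\<^sup>2 = (\<Sum>i<n. (x i j)\<^sup>2)" if "j < p" for j
    unfolding d_def vnorm_sq colX[OF that] by (simp add: vec_sprod_vec power2_eq_square)
  have d2e: "(d j)\<^sup>2 = energy n p (unit_vec p j) x" if "j < p" for j
    using that by (simp add: d2 energy_def scalar_prod_right_unit)
  have low: "real n / 2 * (v \<bullet> (S *\<^sub>v v)) \<le> (X *\<^sub>v v) \<bullet> (X *\<^sub>v v)" if v: "v \<in> signed_sums p m" for v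
    using good(1) v sp design_mult_sq[OF signed_sums_carrier[OF v], of n x]
    by (auto simp: sparse_bad_def X_def energy_def not_less)
  have cols: "(vnorm (col X j))\<^sup>2 \<le> 4 * real n * M1" if j: "j < p" for j
  proof -
    have "(vnorm (col X j))\<^sup>2 \<le> 4 * real n * (unit_vec p j \<bullet> (S *\<^sub>v unit_vec p j))"
      using good(2) sp j d2e[OF j] by (auto simp: column_bad_def d_def not_less)
    also have "\<dots> \<le> 4 * real n * (M1 * (unit_vec p j \<bullet> unit_vec p j))" by (intro mult_left_mono quad_le) auto
    finally show ?thesis using j by simp
  qed
  have re: "h \<bullet> h \<le> 16 * M1\<^sup>2 * ((W *\<^sub>v h) \<bullet> (W *\<^sub>v h))"
    and dlow: "j < p \<Longrightarrow> real n / (2 * M1) \<le> (d j)\<^sup>2"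
    if "T \<subseteq> {..<p}" "card T \<le> k" "h \<in> carrier_vec p" "(\<Sum>j\<in>{..<p} - T. \<bar>h $ j\<bar>) \<le> 3 * (\<Sum>j\<in>T. \<bar>h $ j\<bar>)" for h T j
    using restricted_eigenvalue[OF X _ S M1 quad_ge low cols m that] n1 unfolding W_def d_def by auto
  have dpos: "0 < d j" if "j < p" for j
  proof -
    \<comment> \<open>The column bound carries the cone assumption of its source; the empty support
      and the zero vector satisfy it.\<close>
    have "real n / (2 * M1) \<le> (d j)\<^sup>2" by (rule dlow[of "{}" "0\<^sub>v p"]) (use that in auto)
    then have "0 < (d j)\<^sup>2" using n_pos M1 by (smt (verit) divide_pos_pos)
    then show ?thesis by (simp add: d_def order_less_le)
  qed
  \<comment> \<open>In the normalised design the coefficients are multiplied by the column norms;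
    signal and sparsity are unchanged.\<close>
  define b0 where "b0 = vec p (\<lambda>j. d j * \<beta> $ j)"
  have b0: "b0 \<in> carrier_vec p" by (simp add: b0_def)
  have Wb0: "W *\<^sub>v b0 = X *\<^sub>v \<beta>"
  proof -
    have "vec p (\<lambda>j. b0 $ j / vnorm (col X j)) = \<beta>"
    proof (rule eq_vecI)
      fix j assume "j < dim_vec \<beta>"
      then have "j < p" using \<beta> by simp
      then show "vec p (\<lambda>j. b0 $ j / vnorm (col X j)) $ j = \<beta> $ j"
        using dpos[of j] by (simp add: b0_def d_def)
    qed (use \<beta> in simp)
    then show ?thesis unfolding W_def normalize_cols_mult[OF X b0] by simp
  qed
  have YW: "Y = W *\<^sub>v b0 + \<epsilon>" by (simp add: Y_def response_def Wb0 X_def \<epsilon>_def)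
  define T where "T = {j. j < p \<and> b0 $ j \<noteq> 0}"
  have T: "card T \<le> k" "T \<subseteq> {..<p}"
  proof -
    have "T \<subseteq> {j. j < dim_vec \<beta> \<and> \<beta> $ j \<noteq> 0}" using \<beta> by (auto simp: T_def b0_def)
    then have "card T \<le> nnz \<beta>" unfolding nnz_def by (intro card_mono) auto
    then show "card T \<le> k" using k by simp
  qed (auto simp: T_def)
  have bc: "b \<in> carrier_vec p" using b by (simp add: is_arg_min_def)
  have opt: "vnorm (Y - W *\<^sub>v b) + lam * l1_norm b \<le> vnorm (Y - W *\<^sub>v b0) + lam * l1_norm b0"
    using is_arg_min_le[OF b b0] X by (simp add: sqrt_lasso_obj_def X_def[symmetric] Y_def[symmetric] W_def lam_def)
  have e2: "(vnorm \<epsilon>)\<^sup>2 = sq_noise e" unfolding \<epsilon>_def by (rule vnorm_noise)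
  have Y2: "(vnorm Y)\<^sup>2 = sq_response x e" unfolding Y_def by (rule vnorm_response)
  have ns: "0 < real n * \<sigma>\<^sup>2" using n_pos \<sigma> by simp
  have epos: "0 < vnorm \<epsilon>"
  proof -
    have "0 < (vnorm \<epsilon>)\<^sup>2" using dev(1) ns unfolding e2 by simp
    then show ?thesis using vnorm_nonneg[of \<epsilon>] by (simp add: order_less_le)
  qed
  have corr: "\<bar>col W j \<bullet> \<epsilon>\<bar> \<le> lam / 2 * vnorm \<epsilon>" if j: "j < p" for j
  proof -
    have "col X j \<bullet> \<epsilon> = (\<Sum>i<n. e i * x i j)" unfolding colX[OF j] \<epsilon>_def by (simp add: vec_sprod_vec mult.commute)
    then have "(col X j \<bullet> \<epsilon>)\<^sup>2 \<le> (d j)\<^sup>2 * (4 * ln (real p)) * \<sigma>\<^sup>2"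
      using good(3) sp j d2[OF j] by (auto simp: correlation_bad_def space_model_law not_less)
    also have "\<dots> = (d j)\<^sup>2 * (4 * ln (real p) * \<sigma>\<^sup>2)" by simp
    also have "\<dots> \<le> (d j)\<^sup>2 * ((lam / 2)\<^sup>2 * (vnorm \<epsilon>)\<^sup>2)"
    proof (rule mult_left_mono)
      \<comment> \<open>Here the penalty level 13 suffices: the noise energy is only known to exceed
        n \<sigma>^2 / 2, and 169 / 8 still exceeds 4.\<close>
      have "4 * ln (real p) * \<sigma>\<^sup>2 \<le> 169 / 8 * ln (real p) * \<sigma>\<^sup>2" using lnp by (intro mult_right_mono) auto
      also have "\<dots> = (lam / 2)\<^sup>2 * (real n * \<sigma>\<^sup>2 / 2)" using n_pos by (simp add: power_divide lam2)
      also have "\<dots> \<le> (lam / 2)\<^sup>2 * (vnorm \<epsilon>)\<^sup>2" unfolding e2 using dev(1) by (intro mult_left_mono) auto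
      finally show "4 * ln (real p) * \<sigma>\<^sup>2 \<le> (lam / 2)\<^sup>2 * (vnorm \<epsilon>)\<^sup>2" .
    qed simp
    finally have "\<bar>col X j \<bullet> \<epsilon>\<bar>\<^sup>2 \<le> (d j * (lam / 2 * vnorm \<epsilon>))\<^sup>2" by (simp only: power_mult_distrib power2_abs)
    then have "\<bar>col X j \<bullet> \<epsilon>\<bar> \<le> d j * (lam / 2 * vnorm \<epsilon>)"
      by (rule power2_le_imp_le) (use dpos[OF j] lam in auto)
    moreover have "col W j \<bullet> \<epsilon> = (col X j \<bullet> \<epsilon>) / d j"
      unfolding W_def col_normalize_cols[OF X j] using X \<epsilon> by (simp add: d_def)
    ultimately show ?thesis using dpos[OF j] by (simp add: abs_div_pos[symmetric] divide_le_eq mult.commute)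
  qed
  define R where "R = vnorm (Y - W *\<^sub>v b)"
  have err: "\<bar>R\<^sup>2 - (vnorm \<epsilon>)\<^sup>2\<bar> \<le> 12 * lam\<^sup>2 * real k * (16 * M1\<^sup>2) * (R + vnorm \<epsilon>)\<^sup>2"
    unfolding R_def
    by (rule sqrt_lasso_error[OF W \<epsilon> bc b0 YW lam opt T_def T(1) corr epos _ re[OF T(2,1)]]) auto
  have RY: "R \<le> vnorm Y" unfolding R_def W_def
    by (rule sqrt_lasso_residual_le[OF X Y]) (use p b in \<open>auto simp: X_def Y_def\<close>)
  have RYsq: "R\<^sup>2 \<le> sq_response x e" unfolding Y2[symmetric] using RY by (rule power_mono) (simp add: R_def)
  have Ypos: "0 < sq_response x e" using dev(3) V_pos n_pos by (smt (verit) divide_pos_pos mult_pos_pos)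
  have "(R + vnorm \<epsilon>)\<^sup>2 \<le> 2 * (R\<^sup>2 + (vnorm \<epsilon>)\<^sup>2)"
  proof -
    have "2 * (R\<^sup>2 + (vnorm \<epsilon>)\<^sup>2) - (R + vnorm \<epsilon>)\<^sup>2 = (R - vnorm \<epsilon>)\<^sup>2"
      by (simp add: power2_eq_square algebra_simps)
    also have "0 \<le> \<dots>" by simp
    finally show ?thesis by simp
  qed
  also have "\<dots> \<le> 8 * sq_response x e" using RYsq dev(4) by (simp add: e2)
  finally have "\<bar>R\<^sup>2 - (vnorm \<epsilon>)\<^sup>2\<bar> \<le> 12 * lam\<^sup>2 * real k * (16 * M1\<^sup>2) * (8 * sq_response x e)"
    by (intro order_trans[OF err] mult_left_mono) auto
  also have "\<dots> = 259584 * M1\<^sup>2 * (real k * ln (real p) / real n) * sq_response x e"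
    by (simp add: lam2)
  finally have dR: "\<bar>R\<^sup>2 - sq_noise e\<bar> / sq_response x e \<le> 259584 * M1\<^sup>2 * (real k * ln (real p) / real n)"
    using Ypos by (simp add: e2 pos_divide_le_eq)
  define A where "A = (sq_noise e - R\<^sup>2) / sq_response x e"
  define B where "B = \<sigma>\<^sup>2 / V - sq_noise e / sq_response x e"
  have "eta_SL X Y b - eta S \<beta> \<sigma> = A + B"
    unfolding eta_SL_def eta_eq' W_def[symmetric] R_def[symmetric] Y2 A_def B_def by (simp add: diff_divide_distrib)
  moreover have "(A + B)\<^sup>2 \<le> 2 * A\<^sup>2 + 2 * B\<^sup>2"
  proof -
    have "2 * A\<^sup>2 + 2 * B\<^sup>2 - (A + B)\<^sup>2 = (A - B)\<^sup>2" by (simp add: power2_eq_square algebra_simps)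
    also have "0 \<le> \<dots>" by simp
    finally show ?thesis by simp
  qed
  moreover have "A\<^sup>2 \<le> (259584 * M1\<^sup>2 * (real k * ln (real p) / real n))\<^sup>2"
  proof -
    have "\<bar>A\<bar> = \<bar>R\<^sup>2 - sq_noise e\<bar> / sq_response x e" using Ypos by (simp add: A_def abs_minus_commute)
    then have "\<bar>A\<bar> \<le> 259584 * M1\<^sup>2 * (real k * ln (real p) / real n)" using dR by simp
    then have "\<bar>A\<bar>\<^sup>2 \<le> (259584 * M1\<^sup>2 * (real k * ln (real p) / real n))\<^sup>2" by (rule power_mono) simp
    then show ?thesis by simp
  qed
  moreover have "B\<^sup>2 \<le> 8 * rel_noise (x, e) + 8 * rel_response (x, e)" using dev(5) by (simp add: B_def power2_commute)
  ultimately show ?thesis by (simp add: X_def Y_def)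
qed

text \<open>The extra 1 makes \<open>m = lasso_scale * k\<close> exceed 2048 M1^4 k by at least 1
  whenever \<open>k \<ge> 1\<close>, as the restricted eigenvalue requires.\<close>

definition "lasso_scale = nat \<lceil>2048 * M1 ^ 4\<rceil> + 1"

text \<open>The result is a measurable majorant of the squared error together with its integral, and
  not only a bound on the risk: the adaptive estimator is later compared with the Lasso pointwise,
  on a product with the second sample.\<close>

lemma sqrt_lasso_risk:
  assumes p: "2 \<le> p" "n \<le> p" and k: "1 \<le> k" "nnz \<beta> \<le> k" and sl: "sqrt_lasso_solution n p sl"
    and small: "real k * ln (real p) \<le> real n / (48 * real lasso_scale)"
  shows "\<exists>g\<in>borel_measurable M. (\<forall>(x, e)\<in>space M. ennreal
      ((eta_SL (design n p x) (response n p \<beta> x e) (sl (design n p x) (response n p \<beta> x e)) - eta S \<beta> \<sigma>)\<^sup>2) \<le> g (x, e)) \<and>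
    (\<integral>\<^sup>+\<omega>. g \<omega> \<partial>M) \<le> ennreal (190 / real n + 2 * (259584 * M1\<^sup>2 * (real k * ln (real p) / real n))\<^sup>2)"
proof -
  define m where "m = lasso_scale * k"
  define a where "a = 2 * (259584 * M1\<^sup>2 * (real k * ln (real p) / real n))\<^sup>2"
  have a0: "0 \<le> a" by (simp add: a_def)
  have "2048 * M1 ^ 4 + 1 \<le> real lasso_scale" "1 \<le> lasso_scale"
    using real_nat_ceiling_ge[of "2048 * M1 ^ 4"] unfolding lasso_scale_def by simp_all
  then have sc: "2048 * M1 ^ 4 + 1 \<le> real lasso_scale" "1 \<le> real lasso_scale" by simp_all
  have m: "2048 * M1 ^ 4 * real k + 1 \<le> real m"
  proof -
    have "2048 * M1 ^ 4 * real k + 1 \<le> (2048 * M1 ^ 4 + 1) * real k" using k by (simp add: algebra_simps)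
    also have "\<dots> \<le> real lasso_scale * real k" using sc by (intro mult_right_mono) auto
    finally show ?thesis by (simp add: m_def)
  qed
  have lnp: "0 < ln (real p)" using p by simp
  have small1: "real m * ln (real p) \<le> real n / 48"
  proof -
    have "real lasso_scale * (real k * ln (real p)) \<le> real lasso_scale * (real n / (48 * real lasso_scale))"
      using small by (intro mult_left_mono) auto
    then show ?thesis using sc by (simp add: m_def mult.assoc)
  qed
  have small2: "ln (real p) \<le> real n / 48"
  proof -
    have "1 \<le> real m" using m M1 by (smt (verit) mult_nonneg_nonneg of_nat_0_le_iff zero_le_power)
    then have "1 * ln (real p) \<le> real m * ln (real p)" using lnp by (intro mult_right_mono) auto
    then show ?thesis using small1 by simp
  qed
  have p1: "emeasure D (sparse_bad m) \<le> ennreal (24 / real n)"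
  proof -
    \<comment> \<open>Since 2 p \<le> p^2, the number of signed sums is at most exp (2 m ln p) \<le>
      exp (n / 24). That is half of the exponent n / 12 of the lower tail, which explains the factor
      48 in the sparsity condition.\<close>
    have "real ((2 * p) ^ m) = exp (real m * ln (2 * real p))"
      using p by (simp add: exp_of_nat_mult)
    also have "\<dots> \<le> exp (real n / 24)"
    proof -
      have "ln (2 * real p) \<le> ln (real p * real p)" using p by (subst ln_le_cancel_iff) auto
      also have "\<dots> = 2 * ln (real p)" using p by (simp add: ln_mult)
      finally have "real m * ln (2 * real p) \<le> real m * (2 * ln (real p))" by (rule mult_left_mono) simp
      then show ?thesis using small1 by simp
    qed
    finally have "real ((2 * p) ^ m) * exp (- real n / 12) \<le> exp (real n / 24) * exp (- real n / 12)" by (rule mult_right_mono) simp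
    also have "\<dots> = exp (- (real n / 24))" by (simp add: exp_add[symmetric])
    also have "\<dots> \<le> 24 / real n" using exp_minus_le_inverse[of "real n / 24"] n_pos by simp
    finally show ?thesis by (intro order_trans[OF sparse_bad_prob(2)] ennreal_leI)
  qed
  have p2: "emeasure D column_bad \<le> ennreal (4 / real n)"
  proof -
    have "real p * exp (- real n / 2) = exp (ln (real p)) * exp (- real n / 2)" using p by simp
    also have "\<dots> = exp (ln (real p) + - real n / 2)" by (simp only: exp_add)
    also have "\<dots> \<le> exp (- (real n / 4))" using small2 n_pos by simp
    also have "\<dots> \<le> 4 / real n" using exp_minus_le_inverse[of "real n / 4"] n_pos by simp
    finally show ?thesis by (intro order_trans[OF column_bad_prob(2)] ennreal_leI)
  qed
  have p3: "emeasure M correlation_bad \<le> ennreal (2 / real n)"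
    using p n1 by (intro order_trans[OF correlation_bad_prob(2)] ennreal_leI divide_left_mono) auto
  have c: "correlation_bad \<in> sets M" using p by (intro correlation_bad_prob(1)) auto
  define f1 where "f1 = (indicator (sparse_bad m) :: _ \<Rightarrow> ennreal)"
  define f2 where "f2 = (indicator column_bad :: _ \<Rightarrow> ennreal)"
  have f: "f1 \<in> borel_measurable (PiM {..<n} (\<lambda>_. lebesgue_fun p))" "f2 \<in> borel_measurable (PiM {..<n} (\<lambda>_. lebesgue_fun p))"
    using sparse_bad_prob(1)[of m] column_bad_prob(1) by (auto simp: f1_def f2_def sets_design_law)
  note [measurable] = measurable_model_fst[OF f(1)] measurable_model_fst[OF f(2)] c
  \<comment> \<open>The coefficient 20 is 16 + 4: twice the 8 of the good-event error, plus the 4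
    that makes the term exceed 1 when the deviation is large.\<close>
  define g where "g \<omega> = f1 (fst \<omega>) + f2 (fst \<omega>) + indicator correlation_bad \<omega> + ennreal (20 * rel_noise \<omega>) + ennreal (20 * rel_response \<omega>) + ennreal a" for \<omega>
  show ?thesis
  proof (intro bexI[of _ g] conjI)
    show "g \<in> borel_measurable M" unfolding g_def by measurable
    have "(\<integral>\<^sup>+\<omega>. g \<omega> \<partial>M) = (\<integral>\<^sup>+\<omega>. f1 (fst \<omega>) \<partial>M) + (\<integral>\<^sup>+\<omega>. f2 (fst \<omega>) \<partial>M) + emeasure M correlation_bad
        + (\<integral>\<^sup>+\<omega>. ennreal (20 * rel_noise \<omega>) \<partial>M) + (\<integral>\<^sup>+\<omega>. ennreal (20 * rel_response \<omega>) \<partial>M) + ennreal a"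
      unfolding g_def by (simp add: nn_integral_add M.emeasure_space_1)
    also have "(\<integral>\<^sup>+\<omega>. f1 (fst \<omega>) \<partial>M) = emeasure D (sparse_bad m)"
      using nn_integral_model_fst[OF f(1)] sparse_bad_prob(1)[of m] by (simp add: f1_def)
    also have "(\<integral>\<^sup>+\<omega>. f2 (fst \<omega>) \<partial>M) = emeasure D column_bad"
      using nn_integral_model_fst[OF f(2)] column_bad_prob(1) by (simp add: f2_def)
    also have "(\<integral>\<^sup>+\<omega>. ennreal (20 * rel_noise \<omega>) \<partial>M) = 20 * (\<integral>\<^sup>+\<omega>. ennreal (rel_noise \<omega>) \<partial>M)"
      by (simp add: ennreal_mult' nn_integral_cmult)
    also have "(\<integral>\<^sup>+\<omega>. ennreal (20 * rel_response \<omega>) \<partial>M) = 20 * (\<integral>\<^sup>+\<omega>. ennreal (rel_response \<omega>) \<partial>M)"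
      by (simp add: ennreal_mult' nn_integral_cmult)
    finally have "(\<integral>\<^sup>+\<omega>. g \<omega> \<partial>M) \<le> ennreal (24 / real n) + ennreal (4 / real n) + ennreal (2 / real n)
        + 20 * ennreal (2 / real n) + 20 * ennreal (6 / real n) + ennreal a"
      using p1 p2 p3 rel_noise_mean rel_response_mean by (auto intro!: add_mono mult_left_mono)
    also have "\<dots> = ennreal (24 / real n + 4 / real n + 2 / real n + 20 * (2 / real n) + 20 * (6 / real n) + a)"
    proof -
      have t: "20 * ennreal r = ennreal (20 * r)" for r by (simp add: ennreal_mult')
      show ?thesis unfolding t using a0 by (simp only: ennreal_plus divide_nonneg_nonneg add_nonneg_nonneg mult_nonneg_nonneg of_nat_0_le_iff zero_le_numeral)
    qed
    also have "24 / real n + 4 / real n + 2 / real n + 20 * (2 / real n) + 20 * (6 / real n) + a = 190 / real n + a"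
      by (simp add: add_divide_distrib[symmetric])
    finally show "(\<integral>\<^sup>+\<omega>. g \<omega> \<partial>M) \<le> ennreal (190 / real n + 2 * (259584 * M1\<^sup>2 * (real k * ln (real p) / real n))\<^sup>2)"
      by (simp add: a_def)
    show "\<forall>(x, e)\<in>space M. ennreal
      ((eta_SL (design n p x) (response n p \<beta> x e) (sl (design n p x) (response n p \<beta> x e)) - eta S \<beta> \<sigma>)\<^sup>2) \<le> g (x, e)"
    proof (intro ballI, clarify)
      fix x e assume "(x, e) \<in> space M"
      then have sp: "x \<in> space D" "e \<in> space E" by (auto simp: space_model_law)
      let ?b = "sl (design n p x) (response n p \<beta> x e)"
      let ?L = "(eta_SL (design n p x) (response n p \<beta> x e) ?b - eta S \<beta> \<sigma>)\<^sup>2"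
      have b: "is_arg_min (sqrt_lasso_obj (design n p x) (response n p \<beta> x e)) (\<lambda>b. b \<in> carrier_vec p) ?b"
        using sl response_carrier unfolding sqrt_lasso_solution_def by auto
      have le1: "ennreal ?L \<le> 1"
        using eta_SL_bounds[OF design_carrier response_carrier _ b] p eta_bounds sq_diff_le_1 by simp
      have gg: "g (x, e) \<ge> h" if "h \<in> {f1 x, f2 x, indicator correlation_bad (x, e), ennreal (20 * rel_noise (x, e)), ennreal (20 * rel_response (x, e))}" for h
        using that by (auto simp: g_def intro: add_increasing add_increasing2)
      show "ennreal ?L \<le> g (x, e)"
      proof (cases "x \<notin> sparse_bad m \<and> x \<notin> column_bad \<and> (x, e) \<notin> correlation_bad \<and> 4 * rel_noise (x, e) < 1 \<and> 4 * rel_response (x, e) < 1")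
        case True
        then have "?L \<le> a + 2 * (8 * rel_noise (x, e) + 8 * rel_response (x, e))"
          using sqrt_lasso_good[OF p(1) k(2) m b sp] by (simp add: a_def)
        also have "\<dots> \<le> 20 * rel_noise (x, e) + 20 * rel_response (x, e) + a" using rel_nonneg[of "(x, e)"] by simp
        finally have "ennreal ?L \<le> ennreal (20 * rel_noise (x, e)) + ennreal (20 * rel_response (x, e)) + ennreal a"
          using rel_nonneg[of "(x, e)"] a0 by (simp add: ennreal_plus[symmetric] ennreal_leI del: ennreal_plus)
        also have "\<dots> \<le> g (x, e)" unfolding g_def
          by (intro add_mono) (auto intro: add_increasing)
        finally show ?thesis .
      next
        case False
        then consider "f1 x = 1" | "f2 x = 1" | "indicator correlation_bad (x, e) = (1::ennreal)" | "1 \<le> 4 * rel_noise (x, e)" | "1 \<le> 4 * rel_response (x, e)"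
          by (auto simp: f1_def f2_def not_less)
        then have "1 \<le> g (x, e)"
        proof cases
          case 4
          then have "1 \<le> ennreal (20 * rel_noise (x, e))" using rel_nonneg[of "(x, e)"] by (simp add: ennreal_1[symmetric] ennreal_leI del: ennreal_1)
          then show ?thesis using gg order_trans by blast
        next
          case 5
          then have "1 \<le> ennreal (20 * rel_response (x, e))" using rel_nonneg[of "(x, e)"] by (simp add: ennreal_1[symmetric] ennreal_leI del: ennreal_1)
          then show ?thesis using gg order_trans by blast
        qed (use gg in force)+
        then show ?thesis using le1 by (rule order_trans[rotated])
      qed
    qed
  qed
qed

end

section \<open>The plug-in estimator\<close>

context gaussian_regression
begin

lemma distr_design_row: "i < n \<Longrightarrow> distr D (gaussian_law p S) (\<lambda>x. x i) = gaussian_law p S"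
  unfolding design_law_def by (intro distr_PiM_component prob_space_gaussian_law S) auto

text \<open>The assumed plug-in bound normalises by the variance of the first response, and
  \<open>V\<close> is its value. The second moment is computed as a nonnegative integral first; this
  yields the integrability needed for Fubini, by which the mean vanishes.\<close>

lemma model_variance: "M.variance (\<lambda>(x, e). response n p \<beta> x e $ 0) = V"
proof -
  define y where "y \<omega> = vec p (fst \<omega> 0) \<bullet> \<beta> + snd \<omega> 0" for \<omega> :: "(nat \<Rightarrow> nat \<Rightarrow> real) \<times> (nat \<Rightarrow> real)"
  have y: "(\<lambda>(x, e). response n p \<beta> x e $ 0) = y" using n1 by (auto simp: y_def response_vec)
  have ym [measurable]: "y \<in> borel_measurable M" unfolding y_def
    by (intro borel_measurable_add measurable_model_row measurable_model_noise \<beta>) (use n1 in auto)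
  let ?u = "unit_vec n 0 :: real vec"
  have u: "?u \<in> carrier_vec n" "?u \<bullet> ?u = 1" using n1 by auto
  have eu: "vec n e \<bullet> ?u = e 0" for e using n1 by (simp add: scalar_prod_right_unit)
  note nc = noise_cov_sym_pos_def[OF \<sigma>, of n]
  have ie: "integrable E (\<lambda>e. e 0 ^ k)" for k using integrable_gaussian_pow[OF nc u(1), of k] by (simp add: eu)
  have me: "(\<integral>e. e 0 \<partial>E) = 0" "(\<integral>e. (e 0)\<^sup>2 \<partial>E) = \<sigma>\<^sup>2"
    using integral_gaussian_1[OF nc u(1)] integral_gaussian_2[OF nc u(1)] noise_cov_quad[OF u(1), of \<sigma>] by (simp_all add: eu u)
  have ie1: "integrable E (\<lambda>e. e 0)" using ie[of 1] by simp
  have inner: "(\<integral>\<^sup>+e. ennreal ((a + e 0)\<^sup>2) \<partial>E) = ennreal (a\<^sup>2 + \<sigma>\<^sup>2)" for a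
  proof -
    have eq: "(a + e 0)\<^sup>2 = a\<^sup>2 + 2 * a * e 0 + (e 0)\<^sup>2" for e :: "nat \<Rightarrow> real" by (simp add: power2_sum)
    have "integrable E (\<lambda>e. (a + e 0)\<^sup>2)" unfolding eq using ie ie1 by auto
    then have "(\<integral>\<^sup>+e. ennreal ((a + e 0)\<^sup>2) \<partial>E) = ennreal (\<integral>e. (a + e 0)\<^sup>2 \<partial>E)"
      by (rule nn_integral_eq_integral) auto
    also have "(\<integral>e. (a + e 0)\<^sup>2 \<partial>E) = a\<^sup>2 + \<sigma>\<^sup>2" unfolding eq using ie ie1 me E.prob_space by simp
    finally show ?thesis .
  qed
  have row: "(\<integral>\<^sup>+x. ennreal ((vec p (x 0) \<bullet> \<beta>)\<^sup>2 + \<sigma>\<^sup>2) \<partial>D) = ennreal V"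
  proof -
    interpret G: prob_space "gaussian_law p S" by (rule prob_space_gaussian_law[OF S])
    have m: "(\<lambda>y. ennreal ((vec p y \<bullet> \<beta>)\<^sup>2 + \<sigma>\<^sup>2)) \<in> borel_measurable (gaussian_law p S)" using \<beta> by measurable
    have "(\<integral>\<^sup>+x. ennreal ((vec p (x 0) \<bullet> \<beta>)\<^sup>2 + \<sigma>\<^sup>2) \<partial>D) = (\<integral>\<^sup>+y. ennreal ((vec p y \<bullet> \<beta>)\<^sup>2 + \<sigma>\<^sup>2) \<partial>distr D (gaussian_law p S) (\<lambda>x. x 0))"
      unfolding design_law_def using n1 m by (subst nn_integral_distr) auto
    also have "\<dots> = ennreal (\<integral>y. (vec p y \<bullet> \<beta>)\<^sup>2 + \<sigma>\<^sup>2 \<partial>gaussian_law p S)"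
    proof -
      have "integrable (gaussian_law p S) (\<lambda>y. (vec p y \<bullet> \<beta>)\<^sup>2 + \<sigma>\<^sup>2)" using integrable_gaussian_pow[OF S \<beta>, of 2] by auto
      from nn_integral_eq_integral[OF this] show ?thesis using n1 by (simp only: distr_design_row) simp
    qed
    also have "(\<integral>y. (vec p y \<bullet> \<beta>)\<^sup>2 + \<sigma>\<^sup>2 \<partial>gaussian_law p S) = V"
      using integrable_gaussian_pow[OF S \<beta>, of 2] integral_gaussian_2[OF S \<beta>] G.prob_space by (simp add: V_def q_def)
    finally show ?thesis .
  qed
  have nn: "(\<integral>\<^sup>+\<omega>. ennreal ((y \<omega>)\<^sup>2) \<partial>M) = ennreal V"
  proof -
    have "(\<integral>\<^sup>+\<omega>. ennreal ((y \<omega>)\<^sup>2) \<partial>M) = (\<integral>\<^sup>+x. \<integral>\<^sup>+e. ennreal ((y (x, e))\<^sup>2) \<partial>E \<partial>D)"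
      by (rule nn_integral_model) measurable
    then show ?thesis by (simp only: y_def fst_conv snd_conv inner row)
  qed
  have i2: "integrable M (\<lambda>\<omega>. (y \<omega>)\<^sup>2)" by (rule integrableI_nn_integral_finite[OF _ _ nn]) auto
  have v: "(\<integral>\<omega>. (y \<omega>)\<^sup>2 \<partial>M) = V" using nn V_pos by (subst integral_eq_nn_integral) auto
  have i1: "integrable M y" by (rule M.square_integrable_imp_integrable[OF ym i2])
  have "(\<integral>\<omega>. y \<omega> \<partial>M) = (\<integral>x. \<integral>e. y (x, e) \<partial>E \<partial>D)"
    using DE.integral_fst'[of y] i1 by (simp add: model_law_def)
  also have "\<dots> = (\<integral>x. vec p (x 0) \<bullet> \<beta> \<partial>D)"
    using ie1 me E.prob_space by (simp add: y_def)
  also have "\<dots> = (\<integral>z. vec p z \<bullet> \<beta> \<partial>distr D (gaussian_law p S) (\<lambda>x. x 0))"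
    unfolding design_law_def using n1 measurable_linear_form[OF \<beta>]
    by (subst integral_distr) (auto cong: measurable_cong_sets simp: sets_gaussian_law)
  also have "\<dots> = 0" using n1 integral_gaussian_1[OF S \<beta>] by (simp add: distr_design_row)
  finally show ?thesis unfolding y using v by simp
qed

end

section \<open>The plug-in statistic in coordinates\<close>

definition gram_entry :: "nat \<Rightarrow> (nat \<Rightarrow> nat \<Rightarrow> real) \<Rightarrow> real mat \<Rightarrow> nat \<Rightarrow> nat \<Rightarrow> real" where
  "gram_entry p x A i l = (\<Sum>b<p. (\<Sum>a<p. x i a * A $$ (a, b)) * x l b)"

lemma design_gram:
  assumes A: "A \<in> carrier_mat p p"
  shows "design n p x * A * transpose_mat (design n p x) = mat n n (\<lambda>(i, l). gram_entry p x A i l)"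
  using A by (intro eq_matI) (auto simp: gram_entry_def design_def scalar_prod_lessThan[of _ p])

text \<open>Measurability is formulated for matrix entries, and this expansion expresses the
  statistic by finite sums of products of entries. It also makes its linearity in the matrix
  visible.\<close>

lemma eta_D_sum:
  assumes A: "A \<in> carrier_mat p p" and Y: "Y \<in> carrier_vec n"
  shows "eta_D (design n p x) Y A =
    ((\<Sum>i<n. \<Sum>l<n. Y $ i * gram_entry p x A i l * Y $ l) - (\<Sum>i<n. gram_entry p x A i i) / real n * (Y \<bullet> Y))
      / ((real n + 1) * (Y \<bullet> Y))"
proof -
  define G where "G = mat n n (\<lambda>(i, l). gram_entry p x A i l)"
  define c where "c = mat_trace G / real n"
  have G: "G \<in> carrier_mat n n" by (simp add: G_def)
  have c: "c = (\<Sum>i<n. gram_entry p x A i i) / real n" by (simp add: c_def mat_trace_def G_def)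
  have "(c \<cdot>\<^sub>m 1\<^sub>m n) *\<^sub>v Y = c \<cdot>\<^sub>v Y" using Y by (intro eq_vecI) auto
  then have "(G - c \<cdot>\<^sub>m 1\<^sub>m n) *\<^sub>v Y = G *\<^sub>v Y - c \<cdot>\<^sub>v Y"
    using G Y by (subst minus_mult_distrib_mat_vec[of _ n n]) auto
  then have "Y \<bullet> ((G - c \<cdot>\<^sub>m 1\<^sub>m n) *\<^sub>v Y) = Y \<bullet> (G *\<^sub>v Y) - c * (Y \<bullet> Y)"
    using G Y by (simp add: scalar_prod_minus_distrib[of _ n])
  also have "Y \<bullet> (G *\<^sub>v Y) = (\<Sum>i<n. \<Sum>l<n. Y $ i * gram_entry p x A i l * Y $ l)"
    using quad_form_sum[OF G Y] by (simp add: G_def)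
  finally show ?thesis
    unfolding eta_D_def Let_def design_gram[OF A] G_def[symmetric] by (simp add: design_def c_def[symmetric] c vnorm_sq)
qed

text \<open>The quadratic form in Y and the trace are both unchanged when the kernel is transposed.
  An unsymmetric matrix can thus be replaced by a symmetric one, to which a Cholesky factorisation
  may apply.\<close>

lemma eta_D_symmetric_part:
  assumes A: "A \<in> carrier_mat p p" and Y: "Y \<in> carrier_vec n"
  shows "eta_D (design n p x) Y ((1 / 2) \<cdot>\<^sub>m (A + transpose_mat A)) = eta_D (design n p x) Y A"
proof -
  define B where "B = (1 / 2) \<cdot>\<^sub>m (A + transpose_mat A)"
  have B: "B \<in> carrier_mat p p" using A by (simp add: B_def)
  have g: "gram_entry p x B i l = (gram_entry p x A i l + gram_entry p x A l i) / 2" for i l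
  proof -
    have 1: "gram_entry p x A i l = (\<Sum>a<p. \<Sum>b<p. x i a * A $$ (a, b) * x l b)" for i l
      unfolding gram_entry_def sum_distrib_right by (rule sum.swap)
    have 2: "gram_entry p x A l i = (\<Sum>b<p. \<Sum>a<p. x i a * A $$ (b, a) * x l b)"
      unfolding 1 by (intro sum.cong refl) simp
    have "gram_entry p x B i l = (\<Sum>b<p. \<Sum>a<p. (x i a * A $$ (a, b) * x l b) / 2 + (x i a * A $$ (b, a) * x l b) / 2)"
      unfolding gram_entry_def sum_distrib_right
      by (intro sum.cong refl) (use A in \<open>simp add: B_def algebra_simps\<close>)
    also have "\<dots> = (\<Sum>b<p. \<Sum>a<p. x i a * A $$ (a, b) * x l b) / 2 + (\<Sum>b<p. \<Sum>a<p. x i a * A $$ (b, a) * x l b) / 2"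
      by (simp only: sum.distrib sum_divide_distrib)
    also have "(\<Sum>b<p. \<Sum>a<p. x i a * A $$ (a, b) * x l b) = gram_entry p x A i l"
      unfolding gram_entry_def sum_distrib_right ..
    finally show ?thesis unfolding 2 by (simp add: add_divide_distrib)
  qed
  define f where "f i l = Y $ i * gram_entry p x A i l * Y $ l" for i l
  have "(\<Sum>i<n. \<Sum>l<n. Y $ i * gram_entry p x B i l * Y $ l) = (\<Sum>i<n. \<Sum>l<n. f i l / 2 + f l i / 2)"
    by (intro sum.cong refl) (simp add: g f_def algebra_simps add_divide_distrib)
  also have "\<dots> = (\<Sum>i<n. \<Sum>l<n. f i l) / 2 + (\<Sum>i<n. \<Sum>l<n. f l i) / 2"
    by (simp only: sum.distrib sum_divide_distrib)
  also have "(\<Sum>i<n. \<Sum>l<n. f l i) = (\<Sum>i<n. \<Sum>l<n. f i l)" by (rule sum.swap)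
  finally have "(\<Sum>i<n. \<Sum>l<n. Y $ i * gram_entry p x B i l * Y $ l) = (\<Sum>i<n. \<Sum>l<n. Y $ i * gram_entry p x A i l * Y $ l)"
    by (simp add: f_def)
  moreover have "gram_entry p x B i i = gram_entry p x A i i" for i by (simp add: g)
  ultimately show ?thesis unfolding B_def[symmetric] eta_D_sum[OF B Y] eta_D_sum[OF A Y] by (simp only:)
qed

context gaussian_regression
begin

lemma measurable_eta_D:
  assumes X: "\<And>i j. i < n \<Longrightarrow> j < p \<Longrightarrow> (\<lambda>\<omega>. X \<omega> i j) \<in> borel_measurable N"
    and e: "\<And>i. i < n \<Longrightarrow> (\<lambda>\<omega>. e \<omega> i) \<in> borel_measurable N"
    and A: "\<And>i j. i < p \<Longrightarrow> j < p \<Longrightarrow> (\<lambda>\<omega>. A \<omega> $$ (i, j)) \<in> borel_measurable N"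
    and Ac: "\<And>\<omega>. A \<omega> \<in> carrier_mat p p"
  shows "(\<lambda>\<omega>. eta_D (design n p (X \<omega>)) (response n p \<beta> (X \<omega>) (e \<omega>)) (A \<omega>)) \<in> borel_measurable N"
proof -
  have Y: "(\<lambda>\<omega>. response n p \<beta> (X \<omega>) (e \<omega>) $ i) \<in> borel_measurable N" if i: "i < n" for i
  proof -
    have "response n p \<beta> (X \<omega>) (e \<omega>) $ i = (\<Sum>j<p. X \<omega> i j * \<beta> $ j) + e \<omega> i" for \<omega>
      using i \<beta> by (simp add: response_vec scalar_prod_lessThan[of _ p])
    then show ?thesis using X e i by (auto intro!: borel_measurable_add borel_measurable_sum borel_measurable_times)
  qed
  have G: "(\<lambda>\<omega>. gram_entry p (X \<omega>) (A \<omega>) i l) \<in> borel_measurable N" if "i < n" "l < n" for i l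
    unfolding gram_entry_def using X A that
    by (auto intro!: borel_measurable_sum borel_measurable_times)
  have YY: "(\<lambda>\<omega>. response n p \<beta> (X \<omega>) (e \<omega>) \<bullet> response n p \<beta> (X \<omega>) (e \<omega>)) \<in> borel_measurable N"
    unfolding scalar_prod_lessThan[OF response_carrier] using Y by (auto intro!: borel_measurable_sum borel_measurable_times)
  show ?thesis unfolding eta_D_sum[OF Ac response_carrier]
    using Y G YY by (intro borel_measurable_divide borel_measurable_diff borel_measurable_times borel_measurable_sum borel_measurable_const) auto
qed

end

section \<open>Transfer of the plug-in bound by whitening\<close>

context regression_model
begin

text \<open>The plug-in bound for the identity matrix, applied to the whitened design \<open>Z\<close> with
  \<open>X = Z L\<^sup>T\<close>, where \<open>inv_mat A = L L\<^sup>T\<close>, is the corresponding bound for \<open>A\<close>.\<close>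

lemma plug_in_general:
  assumes pc: "plug_in_constants C1 C2" and np: "n \<le> p" and A: "A \<in> sym_pos_def p"
    and Aq: "\<And>v. v \<in> carrier_vec p \<Longrightarrow> v \<bullet> (A *\<^sub>v v) \<le> a * (v \<bullet> v)" and a: "0 < a"
    and Sop: "\<And>v. v \<in> carrier_vec p \<Longrightarrow> vnorm (S *\<^sub>v v) \<le> M1 * vnorm v"
    and C1: "0 \<le> C1" and t: "0 \<le> t" "t \<le> root 3 (real n)"
  shows "emeasure M {\<omega> \<in> space M. C1 * (a * M1) * sqrt (real p * t) / real n
      < \<bar>eta_D (design n p (fst \<omega>)) (response n p \<beta> (fst \<omega>) (snd \<omega>)) A - ((S *\<^sub>v \<beta>) \<bullet> (A *\<^sub>v (S *\<^sub>v \<beta>))) / V\<bar>}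
    \<le> ennreal (C2 * exp (- t))"
proof -
  have p: "0 < p" using n1 np by simp
  note Ac = sym_pos_defD[OF A] and Sc = sym_pos_defD[OF S]
  obtain L where L: "lower_triangular p L" and AL: "inv_mat A = L * transpose_mat L"
    using cholesky[OF inv_mat_sym_pos_def[OF A]] by blast
  have Lc: "L \<in> carrier_mat p p" using L by (simp add: lower_triangular_def)
  define T where "T = inv_mat L"
  have T: "T \<in> carrier_mat p p" "L * T = 1\<^sub>m p" "T * L = 1\<^sub>m p" using lower_triangular_inv[OF L] by (auto simp: T_def)
  define Lt Tt where "Lt = transpose_mat L" and "Tt = transpose_mat T"
  have Lt: "Lt \<in> carrier_mat p p" and Tt: "Tt \<in> carrier_mat p p" using Lc T by (auto simp: Lt_def Tt_def)
  have LtTt: "Lt * Tt = 1\<^sub>m p" using transpose_mult[OF T(1) Lc] T(3) by (simp add: Lt_def Tt_def)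
  have TtLt: "Tt * Lt = 1\<^sub>m p" using transpose_mult[OF Lc T(1)] T(2) by (simp add: Lt_def Tt_def)
  have ALL: "A * (L * Lt) = 1\<^sub>m p" using inv_mat_works(2)[OF Ac(1) sym_pos_def_det_nonzero[OF A]] AL by (simp add: Lt_def)
  have ATT: "A = Tt * T"
  proof -
    have "(L * Lt) * (Tt * T) = L * ((Lt * Tt) * T)"
      using Lc Lt Tt T(1) by (simp add: assoc_mult_mat[of _ p p _ p _ p])
    also have "\<dots> = 1\<^sub>m p" using T by (simp add: LtTt)
    finally show ?thesis using mat_inverse_unique[of "L * Lt" p A "Tt * T"] ALL Ac(1) Lc Lt Tt T(1) by simp
  qed
  have LAL: "Lt * (A * L) = 1\<^sub>m p"
  proof -
    have "Lt * ((Tt * T) * L) = (Lt * Tt) * (T * L)"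
      using Lc Lt Tt T(1) by (simp add: assoc_mult_mat[of _ p p _ p _ p])
    then show ?thesis using LtTt T(3) by (simp add: ATT)
  qed
  \<comment> \<open>A row \<open>z\<close> of the whitened design satisfies x = L z, so its
    covariance is T S T' with T the inverse of L. The response is kept by the coefficients \<beta>'
    = L' \<beta>.\<close>
  define S' where "S' = T * (S * Tt)"
  have S'c: "S' \<in> carrier_mat p p" using T Tt Sc by (simp add: S'_def)
  have S'v: "S' *\<^sub>v v = T *\<^sub>v (S *\<^sub>v (Tt *\<^sub>v v))" if v: "v \<in> carrier_vec p" for v
    unfolding S'_def using T(1) Tt Sc(1) v by (simp add: assoc_mult_mat_vec[of _ p p _ p])
  have tr: "(Tt *\<^sub>v u) \<bullet> v = u \<bullet> (T *\<^sub>v v)" if "u \<in> carrier_vec p" "v \<in> carrier_vec p" for u v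
    unfolding Tt_def using T(1) that by (intro transpose_vec_mult_scalar) auto
  have S'q: "u \<bullet> (S' *\<^sub>v v) = (Tt *\<^sub>v u) \<bullet> (S *\<^sub>v (Tt *\<^sub>v v))" if "u \<in> carrier_vec p" "v \<in> carrier_vec p" for u v
    using tr[of u "S *\<^sub>v (Tt *\<^sub>v v)"] that Tt Sc(1) by (simp add: S'v)
  have S': "S' \<in> sym_pos_def p"
  proof -
    have "transpose_mat S' = transpose_mat (S * Tt) * transpose_mat T"
      unfolding S'_def using T Tt Sc by (intro transpose_mult[of _ p p _ p]) auto
    also have "transpose_mat (S * Tt) = transpose_mat Tt * transpose_mat S" using Sc Tt by (intro transpose_mult[of _ p p _ p]) auto
    also have "transpose_mat Tt = T" by (simp add: Tt_def)
    finally have "transpose_mat S' = S'" using T(1) Tt Sc by (simp add: S'_def Tt_def[symmetric] assoc_mult_mat[of _ p p _ p _ p])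
    moreover have "0 < v \<bullet> (S' *\<^sub>v v)" if v: "v \<in> carrier_vec p" "v \<noteq> 0\<^sub>v p" for v
    proof -
      have "Lt *\<^sub>v (Tt *\<^sub>v v) = v" using Lt Tt v LtTt by (metis assoc_mult_mat_vec one_mult_mat_vec)
      moreover have "Lt *\<^sub>v 0\<^sub>v p = 0\<^sub>v p" using Lt by auto
      ultimately have "Tt *\<^sub>v v \<noteq> 0\<^sub>v p" using v(2) by metis
      then show ?thesis unfolding S'q[OF v(1) v(1)] using Tt v by (intro Sc(3)) auto
    qed
    ultimately show ?thesis using S'c by (simp add: sym_pos_def_def)
  qed
  have LSL: "L * S' * transpose_mat L = S"
  proof -
    have "L * S' * Lt = L * (T * (S * (Tt * Lt)))"
      using Lc Lt T(1) Tt Sc(1) by (simp add: S'_def assoc_mult_mat[of _ p p _ p _ p])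
    also have "\<dots> = (L * T) * S" using Lc T(1) Sc(1) by (simp add: TtLt assoc_mult_mat[of _ p p _ p _ p])
    finally show ?thesis using T(2) Sc(1) by (simp add: Lt_def)
  qed
  define \<beta>' where "\<beta>' = Lt *\<^sub>v \<beta>"
  have \<beta>': "\<beta>' \<in> carrier_vec p" using Lt \<beta> by (simp add: \<beta>'_def)
  have Tt\<beta>': "Tt *\<^sub>v \<beta>' = \<beta>" unfolding \<beta>'_def using Lt Tt \<beta> TtLt by (metis assoc_mult_mat_vec one_mult_mat_vec)
  have q': "\<beta>' \<bullet> (S' *\<^sub>v \<beta>') = q" unfolding S'q[OF \<beta>' \<beta>'] Tt\<beta>' by (simp add: q_def)
  \<comment> \<open>The identity plug-in aims at \<beta>' S'^2 \<beta>' for the whitened data. Since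
    T' T = A, this is the form of \<open>A\<close> at S \<beta>; for \<open>A\<close> the inverse of
    \<open>S\<close> it would be q, the numerator of \<eta>.\<close>
  have target: "\<beta>' \<bullet> ((S' * S') *\<^sub>v \<beta>') = (S *\<^sub>v \<beta>) \<bullet> (A *\<^sub>v (S *\<^sub>v \<beta>))"
  proof -
    have S\<beta>: "S *\<^sub>v \<beta> \<in> carrier_vec p" using Sc(1) \<beta> by simp
    have "\<beta>' \<bullet> ((S' * S') *\<^sub>v \<beta>') = \<beta>' \<bullet> (S' *\<^sub>v (S' *\<^sub>v \<beta>'))" using S'c \<beta>' by (simp add: assoc_mult_mat_vec[of _ p p _ p])
    also have "\<dots> = \<beta> \<bullet> (S *\<^sub>v (Tt *\<^sub>v (T *\<^sub>v (S *\<^sub>v \<beta>))))"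
    proof -
      have "\<beta>' \<bullet> (S' *\<^sub>v (S' *\<^sub>v \<beta>')) = (Tt *\<^sub>v \<beta>') \<bullet> (S *\<^sub>v (Tt *\<^sub>v (S' *\<^sub>v \<beta>')))"
        using S'c \<beta>' by (intro S'q) auto
      then show ?thesis by (simp only: S'v[OF \<beta>'] Tt\<beta>')
    qed
    also have "Tt *\<^sub>v (T *\<^sub>v (S *\<^sub>v \<beta>)) = A *\<^sub>v (S *\<^sub>v \<beta>)" unfolding ATT using Tt T(1) S\<beta> by (simp add: assoc_mult_mat_vec[of _ p p _ p])
    also have "\<beta> \<bullet> (S *\<^sub>v (A *\<^sub>v (S *\<^sub>v \<beta>))) = (A *\<^sub>v (S *\<^sub>v \<beta>)) \<bullet> (S *\<^sub>v \<beta>)"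
      using Ac(1) S\<beta> by (intro sprod_sym_mat[OF Sc(1,2) \<beta>]) auto
    also have "\<dots> = (S *\<^sub>v \<beta>) \<bullet> (A *\<^sub>v (S *\<^sub>v \<beta>))" using Ac(1) S\<beta> by (intro comm_scalar_prod[of _ p]) auto
    finally show ?thesis .
  qed
  have Tn: "vnorm (T *\<^sub>v v) \<le> sqrt a * vnorm v" if v: "v \<in> carrier_vec p" for v
  proof -
    have "(vnorm (T *\<^sub>v v))\<^sup>2 = (Tt *\<^sub>v (T *\<^sub>v v)) \<bullet> v"
      using tr[of "T *\<^sub>v v" v] T(1) v by (simp add: vnorm_sq)
    also have "Tt *\<^sub>v (T *\<^sub>v v) = A *\<^sub>v v" unfolding ATT using Tt T(1) v by (simp add: assoc_mult_mat_vec[of _ p p _ p])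
    also have "(A *\<^sub>v v) \<bullet> v = v \<bullet> (A *\<^sub>v v)" using Ac(1) v by (intro comm_scalar_prod[of _ p]) auto
    also have "\<dots> \<le> a * (v \<bullet> v)" by (rule Aq[OF v])
    also have "\<dots> = (sqrt a * vnorm v)\<^sup>2" using a by (simp add: power_mult_distrib vnorm_sq)
    finally show ?thesis by (rule power2_le_imp_le) (use a in simp)
  qed
  have Ttn: "vnorm (Tt *\<^sub>v v) \<le> sqrt a * vnorm v" if v: "v \<in> carrier_vec p" for v
  proof -
    let ?u = "Tt *\<^sub>v v"
    have u: "?u \<in> carrier_vec p" using Tt v by simp
    have "vnorm ?u * vnorm ?u = v \<bullet> (T *\<^sub>v ?u)" using tr[OF v u] vnorm_sq[of ?u] by (simp add: power2_eq_square)
    also have "\<dots> \<le> vnorm v * vnorm (T *\<^sub>v ?u)" using abs_sprod_le[OF v, of "T *\<^sub>v ?u"] T(1) u by simp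
    also have "\<dots> \<le> vnorm v * (sqrt a * vnorm ?u)" by (intro mult_left_mono Tn u) simp
    finally have "vnorm ?u * vnorm ?u \<le> vnorm ?u * (sqrt a * vnorm v)" by (simp add: mult_ac)
    then show ?thesis using a vnorm_nonneg[of ?u] vnorm_nonneg[of v]
      by (cases "vnorm ?u = 0") (auto simp: mult_le_cancel_left)
  qed
  \<comment> \<open>|T v|^2 = v' A v gives T the norm bound sqrt a, and so for its transpose; around
    \<open>S\<close> they contribute the factor \<open>a\<close>.\<close>
  have op: "op_norm S' \<le> a * M1"
  proof (rule op_norm_leI[OF S'c p])
    fix v :: "real vec" assume v: "v \<in> carrier_vec p"
    have "vnorm (S' *\<^sub>v v) \<le> sqrt a * vnorm (S *\<^sub>v (Tt *\<^sub>v v))" unfolding S'v[OF v] using Sc(1) Tt v by (intro Tn) auto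
    also have "\<dots> \<le> sqrt a * (M1 * vnorm (Tt *\<^sub>v v))" using a Tt v by (intro mult_left_mono Sop) auto
    also have "\<dots> \<le> sqrt a * (M1 * (sqrt a * vnorm v))" using a M1 by (intro mult_left_mono Ttn v) auto
    also have "\<dots> = (sqrt a * sqrt a) * M1 * vnorm v" by (simp only: mult_ac)
    also have "\<dots> = a * M1 * vnorm v" using a by simp
    finally show "vnorm (S' *\<^sub>v v) \<le> a * M1 * vnorm v" .
  qed
  interpret R': gaussian_regression n p S' \<beta>' \<sigma>
    by unfold_locales (use n1 S' \<beta>' \<sigma> in auto)
  have V': "R'.V = V" unfolding R'.V_def V_def R'.q_def q' ..
  define \<Phi> where "\<Phi> z = compose {..<n} (mat_fun p L) z" for z :: "nat \<Rightarrow> nat \<Rightarrow> real"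
  have gl: "gaussian_law p S = distr (gaussian_law p S') (gaussian_law p S) (mat_fun p L)"
  proof -
    have "gaussian_law p S = distr (gaussian_law p S') (lebesgue_fun p) (mat_fun p L)"
      using gaussian_law_congruence[OF S'c sym_pos_def_det_nonzero[OF S'] L] by (simp add: LSL)
    also have "\<dots> = distr (gaussian_law p S') (gaussian_law p S) (mat_fun p L)"
      by (rule distr_cong) (auto simp: sets_gaussian_law)
    finally show ?thesis .
  qed
  have mfm: "mat_fun p L \<in> measurable (gaussian_law p S') (gaussian_law p S)"
    using measurable_mat_fun[of p L] by (simp cong: measurable_cong_sets add: sets_gaussian_law)
  have \<Phi>m: "\<Phi> \<in> measurable R'.D D"
    unfolding \<Phi>_def compose_def design_law_def
    by (rule measurable_restrict) (rule measurable_compose[OF _ mfm], rule measurable_component_singleton)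
  have dl: "D = distr R'.D D \<Phi>"
  proof -
    have "distr (PiM {..<n} (\<lambda>_. gaussian_law p S')) (PiM {..<n} (\<lambda>_. gaussian_law p S)) (compose {..<n} (mat_fun p L))
       = PiM {..<n} (\<lambda>_. distr (gaussian_law p S') (gaussian_law p S) (mat_fun p L))"
      by (rule distr_PiM_finite_prob_space') (auto intro: prob_space_gaussian_law S S' mfm)
    then show ?thesis by (simp add: design_law_def \<Phi>_def[abs_def] gl[symmetric])
  qed
  define \<Psi> where "\<Psi> = (\<lambda>(z, e). (\<Phi> z, e :: nat \<Rightarrow> real))"
  have \<Psi>m: "\<Psi> \<in> measurable R'.M M"
    unfolding \<Psi>_def model_law_def using \<Phi>m by measurable
  \<comment> \<open>The model law is the image of the whitened one under the rowwise map, with the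
    noise left alone, so probabilities of events can be computed on the whitened side.\<close>
  have ml: "M = distr R'.M M \<Psi>"
  proof -
    have "distr R'.D D \<Phi> \<Otimes>\<^sub>M distr E E (\<lambda>e. e) = distr (R'.D \<Otimes>\<^sub>M E) (D \<Otimes>\<^sub>M E) (\<lambda>(z, e). (\<Phi> z, e))"
      using E.sigma_finite_measure_axioms by (intro pair_measure_distr \<Phi>m) (auto simp: distr_id)
    then show ?thesis by (simp add: model_law_def \<Psi>_def dl[symmetric] distr_id)
  qed
  have dz: "design n p (\<Phi> z) = design n p z * Lt" for z
    using Lc by (intro eq_matI) (auto simp: design_def \<Phi>_def compose_def mat_fun_def Lt_def scalar_prod_lessThan[of _ p] mult.commute)
  have rz: "response n p \<beta> (\<Phi> z) e = response n p \<beta>' z e" for z e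
    unfolding response_def dz \<beta>'_def using Lt \<beta> by (simp add: assoc_mult_mat_vec[of _ n p _ p])
  \<comment> \<open>X A X' = Z (L' A L) Z' and L' A L = I: the statistic with \<open>A\<close> is
    literally the identity statistic of the whitened design.\<close>
  have ez: "eta_D (design n p (\<Phi> z)) Y A = eta_D (design n p z) Y (1\<^sub>m p)" for z Y
  proof -
    let ?Z = "design n p z"
    have Zc: "?Z \<in> carrier_mat n p" "transpose_mat ?Z \<in> carrier_mat p n" by auto
    have "?Z * Lt * A * transpose_mat (?Z * Lt) = ?Z * Lt * A * (L * transpose_mat ?Z)"
      using transpose_mult[OF Zc(1) Lt] by (simp add: Lt_def)
    also have "\<dots> = ?Z * ((Lt * (A * L)) * transpose_mat ?Z)"
      using Zc Lt Lc Ac(1) assoc_mult_mat[OF Zc(1) Lt Ac(1)]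
      by (simp add: assoc_mult_mat[of ?Z n p _ p _ n] assoc_mult_mat[of Lt p p _ p _ n] assoc_mult_mat[of A p p _ p _ n] assoc_mult_mat[of "Lt * A" p p L p "transpose_mat ?Z" n] assoc_mult_mat[of _ p p _ p _ p])
    also have "\<dots> = ?Z * 1\<^sub>m p * transpose_mat ?Z"
      by (simp only: LAL left_mult_one_mat[OF Zc(2)] right_mult_one_mat[OF Zc(1)])
    finally show ?thesis unfolding eta_D_def dz by (simp add: design_def)
  qed
  have mE: "(\<lambda>\<omega>. eta_D (design n p (fst \<omega>)) (response n p \<beta> (fst \<omega>) (snd \<omega>)) A) \<in> borel_measurable M"
    by (rule measurable_eta_D) (use Ac(1) in \<open>auto intro: measurable_model_entry measurable_model_noise\<close>)
  have mE': "(\<lambda>\<omega>. eta_D (design n p (fst \<omega>)) (response n p \<beta>' (fst \<omega>) (snd \<omega>)) (1\<^sub>m p)) \<in> borel_measurable R'.M"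
    by (rule R'.measurable_eta_D) (auto intro: measurable_model_entry measurable_model_noise)
  define target where "target = ((S *\<^sub>v \<beta>) \<bullet> (A *\<^sub>v (S *\<^sub>v \<beta>))) / V"
  define good where "good = {\<omega> \<in> space R'.M. \<bar>eta_D (design n p (fst \<omega>)) (response n p \<beta>' (fst \<omega>) (snd \<omega>)) (1\<^sub>m p) - target\<bar>
     \<le> C1 * op_norm S' * sqrt (real p * t) / real n}"
  have good: "1 - C2 * exp (- t) \<le> R'.M.prob good"
  proof -
    have pci: "1 \<le> n \<and> n \<le> p \<and> S' \<in> sym_pos_def p \<and> \<beta>' \<in> carrier_vec p \<and> 0 < \<sigma> \<and> 0 \<le> t \<and> t \<le> root 3 (real n)"
      using n1 np S' \<beta>' \<sigma> t by simp
    show ?thesis using pc[unfolded plug_in_constants_def, rule_format, OF pci]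
      unfolding R'.model_variance V' target good_def target_def .
  qed
  have goodm: "good \<in> R'.M.events" unfolding good_def using mE' by measurable
  let ?bad = "{\<omega> \<in> space M. C1 * (a * M1) * sqrt (real p * t) / real n
      < \<bar>eta_D (design n p (fst \<omega>)) (response n p \<beta> (fst \<omega>) (snd \<omega>)) A - target\<bar>}"
  have badm: "?bad \<in> sets M" using mE by measurable
  have "emeasure M ?bad = emeasure R'.M (\<Psi> -` ?bad \<inter> space R'.M)"
    by (subst ml) (rule emeasure_distr[OF \<Psi>m badm])
  also have "\<dots> \<le> emeasure R'.M (space R'.M - good)"
  proof (rule emeasure_mono)
    show "\<Psi> -` ?bad \<inter> space R'.M \<subseteq> space R'.M - good"
    proof
      fix \<omega> assume \<omega>: "\<omega> \<in> \<Psi> -` ?bad \<inter> space R'.M"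
      obtain z e where ze: "\<omega> = (z, e)" by fastforce
      have "C1 * op_norm S' * sqrt (real p * t) / real n \<le> C1 * (a * M1) * sqrt (real p * t) / real n"
        using op C1 t n_pos by (intro divide_right_mono mult_right_mono mult_left_mono) auto
      then have "\<omega> \<notin> good" using \<omega> by (auto simp: ze good_def \<Psi>_def ez rz)
      then show "\<omega> \<in> space R'.M - good" using \<omega> by simp
    qed
  qed (use goodm in auto)
  also have "\<dots> = ennreal (1 - R'.M.prob good)" using R'.M.prob_compl[OF goodm] by (simp add: R'.M.emeasure_eq_measure)
  also have "\<dots> \<le> ennreal (C2 * exp (- t))" using good by (intro ennreal_leI) simp
  finally show ?thesis by (simp add: target_def)
qed

end

section \<open>The CLIME estimate and its good event\<close>

lemma clime_sym_carrier: "A \<in> carrier_mat p p \<Longrightarrow> clime_sym A \<in> carrier_mat p p"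
  by (simp add: clime_sym_def)

lemma clime_solution_carrier:
  "clime_solution n p K M1 Om1 \<Longrightarrow> Om1 (design n p x) \<in> carrier_mat p p"
  unfolding clime_solution_def using design_carrier by blast

lemma sets_PiM_borel: "sets (PiM {..<n} (\<lambda>_. PiM {..<p} (\<lambda>_. borel))) = sets (PiM {..<n::nat} (\<lambda>_. lebesgue_fun p))"
  by (intro sets_PiM_cong refl) simp_all

lemma clime_entry_measurable:
  assumes cs: "clime_solution n p K M1 Om1" and ij: "i < p" "j < p"
  shows "(\<lambda>x. clime_sym (Om1 (design n p x)) $$ (i, j)) \<in> borel_measurable (design_law n p S)"
proof -
  have m: "(\<lambda>x. Om1 (design n p x) $$ (i, j)) \<in> borel_measurable (design_law n p S)" if "i < p" "j < p" for i j
    using cs that unfolding clime_solution_def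
    by (simp cong: measurable_cong_sets add: sets_design_law sets_PiM_borel)
  have "clime_sym (Om1 (design n p x)) $$ (i, j) = (if \<bar>Om1 (design n p x) $$ (i, j)\<bar> \<le> \<bar>Om1 (design n p x) $$ (j, i)\<bar>
      then Om1 (design n p x) $$ (i, j) else Om1 (design n p x) $$ (j, i))" for x
    using clime_solution_carrier[OF cs, of x] ij by (auto simp: clime_sym_def)
  then show ?thesis using m[OF ij] m[OF ij(2,1)] by simp
qed

lemma prec_class_M1_ge_1:
  assumes "S \<in> sym_pos_def p" "inv_mat S \<in> prec_class n p K M1" "0 < M1" "1 \<le> p"
  shows "1 \<le> M1"
proof -
  have "(unit_vec p 0 \<bullet> unit_vec p 0) / M1 \<le> M1 * (unit_vec p 0 \<bullet> (unit_vec p 0 :: real vec))"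
    using prec_class_quad_ge[OF assms(1-3), of "unit_vec p 0"] prec_class_quad_le[OF assms(1-3), of "unit_vec p 0"] by simp
  then have "1\<^sup>2 \<le> M1\<^sup>2" using assms(3,4) by (simp add: field_simps power2_eq_square)
  then show ?thesis by (rule power2_le_imp_le) (use assms(3) in simp)
qed

text \<open>For \<open>p \<ge> 5\<close> the guaranteed probability 1 - 4 / p is positive. The event
  is then nonempty, and since operator norms are nonnegative, the constant cannot be
  negative.\<close>

lemma clime_constant_event:
  assumes cc: "clime_constant C3" and S: "S \<in> sym_pos_def p" and prec: "inv_mat S \<in> prec_class n p K M1"
    and n: "1 \<le> n" and p: "5 \<le> p" and K: "0 < K" and M1: "0 < M1" and lnp: "ln (real p) \<le> real n / 8" and cs: "clime_solution n p K M1 Om1"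
  shows "0 \<le> C3"
    and "{x \<in> space (design_law n p S). op_norm (clime_sym (Om1 (design n p x)) - inv_mat S)
      \<le> C3 * K\<^sup>2 * M1\<^sup>2 * sqrt (real p) / real n} \<in> sets (design_law n p S)"
    and "emeasure (design_law n p S) (space (design_law n p S) - {x \<in> space (design_law n p S).
      op_norm (clime_sym (Om1 (design n p x)) - inv_mat S) \<le> C3 * K\<^sup>2 * M1\<^sup>2 * sqrt (real p) / real n}) \<le> ennreal (4 / real p)"
proof -
  interpret prob_space "design_law n p S" by (rule prob_space_design_law[OF S])
  define G where "G = {x \<in> space (design_law n p S). op_norm (clime_sym (Om1 (design n p x)) - inv_mat S)
      \<le> C3 * K\<^sup>2 * M1\<^sup>2 * sqrt (real p) / real n}"
  have p1: "1 \<le> p" using p by simp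
  have h: "1 \<le> n \<and> 1 \<le> p \<and> 0 < K \<and> 0 < M1 \<and> S \<in> sym_pos_def p \<and> ln (real p) \<le> real n / 8 \<and>
      inv_mat S \<in> prec_class n p K M1 \<and> clime_solution n p K M1 Om1" by (intro conjI n p1 K M1 S lnp prec cs)
  have pr: "1 - 4 / real p \<le> prob G"
    unfolding G_def using cc[unfolded clime_constant_def, rule_format, OF h] .
  have "4 / real p < 1" using p by simp
  then have pos: "0 < prob G" using pr by simp
  \<comment> \<open>\<open>measure\<close> is 0 on nonmeasurable sets, so a set of positive measure
    is an event. This replaces a proof that the operator norm is a measurable function of the
    entries.\<close>
  have Gm: "G \<in> events"
  proof (rule ccontr)
    assume "G \<notin> events"
    then have "prob G = 0" by (rule measure_notin_sets)
    then show False using pos by simp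
  qed
  then show "{x \<in> space (design_law n p S). op_norm (clime_sym (Om1 (design n p x)) - inv_mat S)
      \<le> C3 * K\<^sup>2 * M1\<^sup>2 * sqrt (real p) / real n} \<in> sets (design_law n p S)" unfolding G_def .
  have "emeasure (design_law n p S) (space (design_law n p S) - G) = ennreal (1 - prob G)"
    using prob_compl[OF Gm] by (simp add: emeasure_eq_measure)
  also have "\<dots> \<le> ennreal (4 / real p)" using pr by (intro ennreal_leI) simp
  finally have le: "emeasure (design_law n p S) (space (design_law n p S) - G) \<le> ennreal (4 / real p)" .
  then show "emeasure (design_law n p S) (space (design_law n p S) - {x \<in> space (design_law n p S).
      op_norm (clime_sym (Om1 (design n p x)) - inv_mat S) \<le> C3 * K\<^sup>2 * M1\<^sup>2 * sqrt (real p) / real n}) \<le> ennreal (4 / real p)"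
    unfolding G_def .
  show "0 \<le> C3"
  proof (rule ccontr)
    assume neg: "\<not> 0 \<le> C3"
    have "G \<noteq> {}" using pos by auto
    then obtain x where x: "x \<in> G" by blast
    have "0 < K\<^sup>2 * M1\<^sup>2 * sqrt (real p) / real n" using n p1 K M1 by simp
    then have "C3 * (K\<^sup>2 * M1\<^sup>2 * sqrt (real p) / real n) < 0" using neg by (intro mult_neg_pos) auto
    moreover have "0 \<le> op_norm (clime_sym (Om1 (design n p x)) - inv_mat S)"
      by (rule op_norm_nonneg[of _ p p])
        (use sym_pos_defD(1)[OF inv_mat_sym_pos_def[OF S]] clime_sym_carrier[OF clime_solution_carrier[OF cs, of x]] p1 in auto)
    ultimately show False using x by (simp add: G_def mult.assoc)
  qed
qed

context regression_model
begin

lemma measurable_eta_CL: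
  assumes cs: "clime_solution n p K M1' Om1"
  shows "(\<lambda>z. eta_D (design n p (fst (fst z))) (response n p \<beta> (fst (fst z)) (snd (fst z))) (clime_sym (Om1 (design n p (snd z)))))
     \<in> borel_measurable (M \<Otimes>\<^sub>M D)"
proof (rule measurable_eta_D)
  show "(\<lambda>z. fst (fst z) i j) \<in> borel_measurable (M \<Otimes>\<^sub>M D)" if "i < n" "j < p" for i j
    using measurable_compose[OF measurable_fst measurable_model_entry[OF that]] .
  show "(\<lambda>z. snd (fst z) i) \<in> borel_measurable (M \<Otimes>\<^sub>M D)" if "i < n" for i
    using measurable_compose[OF measurable_fst measurable_model_noise[OF that]] .
  show "(\<lambda>z. clime_sym (Om1 (design n p (snd z))) $$ (i, j)) \<in> borel_measurable (M \<Otimes>\<^sub>M D)" if "i < p" "j < p" for i j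
    using measurable_compose[OF measurable_snd clime_entry_measurable[OF cs that]] .
  show "clime_sym (Om1 (design n p (snd z))) \<in> carrier_mat p p" for z
    by (intro clime_sym_carrier clime_solution_carrier[OF cs])
qed

text \<open>The condition 2 M1 \<delta> < 1 keeps the perturbed form within \<delta> < 1 / M1 of the
  precision form: it stays positive and below 2 M1 times the squared norm. Hence the whitened bound
  applies with a = 2 M1, and the second term \<delta> M1 is the displacement of the target.\<close>

lemma plug_in_perturbed:
  assumes pc: "plug_in_constants C1 C2" and np: "n \<le> p" and prec: "inv_mat S \<in> prec_class n p K M1"
    and C1: "0 \<le> C1" and t: "0 \<le> t" "t \<le> root 3 (real n)" and A: "A \<in> carrier_mat p p"
    and \<delta>: "op_norm (A - inv_mat S) \<le> \<delta>" "2 * M1 * \<delta> < 1"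
  shows "emeasure M {\<omega> \<in> space M. 2 * C1 * M1\<^sup>2 * sqrt (real p * t) / real n + \<delta> * M1
      < \<bar>eta_D (design n p (fst \<omega>)) (response n p \<beta> (fst \<omega>) (snd \<omega>)) A - eta S \<beta> \<sigma>\<bar>} \<le> ennreal (C2 * exp (- t))"
proof -
  have p1: "1 \<le> p" using n1 np by simp
  have M11: "1 \<le> M1" by (rule prec_class_M1_ge_1[OF S prec M1 p1])
  define Q where "Q = inv_mat S"
  have Qs: "Q \<in> sym_pos_def p" unfolding Q_def by (rule inv_mat_sym_pos_def[OF S])
  note Qc = sym_pos_defD[OF Qs] and Sc = sym_pos_defD[OF S]
  have QS: "Q *\<^sub>v (S *\<^sub>v v) = v" if v: "v \<in> carrier_vec p" for v
    using inv_mat_works[OF Sc(1) sym_pos_def_det_nonzero[OF S]] Sc(1) v unfolding Q_def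
    by (metis assoc_mult_mat_vec one_mult_mat_vec)
  have Qge: "(v \<bullet> v) / M1 \<le> v \<bullet> (Q *\<^sub>v v)" and Qle: "v \<bullet> (Q *\<^sub>v v) \<le> M1 * (v \<bullet> v)" if "v \<in> carrier_vec p" for v
    using prec_class_quad_ge[OF S prec M1 that] prec_class_quad_le[OF S prec M1 that] by (auto simp: Q_def)
  \<comment> \<open>The given matrix may be unsymmetric; its symmetric part has the same quadratic
    form and yields the same statistic.\<close>
  define B where "B = (1 / 2) \<cdot>\<^sub>m (A + transpose_mat A)"
  have B: "B \<in> carrier_mat p p" using A by (simp add: B_def)
  have Bt: "transpose_mat B = B" using A by (intro eq_matI) (auto simp: B_def)
  have Bq: "v \<bullet> (B *\<^sub>v v) = v \<bullet> (A *\<^sub>v v)" if v: "v \<in> carrier_vec p" for v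
  proof -
    have t': "v \<bullet> (transpose_mat A *\<^sub>v v) = v \<bullet> (A *\<^sub>v v)"
    proof -
      have "v \<bullet> (transpose_mat A *\<^sub>v v) = (transpose_mat A *\<^sub>v v) \<bullet> v" using A v by (intro comm_scalar_prod[of _ p]) auto
      also have "\<dots> = v \<bullet> (A *\<^sub>v v)" using A v by (intro transpose_vec_mult_scalar) auto
      finally show ?thesis .
    qed
    have "B *\<^sub>v v = (1 / 2) \<cdot>\<^sub>v ((A + transpose_mat A) *\<^sub>v v)" unfolding B_def using A v
      by (intro eq_vecI) auto
    also have "(A + transpose_mat A) *\<^sub>v v = A *\<^sub>v v + transpose_mat A *\<^sub>v v" using A v by (intro add_mult_distrib_mat_vec) auto
    finally show ?thesis using A v t' by (simp add: scalar_prod_add_distrib[of _ p])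
  qed
  have dev: "\<bar>v \<bullet> (A *\<^sub>v v) - v \<bullet> (Q *\<^sub>v v)\<bar> \<le> \<delta> * (v \<bullet> v)" if v: "v \<in> carrier_vec p" for v
  proof -
    have AQ: "A - Q \<in> carrier_mat p p" using A Qc(1) by (intro minus_carrier_mat) auto
    have "(A - Q) *\<^sub>v v = A *\<^sub>v v - Q *\<^sub>v v" using A Qc(1) v by (intro minus_mult_distrib_mat_vec) auto
    then have "v \<bullet> (A *\<^sub>v v) - v \<bullet> (Q *\<^sub>v v) = v \<bullet> ((A - Q) *\<^sub>v v)"
      using A Qc(1) v by (simp add: scalar_prod_minus_distrib[of _ p])
    also have "\<bar>\<dots>\<bar> \<le> vnorm v * vnorm ((A - Q) *\<^sub>v v)" using AQ v by (intro abs_sprod_le[of _ p]) auto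
    also have "\<dots> \<le> vnorm v * (op_norm (A - Q) * vnorm v)" by (intro mult_left_mono vnorm_mult_le_op_norm[OF AQ v]) simp
    also have "\<dots> \<le> vnorm v * (\<delta> * vnorm v)" using \<delta>(1) by (intro mult_left_mono mult_right_mono) (auto simp: Q_def)
    also have "\<dots> = \<delta> * (v \<bullet> v)" using vnorm_sq[of v] by (simp add: power2_eq_square)
    finally show ?thesis .
  qed
  have \<delta>0: "0 \<le> \<delta>"
    using \<delta>(1) op_norm_nonneg[of "A - inv_mat S" p p] A Qc(1) p1 minus_carrier_mat[of "inv_mat S" p p A] by (auto simp: Q_def)
  have \<delta>M: "\<delta> < 1 / M1" using \<delta>(2) M1 \<delta>0 by (simp add: field_simps)
  have Bspd: "B \<in> sym_pos_def p"
  proof -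
    have "0 < v \<bullet> (B *\<^sub>v v)" if v: "v \<in> carrier_vec p" "v \<noteq> 0\<^sub>v p" for v
    proof -
      have "\<delta> * (v \<bullet> v) < 1 / M1 * (v \<bullet> v)" using \<delta>M sprod_pos[OF v] by (rule mult_strict_right_mono)
      then show ?thesis using dev[OF v(1)] Qge[OF v(1)] unfolding Bq[OF v(1)] by (auto simp: abs_le_iff)
    qed
    then show ?thesis using B Bt by (simp add: sym_pos_def_def)
  qed
  have Ble: "v \<bullet> (B *\<^sub>v v) \<le> 2 * M1 * (v \<bullet> v)" if v: "v \<in> carrier_vec p" for v
  proof -
    have "1 / M1 \<le> M1" using M11 by (simp add: divide_le_eq mult_ge1_I)
    then have "\<delta> * (v \<bullet> v) \<le> M1 * (v \<bullet> v)" using \<delta>M by (intro mult_right_mono) (auto simp: sprod_self_nonneg)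
    then show ?thesis using dev[OF v] Qle[OF v] unfolding Bq[OF v] by (auto simp: abs_le_iff)
  qed
  define w where "w = S *\<^sub>v \<beta>"
  have w: "w \<in> carrier_vec p" using Sc(1) \<beta> by (simp add: w_def)
  have wQ: "w \<bullet> (Q *\<^sub>v w) = q" unfolding w_def QS[OF \<beta>] q_def using Sc(1) \<beta> by (intro comm_scalar_prod[of _ p]) auto
  \<comment> \<open>With w = S \<beta> the precision form at w is q and |w|^2 \<le> M1 q. Hence a
    form error of \<delta> |w|^2 is at most \<delta> M1 V, and division by V removes the dependence
    on the signal.\<close>
  have target: "\<bar>(w \<bullet> (B *\<^sub>v w)) / V - eta S \<beta> \<sigma>\<bar> \<le> \<delta> * M1"
  proof -
    have "\<bar>w \<bullet> (B *\<^sub>v w) - q\<bar> \<le> \<delta> * (w \<bullet> w)" using dev[OF w] by (simp add: Bq[OF w] wQ)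
    also have "\<dots> \<le> \<delta> * (M1 * q)" using Qge[OF w] M1 \<delta>0 by (intro mult_left_mono) (auto simp: wQ field_simps)
    also have "\<dots> \<le> \<delta> * (M1 * V)" using \<delta>0 M1 by (intro mult_left_mono) (auto simp: V_def)
    finally have "\<bar>w \<bullet> (B *\<^sub>v w) - q\<bar> / V \<le> \<delta> * M1" using V_pos by (simp add: pos_divide_le_eq mult.assoc)
    moreover have "(w \<bullet> (B *\<^sub>v w)) / V - eta S \<beta> \<sigma> = (w \<bullet> (B *\<^sub>v w) - q) / V" by (simp add: eta_eq diff_divide_distrib)
    ultimately show ?thesis using V_pos by simp
  qed
  let ?\<eta> = "\<lambda>\<omega>. eta_D (design n p (fst \<omega>)) (response n p \<beta> (fst \<omega>) (snd \<omega>)) B"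
  have eqAB: "eta_D (design n p (fst \<omega>)) (response n p \<beta> (fst \<omega>) (snd \<omega>)) A = ?\<eta> \<omega>" for \<omega>
    unfolding B_def by (rule eta_D_symmetric_part[OF A response_carrier, symmetric])
  have mB: "?\<eta> \<in> borel_measurable M"
    by (rule measurable_eta_D) (use B in \<open>auto intro: measurable_model_entry measurable_model_noise\<close>)
  have "emeasure M {\<omega> \<in> space M. 2 * C1 * M1\<^sup>2 * sqrt (real p * t) / real n + \<delta> * M1 < \<bar>?\<eta> \<omega> - eta S \<beta> \<sigma>\<bar>}
     \<le> emeasure M {\<omega> \<in> space M. C1 * ((2 * M1) * M1) * sqrt (real p * t) / real n < \<bar>?\<eta> \<omega> - (w \<bullet> (B *\<^sub>v w)) / V\<bar>}"
  proof (rule emeasure_mono)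
    show "{\<omega> \<in> space M. C1 * ((2 * M1) * M1) * sqrt (real p * t) / real n < \<bar>?\<eta> \<omega> - (w \<bullet> (B *\<^sub>v w)) / V\<bar>} \<in> sets M"
      using mB by measurable
    show "{\<omega> \<in> space M. 2 * C1 * M1\<^sup>2 * sqrt (real p * t) / real n + \<delta> * M1 < \<bar>?\<eta> \<omega> - eta S \<beta> \<sigma>\<bar>}
      \<subseteq> {\<omega> \<in> space M. C1 * ((2 * M1) * M1) * sqrt (real p * t) / real n < \<bar>?\<eta> \<omega> - (w \<bullet> (B *\<^sub>v w)) / V\<bar>}"
    proof
      fix \<omega> assume "\<omega> \<in> {\<omega> \<in> space M. 2 * C1 * M1\<^sup>2 * sqrt (real p * t) / real n + \<delta> * M1 < \<bar>?\<eta> \<omega> - eta S \<beta> \<sigma>\<bar>}"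
      then have 1: "\<omega> \<in> space M" and 2: "2 * C1 * M1\<^sup>2 * sqrt (real p * t) / real n + \<delta> * M1 < \<bar>?\<eta> \<omega> - eta S \<beta> \<sigma>\<bar>" by auto
      have "\<bar>?\<eta> \<omega> - eta S \<beta> \<sigma>\<bar> \<le> \<bar>?\<eta> \<omega> - (w \<bullet> (B *\<^sub>v w)) / V\<bar> + \<bar>(w \<bullet> (B *\<^sub>v w)) / V - eta S \<beta> \<sigma>\<bar>"
        using abs_triangle_ineq[of "?\<eta> \<omega> - (w \<bullet> (B *\<^sub>v w)) / V" "(w \<bullet> (B *\<^sub>v w)) / V - eta S \<beta> \<sigma>"] by simp
      then have "2 * C1 * M1\<^sup>2 * sqrt (real p * t) / real n < \<bar>?\<eta> \<omega> - (w \<bullet> (B *\<^sub>v w)) / V\<bar>" using 2 target by simp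
      moreover have eq: "C1 * ((2 * M1) * M1) = 2 * C1 * M1\<^sup>2" by (simp add: power2_eq_square)
      ultimately show "\<omega> \<in> {\<omega> \<in> space M. C1 * ((2 * M1) * M1) * sqrt (real p * t) / real n < \<bar>?\<eta> \<omega> - (w \<bullet> (B *\<^sub>v w)) / V\<bar>}"
        using 1 by (simp only: eq mem_Collect_eq simp_thms)
    qed
  qed
  also have "\<dots> \<le> ennreal (C2 * exp (- t))"
    unfolding w_def
    by (rule plug_in_general[OF pc np Bspd Ble _ cov_vnorm_le[OF S prec M1] C1 t]) (use M1 in auto)
  finally show ?thesis unfolding eqAB .
qed

text \<open>Fubini with the second sample outside: once it is fixed, the CLIME matrix is
  deterministic and independent of the first sample, so \<open>plug_in_perturbed\<close> applies to
  each section. Bad second samples are charged with full measure.\<close>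

lemma clime_bad_event:
  assumes pc: "plug_in_constants C1 C2" and cc: "clime_constant C3" and np: "n \<le> p" and p5: "5 \<le> p"
    and K: "0 < K" and prec: "inv_mat S \<in> prec_class n p K M1" and cs: "clime_solution n p K M1 Om1"
    and lnp: "1 \<le> ln (real p)" "ln (real p) \<le> real n / 8"
    and C1: "0 \<le> C1" and t: "0 \<le> t" "t \<le> root 3 (real n)" "t \<le> ln (real p)"
    and tau: "c0 C1 C3 K M1 * sqrt (real p * ln (real p)) / real n < 1"
  shows "\<exists>B\<in>sets (M \<Otimes>\<^sub>M D). emeasure (M \<Otimes>\<^sub>M D) B \<le> ennreal (4 / real p) + ennreal (C2 * exp (- t)) \<and>
    (\<forall>x e x2. ((x, e), x2) \<in> space (M \<Otimes>\<^sub>M D) - B \<longrightarrow>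
      \<bar>eta_D (design n p x) (response n p \<beta> x e) (clime_sym (Om1 (design n p x2))) - eta S \<beta> \<sigma>\<bar>
        \<le> c0 C1 C3 K M1 * sqrt (real p * ln (real p)) / real n / 2)"
proof -
  interpret MD: pair_prob_space M D ..
  define \<tau> where "\<tau> = c0 C1 C3 K M1 * sqrt (real p * ln (real p)) / real n"
  define \<delta> where "\<delta> = C3 * K\<^sup>2 * M1\<^sup>2 * sqrt (real p) / real n"
  define A where "A x2 = clime_sym (Om1 (design n p x2))" for x2
  define G where "G = {x \<in> space D. op_norm (A x - inv_mat S) \<le> \<delta>}"
  note nn = clime_constant_event[OF cc S prec n1 p5 K M1 lnp(2) cs]
  have C3: "0 \<le> C3" by (rule nn(1))
  have G: "G \<in> sets D" "emeasure D (space D - G) \<le> ennreal (4 / real p)"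
    unfolding G_def A_def \<delta>_def by (rule nn(2), rule nn(3))
  have Ac: "A x2 \<in> carrier_mat p p" for x2 unfolding A_def by (intro clime_sym_carrier clime_solution_carrier[OF cs])
  have sp: "sqrt (real p) \<le> sqrt (real p * ln (real p))"
    using lnp(1) by (intro real_sqrt_le_mono) (simp add: mult_le_cancel_left1)
  have st: "sqrt (real p * t) \<le> sqrt (real p * ln (real p))"
    using t(3) by (intro real_sqrt_le_mono mult_left_mono) auto
  have tau2: "\<tau> / 2 = 2 * C1 * M1\<^sup>2 * sqrt (real p * ln (real p)) / real n + C3 * K\<^sup>2 * M1 ^ 3 * sqrt (real p * ln (real p)) / real n"
  proof -
    have h: "c0 C1 C3 K M1 / 2 = 2 * C1 * M1\<^sup>2 + C3 * K\<^sup>2 * M1 ^ 3" by (simp add: c0_def)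
    have "\<tau> / 2 = (c0 C1 C3 K M1 / 2) * sqrt (real p * ln (real p)) / real n" by (simp add: \<tau>_def)
    then show ?thesis unfolding h by (simp only: distrib_right add_divide_distrib)
  qed
  have \<delta>M: "\<delta> * M1 \<le> C3 * K\<^sup>2 * M1 ^ 3 * sqrt (real p * ln (real p)) / real n"
  proof -
    have "\<delta> * M1 = C3 * K\<^sup>2 * M1 ^ 3 * sqrt (real p) / real n" by (simp add: \<delta>_def power2_eq_square power3_eq_cube)
    also have "\<dots> \<le> C3 * K\<^sup>2 * M1 ^ 3 * sqrt (real p * ln (real p)) / real n"
      using sp C3 M1 K by (intro divide_right_mono mult_left_mono) auto
    finally show ?thesis .
  qed
  have c1nn: "0 \<le> 2 * C1 * M1\<^sup>2 * sqrt (real p * ln (real p)) / real n" using C1 lnp by simp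
  \<comment> \<open>The CLIME part of \<open>c0\<close> makes 2 M1 \<delta> at most the threshold,
    so a threshold below 1 secures positive definiteness. Here \<open>1 \<le> ln (real p)\<close>
    compares sqrt p with sqrt (p ln p).\<close>
  have \<delta>1: "2 * M1 * \<delta> < 1"
  proof -
    have "2 * (\<delta> * M1) \<le> 2 * (\<tau> / 2)" using \<delta>M c1nn unfolding tau2 by simp
    then show ?thesis using tau by (simp add: \<tau>_def mult_ac)
  qed
  have thr: "2 * C1 * M1\<^sup>2 * sqrt (real p * t) / real n + \<delta> * M1 \<le> \<tau> / 2"
    unfolding tau2 using st C1 by (intro add_mono \<delta>M divide_right_mono mult_left_mono) auto
  let ?\<eta> = "\<lambda>z. eta_D (design n p (fst (fst z))) (response n p \<beta> (fst (fst z)) (snd (fst z))) (A (snd z))"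
  have m [measurable]: "?\<eta> \<in> borel_measurable (M \<Otimes>\<^sub>M D)" unfolding A_def by (rule measurable_eta_CL[OF cs])
  define B where "B = {z \<in> space (M \<Otimes>\<^sub>M D). \<tau> / 2 < \<bar>?\<eta> z - eta S \<beta> \<sigma>\<bar>}"
  have B: "B \<in> sets (M \<Otimes>\<^sub>M D)" unfolding B_def by measurable
  have "emeasure (M \<Otimes>\<^sub>M D) B = (\<integral>\<^sup>+x2. emeasure M ((\<lambda>\<omega>. (\<omega>, x2)) -` B) \<partial>D)"
    by (rule MD.emeasure_pair_measure_alt2[OF B])
  also have "\<dots> \<le> (\<integral>\<^sup>+x2. indicator (space D - G) x2 + ennreal (C2 * exp (- t)) \<partial>D)"
  proof (rule nn_integral_mono)
    fix x2 assume x2: "x2 \<in> space D"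
    show "emeasure M ((\<lambda>\<omega>. (\<omega>, x2)) -` B) \<le> indicator (space D - G) x2 + ennreal (C2 * exp (- t))"
    proof (cases "x2 \<in> G")
      case False
      then have "emeasure M ((\<lambda>\<omega>. (\<omega>, x2)) -` B) \<le> indicator (space D - G) x2"
        using x2 M.emeasure_le_1 by simp
      then show ?thesis by (rule order_trans) simp
    next
      case True
      let ?H = "\<lambda>c. {\<omega> \<in> space M. c < \<bar>eta_D (design n p (fst \<omega>)) (response n p \<beta> (fst \<omega>) (snd \<omega>)) (A x2) - eta S \<beta> \<sigma>\<bar>}"
      have mA: "(\<lambda>\<omega>. eta_D (design n p (fst \<omega>)) (response n p \<beta> (fst \<omega>) (snd \<omega>)) (A x2)) \<in> borel_measurable M"
        by (rule measurable_eta_D) (use Ac in \<open>auto intro: measurable_model_entry measurable_model_noise\<close>)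
      have "(\<lambda>\<omega>. (\<omega>, x2)) -` B = ?H (\<tau> / 2)" using x2 by (auto simp: B_def space_pair_measure)
      then have "emeasure M ((\<lambda>\<omega>. (\<omega>, x2)) -` B) = emeasure M (?H (\<tau> / 2))" by simp
      also have "\<dots> \<le> emeasure M (?H (2 * C1 * M1\<^sup>2 * sqrt (real p * t) / real n + \<delta> * M1))"
      proof (rule emeasure_mono)
        show "?H (\<tau> / 2) \<subseteq> ?H (2 * C1 * M1\<^sup>2 * sqrt (real p * t) / real n + \<delta> * M1)" using thr by auto
        show "?H (2 * C1 * M1\<^sup>2 * sqrt (real p * t) / real n + \<delta> * M1) \<in> sets M" using mA by measurable
      qed
      also have "\<dots> \<le> ennreal (C2 * exp (- t))"
        using True by (intro plug_in_perturbed[OF pc np prec C1 t(1,2) Ac _ \<delta>1]) (simp add: G_def)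
      finally show ?thesis by (rule order_trans) simp
    qed
  qed
  also have "\<dots> = emeasure D (space D - G) + ennreal (C2 * exp (- t))"
    using G(1) by (subst nn_integral_add) (auto simp: D.emeasure_space_1)
  also have "\<dots> \<le> ennreal (4 / real p) + ennreal (C2 * exp (- t))" using G(2) by (rule add_right_mono)
  finally have le: "emeasure (M \<Otimes>\<^sub>M D) B \<le> ennreal (4 / real p) + ennreal (C2 * exp (- t))" .
  have "\<bar>eta_D (design n p x) (response n p \<beta> x e) (A x2) - eta S \<beta> \<sigma>\<bar> \<le> \<tau> / 2"
    if z: "((x, e), x2) \<in> space (M \<Otimes>\<^sub>M D) - B" for x e x2
  proof (rule ccontr)
    assume "\<not> ?thesis"
    then have "((x, e), x2) \<in> B" unfolding B_def using z by simp
    then show False using z by simp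
  qed
  then show ?thesis using B le unfolding A_def \<tau>_def by blast
qed

end

section \<open>The one-dimensional case\<close>

lemma nn_integral_pair_fst:
  assumes "prob_space B" "f \<in> borel_measurable A"
  shows "(\<integral>\<^sup>+z. f (fst z) \<partial>(A \<Otimes>\<^sub>M B)) = (\<integral>\<^sup>+x. f x \<partial>A)"
proof -
  interpret prob_space B by fact
  have "(\<lambda>z. f (fst z)) \<in> borel_measurable (A \<Otimes>\<^sub>M B)" using assms(2) by measurable
  from nn_integral_fst[OF this] show ?thesis by (simp add: emeasure_space_1)
qed

lemma nn_integral_pair_snd:
  assumes "prob_space A" "prob_space B" "f \<in> borel_measurable B"
  shows "(\<integral>\<^sup>+z. f (snd z) \<partial>(A \<Otimes>\<^sub>M B)) = (\<integral>\<^sup>+x. f x \<partial>B)"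
proof -
  interpret A: prob_space A by fact
  interpret B: prob_space B by fact
  have "(\<lambda>z. f (snd z)) \<in> borel_measurable (A \<Otimes>\<^sub>M B)" using assms(3) by measurable
  from B.nn_integral_fst[OF this] show ?thesis by (simp add: A.emeasure_space_1)
qed

text \<open>Truncation is the projection onto the unit interval and cannot increase the distance to
  a point of that interval.\<close>

lemma eta_D_T_error:
  assumes "0 \<le> h" "h \<le> 1"
  shows "\<bar>eta_D_T X Y A - h\<bar> \<le> \<bar>eta_D X Y A - h\<bar>"
  using assms by (auto simp: eta_D_T_def min_def max_def abs_if)

lemma eta_D_T_bounds: "0 \<le> eta_D_T X Y A" "eta_D_T X Y A \<le> 1"
  by (auto simp: eta_D_T_def)

text \<open>This is the shape of the one-dimensional estimator: \<open>r\<close> is the ratio of the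
  two sample variances, \<rho> the squared correlation. The factor n / (n + 1) costs at most 3 / n
  because r \<le> 3, and the shift by 1 / n costs another 1 / n.\<close>

lemma product_estimate_error:
  fixes n r \<rho> h :: real
  assumes n: "1 \<le> n" and r: "0 \<le> r" "r \<le> 3" and \<rho>: "0 \<le> \<rho>" "\<rho> \<le> 1"
  shows "\<bar>n / (n + 1) * r * (\<rho> - 1 / n) - h\<bar> \<le> \<bar>r - 1\<bar> + \<bar>\<rho> - h\<bar> + 4 / n"
proof -
  define j where "j = 1 / n"
  have j: "0 \<le> j" "j \<le> 1" using n by (auto simp: j_def)
  have d: "\<bar>\<rho> - j\<bar> \<le> 1" using \<rho> j by (auto simp: abs_le_iff)
  have f: "n / (n + 1) * r - 1 = (r - 1) - r / (n + 1)" using n by (simp add: field_simps)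
  have "r / (n + 1) \<le> 3 / n" using n r by (intro frac_le) auto
  moreover have "0 \<le> r / (n + 1)" using n r by simp
  ultimately have c: "\<bar>n / (n + 1) * r - 1\<bar> \<le> \<bar>r - 1\<bar> + 3 / n" unfolding f by linarith
  have tri: "\<bar>a + b - j\<bar> \<le> \<bar>a\<bar> + \<bar>b\<bar> + j" for a b using j(1) by linarith
  have "n / (n + 1) * r * (\<rho> - j) - h = (n / (n + 1) * r - 1) * (\<rho> - j) + (\<rho> - h) - j"
    by (simp only: left_diff_distrib mult_1)
  also have "\<bar>\<dots>\<bar> \<le> \<bar>(n / (n + 1) * r - 1) * (\<rho> - j)\<bar> + \<bar>\<rho> - h\<bar> + j" by (rule tri)
  also have "\<bar>(n / (n + 1) * r - 1) * (\<rho> - j)\<bar> \<le> (\<bar>r - 1\<bar> + 3 / n) * 1"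
    unfolding abs_mult using c d n by (intro mult_mono) auto
  finally show ?thesis unfolding j_def by (simp add: add_divide_distrib[symmetric])
qed

lemma ratio_error:
  fixes a b m :: real
  assumes m: "0 < m" and a: "4 * ((a - m)\<^sup>2 / m\<^sup>2) < 1" and b: "4 * ((b - m)\<^sup>2 / m\<^sup>2) < 1"
  shows "m / 2 < a" "m / 2 < b" "0 \<le> a / b" "a / b \<le> 3"
    "(a / b - 1)\<^sup>2 \<le> 8 * ((a - m)\<^sup>2 / m\<^sup>2) + 8 * ((b - m)\<^sup>2 / m\<^sup>2)"
proof -
  have half: "\<bar>c - m\<bar> < m / 2" if "4 * ((c - m)\<^sup>2 / m\<^sup>2) < 1" for c
  proof -
    have "(c - m)\<^sup>2 < (m / 2)\<^sup>2" using that m by (simp add: divide_less_eq power_divide)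
    then show ?thesis using m by (metis abs_le_square_iff abs_of_pos half_gt_zero linorder_not_less)
  qed
  show a1: "m / 2 < a" and b1: "m / 2 < b" using half[OF a] half[OF b] unfolding abs_diff_less_iff by auto
  have a2: "a < 3 / 2 * m" using half[OF a] unfolding abs_diff_less_iff by auto
  have bp: "0 < b" using b1 m by simp
  show "0 \<le> a / b" using a1 m bp by simp
  have "a \<le> 3 * b" using a2 b1 by simp
  then show "a / b \<le> 3" using bp by (simp add: divide_le_eq)
  have "(a / b - 1)\<^sup>2 = (a - b)\<^sup>2 / b\<^sup>2" using bp by (simp add: power_divide[symmetric] diff_divide_distrib)
  also have "\<dots> \<le> (2 * (a - m)\<^sup>2 + 2 * (b - m)\<^sup>2) / (m\<^sup>2 / 4)"
  proof (rule frac_le)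
    have "2 * (a - m)\<^sup>2 + 2 * (b - m)\<^sup>2 - (a - b)\<^sup>2 = ((a - m) + (b - m))\<^sup>2" by (simp add: power2_eq_square algebra_simps)
    also have "0 \<le> \<dots>" by simp
    finally show "(a - b)\<^sup>2 \<le> 2 * (a - m)\<^sup>2 + 2 * (b - m)\<^sup>2" by simp
    show "m\<^sup>2 / 4 \<le> b\<^sup>2" using power_mono[of "m / 2" b 2] b1 m by (simp add: power_divide)
  qed (use m in auto)
  also have "\<dots> = 8 * ((a - m)\<^sup>2 / m\<^sup>2) + 8 * ((b - m)\<^sup>2 / m\<^sup>2)" by (simp add: add_divide_distrib)
  finally show "(a / b - 1)\<^sup>2 \<le> 8 * ((a - m)\<^sup>2 / m\<^sup>2) + 8 * ((b - m)\<^sup>2 / m\<^sup>2)" .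
qed

text \<open>As ln 1 = 0, the slack of the CLIME constraint vanishes. The only feasible point is the
  reciprocal of the empirical variance, so minimisation has nothing left to choose.\<close>

lemma clime_one_dim:
  assumes cs: "clime_solution n 1 K M1 Om1" and N: "0 < (\<Sum>i<n. (x i 0)\<^sup>2)" and n: "1 \<le> n"
  shows "Om1 (design n 1 x) $$ (0, 0) = real n / (\<Sum>i<n. (x i 0)\<^sup>2)"
proof -
  define N where "N = (\<Sum>i<n. (x i 0)\<^sup>2)"
  have N0: "0 < N" using N by (simp add: N_def)
  let ?X = "design n 1 x"
  have XX: "transpose_mat ?X * ?X = mat 1 1 (\<lambda>_. N)"
    by (intro eq_matI) (auto simp: design_def scalar_prod_lessThan[of _ n] N_def power2_eq_square)
  have Gd: "((1 / real n) \<cdot>\<^sub>m (transpose_mat ?X * ?X) * A - 1\<^sub>m 1) = mat 1 1 (\<lambda>_. N / real n * A $$ (0, 0) - 1)"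
    if A: "A \<in> carrier_mat 1 1" for A
    unfolding XX using A by (intro eq_matI) (auto simp: scalar_prod_def)
  have el: "elements_mat (mat 1 1 (\<lambda>_. c)) = {c}" for c :: real by (auto simp: elements_mat_def)
  have feas: "clime_feasible K M1 ?X A \<longleftrightarrow> A \<in> carrier_mat 1 1 \<and> N / real n * A $$ (0, 0) = 1" for A
  proof (cases "A \<in> carrier_mat 1 1")
    case True
    have dims: "dim_row ?X = n" "dim_col ?X = 1" by (auto simp: design_def)
    show ?thesis unfolding clime_feasible_def Let_def dims Gd[OF True] max_entry_def el
      using True by (auto simp: clime_lambda_def)
  next
    case False
    then show ?thesis by (simp add: clime_feasible_def Let_def design_def)
  qed
  have "clime_feasible K M1 ?X (mat 1 1 (\<lambda>_. real n / N))" unfolding feas using N0 n by simp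
  then have "is_arg_min entry_l1 (clime_feasible K M1 ?X) (Om1 ?X)"
    using cs design_carrier unfolding clime_solution_def by blast
  then have "clime_feasible K M1 ?X (Om1 ?X)" by (simp add: is_arg_min_def)
  then have "N / real n * Om1 ?X $$ (0, 0) = 1" using feas by blast
  then show ?thesis using N0 n unfolding N_def[symmetric] by (simp add: field_simps)
qed

text \<open>The threshold is 0 for \<open>p = 1\<close>, so the Lasso value is selected only when it
  coincides with the plug-in value.\<close>

lemma eta_A_one_dim:
  assumes "X \<in> carrier_mat n 1"
  shows "eta_A C1 C3 K M1 Om1 sl X Y X2 = eta_D_T X Y (clime_sym (Om1 X2))"
  using assms by (auto simp: eta_A_def Let_def)

context regression_model
begin

text \<open>The statistic factorises into n / (n + 1), the ratio N / N2 of the empirical energies of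
  the two samples, and \<rho> - 1 / n. The error then has four parts, bounded by the sum of four
  squares: the ratio, the noise fraction, the overfit \<open>w\<close> and an O(1 / n) bias.\<close>

lemma one_dim_good:
  assumes p: "p = 1" and A: "A \<in> carrier_mat 1 1" "A $$ (0, 0) = real n / N2"
    and N_def: "N = energy n p (unit_vec p 0) x" and s_def: "s = unit_vec p 0 \<bullet> (S *\<^sub>v unit_vec p 0)"
    and u: "4 * rel_noise (x, e) < 1" "4 * rel_response (x, e) < 1"
    and v: "4 * ((N - real n * s)\<^sup>2 / (real n * s)\<^sup>2) < 1" "4 * ((N2 - real n * s)\<^sup>2 / (real n * s)\<^sup>2) < 1"
  shows "(eta_D (design n p x) (response n p \<beta> x e) A - eta S \<beta> \<sigma>)\<^sup>2 \<le>
    32 * rel_noise (x, e) + 32 * rel_response (x, e) + 32 * ((N - real n * s)\<^sup>2 / (real n * s)\<^sup>2)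
    + 32 * ((N2 - real n * s)\<^sup>2 / (real n * s)\<^sup>2) + 48 * ((\<Sum>i<n. x i 0 * e i)\<^sup>2 / ((real n)\<^sup>2 * s * V)) + 64 / real n"
proof -
  have spos: "0 < s" unfolding s_def
  proof (rule sym_pos_defD(3)[OF S])
    show "unit_vec p 0 \<noteq> (0\<^sub>v p :: real vec)" using p by (metis index_unit_vec(2) index_zero_vec(1) less_one zero_neq_one)
  qed simp
  have ns: "0 < real n * s" using spos n_pos by simp
  note dev = deviation_small[OF u] and rat = ratio_error[OF ns v]
  have Npos: "0 < N" using rat(1) ns by simp
  have NN: "N = (\<Sum>i<n. (x i 0)\<^sup>2)" unfolding N_def using p by (simp add: energy_def scalar_prod_right_unit)
  define Y where "Y = response n p \<beta> x e"
  define b where "b = \<beta> $ 0"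
  have Yc: "Y \<in> carrier_vec n" unfolding Y_def by (rule response_carrier)
  have Yi: "Y $ i = x i 0 * b + e i" if "i < n" for i
    unfolding Y_def response_vec using that \<beta> p by (simp add: b_def scalar_prod_lessThan[of _ "Suc 0"])
  define Y2 where "Y2 = sq_response x e"
  define E2 where "E2 = sq_noise e"
  define c where "c = (\<Sum>i<n. x i 0 * e i)"
  have YY: "Y \<bullet> Y = Y2" unfolding Y_def Y2_def vnorm_response[symmetric] vnorm_sq ..
  have Y2e: "Y2 = b\<^sup>2 * N + 2 * b * c + E2"
  proof -
    have "Y2 = (\<Sum>i<n. (x i 0 * b + e i)\<^sup>2)"
      unfolding YY[symmetric] scalar_prod_lessThan[OF Yc] using Yi by (intro sum.cong) (auto simp: power2_eq_square)
    also have "\<dots> = (\<Sum>i<n. b\<^sup>2 * (x i 0)\<^sup>2 + 2 * b * (x i 0 * e i) + (e i)\<^sup>2)"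
      by (intro sum.cong refl) (simp add: power2_eq_square algebra_simps)
    also have "\<dots> = b\<^sup>2 * N + 2 * b * c + E2" by (simp add: sum.distrib sum_distrib_left[symmetric] NN c_def E2_def sq_noise_def)
    finally show ?thesis .
  qed
  have xY: "(\<Sum>i<n. x i 0 * Y $ i) = b * N + c"
  proof -
    have "(\<Sum>i<n. x i 0 * Y $ i) = (\<Sum>i<n. b * (x i 0)\<^sup>2 + x i 0 * e i)"
      using Yi by (intro sum.cong) (auto simp: power2_eq_square algebra_simps)
    then show ?thesis by (simp add: sum.distrib sum_distrib_left[symmetric] NN c_def)
  qed
  have Y2pos: "0 < Y2" using dev(3) V_pos n_pos unfolding Y2_def by (smt (verit) divide_pos_pos mult_pos_pos)
  \<comment> \<open>The squared cosine of the angle between regressor and response, that is, the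
    least-squares proportion of explained variation.\<close>
  define \<rho> where "\<rho> = (b * N + c)\<^sup>2 / (N * Y2)"
  define w where "w = c\<^sup>2 / (N * Y2)"
  have gram: "gram_entry p x A i l = x i 0 * (real n / N2) * x l 0" for i l using p A by (simp add: gram_entry_def)
  have eD: "eta_D (design n p x) Y A = real n / (real n + 1) * (N / N2) * (\<rho> - 1 / real n)"
  proof -
    have Ap: "A \<in> carrier_mat p p" using A p by simp
    have "(\<Sum>i<n. \<Sum>l<n. Y $ i * gram_entry p x A i l * Y $ l)
        = (\<Sum>i<n. \<Sum>l<n. (real n / N2) * ((x i 0 * Y $ i) * (x l 0 * Y $ l)))"
      unfolding gram by (intro sum.cong refl) simp
    also have "\<dots> = (real n / N2) * (\<Sum>i<n. \<Sum>l<n. (x i 0 * Y $ i) * (x l 0 * Y $ l))"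
      by (simp only: sum_distrib_left)
    also have "\<dots> = (real n / N2) * ((\<Sum>i<n. x i 0 * Y $ i) * (\<Sum>l<n. x l 0 * Y $ l))"
      by (simp only: sum_product)
    also have "\<dots> = (real n / N2) * (b * N + c)\<^sup>2" by (simp only: xY power2_eq_square)
    finally have 1: "(\<Sum>i<n. \<Sum>l<n. Y $ i * gram_entry p x A i l * Y $ l) = (real n / N2) * (b * N + c)\<^sup>2" .
    have 2: "(\<Sum>i<n. gram_entry p x A i i) = (real n / N2) * N"
      unfolding NN sum_distrib_left gram by (intro sum.cong refl) (simp add: power2_eq_square)
    have "eta_D (design n p x) Y A = ((real n / N2) * (b * N + c)\<^sup>2 - (real n / N2) * N / real n * Y2) / ((real n + 1) * Y2)"
      unfolding eta_D_sum[OF Ap Yc] 1 2 YY ..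
    also have "\<dots> = real n / (real n + 1) * (N / N2) * (\<rho> - 1 / real n)"
    proof -
      define Q where "Q = (b * N + c)\<^sup>2 - N * Y2 / real n"
      have 3: "(real n / N2) * (b * N + c)\<^sup>2 - (real n / N2) * N / real n * Y2 = (real n / N2) * Q"
        by (simp add: Q_def right_diff_distrib)
      have 4: "\<rho> - 1 / real n = Q / (N * Y2)"
        using Npos Y2pos by (simp add: \<rho>_def Q_def diff_divide_distrib)
      show ?thesis unfolding 3 4 using Npos by simp
    qed
    finally show ?thesis .
  qed
  have csE: "c\<^sup>2 \<le> N * E2" unfolding c_def NN E2_def sq_noise_def by (rule Cauchy_Schwarz_ineq_sum)
  have id: "N * Y2 - (b * N + c)\<^sup>2 = N * E2 - c\<^sup>2" unfolding Y2e by (simp add: power2_eq_square algebra_simps)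
  \<comment> \<open>Least squares explains everything except the noise energy, and additionally the
    part \<open>w\<close> of the noise that lies in the direction of the regressor.\<close>
  have \<rho>w: "\<rho> = 1 - E2 / Y2 + w"
  proof -
    have "(b * N + c)\<^sup>2 = N * Y2 - N * E2 + c\<^sup>2" using id by simp
    then show ?thesis unfolding \<rho>_def w_def using Npos Y2pos by (simp add: add_divide_distrib diff_divide_distrib)
  qed
  have \<rho>0: "0 \<le> \<rho>" unfolding \<rho>_def using Npos Y2pos by simp
  have \<rho>1: "\<rho> \<le> 1" unfolding \<rho>_def using Npos Y2pos id csE by (simp add: divide_le_eq)
  have w0: "0 \<le> w" unfolding w_def using Npos Y2pos by simp
  have w3: "w \<le> 3"
  proof -
    have "c\<^sup>2 \<le> N * (3 * Y2)" using csE dev(4) Npos by (intro order_trans[OF csE] mult_left_mono) (auto simp: E2_def Y2_def)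
    then show ?thesis unfolding w_def using Npos Y2pos by (simp add: divide_le_eq)
  qed
  have wy: "w \<le> 4 * (c\<^sup>2 / ((real n)\<^sup>2 * s * V))"
  proof -
    have "(real n * s / 2) * (real n * V / 2) \<le> N * Y2"
      using rat(1) dev(3) ns n_pos V_pos Npos unfolding Y2_def by (intro mult_mono) auto
    then have "w \<le> c\<^sup>2 / ((real n * s / 2) * (real n * V / 2))"
      unfolding w_def using n_pos V_pos spos by (intro divide_left_mono mult_pos_pos Npos Y2pos) auto
    also have "\<dots> = 4 * (c\<^sup>2 / ((real n)\<^sup>2 * s * V))" by (simp add: power2_eq_square mult_ac)
    finally show ?thesis .
  qed
  have w2: "w\<^sup>2 \<le> 12 * (c\<^sup>2 / ((real n)\<^sup>2 * s * V))"
  proof -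
    \<comment> \<open>The square of \<open>w\<close> would need the fourth moment of the cross term;
      the bound w \<le> 3 reduces it to the known second moment.\<close>
    have "w\<^sup>2 \<le> 3 * w" unfolding power2_eq_square using w3 w0 by (intro mult_right_mono) auto
    then show ?thesis using wy by simp
  qed
  define st where "st = E2 / Y2 - \<sigma>\<^sup>2 / V"
  have st2: "st\<^sup>2 \<le> 8 * rel_noise (x, e) + 8 * rel_response (x, e)" using dev(5) by (simp add: st_def E2_def Y2_def)
  define r where "r = N / N2"
  have "\<bar>real n / (real n + 1) * r * (\<rho> - 1 / real n) - eta S \<beta> \<sigma>\<bar> \<le> \<bar>r - 1\<bar> + \<bar>\<rho> - eta S \<beta> \<sigma>\<bar> + 4 / real n"
    using n1 rat(3,4) \<rho>0 \<rho>1 unfolding r_def by (intro product_estimate_error) auto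
  also have "\<bar>\<rho> - eta S \<beta> \<sigma>\<bar> \<le> \<bar>st\<bar> + w" unfolding eta_eq' \<rho>w st_def using w0 by linarith
  finally have tot: "\<bar>real n / (real n + 1) * r * (\<rho> - 1 / real n) - eta S \<beta> \<sigma>\<bar> \<le> \<bar>r - 1\<bar> + (\<bar>st\<bar> + w) + 4 / real n" by simp
  have four: "(a + (b + c) + d)\<^sup>2 \<le> 4 * (a\<^sup>2 + b\<^sup>2 + c\<^sup>2 + d\<^sup>2)" for a b c d :: real
  proof -
    have "4 * (a\<^sup>2 + b\<^sup>2 + c\<^sup>2 + d\<^sup>2) - (a + (b + c) + d)\<^sup>2 = (a - b)\<^sup>2 + (a - c)\<^sup>2 + (a - d)\<^sup>2 + (b - c)\<^sup>2 + (b - d)\<^sup>2 + (c - d)\<^sup>2"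
      by (simp add: power2_eq_square algebra_simps)
    also have "0 \<le> \<dots>" by simp
    finally show ?thesis by simp
  qed
  have "(eta_D (design n p x) Y A - eta S \<beta> \<sigma>)\<^sup>2 = \<bar>real n / (real n + 1) * r * (\<rho> - 1 / real n) - eta S \<beta> \<sigma>\<bar>\<^sup>2"
    by (simp add: eD r_def)
  also have "\<dots> \<le> (\<bar>r - 1\<bar> + (\<bar>st\<bar> + w) + 4 / real n)\<^sup>2" by (rule power_mono[OF tot]) simp
  also have "\<dots> \<le> 4 * (\<bar>r - 1\<bar>\<^sup>2 + \<bar>st\<bar>\<^sup>2 + w\<^sup>2 + (4 / real n)\<^sup>2)" by (rule four)
  also have "\<dots> \<le> 4 * ((8 * ((N - real n * s)\<^sup>2 / (real n * s)\<^sup>2) + 8 * ((N2 - real n * s)\<^sup>2 / (real n * s)\<^sup>2))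
     + (8 * rel_noise (x, e) + 8 * rel_response (x, e)) + 12 * (c\<^sup>2 / ((real n)\<^sup>2 * s * V)) + 16 / real n)"
  proof -
    have "(4 / real n)\<^sup>2 \<le> 16 / real n" using n1 by (simp add: power2_eq_square divide_le_eq mult_le_cancel_left1)
    then show ?thesis unfolding power2_abs using rat(5) st2 w2 unfolding r_def by (intro mult_left_mono add_mono) auto
  qed
  finally show ?thesis by (simp add: Y_def c_def)
qed

text \<open>With the penalty and the CLIME slack both zero, concentration of the two empirical
  variances, the noise and response energies and one cross term suffices. Their second moments give
  72 + 216 + 72 + 72 + 48 + 64 = 544.\<close>

lemma one_dim_risk:
  assumes p: "p = 1" and cs: "clime_solution n p K M1' Om1"
  shows "(\<integral>\<^sup>+((x, e), x2). ennreal ((eta_A C1 C3 K M1' Om1 sl (design n p x) (response n p \<beta> x e) (design n p x2) - eta S \<beta> \<sigma>)\<^sup>2)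
    \<partial>(M \<Otimes>\<^sub>M D)) \<le> ennreal (544 / real n)"
proof -
  \<comment> \<open>The model law does not involve \<beta>, so the regressor-noise product can be
    read as \<open>signal_noise\<close> for the coefficient vector with single entry 1, and its
    second moment is already known.\<close>
  interpret U: gaussian_regression n p S "unit_vec p 0" \<sigma>
    by unfold_locales (use n1 S \<sigma> in auto)
  define s where "s = unit_vec p 0 \<bullet> (S *\<^sub>v unit_vec p 0)"
  have Uq: "U.q = s" by (simp add: s_def U.q_def)
  have spos: "0 < s" unfolding s_def
  proof (rule sym_pos_defD(3)[OF S])
    show "unit_vec p 0 \<noteq> (0\<^sub>v p :: real vec)" using p by (metis index_unit_vec(2) index_zero_vec(1) less_one zero_neq_one)
  qed simp
  define v where "v x = (energy n p (unit_vec p 0) x - real n * s)\<^sup>2 / (real n * s)\<^sup>2" for x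
  have v0: "0 \<le> v x" for x by (simp add: v_def)
  have [measurable]: "energy n p (unit_vec p 0) \<in> borel_measurable D"
    using measurable_energy[of "unit_vec p 0" p n] by (simp cong: measurable_cong_sets add: sets_design_law)
  have vm [measurable]: "v \<in> borel_measurable D" unfolding v_def by measurable
  have vE: "(\<integral>\<^sup>+x. ennreal (v x) \<partial>D) = ennreal (2 / real n)"
  proof -
    have "(\<integral>\<^sup>+x. ennreal (v x) \<partial>D) = (\<integral>\<^sup>+x. ennreal (1 / (real n * s)\<^sup>2) * ennreal ((energy n p (unit_vec p 0) x - real n * s)\<^sup>2) \<partial>D)"
      by (intro nn_integral_cong) (simp add: v_def ennreal_mult'[symmetric])
    also have "\<dots> = ennreal (1 / (real n * s)\<^sup>2) * ennreal (2 * real n * s\<^sup>2)"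
      using energy_variance[OF S, of "unit_vec p 0" n] by (subst nn_integral_cmult) (auto simp: s_def)
    also have "\<dots> = ennreal (2 / real n)" using n_pos spos by (simp add: ennreal_mult'[symmetric] power2_eq_square)
    finally show ?thesis .
  qed
  define y where "y \<omega> = (U.signal_noise (fst \<omega>) (snd \<omega>))\<^sup>2 / ((real n)\<^sup>2 * s * V)" for \<omega>
  have y0: "0 \<le> y \<omega>" for \<omega> using spos V_pos by (simp add: y_def)
  have ym [measurable]: "y \<in> borel_measurable M" unfolding y_def by measurable
  have yE: "(\<integral>\<^sup>+\<omega>. ennreal (y \<omega>) \<partial>M) \<le> ennreal (1 / real n)"
  proof -
    have "(\<integral>\<^sup>+\<omega>. ennreal (y \<omega>) \<partial>M) = (\<integral>\<^sup>+\<omega>. ennreal (1 / ((real n)\<^sup>2 * s * V)) * ennreal ((U.signal_noise (fst \<omega>) (snd \<omega>))\<^sup>2) \<partial>M)"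
      using spos V_pos by (intro nn_integral_cong) (simp add: y_def ennreal_mult'[symmetric])
    also have "\<dots> = ennreal (1 / ((real n)\<^sup>2 * s * V)) * ennreal (real n * s * \<sigma>\<^sup>2)"
      by (subst nn_integral_cmult) (auto simp: U.cross_deviation Uq)
    also have "\<dots> = ennreal (\<sigma>\<^sup>2 / V * (1 / real n))" using n_pos spos V_pos by (simp add: ennreal_mult'[symmetric] power2_eq_square)
    also have "\<dots> \<le> ennreal (1 * (1 / real n))"
      using q_nonneg V_pos by (intro ennreal_leI mult_right_mono) (auto simp: V_def)
    finally show ?thesis by simp
  qed
  \<comment> \<open>Each 36 is 32 from the good event plus 4, which makes the corresponding term
    exceed 1 when that deviation is large.\<close>
  define g where "g z = ennreal (36 * rel_noise (fst z)) + ennreal (36 * rel_response (fst z)) + ennreal (36 * v (fst (fst z)))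
    + ennreal (36 * v (snd z)) + ennreal (48 * y (fst z)) + ennreal (64 / real n)" for z
  have vM [measurable]: "(\<lambda>\<omega>. v (fst \<omega>)) \<in> borel_measurable M" unfolding model_law_def by measurable
  have m: "(\<lambda>\<omega>. ennreal (36 * rel_noise \<omega>)) \<in> borel_measurable M" "(\<lambda>\<omega>. ennreal (36 * rel_response \<omega>)) \<in> borel_measurable M"
    "(\<lambda>\<omega>. ennreal (36 * v (fst \<omega>))) \<in> borel_measurable M" "(\<lambda>x. ennreal (36 * v x)) \<in> borel_measurable D"
    "(\<lambda>\<omega>. ennreal (48 * y \<omega>)) \<in> borel_measurable M" by measurable
  have sc: "(\<integral>\<^sup>+\<omega>. ennreal (c * f \<omega>) \<partial>N) \<le> ennreal (c * B)"
    if "f \<in> borel_measurable N" "(\<integral>\<^sup>+\<omega>. ennreal (f \<omega>) \<partial>N) \<le> ennreal B" "0 \<le> c" for c B and f :: "'c \<Rightarrow> real" and N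
  proof -
    have "(\<integral>\<^sup>+\<omega>. ennreal (c * f \<omega>) \<partial>N) = ennreal c * (\<integral>\<^sup>+\<omega>. ennreal (f \<omega>) \<partial>N)"
      using that by (simp add: ennreal_mult' nn_integral_cmult)
    also have "\<dots> \<le> ennreal c * ennreal B" by (intro mult_left_mono that) simp
    finally show ?thesis using that by (simp add: ennreal_mult')
  qed
  have vME: "(\<integral>\<^sup>+\<omega>. ennreal (v (fst \<omega>)) \<partial>M) \<le> ennreal (2 / real n)"
    unfolding model_law_def by (subst nn_integral_pair_fst[OF E.prob_space_axioms]) (auto simp: vE)
  have "(\<integral>\<^sup>+z. g z \<partial>(M \<Otimes>\<^sub>M D)) = (\<integral>\<^sup>+\<omega>. ennreal (36 * rel_noise \<omega>) \<partial>M) + (\<integral>\<^sup>+\<omega>. ennreal (36 * rel_response \<omega>) \<partial>M)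
     + (\<integral>\<^sup>+\<omega>. ennreal (36 * v (fst \<omega>)) \<partial>M) + (\<integral>\<^sup>+x. ennreal (36 * v x) \<partial>D) + (\<integral>\<^sup>+\<omega>. ennreal (48 * y \<omega>) \<partial>M) + ennreal (64 / real n)"
  proof -
    interpret MD: pair_prob_space M D ..
    note [measurable] = measurable_compose[OF measurable_fst m(1)] measurable_compose[OF measurable_fst m(2)]
      measurable_compose[OF measurable_fst m(3)] measurable_compose[OF measurable_snd m(4)] measurable_compose[OF measurable_fst m(5)]
    show ?thesis unfolding g_def
      nn_integral_pair_fst[OF D.prob_space_axioms m(1), symmetric] nn_integral_pair_fst[OF D.prob_space_axioms m(2), symmetric]
      nn_integral_pair_fst[OF D.prob_space_axioms m(3), symmetric] nn_integral_pair_fst[OF D.prob_space_axioms m(5), symmetric]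
      nn_integral_pair_snd[OF M.prob_space_axioms D.prob_space_axioms m(4), symmetric]
      by (simp add: nn_integral_add MD.emeasure_space_1)
  qed
  also have "\<dots> \<le> ennreal (36 * (2 / real n)) + ennreal (36 * (6 / real n)) + ennreal (36 * (2 / real n)) + ennreal (36 * (2 / real n))
      + ennreal (48 * (1 / real n)) + ennreal (64 / real n)"
    by (intro add_mono sc rel_noise_mean rel_response_mean vME yE order_refl rel_measurable vM vm ym) (auto simp: vE)
  also have "\<dots> = ennreal (36 * (2 / real n) + 36 * (6 / real n) + 36 * (2 / real n) + 36 * (2 / real n) + 48 * (1 / real n) + 64 / real n)"
    by (simp only: ennreal_plus divide_nonneg_nonneg add_nonneg_nonneg mult_nonneg_nonneg of_nat_0_le_iff zero_le_numeral zero_le_one)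
  also have "36 * (2 / real n) + 36 * (6 / real n) + 36 * (2 / real n) + 36 * (2 / real n) + 48 * (1 / real n) + 64 / real n = 544 / real n"
    by (simp add: add_divide_distrib[symmetric])
  finally have gE: "(\<integral>\<^sup>+z. g z \<partial>(M \<Otimes>\<^sub>M D)) \<le> ennreal (544 / real n)" .
  have pt: "ennreal ((eta_A C1 C3 K M1' Om1 sl (design n p x) (response n p \<beta> x e) (design n p x2) - eta S \<beta> \<sigma>)\<^sup>2) \<le> g ((x, e), x2)" for x e x2
  proof -
    define A where "A = clime_sym (Om1 (design n p x2))"
    define d where "d = eta_D_T (design n p x) (response n p \<beta> x e) A"
    have eA: "eta_A C1 C3 K M1' Om1 sl (design n p x) (response n p \<beta> x e) (design n p x2) = d"
      unfolding d_def A_def using p by (intro eta_A_one_dim[of _ n]) auto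
    have gr: "ennreal t \<le> g ((x, e), x2)"
      if "t \<le> 36 * rel_noise (x, e) + 36 * rel_response (x, e) + 36 * v x + 36 * v x2 + 48 * y (x, e) + 64 / real n" for t
    proof -
      have "g ((x, e), x2) = ennreal (36 * rel_noise (x, e) + 36 * rel_response (x, e) + 36 * v x + 36 * v x2 + 48 * y (x, e) + 64 / real n)"
        unfolding g_def fst_conv snd_conv using rel_nonneg[of "(x, e)"] v0 y0[of "(x, e)"]
        by (simp only: ennreal_plus divide_nonneg_nonneg add_nonneg_nonneg mult_nonneg_nonneg of_nat_0_le_iff zero_le_numeral)
      then show ?thesis using that by (simp add: ennreal_leI)
    qed
    have base: "0 \<le> rel_noise (x, e)" "0 \<le> rel_response (x, e)" "0 \<le> v x" "0 \<le> v x2" "0 \<le> y (x, e)" "0 \<le> 64 / real n"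
      using rel_nonneg[of "(x, e)"] v0 y0 by auto
    show ?thesis unfolding eA
    proof (rule gr)
      show "(d - eta S \<beta> \<sigma>)\<^sup>2 \<le> 36 * rel_noise (x, e) + 36 * rel_response (x, e) + 36 * v x + 36 * v x2 + 48 * y (x, e) + 64 / real n"
      proof (cases "4 * rel_noise (x, e) < 1 \<and> 4 * rel_response (x, e) < 1 \<and> 4 * v x < 1 \<and> 4 * v x2 < 1")
        case False
        have "(d - eta S \<beta> \<sigma>)\<^sup>2 \<le> 1" unfolding d_def using eta_D_T_bounds eta_bounds by (intro sq_diff_le_1) auto
        then show ?thesis using False base by linarith
      next
        case True
        define N2 where "N2 = energy n p (unit_vec p 0) x2"
        have N2e: "N2 = (\<Sum>i<n. (x2 i 0)\<^sup>2)" unfolding N2_def using p by (simp add: energy_def scalar_prod_right_unit)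
        have "0 < N2"
          using ratio_error(2)[of "real n * s" N2 N2] True n_pos spos unfolding v_def N2_def
          by (smt (verit) half_gt_zero mult_pos_pos)
        then have "Om1 (design n p x2) $$ (0, 0) = real n / N2"
          unfolding N2e p using cs n1 by (intro clime_one_dim) (auto simp: p)
        moreover have Oc: "Om1 (design n p x2) \<in> carrier_mat p p" by (rule clime_solution_carrier[OF cs])
        ultimately have A00: "A $$ (0, 0) = real n / N2" using p by (simp add: A_def clime_sym_def)
        have Ac: "A \<in> carrier_mat 1 1" using clime_sym_carrier[OF Oc] p by (simp add: A_def)
        have "\<bar>d - eta S \<beta> \<sigma>\<bar> \<le> \<bar>eta_D (design n p x) (response n p \<beta> x e) A - eta S \<beta> \<sigma>\<bar>"
          unfolding d_def using eta_bounds by (intro eta_D_T_error) auto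
        then have "(d - eta S \<beta> \<sigma>)\<^sup>2 \<le> (eta_D (design n p x) (response n p \<beta> x e) A - eta S \<beta> \<sigma>)\<^sup>2"
          by (simp only: abs_le_square_iff)
        also have "\<dots> \<le> 32 * rel_noise (x, e) + 32 * rel_response (x, e) + 32 * v x + 32 * v x2 + 48 * y (x, e) + 64 / real n"
        proof -
          have sn: "U.signal_noise x e = (\<Sum>i<n. x i 0 * e i)"
            unfolding U.signal_noise_def using p by (simp add: scalar_prod_right_unit)
          show ?thesis
            using one_dim_good[OF p Ac A00 refl refl, of x e] True unfolding v_def N2_def y_def fst_conv snd_conv sn s_def by blast
        qed
        finally show ?thesis using base by linarith
      qed
    qed
  qed
  have "(\<integral>\<^sup>+((x, e), x2). ennreal ((eta_A C1 C3 K M1' Om1 sl (design n p x) (response n p \<beta> x e) (design n p x2) - eta S \<beta> \<sigma>)\<^sup>2)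
    \<partial>(M \<Otimes>\<^sub>M D)) \<le> (\<integral>\<^sup>+z. g z \<partial>(M \<Otimes>\<^sub>M D))"
    using pt by (intro nn_integral_mono) (auto split: prod.split)
  then show ?thesis using gE by (rule order_trans)
qed

end

section \<open>The adaptive estimator\<close>

text \<open>The diagonal of a positive definite matrix is positive, so every column has a nonzero
  entry. The column sparsity bound is therefore at least 1, which is the claimed inequality.\<close>

lemma prec_class_dimension:
  assumes S: "S \<in> sym_pos_def p" and prec: "inv_mat S \<in> prec_class n p K M1" and n: "1 \<le> n" and p: "2 \<le> p"
  shows "real n * ln (real p) \<le> real p"
proof -
  define Q where "Q = inv_mat S"
  note Qc = sym_pos_defD[OF inv_mat_sym_pos_def[OF S], folded Q_def]
  have u: "unit_vec p 0 \<noteq> (0\<^sub>v p :: real vec)" using p by (metis index_unit_vec(2) index_zero_vec(1) not_numeral_le_zero not_gr_zero zero_neq_one)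
  have "0 < Q $$ (0, 0)" using Qc(3)[OF _ u] quad_form_unit[OF Qc(1), of 0] p by simp
  then have "0 \<in> {j. j < dim_vec (col Q 0) \<and> col Q 0 $ j \<noteq> 0}" using Qc(1) p by auto
  then have "{j. j < dim_vec (col Q 0) \<and> col Q 0 $ j \<noteq> 0} \<noteq> {}" by blast
  then have "1 \<le> nnz (col Q 0)" unfolding nnz_def by (simp add: Suc_le_eq card_gt_0_iff)
  also have "\<dots> \<le> Max ((\<lambda>j. nnz (col Q j)) ` {..<p})" by (rule Max_ge) (use p in auto)
  finally have "1 \<le> real (Max ((\<lambda>j. nnz (col Q j)) ` {..<p}))" by simp
  also have "\<dots> \<le> sqrt (real p / (real n * ln (real p)))" using prec p by (auto simp: prec_class_def Q_def)
  finally have "1 \<le> real p / (real n * ln (real p))" by simp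
  then show ?thesis using n p by (simp add: le_divide_eq)
qed

text \<open>The deviation parameter of the plug-in bound may only grow like the cube root of
  \<open>n\<close>. Cubing u / 3 \<le> exp (u / 3) shows that this still gives failure probability
  O(1 / n), with 27 = 3^3.\<close>

lemma exp_minus_root3_le: "1 \<le> n \<Longrightarrow> exp (- root 3 (real n)) \<le> 27 / real n"
proof -
  assume n: "1 \<le> n"
  define u where "u = root 3 (real n)"
  have u: "0 \<le> u" "u ^ 3 = real n" using n by (auto simp: u_def)
  have "u / 3 \<le> exp (u / 3)" using exp_ge_add_one_self[of "u / 3"] by (rule order_trans[rotated]) simp
  then have "(u / 3) ^ 3 \<le> exp (u / 3) ^ 3" using u by (intro power_mono) auto
  also have "exp (u / 3) ^ 3 = exp u" using exp_of_nat_mult[of 3 "u / 3"] by simp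
  finally have "real n / 27 \<le> exp u" using u by (simp add: power_divide)
  then show ?thesis using n by (simp add: u_def[symmetric] exp_minus field_simps)
qed

context regression_model
begin

lemma adaptive_bounds:
  assumes p: "1 \<le> p" and sl: "sqrt_lasso_solution n p sl"
  shows "0 \<le> eta_SL (design n p x) (response n p \<beta> x e) (sl (design n p x) (response n p \<beta> x e))"
    "eta_SL (design n p x) (response n p \<beta> x e) (sl (design n p x) (response n p \<beta> x e)) \<le> 1"
proof -
  have "is_arg_min (sqrt_lasso_obj (design n p x) (response n p \<beta> x e)) (\<lambda>b. b \<in> carrier_vec p) (sl (design n p x) (response n p \<beta> x e))"
    using sl response_carrier design_carrier unfolding sqrt_lasso_solution_def by blast
  from eta_SL_bounds[OF design_carrier response_carrier p this]
  show "0 \<le> eta_SL (design n p x) (response n p \<beta> x e) (sl (design n p x) (response n p \<beta> x e))"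
    "eta_SL (design n p x) (response n p \<beta> x e) (sl (design n p x) (response n p \<beta> x e)) \<le> 1" by auto
qed

lemma eta_A_design:
  "eta_A C1 C3 K M1' Om1 sl (design n p x) Y X2 =
    (if \<bar>eta_D_T (design n p x) Y (clime_sym (Om1 X2)) - eta_SL (design n p x) Y (sl (design n p x) Y)\<bar>
        \<le> c0 C1 C3 K M1' * sqrt (real p * ln (real p)) / real n
     then eta_SL (design n p x) Y (sl (design n p x) Y) else eta_D_T (design n p x) Y (clime_sym (Om1 X2)))"
proof -
  have "dim_row (design n p x) = n" "dim_col (design n p x) = p" by (auto simp: design_def)
  then show ?thesis unfolding eta_A_def Let_def by simp
qed

abbreviation "sq_error C1 C3 K Om1 sl x e x2 \<equiv>
  (eta_A C1 C3 K M1 Om1 sl (design n p x) (response n p \<beta> x e) (design n p x2) - eta S \<beta> \<sigma>)\<^sup>2"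

abbreviation "risk C1 C3 K Om1 sl \<equiv>
  (\<integral>\<^sup>+((x, e), x2). ennreal (sq_error C1 C3 K Om1 sl x e x2) \<partial>(M \<Otimes>\<^sub>M D))"

lemma sq_error_le_1:
  assumes "1 \<le> p" "sqrt_lasso_solution n p sl"
  shows "sq_error C1 C3 K Om1 sl x e x2 \<le> 1"
  unfolding eta_A_design
  using adaptive_bounds[OF assms, of x e] eta_D_T_bounds[of "design n p x" "response n p \<beta> x e" "clime_sym (Om1 (design n p x2))"] eta_bounds
  by (auto intro!: sq_diff_le_1)

lemma risk_le:
  assumes "\<And>x e x2. ((x, e), x2) \<in> space (M \<Otimes>\<^sub>M D) \<Longrightarrow> ennreal (sq_error C1 C3 K Om1 sl x e x2) \<le> f ((x, e), x2)"
  shows "risk C1 C3 K Om1 sl \<le> (\<integral>\<^sup>+z. f z \<partial>(M \<Otimes>\<^sub>M D))"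
proof (rule nn_integral_mono)
  fix z assume z: "z \<in> space (M \<Otimes>\<^sub>M D)"
  obtain x e x2 where "z = ((x, e), x2)" by (metis prod.exhaust)
  then show "(case z of (xe, x2) \<Rightarrow> (case xe of (x, e) \<Rightarrow> \<lambda>x2. ennreal (sq_error C1 C3 K Om1 sl x e x2)) x2) \<le> f z"
    using assms z by simp
qed

lemma prob_space_pair: "prob_space (M \<Otimes>\<^sub>M D)"
proof -
  interpret MD: pair_prob_space M D ..
  show ?thesis by (rule MD.prob_space_axioms)
qed

lemma risk_le_1:
  assumes "1 \<le> p" "sqrt_lasso_solution n p sl"
  shows "risk C1 C3 K Om1 sl \<le> 1"
proof -
  interpret MD: prob_space "M \<Otimes>\<^sub>M D" by (rule prob_space_pair)
  have "risk C1 C3 K Om1 sl \<le> (\<integral>\<^sup>+z. 1 \<partial>(M \<Otimes>\<^sub>M D))"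
    using sq_error_le_1[OF assms] by (intro risk_le) simp
  then show ?thesis by (simp add: MD.emeasure_space_1)
qed

text \<open>If \<open>d\<close> is selected, \<open>s\<close> is more than \<tau> away from it and
  thus farther than \<tau> / 2 from \<open>h\<close>, so \<open>d\<close> is the better estimate. If
  \<open>s\<close> is selected, its error is at most \<tau> + \<tau> / 2. One threshold therefore
  serves both rates.\<close>

lemma selection_error:
  fixes d s h \<tau> :: real
  assumes "\<bar>d - h\<bar> \<le> \<tau> / 2"
  shows "\<bar>(if \<bar>d - s\<bar> \<le> \<tau> then s else d) - h\<bar> \<le> \<bar>s - h\<bar>"
    and "\<bar>(if \<bar>d - s\<bar> \<le> \<tau> then s else d) - h\<bar> \<le> 3 / 2 * \<tau>"
proof -
  have "\<bar>d - s\<bar> \<le> \<bar>d - h\<bar> + \<bar>s - h\<bar>" "\<bar>s - h\<bar> \<le> \<bar>d - s\<bar> + \<bar>d - h\<bar>" "0 \<le> \<bar>d - h\<bar>" by (auto simp: abs_if)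
  then show "\<bar>(if \<bar>d - s\<bar> \<le> \<tau> then s else d) - h\<bar> \<le> \<bar>s - h\<bar>"
    "\<bar>(if \<bar>d - s\<bar> \<le> \<tau> then s else d) - h\<bar> \<le> 3 / 2 * \<tau>" using assms by auto
qed

text \<open>The dense bound uses that the error is at most 3/2 of the threshold off the bad event.
  The sparse bound uses that the error is at most that of the Lasso there, so the Lasso majorant can
  be integrated over the first sample alone. Each pays O(1 / n) for the bad event.\<close>

lemma adaptive_risk_main:
  assumes pc: "plug_in_constants C1 C2" and cc: "clime_constant C3" and np: "n \<le> p" and p5: "5 \<le> p"
    and K: "0 < K" and prec: "inv_mat S \<in> prec_class n p K M1" and cs: "clime_solution n p K M1 Om1"
    and sl: "sqrt_lasso_solution n p sl" and k: "1 \<le> k" "nnz \<beta> \<le> k"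
    and lnp: "1 \<le> ln (real p)" "ln (real p) \<le> real n / 8" and C1: "0 \<le> C1"
  shows "risk C1 C3 K Om1 sl \<le> ennreal ((4 + 27 * max 0 C2) / real n + 3 * (c0 C1 C3 K M1)\<^sup>2 * (real p * ln (real p) / (real n)\<^sup>2))"
    and "real k * ln (real p) \<le> real n / (48 * real lasso_scale) \<Longrightarrow>
      risk C1 C3 K Om1 sl \<le> ennreal ((194 + 27 * max 0 C2) / real n + 2 * (259584 * M1\<^sup>2 * (real k * ln (real p) / real n))\<^sup>2)"
proof -
  interpret MD: prob_space "M \<Otimes>\<^sub>M D" by (rule prob_space_pair)
  define \<tau> where "\<tau> = c0 C1 C3 K M1 * sqrt (real p * ln (real p)) / real n"
  have p1: "1 \<le> p" using p5 by simp
  have \<tau>2: "\<tau>\<^sup>2 = (c0 C1 C3 K M1)\<^sup>2 * (real p * ln (real p) / (real n)\<^sup>2)"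
    using lnp(1) by (simp add: \<tau>_def power_mult_distrib power_divide)
  \<comment> \<open>The largest deviation parameter allowed by both limits: the cube root of
    \<open>n\<close> in the assumed bound, and ln p, at which sqrt (p t) still matches the
    threshold. In either case exp (- t) is O(1 / n), using \<open>n \<le> p\<close>.\<close>
  define t where "t = min (ln (real p)) (root 3 (real n))"
  have t: "0 \<le> t" "t \<le> root 3 (real n)" "t \<le> ln (real p)" using lnp(1) by (auto simp: t_def)
  have et: "C2 * exp (- t) \<le> 27 * max 0 C2 / real n"
  proof -
    have "exp (- t) \<le> 27 / real n"
    proof (cases "ln (real p) \<le> root 3 (real n)")
      case True
      then have "exp (- t) = 1 / real p" using p1 by (simp add: t_def exp_minus inverse_eq_divide)
      also have "\<dots> \<le> 27 / real n" using np n1 by (intro frac_le) auto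
      finally show ?thesis .
    next
      case False
      then have "t = root 3 (real n)" by (simp add: t_def)
      then show ?thesis using exp_minus_root3_le[OF n1] by simp
    qed
    then have "max 0 C2 * exp (- t) \<le> max 0 C2 * (27 / real n)" by (intro mult_left_mono) auto
    moreover have "C2 * exp (- t) \<le> max 0 C2 * exp (- t)" by (intro mult_right_mono) auto
    ultimately have "C2 * exp (- t) \<le> max 0 C2 * (27 / real n)" by (rule order_trans[rotated])
    then show ?thesis by (simp add: mult.commute)
  qed
  have bad: "\<exists>B\<in>sets (M \<Otimes>\<^sub>M D). emeasure (M \<Otimes>\<^sub>M D) B \<le> ennreal ((4 + 27 * max 0 C2) / real n) \<and>
    (\<forall>x e x2. ((x, e), x2) \<in> space (M \<Otimes>\<^sub>M D) - B \<longrightarrow>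
      \<bar>eta_D_T (design n p x) (response n p \<beta> x e) (clime_sym (Om1 (design n p x2))) - eta S \<beta> \<sigma>\<bar> \<le> \<tau> / 2)"
    if tau: "\<tau> < 1"
  proof -
    obtain B where B: "B \<in> sets (M \<Otimes>\<^sub>M D)" "emeasure (M \<Otimes>\<^sub>M D) B \<le> ennreal (4 / real p) + ennreal (C2 * exp (- t))"
      "\<And>x e x2. ((x, e), x2) \<in> space (M \<Otimes>\<^sub>M D) - B \<Longrightarrow>
      \<bar>eta_D (design n p x) (response n p \<beta> x e) (clime_sym (Om1 (design n p x2))) - eta S \<beta> \<sigma>\<bar> \<le> \<tau> / 2"
      using clime_bad_event[OF pc cc np p5 K prec cs lnp C1 t] tau unfolding \<tau>_def by blast
    have "ennreal (4 / real p) + ennreal (C2 * exp (- t)) \<le> ennreal (4 / real n) + ennreal (27 * max 0 C2 / real n)"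
      using np n1 et by (intro add_mono ennreal_leI frac_le) auto
    also have "\<dots> = ennreal ((4 + 27 * max 0 C2) / real n)" by (simp add: add_divide_distrib)
    finally have "emeasure (M \<Otimes>\<^sub>M D) B \<le> ennreal ((4 + 27 * max 0 C2) / real n)" using B(2) by (rule order_trans[rotated])
    moreover have "\<bar>eta_D_T (design n p x) (response n p \<beta> x e) (clime_sym (Om1 (design n p x2))) - eta S \<beta> \<sigma>\<bar> \<le> \<tau> / 2"
      if "((x, e), x2) \<in> space (M \<Otimes>\<^sub>M D) - B" for x e x2
      using eta_D_T_error[OF eta_bounds] B(3)[OF that] by (rule order_trans)
    ultimately show ?thesis using B(1) by blast
  qed
  show "risk C1 C3 K Om1 sl \<le> ennreal ((4 + 27 * max 0 C2) / real n + 3 * (c0 C1 C3 K M1)\<^sup>2 * (real p * ln (real p) / (real n)\<^sup>2))"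
  proof (cases "\<tau> < 1")
    case False
    then have "1\<^sup>2 \<le> \<tau>\<^sup>2" by (intro power_mono) auto
    then have "1 \<le> (4 + 27 * max 0 C2) / real n + 3 * \<tau>\<^sup>2" by (smt (verit) divide_nonneg_nonneg of_nat_0_le_iff one_power2)
    then have "1 \<le> (4 + 27 * max 0 C2) / real n + 3 * (c0 C1 C3 K M1)\<^sup>2 * (real p * ln (real p) / (real n)\<^sup>2)"
      unfolding \<tau>2 by (simp only: mult.assoc)
    then have "1 \<le> ennreal ((4 + 27 * max 0 C2) / real n + 3 * (c0 C1 C3 K M1)\<^sup>2 * (real p * ln (real p) / (real n)\<^sup>2))"
      by (metis ennreal_1 ennreal_leI)
    then show ?thesis by (rule order_trans[OF risk_le_1[OF p1 sl]])
  next
    case True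
    then obtain B where B: "B \<in> sets (M \<Otimes>\<^sub>M D)" "emeasure (M \<Otimes>\<^sub>M D) B \<le> ennreal ((4 + 27 * max 0 C2) / real n)"
      "\<And>x e x2. ((x, e), x2) \<in> space (M \<Otimes>\<^sub>M D) - B \<Longrightarrow>
      \<bar>eta_D_T (design n p x) (response n p \<beta> x e) (clime_sym (Om1 (design n p x2))) - eta S \<beta> \<sigma>\<bar> \<le> \<tau> / 2"
      using bad by blast
    have "risk C1 C3 K Om1 sl \<le> (\<integral>\<^sup>+z. indicator B z + ennreal (3 * \<tau>\<^sup>2) \<partial>(M \<Otimes>\<^sub>M D))"
    proof (rule risk_le)
      fix x e x2 assume z: "((x, e), x2) \<in> space (M \<Otimes>\<^sub>M D)"
      show "ennreal (sq_error C1 C3 K Om1 sl x e x2) \<le> indicator B ((x, e), x2) + ennreal (3 * \<tau>\<^sup>2)"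
      proof (cases "((x, e), x2) \<in> B")
        case True
        have "ennreal (sq_error C1 C3 K Om1 sl x e x2) \<le> 1" using sq_error_le_1[OF p1 sl] by simp
        then show ?thesis using True by (simp add: add_increasing2)
      next
        case False
        then have "\<bar>eta_D_T (design n p x) (response n p \<beta> x e) (clime_sym (Om1 (design n p x2))) - eta S \<beta> \<sigma>\<bar> \<le> \<tau> / 2"
          using B(3) z by simp
        from selection_error(2)[OF this]
        have "\<bar>eta_A C1 C3 K M1 Om1 sl (design n p x) (response n p \<beta> x e) (design n p x2) - eta S \<beta> \<sigma>\<bar> \<le> 3 / 2 * \<tau>"
          unfolding eta_A_design \<tau>_def .
        then have "\<bar>eta_A C1 C3 K M1 Om1 sl (design n p x) (response n p \<beta> x e) (design n p x2) - eta S \<beta> \<sigma>\<bar>\<^sup>2 \<le> (3 / 2 * \<tau>)\<^sup>2"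
          by (rule power_mono) simp
        also have "(3 / 2 * \<tau>)\<^sup>2 = 9 / 4 * \<tau>\<^sup>2" by (simp add: power_mult_distrib power_divide)
        also have "\<dots> \<le> 3 * \<tau>\<^sup>2" by simp
        finally have "sq_error C1 C3 K Om1 sl x e x2 \<le> 3 * \<tau>\<^sup>2" by simp
        then show ?thesis by (simp add: add_increasing ennreal_leI)
      qed
    qed
    also have "\<dots> = emeasure (M \<Otimes>\<^sub>M D) B + ennreal (3 * \<tau>\<^sup>2)"
      using B(1) by (subst nn_integral_add) (auto simp: MD.emeasure_space_1)
    also have "\<dots> \<le> ennreal ((4 + 27 * max 0 C2) / real n) + ennreal (3 * \<tau>\<^sup>2)" using B(2) by (rule add_right_mono)
    also have "\<dots> = ennreal ((4 + 27 * max 0 C2) / real n + 3 * \<tau>\<^sup>2)"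
      by (subst ennreal_plus) auto
    finally show ?thesis unfolding \<tau>2 by (simp only: mult.assoc)
  qed
  assume small: "real k * ln (real p) \<le> real n / (48 * real lasso_scale)"
  define a where "a = 2 * (259584 * M1\<^sup>2 * (real k * ln (real p) / real n))\<^sup>2"
  have a0: "0 \<le> a" by (simp add: a_def)
  obtain g where g: "g \<in> borel_measurable M"
    "\<And>x e. (x, e) \<in> space M \<Longrightarrow> ennreal ((eta_SL (design n p x) (response n p \<beta> x e) (sl (design n p x) (response n p \<beta> x e)) - eta S \<beta> \<sigma>)\<^sup>2) \<le> g (x, e)"
    "(\<integral>\<^sup>+\<omega>. g \<omega> \<partial>M) \<le> ennreal (190 / real n + a)"
    using sqrt_lasso_risk[OF _ np k sl small] p5 unfolding a_def by fastforce
  have gm: "(\<lambda>z. g (fst z)) \<in> borel_measurable (M \<Otimes>\<^sub>M D)" using g(1) by measurable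
  have gi: "(\<integral>\<^sup>+z. g (fst z) \<partial>(M \<Otimes>\<^sub>M D)) \<le> ennreal (190 / real n + a)"
    using nn_integral_pair_fst[OF D.prob_space_axioms g(1)] g(3) by simp
  \<comment> \<open>For a threshold of at least 1 the selector always returns the Lasso, so an empty
    exceptional set does.\<close>
  obtain B where B: "B \<in> sets (M \<Otimes>\<^sub>M D)" "emeasure (M \<Otimes>\<^sub>M D) B \<le> ennreal ((4 + 27 * max 0 C2) / real n)"
    "\<And>x e x2. \<tau> < 1 \<Longrightarrow> ((x, e), x2) \<in> space (M \<Otimes>\<^sub>M D) - B \<Longrightarrow>
      \<bar>eta_D_T (design n p x) (response n p \<beta> x e) (clime_sym (Om1 (design n p x2))) - eta S \<beta> \<sigma>\<bar> \<le> \<tau> / 2"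
  proof (cases "\<tau> < 1")
    case True
    then show ?thesis using bad that by blast
  next
    case False
    show ?thesis by (rule that[of "{}"]) (use False in auto)
  qed
  have "risk C1 C3 K Om1 sl \<le> (\<integral>\<^sup>+z. indicator B z + g (fst z) \<partial>(M \<Otimes>\<^sub>M D))"
  proof (rule risk_le)
    fix x e x2 assume z: "((x, e), x2) \<in> space (M \<Otimes>\<^sub>M D)"
    define d where "d = eta_D_T (design n p x) (response n p \<beta> x e) (clime_sym (Om1 (design n p x2)))"
    define s where "s = eta_SL (design n p x) (response n p \<beta> x e) (sl (design n p x) (response n p \<beta> x e))"
    have eA: "eta_A C1 C3 K M1 Om1 sl (design n p x) (response n p \<beta> x e) (design n p x2) = (if \<bar>d - s\<bar> \<le> \<tau> then s else d)"
      unfolding eta_A_design d_def s_def \<tau>_def ..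
    show "ennreal (sq_error C1 C3 K Om1 sl x e x2) \<le> indicator B ((x, e), x2) + g (fst ((x, e), x2))"
    proof (cases "((x, e), x2) \<in> B")
      case True
      have "ennreal (sq_error C1 C3 K Om1 sl x e x2) \<le> 1" using sq_error_le_1[OF p1 sl] by simp
      then show ?thesis using True by (simp add: add_increasing2)
    next
      case False
      have "\<bar>(if \<bar>d - s\<bar> \<le> \<tau> then s else d) - eta S \<beta> \<sigma>\<bar> \<le> \<bar>s - eta S \<beta> \<sigma>\<bar>"
      proof (cases "\<tau> < 1")
        case True
        then show ?thesis using B(3)[OF True] z False by (intro selection_error(1)) (simp add: d_def)
      next
        case False
        have "0 \<le> d" "d \<le> 1" "0 \<le> s" "s \<le> 1"
          using eta_D_T_bounds adaptive_bounds[OF p1 sl, of x e] by (auto simp: d_def s_def)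
        then have "\<bar>d - s\<bar> \<le> \<tau>" using False by (auto simp: abs_if)
        then show ?thesis by simp
      qed
      then have "sq_error C1 C3 K Om1 sl x e x2 \<le> (s - eta S \<beta> \<sigma>)\<^sup>2"
        unfolding eA by (simp only: abs_le_square_iff)
      then have "ennreal (sq_error C1 C3 K Om1 sl x e x2) \<le> ennreal ((s - eta S \<beta> \<sigma>)\<^sup>2)" by (rule ennreal_leI)
      also have "\<dots> \<le> g (x, e)" unfolding s_def using z by (intro g(2)) (auto simp: space_pair_measure)
      finally show ?thesis by (simp add: add_increasing)
    qed
  qed
  also have "\<dots> = emeasure (M \<Otimes>\<^sub>M D) B + (\<integral>\<^sup>+z. g (fst z) \<partial>(M \<Otimes>\<^sub>M D))"
    using B(1) gm by (subst nn_integral_add) auto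
  also have "\<dots> \<le> ennreal ((4 + 27 * max 0 C2) / real n) + ennreal (190 / real n + a)" using B(2) gi by (rule add_mono)
  also have "\<dots> = ennreal ((4 + 27 * max 0 C2) / real n + (190 / real n + a))"
    using a0 by (subst ennreal_plus) auto
  also have "(4 + 27 * max 0 C2) / real n + (190 / real n + a) = (194 + 27 * max 0 C2) / real n + a"
    by (simp add: add_divide_distrib)
  finally show "risk C1 C3 K Om1 sl \<le> ennreal ((194 + 27 * max 0 C2) / real n + 2 * (259584 * M1\<^sup>2 * (real k * ln (real p) / real n))\<^sup>2)"
    by (simp add: a_def)
qed

text \<open>A negative constant makes the radius of the assumed event negative, so the event is
  empty and 1 \<le> C2 exp (- t). At the largest admissible t, the cube root of \<open>n\<close>,
  this bounds \<open>n\<close>, and the trivial risk bound is then of order 1 / n.\<close>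

lemma plug_in_negative_constant:
  assumes pc: "plug_in_constants C1 C2" and np: "n \<le> p" and C1: "C1 < 0"
  shows "real n \<le> 27 * max 0 C2"
proof -
  have p: "0 < p" using n1 np by simp
  have Sc: "S \<in> carrier_mat p p" using sym_pos_defD(1)[OF S] .
  define t where "t = root 3 (real n)"
  have t: "0 < t" using n1 by (simp add: t_def)
  have op: "0 < op_norm S"
  proof (rule ccontr)
    assume "\<not> 0 < op_norm S"
    then have "op_norm S = 0" using op_norm_nonneg[OF Sc p] by simp
    then have "vnorm (S *\<^sub>v unit_vec p 0) = 0" using vnorm_mult_le_op_norm[OF Sc, of "unit_vec p 0"] vnorm_nonneg[of "S *\<^sub>v unit_vec p 0"] by simp
    then have "S *\<^sub>v unit_vec p 0 = 0\<^sub>v p" using Sc by (subst (asm) vnorm_eq_0[of _ p]) auto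
    moreover have "unit_vec p 0 \<noteq> (0\<^sub>v p :: real vec)" using p by (metis index_unit_vec(2) index_zero_vec(1) zero_neq_one)
    ultimately show False using sym_pos_defD(3)[OF S, of "unit_vec p 0"] by simp
  qed
  have "0 < op_norm S * sqrt (real p * t) / real n" using op p t n_pos by simp
  then have neg: "C1 * op_norm S * sqrt (real p * t) / real n < 0"
    using mult_neg_pos[OF C1, of "op_norm S * sqrt (real p * t) / real n"] by (simp add: mult.assoc)
  have h: "1 \<le> n \<and> n \<le> p \<and> S \<in> sym_pos_def p \<and> \<beta> \<in> carrier_vec p \<and> 0 < \<sigma> \<and> 0 \<le> t \<and> t \<le> root 3 (real n)"
    using n1 np S \<beta> \<sigma> t by (simp add: t_def)
  have empty: "{\<omega> \<in> space M. \<bar>f \<omega>\<bar> \<le> C1 * op_norm S * sqrt (real p * t) / real n} = {}" for f :: "_ \<Rightarrow> real"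
  proof -
    have "\<not> \<bar>f \<omega>\<bar> \<le> C1 * op_norm S * sqrt (real p * t) / real n" for \<omega>
      using neg abs_ge_zero[of "f \<omega>"] by (metis leD order_trans)
    then show ?thesis by blast
  qed
  have "1 - C2 * exp (- t) \<le> 0"
    using pc[unfolded plug_in_constants_def, rule_format, OF h] unfolding empty measure_empty .
  then have "1 \<le> max 0 C2 * exp (- t)" by (smt (verit) exp_gt_zero max.cobounded2 mult_right_mono)
  also have "\<dots> \<le> max 0 C2 * (27 / real n)"
    using exp_minus_root3_le[OF n1] by (intro mult_left_mono) (auto simp: t_def)
  finally show ?thesis using n_pos by (simp add: field_simps)
qed

end

section \<open>Case distinction over the regimes of n, p and k\<close>

theorem corollary4p4:
  fixes C1 C2 C3 M M1 :: real
  assumes "plug_in_constants C1 C2"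
    and "clime_constant C3"
    and "0 < M" and "0 < M1"
  shows "\<exists>C>0. \<forall>(n::nat) (p::nat) S Om1 sl (k::nat) \<beta> \<sigma>.
    1 \<le> n \<longrightarrow> 1 \<le> p \<longrightarrow>
    S \<in> sym_pos_def p \<longrightarrow> inv_mat S \<in> prec_class n p M M1 \<longrightarrow>
    clime_solution n p M M1 Om1 \<longrightarrow> sqrt_lasso_solution n p sl \<longrightarrow>
    1 \<le> k \<longrightarrow> k \<le> p \<longrightarrow> \<beta> \<in> carrier_vec p \<longrightarrow> nnz \<beta> \<le> k \<longrightarrow> 0 < \<sigma> \<longrightarrow>
    (\<integral>\<^sup>+ ((x, e), x2). ennreal
        ((eta_A C1 C3 M M1 Om1 sl (design n p x) (response n p \<beta> x e) (design n p x2)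
          - eta S \<beta> \<sigma>)\<^sup>2)
      \<partial>(model_law n p S \<sigma> \<Otimes>\<^sub>M design_law n p S))
    \<le> ennreal (C * (1 / real n +
        min ((real k)\<^sup>2 * (ln (real p))\<^sup>2 / (real n)\<^sup>2) (real p * ln (real p) / (real n)\<^sup>2)))"
proof -
  define ls where "ls = real (nat \<lceil>2048 * M1 ^ 4\<rceil> + 1)"
  define a where "a = 2 * (259584 * M1\<^sup>2)\<^sup>2"
  \<comment> \<open>The summands dominate the numerical coefficients of 1 / n, the bounded sample
    sizes, the squared Lasso rate \<open>a\<close>, the regimes where k ln p is not small against
    \<open>n\<close>, and the squared threshold constant.\<close>
  define C where "C = 744 + 27 * max 0 C2 + a + (48 * ls)\<^sup>2 + 3 * (c0 C1 C3 M M1)\<^sup>2"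
  have "real 1 \<le> ls" unfolding ls_def by (rule of_nat_mono) simp
  then have ls: "1 \<le> ls" by simp
  have a0: "0 \<le> a" by (simp add: a_def)
  have parts: "0 \<le> max 0 C2" "0 \<le> (48 * ls)\<^sup>2" "0 \<le> (c0 C1 C3 M M1)\<^sup>2" by auto
  have C: "544 \<le> C" "8 \<le> C" "27 * max 0 C2 \<le> C" "194 + 27 * max 0 C2 \<le> C" "a \<le> C" "(48 * ls)\<^sup>2 \<le> C" "3 * (c0 C1 C3 M M1)\<^sup>2 \<le> C"
    using a0 parts unfolding C_def by linarith+
  show ?thesis
  proof (intro exI[of _ C] conjI allI impI)
    show "0 < C" using C(1) by simp
    fix n p k :: nat and S Om1 sl \<beta> and \<sigma> :: real
    assume n: "1 \<le> n" and p: "1 \<le> p" and S: "S \<in> sym_pos_def p" and prec: "inv_mat S \<in> prec_class n p M M1"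
      and cs: "clime_solution n p M M1 Om1" and sl: "sqrt_lasso_solution n p sl" and k: "1 \<le> k" "k \<le> p"
      and \<beta>: "\<beta> \<in> carrier_vec p" "nnz \<beta> \<le> k" and \<sigma>: "0 < \<sigma>"
    interpret R: regression_model n p S \<beta> \<sigma> M1
      by unfold_locales (use n S \<beta> \<sigma> assms(4) cov_quad_ge[OF S prec assms(4)] cov_quad_le[OF S prec assms(4)] in auto)
    define l where "l = ln (real p)"
    define rk where "rk = (real k)\<^sup>2 * l\<^sup>2 / (real n)\<^sup>2"
    define rp where "rp = real p * l / (real n)\<^sup>2"
    let ?risk = "R.risk C1 C3 M Om1 sl"
    have l0: "0 \<le> l" using p by (simp add: l_def)
    have rk0: "0 \<le> rk" and rp0: "0 \<le> rp" using l0 by (auto simp: rk_def rp_def)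
    have n0: "0 < real n" using n by simp
    have fin: "?risk \<le> ennreal (C * (1 / real n + min rk rp))"
      if "?risk \<le> ennreal A" "A \<le> C * (1 / real n) + C * min rk rp" for A
    proof -
      have "A \<le> C * (1 / real n + min rk rp)" using that(2) by (simp only: distrib_left)
      then show ?thesis using that(1) ennreal_leI order_trans by blast
    qed
    have le1: "?risk \<le> ennreal 1" using R.risk_le_1[OF p sl] by simp
    have Cm0: "0 \<le> C * min rk rp" using C(1) rk0 rp0 by simp
    have small_n: "?risk \<le> ennreal (C * (1 / real n + min rk rp))" if "real n \<le> C"
    proof (rule fin[OF le1])
      have "1 \<le> C * (1 / real n)" using that n0 by simp
      then show "1 \<le> C * (1 / real n) + C * min rk rp" using Cm0 by simp
    qed
    have "?risk \<le> ennreal (C * (1 / real n + min rk rp))"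
    proof (cases "p = 1")
      case True
      have "?risk \<le> ennreal (544 / real n)" using R.one_dim_risk[OF True cs] .
      moreover have "544 / real n \<le> C * (1 / real n) + C * min rk rp"
        using divide_right_mono[OF C(1), of "real n"] n0 Cm0 by simp
      ultimately show ?thesis by (rule fin)
    next
      case False
      then have p2: "2 \<le> p" using p by simp
      have dim: "real n * l \<le> real p" unfolding l_def by (rule prec_class_dimension[OF S prec n p2])
      show ?thesis
      proof (cases "5 \<le> p")
        case False
        \<comment> \<open>For \<open>2 \<le> p \<le> 4\<close> the sparsity constraint n ln p \<le>
          p already forces \<open>n \<le> 8\<close>.\<close>
        have "1 / 2 \<le> ln (2::real)" using ln2_ge_two_thirds by simp
        also have "\<dots> \<le> l" unfolding l_def using p2 by simp
        finally have "real n * (1 / 2) \<le> real n * l" by (rule mult_left_mono) simp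
        then have "real n \<le> 8" using dim False by simp
        then show ?thesis using C(2) by (intro small_n) simp
      next
        case p5: True
        have l1: "1 \<le> l"
        proof -
          have "exp (1::real) \<le> 3" using exp_le by simp
          then have "exp 1 \<le> real p" using p5 by simp
          then show ?thesis unfolding l_def using p by (subst ln_ge_iff) auto
        qed
        have np: "n \<le> p"
        proof -
          have "real n * 1 \<le> real n * l" using l1 by (rule mult_left_mono) simp
          then show ?thesis using dim by simp
        qed
        \<comment> \<open>The same ratio as in the sparsity condition of the Lasso risk; above it,
          (48 ls)^2 times the squared rate exceeds 1, so the trivial bound matches.\<close>
        define \<kappa> where "\<kappa> = 1 / (48 * ls)"
        have \<kappa>: "0 < \<kappa>" "\<kappa> \<le> 1 / 48" "(48 * ls)\<^sup>2 * \<kappa>\<^sup>2 = 1"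
          using ls by (auto simp: \<kappa>_def power_divide)
        have big: "1 \<le> C * y" if "\<kappa> * real n \<le> x" "(x / real n)\<^sup>2 \<le> y" for x y
        proof -
          have "\<kappa> \<le> x / real n" using that(1) n0 by (simp add: le_divide_eq)
          then have "\<kappa>\<^sup>2 \<le> (x / real n)\<^sup>2" using \<kappa>(1) by (intro power_mono) auto
          then have "\<kappa>\<^sup>2 \<le> y" using that(2) by simp
          then have "(48 * ls)\<^sup>2 * \<kappa>\<^sup>2 \<le> C * y" using C(1,6) parts by (intro mult_mono) auto
          then show ?thesis using \<kappa>(3) by simp
        qed
        show ?thesis
        proof (cases "l \<le> \<kappa> * real n")
          case False
          \<comment> \<open>When ln p is large against \<open>n\<close>, both rates are at least (ln
            p / n)^2: the sparse one because k \<ge> 1, the dense one because ln p \<le> n ln p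
            \<le> p.\<close>
          have "(l / real n)\<^sup>2 \<le> min rk rp"
          proof (rule min.boundedI)
            have "1 * l\<^sup>2 \<le> (real k)\<^sup>2 * l\<^sup>2" using k by (intro mult_right_mono) auto
            then show "(l / real n)\<^sup>2 \<le> rk" unfolding rk_def power_divide by (intro divide_right_mono) auto
            have "l * l \<le> real p * l"
            proof (rule mult_right_mono)
              have "1 * l \<le> real n * l" using n l0 by (intro mult_right_mono) auto
              then show "l \<le> real p" using dim by simp
            qed (rule l0)
            then show "(l / real n)\<^sup>2 \<le> rp" unfolding rp_def power_divide by (simp add: power2_eq_square divide_right_mono)
          qed
          then have "1 \<le> C * min rk rp" using False by (intro big[of l]) auto
          moreover have "0 \<le> C * (1 / real n)" using C(1) by simp
          ultimately show ?thesis by (intro fin[OF le1]) simp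
        next
          case True
          have "l \<le> real n / 48" using True mult_right_mono[OF \<kappa>(2), of "real n"] by simp
          then have l8: "l \<le> real n / 8" by simp
          show ?thesis
          proof (cases "0 \<le> C1")
            case False
            then have "real n \<le> 27 * max 0 C2" by (intro R.plug_in_negative_constant[OF assms(1) np]) simp
            then show ?thesis using C(3) by (intro small_n) simp
          next
            case C1: True
            note main = R.adaptive_risk_main[OF assms(1,2) np p5 assms(3) prec cs sl k(1) \<beta>(2)
              l1[unfolded l_def] l8[unfolded l_def] C1]
            have nn: "0 \<le> C * (1 / real n)" using C(1) by simp
            have dense: "?risk \<le> ennreal (C * (1 / real n) + C * rp)"
            proof (rule order_trans[OF main(1)], rule ennreal_leI)
              have "(4 + 27 * max 0 C2) / real n \<le> C * (1 / real n)"
                using divide_right_mono[of "4 + 27 * max 0 C2" C "real n"] C(4) by simp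
              moreover have "3 * (c0 C1 C3 M M1)\<^sup>2 * rp \<le> C * rp" using C(7) rp0 by (rule mult_right_mono)
              ultimately show "(4 + 27 * max 0 C2) / real n + 3 * (c0 C1 C3 M M1)\<^sup>2 * (real p * ln (real p) / (real n)\<^sup>2)
                \<le> C * (1 / real n) + C * rp" unfolding rp_def l_def by (rule add_mono)
            qed
            \<comment> \<open>Beyond the range of the Lasso analysis, k ln p exceeds \<kappa> n and
              the sparse rate times \<open>C\<close> is at least 1.\<close>
            have sparse: "?risk \<le> ennreal (C * (1 / real n) + C * rk)"
            proof (cases "real k * l \<le> \<kappa> * real n")
              case True
              then have "real k * ln (real p) \<le> real n / (48 * real R.lasso_scale)"
                by (simp add: \<kappa>_def l_def ls_def R.lasso_scale_def)
              from main(2)[OF this] show ?thesis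
              proof (rule order_trans, intro ennreal_leI add_mono)
                show "(194 + 27 * max 0 C2) / real n \<le> C * (1 / real n)"
                  using divide_right_mono[of "194 + 27 * max 0 C2" C "real n"] C(4) by simp
                have "2 * (259584 * M1\<^sup>2 * (real k * ln (real p) / real n))\<^sup>2 = a * rk"
                  by (simp add: a_def rk_def l_def power_mult_distrib power_divide)
                also have "\<dots> \<le> C * rk" using C(5) rk0 by (rule mult_right_mono)
                finally show "2 * (259584 * M1\<^sup>2 * (real k * ln (real p) / real n))\<^sup>2 \<le> C * rk" .
              qed
            next
              case False
              have "1 \<le> C * rk" using False by (intro big[of "real k * l"]) (auto simp: rk_def power_mult_distrib power_divide)
              then have "1 \<le> C * (1 / real n) + C * rk" using nn by simp
              then show ?thesis using le1 ennreal_leI order_trans by blast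
            qed
            show ?thesis
            proof (cases "rk \<le> rp")
              case True
              then show ?thesis using sparse by (intro fin) auto
            next
              case False
              then show ?thesis using dense by (intro fin) auto
            qed
          qed
        qed
      qed
    qed
    then show "(\<integral>\<^sup>+ ((x, e), x2). ennreal
        ((eta_A C1 C3 M M1 Om1 sl (design n p x) (response n p \<beta> x e) (design n p x2)
          - eta S \<beta> \<sigma>)\<^sup>2)
      \<partial>(model_law n p S \<sigma> \<Otimes>\<^sub>M design_law n p S))
    \<le> ennreal (C * (1 / real n +
        min ((real k)\<^sup>2 * (ln (real p))\<^sup>2 / (real n)\<^sup>2) (real p * ln (real p) / (real n)\<^sup>2)))"
      by (simp only: rk_def rp_def l_def)
  qed
qed

end
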